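(* The map $$\mathcal{L}^1_E(H)\to E,\qquad u\mapsto \operatorname{tr}u$$ is linear, involutive (i.e. $\operatorname{tr}(u^* )=(\operatorname{tr}u)^*$), positive, and continuous with norm $1$ (with respect to $\|\cdot\|_1$), and $$\|\operatorname{tr}u\|=\|u\|_1$$ for every positive element $u$ of $\mathcal{L}^1_E(H)$. Moreover, for all $u\in\mathcal{L}^1_E(H)$ and $x\in E$, $$\operatorname{tr}(ux)=(\operatorname{tr}u)\,x.$$
   Context: $\mathbb{K}$ is $\mathbb{R}$ or $\mathbb{C}$; $\mathbb{N}=\{1,2,\dots\}$. $T$ is a compact hyperstonian space and $E:=\mathcal{C}(T)$ is the commutative C*-algebra (in fact W*-algebra) of continuous $\mathbb{K}$-valued functions on $T$. $(p_\iota)_{\iota\in I}$ is a family of projections of $E$. $K$ is the selfdual Hilbert right $E$-module given by the W*-direct sum of the $p_\iota E$: families $\xi=(\xi_\iota)_{\iota\in I}$ with $\xi_\iota\in p_\iota E$ for which the finite partial sums of $\sum_\iota \xi_\iota^*\xi_\iota$ are bounded, with $\langle\xi|\eta\rangle=\sum_{\iota}\eta_\iota^*\xi_\iota$ (weak* sum in $E$). $H\subset K$ is the C*-direct sum of the $p_\iota E$: families for which $\sum_\iota\xi_\iota^*\xi_\iota$ is norm-summable in $E$. $\mathcal{L}_E(\cdot)$ denotes the C*-algebra of adjointable operators, $\mathcal{K}_E(\cdot)$ its C*-subalgebra of "compact" operators, i.e. the closed linear span of the operators $\xi\langle\cdot|\eta\rangle:\zeta\mapsto\xi\langle\zeta|\eta\rangle$;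 $\mathcal{K}_E(H)\subset\mathcal{K}_E(K)$ by letting $\xi\langle\cdot|\eta\rangle$ ($\xi,\eta\in H$) act on $K$. For $u\in\mathcal{L}_E(H)$ and $x\in E$, $ux\in\mathcal{L}_E(H)$ is the operator $\xi\mapsto(u\xi)x=u(\xi x)$. For $t\in T$ let $\psi:l^2(I)\to H$, $\zeta\mapsto(\zeta_\iota p_\iota)_\iota$; $\psi_t:H\to l^2(I)$, $\xi\mapsto(\xi_\iota(t))_\iota$; $\varphi_t u:=\psi_t\circ u\circ\psi\in\mathcal{L}(l^2(I))$ for $u\in\mathcal{L}_E(H)$. For $u\in\mathcal{K}_E(H)$, $t\mapsto\varphi_tu$ is continuous from $T$ into the compact operators on $l^2(I)$. For a compact operator $x$ on a Hilbert space, $\theta_n(x)$ is its $n$-th singular value (decreasing order, with multiplicity, completed by $0$); $\theta_n(u)\in E$ is the continuous function $t\mapsto\theta_n(\varphi_tu)$. For $\xi\in K$ put $\xi(t):=(\xi_\iota(t))_\iota\in l^2(I)$. Put $U_n(u):=\{t\in T:\theta_n(\varphi_tu)\ne0\}$, and let $e_n(u)\in E$ be the indicator function of the clopen set $\overline{U_n(u)}$. A sequence $(\xi_n)$ in $K$ is $u$-orthonormal if $\langle\xi_m|\xi_n\rangle=\delta_{m,n}e_n(u)$ for $m\le n$ and each map $U_n(u)\to l^2(I)$, $t\mapsto\xi_n(t)$ is continuous. Every $u\in\mathcal{K}_E(H)$ has a Schatten decomposition: an identity $u=\sum_{n}\theta_n(u)\,\xi_n\langle\cdot|\eta_n\rangle$,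 convergent in $\mathcal{K}_E(K)$, with $(\xi_n)$, $(\eta_n)$ $u$-orthonormal sequences in $K$. $\mathcal{L}^1_E(H)$ is the set of $u\in\mathcal{K}_E(H)$ such that $(\theta_n(u))_{n}$ is (norm-)summable in $E$; it is a vector space with norm $\|u\|_1:=\|\sum_n\theta_n(u)\|$. For $u\in\mathcal{L}^1_E(H)$ with Schatten decomposition $u=\sum_{n}\theta_n(u)\,\xi_n\langle\cdot|\eta_n\rangle$ (where $(\xi_n)$, $(\eta_n)$ are $u$-orthonormal sequences in $K$), $\operatorname{tr}u:=\sum_{n}\theta_n(u)\langle\xi_n|\eta_n\rangle\in E$, which does not depend on the chosen Schatten decomposition. *)

theory Defs
  imports "HOL-Analysis.Analysis" "HOL-Library.Function_Algebras"
begin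

section \<open>The scalar field\<close>

text \<open>The axioms say that the type is isometrically isomorphic, with its conjugation, to the
  real or to the complex numbers.\<close>

class real_or_complex = real_normed_field + banach +
  fixes to_complex :: "'a \<Rightarrow> complex"
    and cnjg :: "'a \<Rightarrow> 'a"
  assumes to_complex_add: "to_complex (x + y) = to_complex x + to_complex y"
    and to_complex_mult: "to_complex (x * y) = to_complex x * to_complex y"
    and to_complex_scaleR: "to_complex (r *\<^sub>R x) = r *\<^sub>R to_complex x"
    and norm_to_complex: "norm (to_complex x) = norm x"
    and to_complex_cnjg: "to_complex (cnjg x) = cnj (to_complex x)"
    and range_to_complex: "range to_complex = \<real> \<or> range to_complex = UNIV"

instantiation real :: real_or_complex
begin
definition "to_complex (x::real) = complex_of_real x"
definition "cnjg (x::real) = x"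
instance
  by standard (auto simp: to_complex_real_def cnjg_real_def Reals_def scaleR_conv_of_real)
end

instantiation complex :: real_or_complex
begin
definition "to_complex (x::complex) = x"
definition "cnjg (x::complex) = cnj x"
instance
  by standard (auto simp: to_complex_complex_def cnjg_complex_def)
end

lemma to_complex_diff: "to_complex (x - y) = to_complex x - to_complex y"
  by (metis add_diff_cancel_right' diff_add_cancel to_complex_add)

lemma inj_to_complex: "to_complex x = to_complex y \<Longrightarrow> x = y"
  by (metis eq_iff_diff_eq_0 norm_eq_zero norm_to_complex to_complex_diff)

lemma cnjg_diff: "cnjg (x - y) = cnjg x - cnjg y"
  by (rule inj_to_complex) (simp add: to_complex_cnjg to_complex_diff)

lemma norm_cnjg [simp]: "norm (cnjg x) = norm x"
  by (metis complex_mod_cnj norm_to_complex to_complex_cnjg)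

lemma continuous_on_cnjg: "continuous_on S (cnjg :: 'a::real_or_complex \<Rightarrow> 'a)"
  unfolding continuous_on_iff dist_norm cnjg_diff [symmetric] norm_cnjg by blast

definition scalar_nonneg :: "'k::real_or_complex \<Rightarrow> bool" where
  "scalar_nonneg z \<longleftrightarrow> (\<exists>r\<ge>0. z = of_real r)"


section \<open>The algebra of continuous functions\<close>

text \<open>\<open>E = C(T)\<close> is the type \<open>'t \<Rightarrow>\<^sub>C 'k\<close> with its supremum norm: \<open>T\<close> will be compact, so that
  every continuous function is bounded.\<close>

instantiation bcontfun :: (topological_space, real_normed_algebra) real_normed_algebra
begin

context includes bcontfun.lifting
begin

lift_definition times_bcontfun :: "('a \<Rightarrow>\<^sub>C 'b) \<Rightarrow> ('a \<Rightarrow>\<^sub>C 'b) \<Rightarrow> 'a \<Rightarrow>\<^sub>C 'b"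
  is "\<lambda>f g x. f x * g x"
proof -
  fix f g :: "'a \<Rightarrow> 'b"
  assume f: "f \<in> bcontfun" and g: "g \<in> bcontfun"
  obtain B C where B: "\<And>x. norm (f x) \<le> B" and C: "\<And>x. norm (g x) \<le> C"
    using f g unfolding bcontfun_def bounded_iff by auto
  show "(\<lambda>x. f x * g x) \<in> bcontfun"
  proof (rule bcontfun_normI)
    show "continuous_on UNIV (\<lambda>x. f x * g x)"
      using f g unfolding bcontfun_def by (auto intro!: continuous_intros)
    show "norm (f x * g x) \<le> B * C" for x
      by (rule order_trans [OF norm_mult_ineq])
        (meson B C mult_mono norm_ge_zero order_trans)
  qed
qed

end

lemma times_bcontfun_apply [simp]:
  "apply_bcontfun (f * g) x = apply_bcontfun f x * apply_bcontfun g x"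
  by (simp add: times_bcontfun.rep_eq)

instance
proof
  show "norm (f * g) \<le> norm f * norm g" for f g :: "'a \<Rightarrow>\<^sub>C 'b"
    by (rule norm_bound)
      (simp add: order_trans [OF norm_mult_ineq mult_mono] norm_bounded)
qed (auto intro!: bcontfun_eqI simp: algebra_simps)

end

instance bcontfun :: (topological_space, "{real_normed_algebra, comm_ring}") comm_ring
  by standard (auto intro!: bcontfun_eqI simp: algebra_simps)

context includes bcontfun.lifting
begin

lift_definition estar :: "('t::topological_space \<Rightarrow>\<^sub>C 'k::real_or_complex) \<Rightarrow> 't \<Rightarrow>\<^sub>C 'k"
  is "\<lambda>f t. cnjg (f t)"
proof -
  fix f :: "'t \<Rightarrow> 'k"
  assume f: "f \<in> bcontfun"
  obtain B where B: "\<And>x. norm (f x) \<le> B"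
    using f unfolding bcontfun_def bounded_iff by auto
  show "(\<lambda>x. cnjg (f x)) \<in> bcontfun"
  proof (rule bcontfun_normI [where b = B])
    show "continuous_on UNIV (\<lambda>x. cnjg (f x))"
      using f unfolding bcontfun_def
      by (auto intro: continuous_on_compose2 [OF continuous_on_cnjg])
  qed (simp add: B)
qed

end

lemma estar_apply [simp]: "apply_bcontfun (estar f) t = cnjg (apply_bcontfun f t)"
  by (simp add: estar.rep_eq)

definition e_nonneg :: "('t::topological_space \<Rightarrow>\<^sub>C 'k::real_or_complex) \<Rightarrow> bool" where
  "e_nonneg f \<longleftrightarrow> (\<forall>t. scalar_nonneg (apply_bcontfun f t))"

definition e_le :: "('t::topological_space \<Rightarrow>\<^sub>C 'k::real_or_complex) \<Rightarrow> ('t \<Rightarrow>\<^sub>C 'k) \<Rightarrow> bool" where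
  "e_le f g \<longleftrightarrow> e_nonneg (g - f)"

definition projection :: "('t::topological_space \<Rightarrow>\<^sub>C 'k::real_or_complex) \<Rightarrow> bool" where
  "projection e \<longleftrightarrow> e * e = e \<and> estar e = e"


section \<open>Hyperstonian spaces and the weak* topology\<close>

definition self_adjoint_lub ::
  "('t::topological_space \<Rightarrow>\<^sub>C 'k::real_or_complex) set \<Rightarrow> ('t \<Rightarrow>\<^sub>C 'k) \<Rightarrow> bool" where
  "self_adjoint_lub F g \<longleftrightarrow>
     estar g = g \<and> (\<forall>f\<in>F. e_le f g) \<and>
     (\<forall>h. estar h = h \<and> (\<forall>f\<in>F. e_le f h) \<longrightarrow> e_le g h)"

text \<open>Radon measures on \<open>T\<close> are taken as linear functionals on \<open>C(T)\<close>. A positive one is normal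
  if it preserves the suprema, formed in the order of \<open>C(T)\<close>, of upward directed sets.\<close>

definition normal_positive_functional ::
  "(('t::topological_space \<Rightarrow>\<^sub>C 'k::real_or_complex) \<Rightarrow> 'k) \<Rightarrow> bool" where
  "normal_positive_functional \<mu> \<longleftrightarrow>
     (\<forall>f g. \<mu> (f + g) = \<mu> f + \<mu> g) \<and>
     (\<forall>c f. \<mu> (const_bcontfun c * f) = c * \<mu> f) \<and>
     (\<forall>f. e_nonneg f \<longrightarrow> scalar_nonneg (\<mu> f)) \<and>
     (\<forall>F g. F \<noteq> {} \<and> (\<forall>f\<in>F. estar f = f) \<and>
        (\<forall>f\<in>F. \<forall>f'\<in>F. \<exists>h\<in>F. e_le f h \<and> e_le f' h) \<and> self_adjoint_lub F g \<longrightarrow>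
        Re (to_complex (\<mu> g)) = (SUP f\<in>F. Re (to_complex (\<mu> f))))"

text \<open>Compact, extremally disconnected, and with enough normal measures. The Hausdorff property
  is part of the sort.\<close>

definition hyperstonian :: "'t::t2_space itself \<Rightarrow> bool" where
  "hyperstonian _ \<longleftrightarrow>
     compact (UNIV :: 't set) \<and>
     (\<forall>U :: 't set. open U \<longrightarrow> open (closure U)) \<and>
     (\<forall>f :: 't \<Rightarrow>\<^sub>C real. e_nonneg f \<and> f \<noteq> 0 \<longrightarrow>
        (\<exists>\<mu>. normal_positive_functional \<mu> \<and> \<mu> f \<noteq> 0))"

text \<open>The predual of \<open>C(T)\<close> is spanned by the normal positive functionals, so they determine the
  weak* convergence of the net of finite partial sums.\<close>

definition has_weak_star_sum ::
  "('i \<Rightarrow> ('t::topological_space \<Rightarrow>\<^sub>C 'k::real_or_complex)) \<Rightarrow> ('t \<Rightarrow>\<^sub>C 'k) \<Rightarrow> bool" where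
  "has_weak_star_sum f a \<longleftrightarrow>
     (\<forall>\<mu>. normal_positive_functional \<mu> \<longrightarrow> ((\<lambda>\<iota>. \<mu> (f \<iota>)) has_sum \<mu> a) UNIV)"

definition weak_star_sum ::
  "('i \<Rightarrow> ('t::topological_space \<Rightarrow>\<^sub>C 'k::real_or_complex)) \<Rightarrow> 't \<Rightarrow>\<^sub>C 'k" where
  "weak_star_sum f = (THE a. has_weak_star_sum f a)"


section \<open>The Hilbert modules\<close>

text \<open>The index set \<open>I\<close> is the type \<open>'i\<close>. The W*-direct sum \<open>K\<close> is \<open>modK p\<close>, and the C*-direct
  sum \<open>H\<close> is \<open>modH p\<close>.\<close>

definition modK ::
  "('i \<Rightarrow> ('t::topological_space \<Rightarrow>\<^sub>C 'k::real_or_complex)) \<Rightarrow> ('i \<Rightarrow> ('t \<Rightarrow>\<^sub>C 'k)) set" where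
  "modK p = {\<xi>. (\<forall>\<iota>. \<xi> \<iota> \<in> range (\<lambda>x. p \<iota> * x)) \<and>
     (\<exists>B. \<forall>F. finite F \<longrightarrow> norm (\<Sum>\<iota>\<in>F. estar (\<xi> \<iota>) * \<xi> \<iota>) \<le> B)}"

definition modH ::
  "('i \<Rightarrow> ('t::topological_space \<Rightarrow>\<^sub>C 'k::real_or_complex)) \<Rightarrow> ('i \<Rightarrow> ('t \<Rightarrow>\<^sub>C 'k)) set" where
  "modH p = {\<xi>. (\<forall>\<iota>. \<xi> \<iota> \<in> range (\<lambda>x. p \<iota> * x)) \<and>
     (\<lambda>\<iota>. estar (\<xi> \<iota>) * \<xi> \<iota>) summable_on UNIV}"

definition minner ::
  "('i \<Rightarrow> ('t::topological_space \<Rightarrow>\<^sub>C 'k::real_or_complex)) \<Rightarrow> ('i \<Rightarrow> ('t \<Rightarrow>\<^sub>C 'k)) \<Rightarrow> 't \<Rightarrow>\<^sub>C 'k" where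
  "minner \<xi> \<eta> = weak_star_sum (\<lambda>\<iota>. estar (\<eta> \<iota>) * \<xi> \<iota>)"

definition mnorm :: "('i \<Rightarrow> ('t::topological_space \<Rightarrow>\<^sub>C 'k::real_or_complex)) \<Rightarrow> real" where
  "mnorm \<xi> = sqrt (norm (minner \<xi> \<xi>))"


section \<open>Operators\<close>

text \<open>An operator on \<open>M\<close> is a function that vanishes outside \<open>M\<close>. Then equality of functions is
  equality of operators, and the pointwise operations on functions are those on operators.\<close>

definition is_adjoint ::
  "'a::zero set \<Rightarrow> ('a \<Rightarrow> 'a \<Rightarrow> 'b) \<Rightarrow> ('a \<Rightarrow> 'a) \<Rightarrow> ('a \<Rightarrow> 'a) \<Rightarrow> bool" where
  "is_adjoint M ip u v \<longleftrightarrow>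
     (\<forall>\<xi>\<in>M. v \<xi> \<in> M) \<and> (\<forall>\<xi>. \<xi> \<notin> M \<longrightarrow> v \<xi> = 0) \<and>
     (\<forall>\<xi>\<in>M. \<forall>\<eta>\<in>M. ip (u \<xi>) \<eta> = ip \<xi> (v \<eta>))"

definition adj :: "'a::zero set \<Rightarrow> ('a \<Rightarrow> 'a \<Rightarrow> 'b) \<Rightarrow> ('a \<Rightarrow> 'a) \<Rightarrow> 'a \<Rightarrow> 'a" where
  "adj M ip u = (THE v. is_adjoint M ip u v)"

type_synonym ('i, 't, 'k) mop = "('i \<Rightarrow> 't \<Rightarrow>\<^sub>C 'k) \<Rightarrow> 'i \<Rightarrow> 't \<Rightarrow>\<^sub>C 'k"

definition adjointable ::
  "('i \<Rightarrow> ('t::topological_space \<Rightarrow>\<^sub>C 'k::real_or_complex)) set \<Rightarrow> ('i, 't, 'k) mop set" where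
  "adjointable M = {u. (\<forall>\<xi>\<in>M. u \<xi> \<in> M) \<and> (\<forall>\<xi>. \<xi> \<notin> M \<longrightarrow> u \<xi> = 0) \<and>
     (\<exists>v. is_adjoint M minner u v)}"

definition opnorm ::
  "('i \<Rightarrow> ('t::topological_space \<Rightarrow>\<^sub>C 'k::real_or_complex)) set \<Rightarrow> ('i, 't, 'k) mop \<Rightarrow> real" where
  "opnorm M u = (SUP \<xi>\<in>{\<xi>\<in>M. mnorm \<xi> \<le> 1}. mnorm (u \<xi>))"

text \<open>\<open>u x\<close>; for constant \<open>x\<close> this is multiplication by a scalar.\<close>

definition op_mult ::
  "('i, 't::topological_space, 'k::real_or_complex) mop \<Rightarrow> ('t \<Rightarrow>\<^sub>C 'k) \<Rightarrow> ('i, 't, 'k) mop" where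
  "op_mult u x = (\<lambda>\<xi> \<iota>. u \<xi> \<iota> * x)"

text \<open>\<open>\<xi>\<langle>\<cdot>|\<eta>\<rangle>\<close> as an operator on \<open>M\<close>\<close>

definition rank1 ::
  "('i \<Rightarrow> ('t::topological_space \<Rightarrow>\<^sub>C 'k::real_or_complex)) set \<Rightarrow>
   ('i \<Rightarrow> ('t \<Rightarrow>\<^sub>C 'k)) \<Rightarrow> ('i \<Rightarrow> ('t \<Rightarrow>\<^sub>C 'k)) \<Rightarrow> ('i, 't, 'k) mop" where
  "rank1 M \<xi> \<eta> = (\<lambda>\<zeta>. if \<zeta> \<in> M then (\<lambda>\<iota>. \<xi> \<iota> * minner \<zeta> \<eta>) else 0)"

definition rank1_span ::
  "('i \<Rightarrow> ('t::topological_space \<Rightarrow>\<^sub>C 'k::real_or_complex)) set \<Rightarrow> ('i, 't, 'k) mop set" where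
  "rank1_span M = {\<Sum>k<n. op_mult (rank1 M (X k) (Y k)) (const_bcontfun (c k)) |
     (n::nat) X Y c. (\<forall>k<n. X k \<in> M \<and> Y k \<in> M)}"

definition compact_ops ::
  "('i \<Rightarrow> ('t::topological_space \<Rightarrow>\<^sub>C 'k::real_or_complex)) set \<Rightarrow> ('i, 't, 'k) mop set" where
  "compact_ops M = {u \<in> adjointable M. \<forall>\<epsilon>>0. \<exists>v\<in>rank1_span M. opnorm M (u - v) < \<epsilon>}"

text \<open>positivity in the C*-algebra of adjointable operators\<close>

definition op_positive ::
  "('i \<Rightarrow> ('t::topological_space \<Rightarrow>\<^sub>C 'k::real_or_complex)) set \<Rightarrow> ('i, 't, 'k) mop \<Rightarrow> bool" where
  "op_positive M u \<longleftrightarrow> (\<exists>v\<in>adjointable M. u = adj M minner v \<circ> v)"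


section \<open>Singular values\<close>

definition l2 :: "('i \<Rightarrow> 'k::real_or_complex) set" where
  "l2 = {\<zeta>. (\<lambda>\<iota>. (norm (\<zeta> \<iota>))\<^sup>2) summable_on UNIV}"

definition l2_inner :: "('i \<Rightarrow> 'k::real_or_complex) \<Rightarrow> ('i \<Rightarrow> 'k) \<Rightarrow> 'k" where
  "l2_inner \<zeta> \<eta> = (\<Sum>\<^sub>\<infinity>\<iota>. \<zeta> \<iota> * cnjg (\<eta> \<iota>))"

definition l2_norm :: "('i \<Rightarrow> 'k::real_or_complex) \<Rightarrow> real" where
  "l2_norm \<zeta> = sqrt (\<Sum>\<^sub>\<infinity>\<iota>. (norm (\<zeta> \<iota>))\<^sup>2)"

text \<open>The multiplicity of \<open>s > 0\<close> as an eigenvalue of \<open>|x|\<close>, the positive square root of \<open>x\<^sup>* x\<close>: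
  the eigenspace of \<open>|x|\<close> for \<open>s\<close> is that of \<open>x\<^sup>* x\<close> for \<open>s\<^sup>2\<close>.\<close>

definition sing_mult :: "(('i \<Rightarrow> 'k::real_or_complex) \<Rightarrow> 'i \<Rightarrow> 'k) \<Rightarrow> real \<Rightarrow> nat" where
  "sing_mult x s = vector_space.dim (\<lambda>(c::'k) \<zeta> \<iota>. c * \<zeta> \<iota>)
     {\<zeta>\<in>l2. adj l2 l2_inner x (x \<zeta>) = (\<lambda>\<iota>. of_real (s\<^sup>2) * \<zeta> \<iota>)}"

text \<open>The decreasing sequence in which each \<open>s > 0\<close> is repeated according to its multiplicity, and
  all the other terms are \<open>0\<close>. All sequences are indexed from \<open>0\<close> here: \<open>sing_val x n\<close> is the
  singular value number \<open>n + 1\<close>.\<close>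

definition sing_val :: "(('i \<Rightarrow> 'k::real_or_complex) \<Rightarrow> 'i \<Rightarrow> 'k) \<Rightarrow> nat \<Rightarrow> real" where
  "sing_val x = (THE \<theta>. antimono \<theta> \<and> (\<forall>n. 0 \<le> \<theta> n) \<and>
     (\<forall>s>0. finite {n. \<theta> n = s} \<and> card {n. \<theta> n = s} = sing_mult x s))"

definition psi ::
  "('i \<Rightarrow> ('t::topological_space \<Rightarrow>\<^sub>C 'k::real_or_complex)) \<Rightarrow> ('i \<Rightarrow> 'k) \<Rightarrow> 'i \<Rightarrow> ('t \<Rightarrow>\<^sub>C 'k)" where
  "psi p \<zeta> = (\<lambda>\<iota>. const_bcontfun (\<zeta> \<iota>) * p \<iota>)"

definition eval_at ::
  "'t::topological_space \<Rightarrow> ('i \<Rightarrow> ('t \<Rightarrow>\<^sub>C 'k::real_or_complex)) \<Rightarrow> 'i \<Rightarrow> 'k" where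
  "eval_at t \<xi> = (\<lambda>\<iota>. apply_bcontfun (\<xi> \<iota>) t)"

definition phi ::
  "('i \<Rightarrow> ('t::topological_space \<Rightarrow>\<^sub>C 'k::real_or_complex)) \<Rightarrow> 't \<Rightarrow> ('i, 't, 'k) mop \<Rightarrow>
   ('i \<Rightarrow> 'k) \<Rightarrow> 'i \<Rightarrow> 'k" where
  "phi p t u = eval_at t \<circ> u \<circ> psi p"

text \<open>\<^const>\<open>Bcontfun\<close> is meaningful only on continuous functions; below it is applied only for
  compact \<open>u\<close>, where the functions are continuous.\<close>

definition theta ::
  "('i \<Rightarrow> ('t::topological_space \<Rightarrow>\<^sub>C 'k::real_or_complex)) \<Rightarrow> ('i, 't, 'k) mop \<Rightarrow> nat \<Rightarrow> 't \<Rightarrow>\<^sub>C 'k" where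
  "theta p u n = Bcontfun (\<lambda>t. of_real (sing_val (phi p t u) n))"


section \<open>Schatten decompositions, trace class operators and the trace\<close>

definition U_set ::
  "('i \<Rightarrow> ('t::topological_space \<Rightarrow>\<^sub>C 'k::real_or_complex)) \<Rightarrow> ('i, 't, 'k) mop \<Rightarrow> nat \<Rightarrow> 't set" where
  "U_set p u n = {t. sing_val (phi p t u) n \<noteq> 0}"

definition e_proj ::
  "('i \<Rightarrow> ('t::topological_space \<Rightarrow>\<^sub>C 'k::real_or_complex)) \<Rightarrow> ('i, 't, 'k) mop \<Rightarrow> nat \<Rightarrow> 't \<Rightarrow>\<^sub>C 'k" where
  "e_proj p u n = Bcontfun (indicator (closure (U_set p u n)))"

definition u_orthonormal ::
  "('i \<Rightarrow> ('t::topological_space \<Rightarrow>\<^sub>C 'k::real_or_complex)) \<Rightarrow> ('i, 't, 'k) mop \<Rightarrow>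
   (nat \<Rightarrow> 'i \<Rightarrow> ('t \<Rightarrow>\<^sub>C 'k)) \<Rightarrow> bool" where
  "u_orthonormal p u \<xi> \<longleftrightarrow>
     (\<forall>n. \<xi> n \<in> modK p) \<and>
     (\<forall>m n. m \<le> n \<longrightarrow> minner (\<xi> m) (\<xi> n) = (if m = n then e_proj p u n else 0)) \<and>
     (\<forall>n. \<forall>t\<in>U_set p u n.
        ((\<lambda>s. l2_norm (eval_at s (\<xi> n) - eval_at t (\<xi> n))) \<longlongrightarrow> 0) (at t within U_set p u n))"

text \<open>The operator \<open>v\<close> is \<open>u\<close> regarded as an element of \<open>K\<^sub>E(K)\<close>. An adjointable operator on
  \<open>K\<close> is determined by its restriction to \<open>H\<close>, so there is only one such \<open>v\<close>: the one obtained by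
  letting \<open>\<xi>\<langle>\<cdot>|\<eta>\<rangle>\<close>, for \<open>\<xi>\<close> and \<open>\<eta>\<close> in \<open>H\<close>, act on \<open>K\<close>.\<close>

definition schatten_decomposition ::
  "('i \<Rightarrow> ('t::topological_space \<Rightarrow>\<^sub>C 'k::real_or_complex)) \<Rightarrow> ('i, 't, 'k) mop \<Rightarrow>
   (nat \<Rightarrow> 'i \<Rightarrow> ('t \<Rightarrow>\<^sub>C 'k)) \<Rightarrow> (nat \<Rightarrow> 'i \<Rightarrow> ('t \<Rightarrow>\<^sub>C 'k)) \<Rightarrow> bool" where
  "schatten_decomposition p u \<xi> \<eta> \<longleftrightarrow>
     u_orthonormal p u \<xi> \<and> u_orthonormal p u \<eta> \<and>
     (\<exists>v\<in>compact_ops (modK p). (\<forall>\<zeta>\<in>modH p. v \<zeta> = u \<zeta>) \<and>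
        (\<lambda>N. opnorm (modK p)
           (v - (\<Sum>n<N. op_mult (rank1 (modK p) (\<xi> n) (\<eta> n)) (theta p u n)))) \<longlonglongrightarrow> 0)"

definition trace_class ::
  "('i \<Rightarrow> ('t::topological_space \<Rightarrow>\<^sub>C 'k::real_or_complex)) \<Rightarrow> ('i, 't, 'k) mop set" where
  "trace_class p = {u \<in> compact_ops (modH p). theta p u summable_on UNIV}"

definition trace_norm ::
  "('i \<Rightarrow> ('t::topological_space \<Rightarrow>\<^sub>C 'k::real_or_complex)) \<Rightarrow> ('i, 't, 'k) mop \<Rightarrow> real" where
  "trace_norm p u = norm (\<Sum>\<^sub>\<infinity>n. theta p u n)"

definition tr ::
  "('i \<Rightarrow> ('t::topological_space \<Rightarrow>\<^sub>C 'k::real_or_complex)) \<Rightarrow> ('i, 't, 'k) mop \<Rightarrow> 't \<Rightarrow>\<^sub>C 'k" where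
  "tr p u = (THE a. \<exists>\<xi> \<eta>. schatten_decomposition p u \<xi> \<eta> \<and>
     ((\<lambda>n. theta p u n * minner (\<xi> n) (\<eta> n)) has_sum a) UNIV)"

end

(*
  The fibre of u at t is a compact operator Phi t u on l2(I) which depends norm continuously on t, and
  tr u (t) turns out to be the sum of its diagonal entries. This makes the trace linear and
  independent of the Schatten decomposition, and reduces all the claims to operators on l2(I).

  As T is extremally disconnected, the identity of the clopen sets extends to a Boolean homomorphism
  from all subsets of T to the clopen ones; it provides ultrafilters converging to the points of T,
  along which every bounded function has a limit that depends continuously on the point.
  Lifting pointwise sums in this way computes weak* sums. Lifting an arbitrary
  pointwise choice of singular vectors of Phi t u coordinatewise yields a Schatten decomposition,
  because compact operators turn coordinatewise convergence into norm convergence.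
*)
theory Submission
  imports Defs
begin

section \<open>Scalars\<close>

text \<open>The obstacle is that \<open>minner\<close> on \<open>modK p\<close> is a weak* sum: its
  value at a point is a limit of inner products of nearby fibres and may differ from the inner
  product of the fibres at that point. Now \<open>u_orthonormal\<close> asks for norm continuity
  exactly on \<open>U_set p u n\<close>, and off that set the factor \<open>theta p u n\<close>
  vanishes, so every term \<open>theta p u n * minner (\<xi> n) (\<eta> n)\<close> has the naive
  value at every point after all. On \<open>modH p\<close> the fibres are norm continuous and the
  defect does not occur. Singular values are handled as approximation numbers because the distance
  to operators of rank at most n is visibly Lipschitz in the operator, invariant under adjoints, and
  subadditive when indices add. This yields the continuity of \<open>theta p u n\<close> and the
  closure of the trace class under sums. Since \<open>opnorm\<close>, \<open>tr\<close> and
  \<open>adj\<close> are defined through SUP and THE, they mean something only once boundedness of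
  adjointable operators, existence of decompositions and uniqueness of the values are
  established.\<close>

lemma to_complex_0 [simp]: "to_complex (0 :: 'k::real_or_complex) = 0"
  by (metis add_cancel_right_right to_complex_add)

lemma to_complex_eq_iff [simp]: "to_complex (x :: 'k::real_or_complex) = to_complex y \<longleftrightarrow> x = y"
  using inj_to_complex by blast

text \<open>The image of \<open>1\<close> is an idempotent complex number, hence \<open>0\<close> or
  \<open>1\<close>, and injectivity excludes \<open>0\<close>.\<close>

lemma to_complex_1 [simp]: "to_complex (1 :: 'k::real_or_complex) = 1"
proof -
  have "to_complex (1 :: 'k) * to_complex (1 :: 'k) = to_complex (1 :: 'k)"
    by (simp flip: to_complex_mult)
  moreover have "to_complex (1 :: 'k) \<noteq> 0"
    by (metis to_complex_0 to_complex_eq_iff zero_neq_one)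
  ultimately show ?thesis by simp
qed

lemma to_complex_of_real [simp]:
  "to_complex (of_real r :: 'k::real_or_complex) = complex_of_real r"
  by (simp add: of_real_def to_complex_scaleR)

lemma cnjg_add: "cnjg (x + y :: 'k::real_or_complex) = cnjg x + cnjg y"
  by (rule inj_to_complex) (simp add: to_complex_cnjg to_complex_add)

lemma cnjg_mult: "cnjg (x * y :: 'k::real_or_complex) = cnjg x * cnjg y"
  by (rule inj_to_complex) (simp add: to_complex_cnjg to_complex_mult)

lemma cnjg_cnjg [simp]: "cnjg (cnjg x :: 'k::real_or_complex) = x"
  by (rule inj_to_complex) (simp add: to_complex_cnjg)

lemma cnjg_of_real [simp]: "cnjg (of_real r :: 'k::real_or_complex) = of_real r"
  by (rule inj_to_complex) (simp add: to_complex_cnjg)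

lemma cnjg_0 [simp]: "cnjg (0 :: 'k::real_or_complex) = 0"
  using cnjg_of_real [of 0] by simp

lemma cnjg_1 [simp]: "cnjg (1 :: 'k::real_or_complex) = 1"
  using cnjg_of_real [of 1] by simp

lemma cnjg_scaleR: "cnjg (r *\<^sub>R x :: 'k::real_or_complex) = r *\<^sub>R cnjg x"
  by (rule inj_to_complex) (simp add: to_complex_cnjg to_complex_scaleR)

lemma mult_cnjg_self: "x * cnjg (x :: 'k::real_or_complex) = of_real ((norm x)\<^sup>2)"
  by (rule inj_to_complex)
    (metis complex_norm_square norm_to_complex to_complex_cnjg to_complex_mult to_complex_of_real)

lemma bounded_linear_cnjg: "bounded_linear (cnjg :: 'k::real_or_complex \<Rightarrow> 'k)"
  by (rule bounded_linear_intro [where K = 1]) (auto simp: cnjg_add cnjg_scaleR)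

lemma bounded_linear_to_complex: "bounded_linear (to_complex :: 'k::real_or_complex \<Rightarrow> complex)"
  by (rule bounded_linear_intro [where K = 1])
    (auto simp: to_complex_add to_complex_scaleR norm_to_complex)

lemmas tendsto_cnjg = bounded_linear.tendsto [OF bounded_linear_cnjg]
text \<open>Real and imaginary parts are taken through the embedding so that one argument serves
  both scalar fields; over the reals \<open>ipart\<close> is constantly \<open>0\<close>.\<close>

definition rpart :: "'k::real_or_complex \<Rightarrow> real" where
  "rpart x = Re (to_complex x)"

definition ipart :: "'k::real_or_complex \<Rightarrow> real" where
  "ipart x = Im (to_complex x)"

lemma bounded_linear_rpart: "bounded_linear (rpart :: 'k::real_or_complex \<Rightarrow> real)"
  unfolding rpart_def
  by (rule bounded_linear_compose [OF bounded_linear_Re bounded_linear_to_complex])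

lemma bounded_linear_ipart: "bounded_linear (ipart :: 'k::real_or_complex \<Rightarrow> real)"
  unfolding ipart_def
  by (rule bounded_linear_compose [OF bounded_linear_Im bounded_linear_to_complex])

lemmas tendsto_rpart = bounded_linear.tendsto [OF bounded_linear_rpart]

lemma rpart_add: "rpart (x + y :: 'k::real_or_complex) = rpart x + rpart y"
  and rpart_diff: "rpart (x - y :: 'k::real_or_complex) = rpart x - rpart y"
  and rpart_scaleR: "rpart (r *\<^sub>R x :: 'k::real_or_complex) = r * rpart x"
  by (simp_all add: rpart_def to_complex_add to_complex_diff to_complex_scaleR)

lemma ipart_add: "ipart (x + y :: 'k::real_or_complex) = ipart x + ipart y"
  and ipart_diff: "ipart (x - y :: 'k::real_or_complex) = ipart x - ipart y"
  by (simp_all add: ipart_def to_complex_add to_complex_diff to_complex_scaleR)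

lemma rpart_of_real [simp]: "rpart (of_real r :: 'k::real_or_complex) = r"
  and ipart_of_real [simp]: "ipart (of_real r :: 'k::real_or_complex) = 0"
  by (simp_all add: rpart_def ipart_def)

lemma rpart_cnjg [simp]: "rpart (cnjg x :: 'k::real_or_complex) = rpart x"
  by (simp add: rpart_def to_complex_cnjg)

lemma rpart_0 [simp]: "rpart (0 :: 'k::real_or_complex) = 0"
  and ipart_0 [simp]: "ipart (0 :: 'k::real_or_complex) = 0"
  by (simp_all add: rpart_def ipart_def)

lemma abs_rpart_le: "\<bar>rpart (x :: 'k::real_or_complex)\<bar> \<le> norm x"
  by (metis abs_Re_le_cmod norm_to_complex rpart_def)

lemma abs_ipart_le: "\<bar>ipart (x :: 'k::real_or_complex)\<bar> \<le> norm x"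
  by (metis abs_Im_le_cmod norm_to_complex ipart_def)

lemma rpart_ipart_eqI:
  "rpart (x :: 'k::real_or_complex) = rpart y \<Longrightarrow> ipart x = ipart y \<Longrightarrow> x = y"
  by (rule inj_to_complex) (simp add: rpart_def ipart_def complex_eq_iff del: to_complex_eq_iff)

text \<open>The imaginary unit if the scalars are complex, and \<open>0\<close> if they are real. In both cases
  \<open>x = rpart x + imag_unit * ipart x\<close>.\<close>

definition imag_unit :: "'k::real_or_complex" where
  "imag_unit = (if range (to_complex :: 'k \<Rightarrow> complex) = UNIV then inv to_complex \<i> else 0)"

lemma scalar_decomp:
  "x = of_real (rpart x) + imag_unit * of_real (ipart (x :: 'k::real_or_complex))"
proof (cases "range (to_complex :: 'k \<Rightarrow> complex) = UNIV")
  case True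
  have u: "to_complex (imag_unit :: 'k) = \<i>"
    unfolding imag_unit_def if_P [OF True] by (rule f_inv_into_f) (simp only: True UNIV_I)
  show ?thesis
    by (rule inj_to_complex)
      (simp add: u to_complex_add to_complex_mult rpart_def ipart_def complex_eq_iff
        del: to_complex_eq_iff)
next
  case False
  then have "range (to_complex :: 'k \<Rightarrow> complex) = \<real>"
    using range_to_complex by auto
  then have "to_complex x \<in> \<real>" by blast
  then have "to_complex x = of_real (rpart x)" "imag_unit = (0 :: 'k)"
    using False by (auto simp: rpart_def imag_unit_def of_real_Re)
  then show ?thesis
    using inj_to_complex [of x "of_real (rpart x)"] by simp
qed

lemma scalar_nonneg_iff:
  "scalar_nonneg (z :: 'k::real_or_complex) \<longleftrightarrow> z = of_real (rpart z) \<and> 0 \<le> rpart z"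
  unfolding scalar_nonneg_def by (metis rpart_of_real)

lemma scalar_nonneg_real [simp]: "scalar_nonneg (r :: real) \<longleftrightarrow> 0 \<le> r"
  by (auto simp: scalar_nonneg_def)

text \<open>The isometry \<open>to_complex\<close> identifies this ball with the part of the complex
  ball that lies in its closed range, and compactness is carried back along the inverse isometry.
  Limits along ultrafilters and the weak compactness of the unit ball rest on it.\<close>

lemma compact_cball_scalar: "compact (cball (0 :: 'k::real_or_complex) B)"
proof -
  let ?c = "to_complex :: 'k \<Rightarrow> complex"
  have cl: "closed (range ?c)"
    using range_to_complex closed_complex_Reals by (metis closed_UNIV)
  have c: "compact (cball 0 B \<inter> range ?c)"
    by (intro compact_Int_closed cl) auto
  have inv: "inv ?c (?c z) = z" for z
    by (rule inv_f_f) (simp add: inj_def)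
  have lip: "dist (inv ?c x) (inv ?c y) = dist x y" if xy: "x \<in> range ?c" "y \<in> range ?c" for x y
  proof -
    from xy obtain a b where ab: "x = ?c a" "y = ?c b" by blast
    show ?thesis
      unfolding ab inv dist_norm to_complex_diff [symmetric] norm_to_complex by (rule refl)
  qed
  have "continuous_on (cball 0 B \<inter> range ?c) (inv ?c)"
    unfolding continuous_on_iff
  proof (intro ballI allI impI)
    fix x and e :: real
    assume "x \<in> cball 0 B \<inter> range ?c" "0 < e"
    then show "\<exists>d>0. \<forall>x'\<in>cball 0 B \<inter> range ?c. dist x' x < d \<longrightarrow> dist (inv ?c x') (inv ?c x) < e"
      using lip by (intro exI [of _ e]) auto
  qed
  from compact_continuous_image [OF this c]
  have "compact (inv ?c ` (cball 0 B \<inter> range ?c))" .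
  also have "inv ?c ` (cball 0 B \<inter> range ?c) = cball 0 B"
  proof (intro equalityI subsetI)
    fix x :: 'k assume "x \<in> cball 0 B"
    then show "x \<in> inv ?c ` (cball 0 B \<inter> range ?c)"
      by (intro image_eqI [of _ _ "?c x"]) (auto simp: inv norm_to_complex)
  qed (auto simp: inv norm_to_complex)
  finally show ?thesis .
qed

section \<open>The Hilbert space of square summable families\<close>

lemma l2_iff_bounded:
  "(\<zeta> :: 'i \<Rightarrow> 'k::real_or_complex) \<in> l2 \<longleftrightarrow> (\<exists>B. \<forall>F. finite F \<longrightarrow> (\<Sum>\<iota>\<in>F. (norm (\<zeta> \<iota>))\<^sup>2) \<le> B)"
proof
  assume "\<zeta> \<in> l2"
  then show "\<exists>B. \<forall>F. finite F \<longrightarrow> (\<Sum>\<iota>\<in>F. (norm (\<zeta> \<iota>))\<^sup>2) \<le> B"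
    unfolding l2_def mem_Collect_eq
    by (intro exI [of _ "\<Sum>\<^sub>\<infinity>\<iota>. (norm (\<zeta> \<iota>))\<^sup>2"]) (auto intro!: finite_sum_le_infsum)
next
  assume "\<exists>B. \<forall>F. finite F \<longrightarrow> (\<Sum>\<iota>\<in>F. (norm (\<zeta> \<iota>))\<^sup>2) \<le> B"
  then show "\<zeta> \<in> l2"
    unfolding l2_def mem_Collect_eq
    by (intro nonneg_bdd_above_summable_on) (auto simp: bdd_above_def)
qed

lemma l2D: "\<zeta> \<in> l2 \<Longrightarrow> (\<lambda>\<iota>. (norm (\<zeta> \<iota>))\<^sup>2) summable_on UNIV"
  by (simp add: l2_def)

lemma l2_boundedI:
  "(\<And>F. finite F \<Longrightarrow> (\<Sum>\<iota>\<in>F. (norm (\<zeta> \<iota> :: 'k::real_or_complex))\<^sup>2) \<le> B) \<Longrightarrow> \<zeta> \<in> l2"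
  unfolding l2_iff_bounded by blast

lemma l2_prod_abs_summable:
  fixes \<zeta> \<eta> :: "'i \<Rightarrow> 'k::real_or_complex"
  assumes "\<zeta> \<in> l2" "\<eta> \<in> l2"
  shows "(\<lambda>\<iota>. norm (\<zeta> \<iota> * cnjg (\<eta> \<iota>))) summable_on UNIV"
proof (rule summable_on_comparison_test)
  show "(\<lambda>\<iota>. (norm (\<zeta> \<iota>))\<^sup>2 + (norm (\<eta> \<iota>))\<^sup>2) summable_on UNIV"
    by (intro summable_on_add l2D assms)
  show "norm (\<zeta> \<iota> * cnjg (\<eta> \<iota>)) \<le> (norm (\<zeta> \<iota>))\<^sup>2 + (norm (\<eta> \<iota>))\<^sup>2" for \<iota>
  proof -
    have "2 * (norm (\<zeta> \<iota>) * norm (\<eta> \<iota>)) \<le> (norm (\<zeta> \<iota>))\<^sup>2 + (norm (\<eta> \<iota>))\<^sup>2"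
      using sum_squares_bound [of "norm (\<zeta> \<iota>)" "norm (\<eta> \<iota>)"] by simp
    moreover have "0 \<le> norm (\<zeta> \<iota>) * norm (\<eta> \<iota>)" by simp
    ultimately show ?thesis unfolding norm_mult norm_cnjg by linarith
  qed
qed auto

lemma l2_inner_has_sum:
  assumes "\<zeta> \<in> l2" "\<eta> \<in> l2"
  shows "((\<lambda>\<iota>. \<zeta> \<iota> * cnjg (\<eta> \<iota>)) has_sum l2_inner \<zeta> \<eta>) UNIV"
  unfolding l2_inner_def
  by (rule has_sum_infsum [OF abs_summable_summable [OF l2_prod_abs_summable [OF assms]]])

lemma l2_add:
  assumes "\<zeta> \<in> l2" "\<eta> \<in> l2"
  shows "(\<lambda>\<iota>. \<zeta> \<iota> + \<eta> \<iota> :: 'k::real_or_complex) \<in> l2"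
  unfolding l2_def mem_Collect_eq
proof (rule summable_on_comparison_test)
  show "(\<lambda>\<iota>. 2 * (norm (\<zeta> \<iota>))\<^sup>2 + 2 * (norm (\<eta> \<iota>))\<^sup>2) summable_on UNIV"
    by (intro summable_on_add summable_on_cmult_right l2D assms)
  show "(norm (\<zeta> \<iota> + \<eta> \<iota>))\<^sup>2 \<le> 2 * (norm (\<zeta> \<iota>))\<^sup>2 + 2 * (norm (\<eta> \<iota>))\<^sup>2" for \<iota>
  proof -
    have "(norm (\<zeta> \<iota> + \<eta> \<iota>))\<^sup>2 \<le> (norm (\<zeta> \<iota>) + norm (\<eta> \<iota>))\<^sup>2"
      by (intro power_mono norm_triangle_ineq) auto
    then show ?thesis
      using sum_squares_bound [of "norm (\<zeta> \<iota>)" "norm (\<eta> \<iota>)"] by (simp add: power2_sum)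
  qed
qed auto

lemma l2_mult_bounded:
  assumes "\<zeta> \<in> l2" "\<And>\<iota>. norm (c \<iota>) \<le> B"
  shows "(\<lambda>\<iota>. c \<iota> * \<zeta> \<iota> :: 'k::real_or_complex) \<in> l2"
  unfolding l2_def mem_Collect_eq
proof (rule summable_on_comparison_test)
  show "(\<lambda>\<iota>. B\<^sup>2 * (norm (\<zeta> \<iota>))\<^sup>2) summable_on UNIV"
    by (intro summable_on_cmult_right l2D assms)
  show "(norm (c \<iota> * \<zeta> \<iota>))\<^sup>2 \<le> B\<^sup>2 * (norm (\<zeta> \<iota>))\<^sup>2" for \<iota>
    by (auto simp: norm_mult power_mult_distrib intro!: mult_right_mono power_mono assms)
qed auto

lemma l2_scale: "\<zeta> \<in> l2 \<Longrightarrow> (\<lambda>\<iota>. c * \<zeta> \<iota> :: 'k::real_or_complex) \<in> l2"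
  by (rule l2_mult_bounded [where B = "norm c"]) auto

lemma l2_minus: "\<zeta> \<in> l2 \<Longrightarrow> (\<lambda>\<iota>. - \<zeta> \<iota> :: 'k::real_or_complex) \<in> l2"
  by (simp add: l2_def)

lemma l2_diff: "\<zeta> \<in> l2 \<Longrightarrow> \<eta> \<in> l2 \<Longrightarrow> (\<lambda>\<iota>. \<zeta> \<iota> - \<eta> \<iota> :: 'k::real_or_complex) \<in> l2"
  using l2_add [of \<zeta> "\<lambda>\<iota>. - \<eta> \<iota>"] l2_minus [of \<eta>] by simp

lemma l2_zero: "(\<lambda>\<iota>. 0 :: 'k::real_or_complex) \<in> l2"
  by (simp add: l2_def)

text \<open>As a type, the square summable families become an instance of \<open>real_inner\<close>.
  The scalar-valued \<open>kinner\<close> is kept beside the real \<open>inner\<close>, which is its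
  real part.\<close>

typedef (overloaded) ('i, 'k) ell2 = "l2 :: ('i \<Rightarrow> 'k::real_or_complex) set"
  using l2_zero by blast

setup_lifting type_definition_ell2

lemma Rep_ell2_l2 [simp]: "Rep_ell2 x \<in> l2"
  by (rule Rep_ell2)

lemma Abs_ell2_inverse' [simp]: "f \<in> l2 \<Longrightarrow> Rep_ell2 (Abs_ell2 f) = f"
  by (rule Abs_ell2_inverse)

lemma ell2_eqI: "(\<And>\<iota>. Rep_ell2 x \<iota> = Rep_ell2 y \<iota>) \<Longrightarrow> x = y"
  by (metis Rep_ell2_inject ext)

lift_definition kscale :: "'k \<Rightarrow> ('i, 'k::real_or_complex) ell2 \<Rightarrow> ('i, 'k) ell2"
  is "\<lambda>c x \<iota>. c * x \<iota>"
  by (rule l2_scale)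

lift_definition kinner :: "('i, 'k::real_or_complex) ell2 \<Rightarrow> ('i, 'k) ell2 \<Rightarrow> 'k"
  is l2_inner .

lemma kinner_has_sum:
  "((\<lambda>\<iota>. Rep_ell2 x \<iota> * cnjg (Rep_ell2 y \<iota>)) has_sum kinner x y) UNIV"
  unfolding kinner.rep_eq by (rule l2_inner_has_sum) auto

instantiation ell2 :: (type, real_or_complex) ab_group_add
begin
lift_definition zero_ell2 :: "('a, 'b) ell2" is "\<lambda>_. 0" by (rule l2_zero)
lift_definition plus_ell2 :: "('a, 'b) ell2 \<Rightarrow> ('a, 'b) ell2 \<Rightarrow> ('a, 'b) ell2"
  is "\<lambda>x y \<iota>. x \<iota> + y \<iota>" by (rule l2_add)
lift_definition minus_ell2 :: "('a, 'b) ell2 \<Rightarrow> ('a, 'b) ell2 \<Rightarrow> ('a, 'b) ell2"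
  is "\<lambda>x y \<iota>. x \<iota> - y \<iota>" by (rule l2_diff)
lift_definition uminus_ell2 :: "('a, 'b) ell2 \<Rightarrow> ('a, 'b) ell2"
  is "\<lambda>x \<iota>. - x \<iota>" by (rule l2_minus)
instance
  by standard (transfer; simp add: fun_eq_iff algebra_simps)+
end

lemmas Rep_ell2_simps [simp] =
  zero_ell2.rep_eq plus_ell2.rep_eq minus_ell2.rep_eq uminus_ell2.rep_eq kscale.rep_eq

lemma kinner_eqI:
  "((\<lambda>\<iota>. Rep_ell2 x \<iota> * cnjg (Rep_ell2 y \<iota>)) has_sum s) UNIV \<Longrightarrow> kinner x y = s"
  using kinner_has_sum has_sum_unique by blast

lemma kinner_add_left: "kinner (x + y) z = kinner x z + kinner y z"
  by (rule kinner_eqI)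
    (use has_sum_add [OF kinner_has_sum [of x z] kinner_has_sum [of y z]]
     in \<open>simp add: algebra_simps\<close>)

lemma kinner_kscale_left: "kinner (kscale c x) z = c * kinner x z"
  by (rule kinner_eqI)
    (use has_sum_cmult_right [OF kinner_has_sum [of x z], of c] in \<open>simp add: algebra_simps\<close>)

lemma kinner_commute: "kinner y x = cnjg (kinner x y)"
  by (rule kinner_eqI)
    (use has_sum_bounded_linear [OF bounded_linear_cnjg kinner_has_sum [of x y]]
     in \<open>simp add: o_def cnjg_mult mult.commute\<close>)

lemma kinner_add_right: "kinner x (y + z) = kinner x y + kinner x z"
  by (metis cnjg_add kinner_add_left kinner_commute)

lemma kinner_kscale_right: "kinner x (kscale c z) = cnjg c * kinner x z"
  by (metis cnjg_mult kinner_commute kinner_kscale_left)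

lemma kinner_self_has_sum:
  "((\<lambda>\<iota>. (norm (Rep_ell2 x \<iota>))\<^sup>2) has_sum rpart (kinner x x)) UNIV"
  using has_sum_bounded_linear [OF bounded_linear_rpart kinner_has_sum [of x x]]
  by (simp add: o_def mult_cnjg_self del: of_real_power)

lemma kinner_self: "kinner x x = of_real (rpart (kinner x x))"
  by (rule kinner_eqI)
    (use has_sum_bounded_linear [OF bounded_linear_of_real kinner_self_has_sum [of x]]
     in \<open>simp add: o_def mult_cnjg_self del: of_real_power\<close>)

lemma kinner_self_eq_0:
  assumes "rpart (kinner x x) = 0" shows "x = 0"
proof (rule ell2_eqI)
  fix \<iota>
  have "(norm (Rep_ell2 x \<iota>))\<^sup>2 \<le> 0"
    using has_sum_mono_neutral [OF has_sum_finite [of "{\<iota>}" "\<lambda>\<iota>. (norm (Rep_ell2 x \<iota>))\<^sup>2"]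
        kinner_self_has_sum [of x]] assms
    by auto
  then show "Rep_ell2 x \<iota> = Rep_ell2 0 \<iota>" by simp
qed

instantiation ell2 :: (type, real_or_complex) real_inner
begin

definition scaleR_ell2 :: "real \<Rightarrow> ('a, 'b) ell2 \<Rightarrow> ('a, 'b) ell2" where
  "scaleR_ell2 r x = kscale (of_real r) x"
definition inner_ell2 :: "('a, 'b) ell2 \<Rightarrow> ('a, 'b) ell2 \<Rightarrow> real" where
  "inner_ell2 x y = rpart (kinner x y)"
definition norm_ell2 :: "('a, 'b) ell2 \<Rightarrow> real" where
  "norm_ell2 x = sqrt (inner x x)"
definition sgn_ell2 :: "('a, 'b) ell2 \<Rightarrow> ('a, 'b) ell2" where
  "sgn_ell2 x = inverse (norm x) *\<^sub>R x"
definition dist_ell2 :: "('a, 'b) ell2 \<Rightarrow> ('a, 'b) ell2 \<Rightarrow> real" where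
  "dist_ell2 x y = norm (x - y)"
definition uniformity_ell2 :: "(('a, 'b) ell2 \<times> ('a, 'b) ell2) filter" where
  "uniformity_ell2 = (INF e\<in>{0 <..}. principal {(x, y). dist x y < e})"
definition open_ell2 :: "('a, 'b) ell2 set \<Rightarrow> bool" where
  "open_ell2 U \<longleftrightarrow> (\<forall>x\<in>U. eventually (\<lambda>(x', y). x' = x \<longrightarrow> y \<in> U) uniformity)"

instance
proof
  fix x y z :: "('a, 'b) ell2" and a b r :: real
  show "a *\<^sub>R (x + y) = a *\<^sub>R x + a *\<^sub>R y" "(a + b) *\<^sub>R x = a *\<^sub>R x + b *\<^sub>R x"
    "a *\<^sub>R b *\<^sub>R x = (a * b) *\<^sub>R x" "1 *\<^sub>R x = x"
    by (rule ell2_eqI; simp add: scaleR_ell2_def algebra_simps)+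
  show "sgn x = inverse (norm x) *\<^sub>R x"
    "dist x y = norm (x - y)"
    "norm x = sqrt (inner x x)"
    "uniformity = (INF e\<in>{0 <..}. principal {(x :: ('a, 'b) ell2, y). dist x y < e})"
    by (simp_all add: sgn_ell2_def dist_ell2_def norm_ell2_def uniformity_ell2_def)
  show "open U \<longleftrightarrow> (\<forall>x\<in>U. eventually (\<lambda>(x', y). x' = x \<longrightarrow> y \<in> U) uniformity)"
    for U :: "('a, 'b) ell2 set"
    by (simp add: open_ell2_def)
  show "inner x y = inner y x"
    by (metis inner_ell2_def kinner_commute rpart_cnjg)
  show "inner (x + y) z = inner x z + inner y z"
    by (simp add: inner_ell2_def kinner_add_left rpart_add)
  show "inner (r *\<^sub>R x) y = r * inner x y"
    by (simp add: inner_ell2_def scaleR_ell2_def kinner_kscale_left rpart_scaleR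
        flip: scaleR_conv_of_real)
  show "0 \<le> inner x x"
    unfolding inner_ell2_def by (rule has_sum_nonneg [OF kinner_self_has_sum]) simp
  show "inner x x = 0 \<longleftrightarrow> x = 0"
    using kinner_self_eq_0 [of x] kinner_add_left [of 0 0 "0 :: ('a, 'b) ell2"]
    by (auto simp: inner_ell2_def)
qed

end

lemma kinner_self_norm: "kinner x x = of_real ((norm x)\<^sup>2)"
proof -
  have "rpart (kinner x x) = (norm x)\<^sup>2"
    by (simp add: dot_square_norm flip: inner_ell2_def)
  then show ?thesis
    by (metis kinner_self)
qed

lemma norm_ell2_has_sum: "((\<lambda>\<iota>. (norm (Rep_ell2 x \<iota>))\<^sup>2) has_sum (norm x)\<^sup>2) UNIV"
  using kinner_self_has_sum [of x] by (simp add: kinner_self_norm del: of_real_power)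

lemma l2_norm_Rep_ell2: "l2_norm (Rep_ell2 x) = norm x"
  using infsumI [OF norm_ell2_has_sum [of x]] by (simp add: l2_norm_def)

lemma norm_kscale: "norm (kscale c x) = norm c * norm x"
proof (rule power2_eq_imp_eq)
  have "((\<lambda>\<iota>. (norm (Rep_ell2 (kscale c x) \<iota>))\<^sup>2) has_sum (norm c)\<^sup>2 * (norm x)\<^sup>2) UNIV"
    using has_sum_cmult_right [OF norm_ell2_has_sum [of x], of "(norm c)\<^sup>2"]
    by (simp add: norm_mult power_mult_distrib)
  then show "(norm (kscale c x))\<^sup>2 = (norm c * norm x)\<^sup>2"
    using norm_ell2_has_sum [of "kscale c x"] has_sum_unique
    by (fastforce simp: power_mult_distrib)
qed auto

lemma norm_ell2_le_iff:
  assumes "0 \<le> B"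
  shows "norm x \<le> B \<longleftrightarrow> (\<forall>F. finite F \<longrightarrow> (\<Sum>\<iota>\<in>F. (norm (Rep_ell2 x \<iota>))\<^sup>2) \<le> B\<^sup>2)"
proof
  assume "norm x \<le> B"
  show "\<forall>F. finite F \<longrightarrow> (\<Sum>\<iota>\<in>F. (norm (Rep_ell2 x \<iota>))\<^sup>2) \<le> B\<^sup>2"
  proof (intro allI impI)
    fix F :: "'a set" assume "finite F"
    have "(\<Sum>\<iota>\<in>F. (norm (Rep_ell2 x \<iota>))\<^sup>2) \<le> (norm x)\<^sup>2"
      using has_sum_mono_neutral [OF has_sum_finite [OF \<open>finite F\<close>] norm_ell2_has_sum [of x]]
      by auto
    also have "\<dots> \<le> B\<^sup>2"
      using \<open>norm x \<le> B\<close> by (intro power_mono) auto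
    finally show "(\<Sum>\<iota>\<in>F. (norm (Rep_ell2 x \<iota>))\<^sup>2) \<le> B\<^sup>2" .
  qed
next
  assume "\<forall>F. finite F \<longrightarrow> (\<Sum>\<iota>\<in>F. (norm (Rep_ell2 x \<iota>))\<^sup>2) \<le> B\<^sup>2"
  then have "(norm x)\<^sup>2 \<le> B\<^sup>2"
    by (intro has_sum_le_finite_sums [OF norm_ell2_has_sum]) auto
  then show "norm x \<le> B"
    using assms by (rule power2_le_imp_le)
qed

lemma norm_Rep_ell2_le: "norm (Rep_ell2 x \<iota>) \<le> norm x"
  using norm_ell2_le_iff [of "norm x" x]
  by (auto dest!: spec [of _ "{\<iota>}"] intro: power2_le_imp_le)

lemma norm_kinner_le: "norm (kinner x y) \<le> norm x * norm y"
proof (cases "kinner x y = 0")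
  case False
  let ?k = "kinner x y"
  \<comment> \<open>Multiplying \<open>x\<close> by this phase makes the inner product real and
    nonnegative, so that Cauchy-Schwarz for the real \<open>inner\<close> bounds the
    modulus.\<close>
  let ?c = "cnjg ?k / of_real (norm ?k)"
  have "kinner (kscale ?c x) y = of_real (norm ?k)"
    using False mult_cnjg_self [of ?k]
    by (simp add: kinner_kscale_left power2_eq_square mult.commute)
  then have "norm ?k = inner (kscale ?c x) y"
    by (simp add: inner_ell2_def)
  also have "\<dots> \<le> norm (kscale ?c x) * norm y"
    by (rule norm_cauchy_schwarz)
  also have "norm (kscale ?c x) = norm x"
    using False by (simp add: norm_kscale norm_divide)
  finally show ?thesis .
qed simp

lemma bounded_bilinear_kinner:
  "bounded_bilinear (kinner :: ('i, 'k::real_or_complex) ell2 \<Rightarrow> _)"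
proof
  fix x y z :: "('i, 'k) ell2" and r :: real
  show "kinner (r *\<^sub>R x) y = r *\<^sub>R kinner x y" "kinner x (r *\<^sub>R y) = r *\<^sub>R kinner x y"
    by (simp_all add: scaleR_ell2_def kinner_kscale_left kinner_kscale_right scaleR_conv_of_real)
  show "\<exists>K. \<forall>(a :: ('i, 'k) ell2) b. norm (kinner a b) \<le> norm a * norm b * K"
    by (intro exI [of _ 1]) (simp add: norm_kinner_le)
qed (simp_all add: kinner_add_left kinner_add_right)

lemma bounded_bilinear_kscale:
  "bounded_bilinear (kscale :: 'k \<Rightarrow> ('i, 'k::real_or_complex) ell2 \<Rightarrow> _)"
proof
  fix a b :: 'k and x y :: "('i, 'k) ell2" and r :: real
  show "kscale (a + b) x = kscale a x + kscale b x" "kscale a (x + y) = kscale a x + kscale a y"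
    "kscale (r *\<^sub>R a) x = r *\<^sub>R kscale a x" "kscale a (r *\<^sub>R x) = r *\<^sub>R kscale a x"
    by (rule ell2_eqI; simp add: scaleR_ell2_def algebra_simps scaleR_conv_of_real)+
  show "\<exists>K. \<forall>a (x :: ('i, 'k) ell2). norm (kscale a x) \<le> norm a * norm x * K"
    by (intro exI [of _ 1]) (simp add: norm_kscale)
qed

interpretation kinner: bounded_bilinear kinner
  by (rule bounded_bilinear_kinner)

interpretation kscale: bounded_bilinear kscale
  by (rule bounded_bilinear_kscale)

lemma kscale_kscale [simp]: "kscale a (kscale b x) = kscale (a * b) x"
  by (rule ell2_eqI) (simp add: mult.assoc)

lemma kscale_1 [simp]: "kscale 1 x = x"
  by (rule ell2_eqI) simp

lemma Rep_ell2_sum: "Rep_ell2 (\<Sum>i\<in>F. f i) \<iota> = (\<Sum>i\<in>F. Rep_ell2 (f i) \<iota>)"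
  by (induction F rule: infinite_finite_induct) auto

lift_definition unit_vec :: "'i \<Rightarrow> ('i, 'k::real_or_complex) ell2" is "\<lambda>\<iota> \<kappa>. if \<kappa> = \<iota> then 1 else 0"
proof (rule l2_boundedI [where B = 1])
  fix \<iota> :: 'i and F :: "'i set" assume "finite F"
  then show "(\<Sum>\<kappa>\<in>F. (norm (if \<kappa> = \<iota> then 1 else 0 :: 'k))\<^sup>2) \<le> 1"
    by (simp add: if_distrib [of "\<lambda>x. (norm x)\<^sup>2"] cong: if_cong)
qed

lemma kinner_unit_vec: "kinner x (unit_vec \<iota>) = Rep_ell2 x \<iota>"
proof (rule kinner_eqI)
  have "((\<lambda>\<kappa>. Rep_ell2 x \<kappa> * cnjg (Rep_ell2 (unit_vec \<iota>) \<kappa>)) has_sum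
      (\<Sum>\<kappa>\<in>{\<iota>}. Rep_ell2 x \<kappa> * cnjg (Rep_ell2 (unit_vec \<iota>) \<kappa>))) {\<iota>}"
    by (rule has_sum_finite) simp
  then show "((\<lambda>\<kappa>. Rep_ell2 x \<kappa> * cnjg (Rep_ell2 (unit_vec \<iota>) \<kappa>)) has_sum Rep_ell2 x \<iota>) UNIV"
    by (subst has_sum_cong_neutral [where T = "{\<iota>}"]) (auto simp: unit_vec.rep_eq)
qed

lemma norm_unit_vec [simp]: "norm (unit_vec \<iota> :: ('i, 'k::real_or_complex) ell2) = 1"
proof -
  have "(of_real ((norm (unit_vec \<iota> :: ('i, 'k) ell2))\<^sup>2) :: 'k) = of_real 1"
    by (metis kinner_self_norm kinner_unit_vec of_real_1 unit_vec.rep_eq)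
  then have "(norm (unit_vec \<iota> :: ('i, 'k) ell2))\<^sup>2 = 1"
    using of_real_eq_iff by blast
  then show ?thesis by (metis norm_ge_zero one_power2 power2_eq_imp_eq zero_le_one)
qed

lemma Rep_ell2_tendsto: "(f \<longlongrightarrow> l) F \<Longrightarrow> ((\<lambda>s. Rep_ell2 (f s) \<iota>) \<longlongrightarrow> Rep_ell2 l \<iota>) F"
  by (simp add: kinner.tendsto flip: kinner_unit_vec)

lemma kinner_left_eqI: "(\<And>z. kinner x z = kinner y z) \<Longrightarrow> x = y"
  by (metis ell2_eqI kinner_unit_vec)

text \<open>The vector \<open>b\<close> is split into a finitely supported part, handled by the
  coordinates, and a tail of small norm, handled by Cauchy-Schwarz and the bound \<open>C\<close>.
  The filter is arbitrary, so that neighbourhoods and ultrafilters are both covered.\<close>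

lemma weak_tendsto:
  fixes f :: "'s \<Rightarrow> ('i, 'k::real_or_complex) ell2"
  assumes bnd: "\<forall>\<^sub>F s in F. norm (f s) \<le> C" "norm l \<le> C"
    and crd: "\<And>\<iota>. ((\<lambda>s. Rep_ell2 (f s) \<iota>) \<longlongrightarrow> Rep_ell2 l \<iota>) F"
  shows "((\<lambda>s. kinner (f s) b) \<longlongrightarrow> kinner l b) F"
proof (rule tendstoI)
  fix e :: real assume "e > 0"
  have C: "C \<ge> 0" using bnd(2) norm_ge_zero order_trans by blast
  \<comment> \<open>The tail of \<open>b\<close> then contributes at most \<open>e / 4\<close> for
    \<open>f s\<close> and for \<open>l\<close>; adding \<open>1\<close> keeps the quotient
    meaningful when \<open>C = 0\<close>.\<close>
  define d where "d = e / (4 * (C + 1))"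
  have "d > 0" using \<open>e > 0\<close> C by (simp add: d_def)
  from norm_ell2_has_sum [of b] have "\<forall>\<^sub>F A in finite_subsets_at_top UNIV.
      dist (\<Sum>\<iota>\<in>A. (norm (Rep_ell2 b \<iota>))\<^sup>2) ((norm b)\<^sup>2) < d\<^sup>2"
    unfolding has_sum_def using \<open>d > 0\<close> by (intro tendstoD) auto
  then obtain A where A: "finite A" "dist (\<Sum>\<iota>\<in>A. (norm (Rep_ell2 b \<iota>))\<^sup>2) ((norm b)\<^sup>2) < d\<^sup>2"
    unfolding eventually_finite_subsets_at_top by blast
  define b1 where "b1 = (\<Sum>\<iota>\<in>A. kscale (Rep_ell2 b \<iota>) (unit_vec \<iota>))"
  define b2 where "b2 = b - b1"
  have Rep_b1: "Rep_ell2 b1 \<kappa> = (if \<kappa> \<in> A then Rep_ell2 b \<kappa> else 0)" for \<kappa>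
    using A(1) by (simp add: b1_def Rep_ell2_sum unit_vec.rep_eq if_distrib [of "(*) _"] sum.delta'
        cong: if_cong)
  have "norm b2 \<le> d"
    unfolding norm_ell2_le_iff [OF less_imp_le [OF \<open>d > 0\<close>]]
  proof (intro allI impI)
    fix F :: "'i set" assume F: "finite F"
    have "(\<Sum>\<iota>\<in>F. (norm (Rep_ell2 b2 \<iota>))\<^sup>2) = (\<Sum>\<iota>\<in>F - A. (norm (Rep_ell2 b \<iota>))\<^sup>2)"
      using F by (intro sum.mono_neutral_cong_right) (auto simp: b2_def Rep_b1)
    also have "\<dots> = (\<Sum>\<iota>\<in>F \<union> A. (norm (Rep_ell2 b \<iota>))\<^sup>2) - (\<Sum>\<iota>\<in>A. (norm (Rep_ell2 b \<iota>))\<^sup>2)"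
      using F A(1) by (subst sum_diff [symmetric]) (auto intro: sum.cong)
    also have "\<dots> \<le> (norm b)\<^sup>2 - (\<Sum>\<iota>\<in>A. (norm (Rep_ell2 b \<iota>))\<^sup>2)"
      using norm_ell2_le_iff [of "norm b" b] F A(1) by auto
    also have "\<dots> \<le> d\<^sup>2"
      using A(2) by (simp add: dist_real_def)
    finally show "(\<Sum>\<iota>\<in>F. (norm (Rep_ell2 b2 \<iota>))\<^sup>2) \<le> d\<^sup>2" .
  qed
  have kb1: "kinner x b1 = (\<Sum>\<iota>\<in>A. cnjg (Rep_ell2 b \<iota>) * Rep_ell2 x \<iota>)" for x
    by (simp add: b1_def kinner.sum_right kinner_kscale_right kinner_unit_vec)
  have "((\<lambda>s. kinner (f s) b1) \<longlongrightarrow> kinner l b1) F"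
    unfolding kb1 by (intro tendsto_intros crd)
  then have "\<forall>\<^sub>F s in F. dist (kinner (f s) b1) (kinner l b1) < e / 2"
    using \<open>e > 0\<close> by (intro tendstoD) auto
  then show "\<forall>\<^sub>F s in F. dist (kinner (f s) b) (kinner l b) < e"
    using bnd(1)
  proof eventually_elim
    case (elim s)
    have b: "b = b1 + b2" by (simp add: b2_def)
    have small: "norm (kinner x b2) \<le> e / 4" if "norm x \<le> C" for x
    proof -
      have "norm (kinner x b2) \<le> C * d"
        using that \<open>norm b2 \<le> d\<close> C
        by (intro order_trans [OF norm_kinner_le] mult_mono) auto
      also have "\<dots> \<le> e / 4"
        using \<open>e > 0\<close> C by (simp add: d_def field_simps)
      finally show ?thesis .
    qed
    have "kinner (f s) b - kinner l b
        = (kinner (f s) b1 - kinner l b1) + (kinner (f s) b2 - kinner l b2)"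
      by (simp add: b kinner_add_right)
    then have "norm (kinner (f s) b - kinner l b)
        \<le> norm (kinner (f s) b1 - kinner l b1) + (norm (kinner (f s) b2) + norm (kinner l b2))"
      by (metis (no_types) add_left_mono norm_triangle_ineq norm_triangle_ineq4 order_trans)
    also have "\<dots> < e / 2 + (e / 4 + e / 4)"
      using elim small [of "f s"] small [OF bnd(2)] by (simp add: dist_norm)
    finally show ?case by (simp add: dist_norm)
  qed
qed

section \<open>Compact operators on the Hilbert space\<close>

text \<open>Linearity is not built in: it follows from having an adjoint, because vectors are
  determined by their inner products.\<close>

definition kadj ::
  "(('i, 'k::real_or_complex) ell2 \<Rightarrow> ('i, 'k) ell2) \<Rightarrow> (('i, 'k) ell2 \<Rightarrow> ('i, 'k) ell2) \<Rightarrow> bool" where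
  "kadj x y \<longleftrightarrow> (\<forall>\<zeta> \<eta>. kinner (x \<zeta>) \<eta> = kinner \<zeta> (y \<eta>))"

lemma kadjD: "kadj x y \<Longrightarrow> kinner (x \<zeta>) \<eta> = kinner \<zeta> (y \<eta>)"
  by (simp add: kadj_def)

lemma kadj_sym: "kadj x y \<Longrightarrow> kadj y x"
  unfolding kadj_def by (metis kinner_commute)

lemma kadj_add: "kadj x y \<Longrightarrow> x (\<zeta> + \<zeta>') = x \<zeta> + x \<zeta>'"
  by (rule kinner_left_eqI) (simp add: kadjD kinner_add_left)

lemma kadj_kscale: "kadj x y \<Longrightarrow> x (kscale c \<zeta>) = kscale c (x \<zeta>)"
  by (rule kinner_left_eqI) (simp add: kadjD kinner_kscale_left)

lemma kadj_diff: "kadj x y \<Longrightarrow> x (\<zeta> - \<zeta>') = x \<zeta> - x \<zeta>'"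
  by (rule kinner_left_eqI) (simp add: kadjD kinner.diff_left)

lemma kadj_0: "kadj x y \<Longrightarrow> x 0 = 0"
  using kadj_diff [of x y 0 0] by simp

lemma kadj_sum: "kadj x y \<Longrightarrow> x (\<Sum>i\<in>F. f i) = (\<Sum>i\<in>F. x (f i))"
  by (induction F rule: infinite_finite_induct) (simp_all add: kadj_0 kadj_add)

lemma kadj_inner: "kadj x y \<Longrightarrow> inner (x \<zeta>) \<eta> = inner \<zeta> (y \<eta>)"
  by (simp add: inner_ell2_def kadjD)

text \<open>Pair \<open>y \<zeta>\<close> with itself and cancel one factor
  \<open>norm (y \<zeta>)\<close>. If that factor is \<open>0\<close>, the assumed bound shows that
  the right-hand side is nonnegative.\<close>

lemma kadj_bound:
  assumes "kadj x y" "\<And>\<zeta>. norm (x \<zeta>) \<le> C * norm \<zeta>"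
  shows "norm (y \<zeta>) \<le> C * norm \<zeta>"
proof (cases "y \<zeta> = 0")
  case True
  then show ?thesis
    using order_trans [OF norm_ge_zero assms(2) [of \<zeta>]] by simp
next
  case False
  have "(norm (y \<zeta>))\<^sup>2 = inner (x (y \<zeta>)) \<zeta>"
    using assms(1) by (simp add: kadj_inner power2_norm_eq_inner)
  also have "\<dots> \<le> C * norm (y \<zeta>) * norm \<zeta>"
    by (intro order_trans [OF norm_cauchy_schwarz] mult_right_mono assms) auto
  finally show ?thesis
    using False by (simp add: power2_eq_square mult.commute mult.left_commute)
qed

text \<open>With explicit vectors the adjoint of a finite rank operator is a swap of
  \<open>a\<close> and \<open>b\<close>, and a sum of two such operators is a concatenation.\<close>

definition frank ::
  "nat \<Rightarrow> (nat \<Rightarrow> ('i, 'k::real_or_complex) ell2) \<Rightarrow> (nat \<Rightarrow> ('i, 'k) ell2) \<Rightarrow> ('i, 'k) ell2 \<Rightarrow> ('i, 'k) ell2"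
  where "frank n a b \<zeta> = (\<Sum>k<n. kscale (kinner \<zeta> (b k)) (a k))"

lemma kadj_frank: "kadj (frank n a b) (frank n b a)"
  unfolding kadj_def frank_def
  by (simp add: kinner.sum_left kinner.sum_right kinner_kscale_left kinner_kscale_right
      mult.commute flip: kinner_commute)

lemma norm_frank_le: "norm (frank n a b \<zeta>) \<le> (\<Sum>k<n. norm (b k) * norm (a k)) * norm \<zeta>"
proof -
  have "norm (frank n a b \<zeta>) \<le> (\<Sum>k<n. norm \<zeta> * norm (b k) * norm (a k))"
    unfolding frank_def
    by (intro sum_norm_le) (simp add: norm_kscale norm_kinner_le mult_right_mono)
  also have "\<dots> = (\<Sum>k<n. norm (b k) * norm (a k)) * norm \<zeta>"
    by (simp add: sum_distrib_left mult_ac)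
  finally show ?thesis .
qed

lemma sum_lessThan_add: "(\<Sum>k<m + n. f k) = (\<Sum>k<m. f k) + (\<Sum>k<n. f (m + k :: nat) :: 'a::comm_monoid_add)"
  by (induction n) (simp_all add: add.assoc)

lemma frank_append:
  "frank (m + n) (\<lambda>k. if k < m then a k else a' (k - m)) (\<lambda>k. if k < m then b k else b' (k - m)) \<zeta>
    = frank m a b \<zeta> + frank n a' b' \<zeta>"
  unfolding frank_def sum_lessThan_add by simp

text \<open>The inequality on all vectors stands in for an operator norm, so that boundedness need
  not be known beforehand.\<close>

definition rk_approx :: "(('i, 'k::real_or_complex) ell2 \<Rightarrow> ('i, 'k) ell2) \<Rightarrow> nat \<Rightarrow> real \<Rightarrow> bool" where
  "rk_approx x n \<epsilon> \<longleftrightarrow> (\<exists>a b. \<forall>\<zeta>. norm (x \<zeta> - frank n a b \<zeta>) \<le> \<epsilon> * norm \<zeta>)"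

text \<open>Approximability by finite rank is taken as the definition of compactness because it is
  what membership in \<open>compact_ops\<close> yields in each fibre.\<close>

definition cpt :: "(('i, 'k::real_or_complex) ell2 \<Rightarrow> ('i, 'k) ell2) \<Rightarrow> bool" where
  "cpt x \<longleftrightarrow> (\<forall>\<epsilon>>0. \<exists>n. rk_approx x n \<epsilon>)"

text \<open>The approximation numbers; they are the singular values (\<open>sing_val_eq_apn\<close>), but their
  perturbation inequalities are immediate.\<close>

definition apn :: "(('i, 'k::real_or_complex) ell2 \<Rightarrow> ('i, 'k) ell2) \<Rightarrow> nat \<Rightarrow> real" where
  "apn x n = Inf {\<epsilon>. 0 \<le> \<epsilon> \<and> rk_approx x n \<epsilon>}"

lemma rk_approx_add:
  assumes "rk_approx x m \<epsilon>" "rk_approx y n \<delta>"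
  shows "rk_approx (\<lambda>\<zeta>. x \<zeta> + y \<zeta>) (m + n) (\<epsilon> + \<delta>)"
proof -
  obtain a b a' b' where 1: "\<And>\<zeta>. norm (x \<zeta> - frank m a b \<zeta>) \<le> \<epsilon> * norm \<zeta>"
    and 2: "\<And>\<zeta>. norm (y \<zeta> - frank n a' b' \<zeta>) \<le> \<delta> * norm \<zeta>"
    using assms unfolding rk_approx_def by blast
  have "norm (x \<zeta> + y \<zeta> - (frank m a b \<zeta> + frank n a' b' \<zeta>)) \<le> (\<epsilon> + \<delta>) * norm \<zeta>" for \<zeta>
    using norm_triangle_le [OF add_mono [OF 1 [of \<zeta>] 2 [of \<zeta>]]] by (simp add: algebra_simps)
  then show ?thesis
    unfolding rk_approx_def frank_append [symmetric] by blast
qed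

lemma rk_approx_0: "(\<And>\<zeta>. norm (x \<zeta>) \<le> C * norm \<zeta>) \<Longrightarrow> rk_approx x 0 C"
  by (auto simp: rk_approx_def frank_def)

lemma rk_approx_perturb:
  assumes "rk_approx x n \<epsilon>" "\<And>\<zeta>. norm (y \<zeta> - x \<zeta>) \<le> \<delta> * norm \<zeta>"
  shows "rk_approx y n (\<epsilon> + \<delta>)"
  using rk_approx_add [OF assms(1) rk_approx_0 [OF assms(2)]] by simp

lemma rk_approx_kscale:
  assumes "rk_approx x n \<epsilon>"
  shows "rk_approx (\<lambda>\<zeta>. kscale c (x \<zeta>)) n (norm c * \<epsilon>)"
proof -
  obtain a b where 1: "\<And>\<zeta>. norm (x \<zeta> - frank n a b \<zeta>) \<le> \<epsilon> * norm \<zeta>"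
    using assms unfolding rk_approx_def by blast
  have "kscale c (x \<zeta>) - frank n (\<lambda>k. kscale c (a k)) b \<zeta> = kscale c (x \<zeta> - frank n a b \<zeta>)" for \<zeta>
    by (simp add: frank_def kscale.diff_right kscale.sum_right mult.commute)
  then have "norm (kscale c (x \<zeta>) - frank n (\<lambda>k. kscale c (a k)) b \<zeta>) \<le> norm c * \<epsilon> * norm \<zeta>" for \<zeta>
    using 1 by (simp add: norm_kscale mult.assoc mult_left_mono)
  then show ?thesis unfolding rk_approx_def by blast
qed

lemma rk_approx_kadj:
  assumes "kadj x y" "rk_approx x n \<epsilon>"
  shows "rk_approx y n \<epsilon>"
proof -
  obtain a b where 1: "\<And>\<zeta>. norm (x \<zeta> - frank n a b \<zeta>) \<le> \<epsilon> * norm \<zeta>"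
    using assms unfolding rk_approx_def by blast
  have "kadj (\<lambda>\<zeta>. x \<zeta> - frank n a b \<zeta>) (\<lambda>\<zeta>. y \<zeta> - frank n b a \<zeta>)"
    using assms(1) kadj_frank [of n a b] by (simp add: kadj_def kinner.diff_left kinner.diff_right)
  from kadj_bound [OF this 1] show ?thesis
    unfolding rk_approx_def by blast
qed

lemma rk_approx_bounded: "rk_approx x n \<epsilon> \<Longrightarrow> \<exists>C\<ge>0. \<forall>\<zeta>. norm (x \<zeta>) \<le> C * norm \<zeta>"
proof -
  assume "rk_approx x n \<epsilon>"
  then obtain a b where 1: "\<And>\<zeta>. norm (x \<zeta> - frank n a b \<zeta>) \<le> \<epsilon> * norm \<zeta>"
    unfolding rk_approx_def by blast
  let ?S = "\<Sum>k<n. norm (b k) * norm (a k)"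
  have "norm (x \<zeta>) \<le> max 0 (\<epsilon> + ?S) * norm \<zeta>" for \<zeta>
  proof -
    have "norm (x \<zeta>) \<le> norm (x \<zeta> - frank n a b \<zeta>) + norm (frank n a b \<zeta>)"
      by (metis norm_triangle_sub add.commute)
    also have "\<dots> \<le> (\<epsilon> + ?S) * norm \<zeta>"
      using 1 [of \<zeta>] norm_frank_le [of n a b \<zeta>] by (simp add: distrib_right)
    also have "\<dots> \<le> max 0 (\<epsilon> + ?S) * norm \<zeta>"
      by (intro mult_right_mono) auto
    finally show ?thesis .
  qed
  then show ?thesis by (intro exI [of _ "max 0 (\<epsilon> + ?S)"]) auto
qed

lemma cpt_bounded: "cpt x \<Longrightarrow> \<exists>C\<ge>0. \<forall>\<zeta>. norm (x \<zeta>) \<le> C * norm \<zeta>"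
  unfolding cpt_def using rk_approx_bounded zero_less_one by blast

lemma rk_approx_mono:
  assumes "rk_approx x m \<epsilon>" "m \<le> n"
  shows "rk_approx x n \<epsilon>"
proof -
  have "rk_approx (\<lambda>_. 0 :: ('a, 'b) ell2) (n - m) 0"
    unfolding rk_approx_def
    by (intro exI [of _ "\<lambda>_. 0"]) (simp add: frank_def kinner.zero_right kscale.zero_left)
  from rk_approx_add [OF assms(1) this] show ?thesis
    using assms(2) by simp
qed

lemma apn_le: "0 \<le> \<epsilon> \<Longrightarrow> rk_approx x n \<epsilon> \<Longrightarrow> apn x n \<le> \<epsilon>"
  unfolding apn_def by (rule cInf_lower) (auto simp: bdd_below_def)

text \<open>Guards the infimum in \<open>apn\<close>, which would be unspecified for an empty
  set.\<close>

lemma bounded_approx_nonempty: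
  assumes "cpt x" shows "{\<epsilon>. 0 \<le> \<epsilon> \<and> rk_approx x n \<epsilon>} \<noteq> {}"
proof -
  obtain C where "C \<ge> 0" "\<And>\<zeta>. norm (x \<zeta>) \<le> C * norm \<zeta>"
    using cpt_bounded [OF assms] by blast
  then have "rk_approx x n C"
    using rk_approx_mono [OF rk_approx_0] by blast
  with \<open>C \<ge> 0\<close> show ?thesis by blast
qed

lemma apn_ge:
  assumes "cpt x" "\<And>\<epsilon>. 0 \<le> \<epsilon> \<Longrightarrow> rk_approx x n \<epsilon> \<Longrightarrow> c \<le> \<epsilon>"
  shows "c \<le> apn x n"
  unfolding apn_def using bounded_approx_nonempty [OF assms(1)] assms(2)
  by (intro cInf_greatest) auto

lemma apn_nonneg: "cpt x \<Longrightarrow> 0 \<le> apn x n"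
  by (rule apn_ge)

lemma apn_approx:
  assumes "cpt x" "apn x n < \<epsilon>"
  shows "rk_approx x n \<epsilon>"
proof -
  obtain e where "0 \<le> e" "rk_approx x n e" "e < \<epsilon>"
    using cInf_lessD [OF bounded_approx_nonempty [OF assms(1)]] assms(2) unfolding apn_def by blast
  then show ?thesis
    using rk_approx_perturb [of x n e x "\<epsilon> - e"] by simp
qed

lemma cpt_add:
  assumes "cpt x" "cpt y" shows "cpt (\<lambda>\<zeta>. x \<zeta> + y \<zeta>)"
  unfolding cpt_def
proof (intro allI impI)
  fix \<epsilon> :: real assume "\<epsilon> > 0"
  then obtain m n where "rk_approx x m (\<epsilon> / 2)" "rk_approx y n (\<epsilon> / 2)"
    using assms unfolding cpt_def by (meson half_gt_zero)
  from rk_approx_add [OF this] show "\<exists>n. rk_approx (\<lambda>\<zeta>. x \<zeta> + y \<zeta>) n \<epsilon>"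
    by auto
qed

lemma cpt_frank: "cpt (frank n a b)"
  unfolding cpt_def rk_approx_def by (intro allI impI exI [of _ n] exI [of _ a] exI [of _ b]) simp

text \<open>Approximants add, and so do their ranks and errors; \<open>e\<close> enters because the
  infima need not be attained. The closure of the trace class under sums comes from this
  inequality.\<close>

lemma apn_add:
  assumes "cpt x" "cpt y"
  shows "apn (\<lambda>\<zeta>. x \<zeta> + y \<zeta>) (m + n) \<le> apn x m + apn y n"
proof (rule field_le_epsilon)
  fix e :: real assume "e > 0"
  have "rk_approx (\<lambda>\<zeta>. x \<zeta> + y \<zeta>) (m + n) ((apn x m + e/2) + (apn y n + e/2))"
    using \<open>e > 0\<close> by (intro rk_approx_add apn_approx assms) auto
  moreover have "(apn x m + e/2) + (apn y n + e/2) = apn x m + apn y n + e" by simp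
  ultimately show "apn (\<lambda>\<zeta>. x \<zeta> + y \<zeta>) (m + n) \<le> apn x m + apn y n + e"
    using \<open>e > 0\<close> apn_nonneg [OF assms(1), of m] apn_nonneg [OF assms(2), of n]
    by (intro apn_le) auto
qed

lemma apn_perturb:
  assumes "cpt x" "0 \<le> \<delta>" "\<And>\<zeta>. norm (y \<zeta> - x \<zeta>) \<le> \<delta> * norm \<zeta>"
  shows "apn y n \<le> apn x n + \<delta>"
proof (rule field_le_epsilon)
  fix e :: real assume "e > 0"
  have "rk_approx y n ((apn x n + e) + \<delta>)"
    using \<open>e > 0\<close> by (intro rk_approx_perturb [OF _ assms(3)] apn_approx assms) auto
  then show "apn y n \<le> apn x n + \<delta> + e"
    using \<open>e > 0\<close> apn_nonneg [OF assms(1), of n] assms(2)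
    by (intro apn_le) (auto simp: field_simps)
qed

lemma apn_kscale_le:
  assumes "cpt x"
  shows "apn (\<lambda>\<zeta>. kscale c (x \<zeta>)) n \<le> norm c * apn x n"
proof (rule field_le_epsilon)
  fix e :: real assume "e > 0"
  \<comment> \<open>Chosen so that \<open>norm c * ?d \<le> e\<close> holds for \<open>c = 0\<close>
    as well.\<close>
  let ?d = "e / (norm c + 1)"
  have "?d > 0" using \<open>e > 0\<close> by (simp add: add_nonneg_pos)
  then have "rk_approx (\<lambda>\<zeta>. kscale c (x \<zeta>)) n (norm c * (apn x n + ?d))"
    by (intro rk_approx_kscale apn_approx assms) auto
  then have "apn (\<lambda>\<zeta>. kscale c (x \<zeta>)) n \<le> norm c * (apn x n + ?d)"
    using \<open>?d > 0\<close> apn_nonneg [OF assms, of n] by (intro apn_le) auto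
  also have "norm c * ?d \<le> e"
    using \<open>e > 0\<close> norm_ge_zero [of c] by (simp add: divide_le_eq add_nonneg_pos distrib_left mult.commute)
  then have "norm c * (apn x n + ?d) \<le> norm c * apn x n + e"
    by (simp add: distrib_left)
  finally show "apn (\<lambda>\<zeta>. kscale c (x \<zeta>)) n \<le> norm c * apn x n + e" .
qed

lemma apn_kadj:
  assumes "kadj x y"
  shows "apn y = apn x"
proof -
  have "rk_approx y n \<epsilon> \<longleftrightarrow> rk_approx x n \<epsilon>" for n \<epsilon>
    using rk_approx_kadj [OF assms] rk_approx_kadj [OF kadj_sym [OF assms]] by blast
  then show ?thesis by (simp add: apn_def fun_eq_iff)
qed

text \<open>A finite rank operator sees only finitely many inner products, and these converge by
  \<open>weak_tendsto\<close>; on the ball of radius \<open>C\<close> a compact operator differs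
  from it uniformly little.\<close>

lemma cpt_weak_tendsto:
  assumes x: "cpt x" and bnd: "\<forall>\<^sub>F s in F. norm (f s) \<le> C" "norm l \<le> C"
    and crd: "\<And>\<iota>. ((\<lambda>s. Rep_ell2 (f s) \<iota>) \<longlongrightarrow> Rep_ell2 l \<iota>) F"
  shows "((\<lambda>s. x (f s)) \<longlongrightarrow> x l) F"
proof (rule tendstoI)
  fix e :: real assume "e > 0"
  have C: "C \<ge> 0" using bnd(2) norm_ge_zero order_trans by blast
  define d where "d = e / (4 * (C + 1))"
  have "d > 0" using \<open>e > 0\<close> C by (simp add: d_def)
  have Cd: "d * C \<le> e / 4"
    using \<open>e > 0\<close> C by (simp add: d_def field_simps)
  obtain n a b where v: "\<And>\<zeta>. norm (x \<zeta> - frank n a b \<zeta>) \<le> d * norm \<zeta>"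
    using x \<open>d > 0\<close> unfolding cpt_def rk_approx_def by blast
  have "((\<lambda>s. frank n a b (f s)) \<longlongrightarrow> frank n a b l) F"
    unfolding frank_def
    by (intro tendsto_sum kscale.tendsto tendsto_const weak_tendsto [OF bnd] crd)
  then have "\<forall>\<^sub>F s in F. dist (frank n a b (f s)) (frank n a b l) < e / 2"
    using \<open>e > 0\<close> by (intro tendstoD) auto
  then show "\<forall>\<^sub>F s in F. dist (x (f s)) (x l) < e"
    using bnd(1)
  proof eventually_elim
    case (elim s)
    have small: "norm (x z - frank n a b z) \<le> e / 4" if "norm z \<le> C" for z
      using v [of z] mult_left_mono [OF that less_imp_le [OF \<open>d > 0\<close>]] Cd by linarith
    have "x (f s) - x l = (x (f s) - frank n a b (f s)) + (frank n a b (f s) - frank n a b l)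
        - (x l - frank n a b l)"
      by simp
    then have "norm (x (f s) - x l) \<le> norm (x (f s) - frank n a b (f s))
        + norm (frank n a b (f s) - frank n a b l) + norm (x l - frank n a b l)"
      using norm_triangle_ineq4 [of "(x (f s) - frank n a b (f s)) + (frank n a b (f s) - frank n a b l)"
          "x l - frank n a b l"]
        norm_triangle_ineq [of "x (f s) - frank n a b (f s)" "frank n a b (f s) - frank n a b l"]
      by simp
    also have "\<dots> < e / 4 + e / 2 + e / 4"
      using elim small [of "f s"] small [OF bnd(2)] by (simp add: dist_norm)
    finally show ?case by (simp add: dist_norm)
  qed
qed

section \<open>Singular value decomposition of a compact operator\<close>

text \<open>The unit ball is compact in the product topology, which is its weak topology.\<close>

lemma cpt_attains_norm:
  fixes x :: "('i, 'k::real_or_complex) ell2 \<Rightarrow> ('i, 'k) ell2"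
  assumes adj: "kadj x y" and x: "cpt x"
  shows "\<exists>\<eta>. norm \<eta> \<le> 1 \<and> (\<forall>\<zeta>. norm (x \<zeta>) \<le> norm (x \<eta>) * norm \<zeta>)"
proof -
  define B :: "('i \<Rightarrow> 'k) set" where "B = {f. \<forall>F. finite F \<longrightarrow> (\<Sum>\<iota>\<in>F. (norm (f \<iota>))\<^sup>2) \<le> 1}"
  have B_l2: "f \<in> l2" if "f \<in> B" for f
    using that by (intro l2_boundedI [where B = 1]) (auto simp: B_def)
  have B_norm: "norm (Abs_ell2 f) \<le> 1" if "f \<in> B" for f
    using that B_l2 [OF that] by (subst norm_ell2_le_iff) (auto simp: B_def)
  \<comment> \<open>Tychonoff's theorem for the product of scalar unit balls. The set
    \<open>B\<close> is closed in it because each finite partial sum is continuous in the product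
    topology.\<close>
  have "compact (PiE UNIV (\<lambda>_ :: 'i. cball (0 :: 'k) 1))"
    using compactin_PiE [of "\<lambda>_ :: 'i. euclidean :: 'k topology" UNIV "\<lambda>_. cball 0 1"]
    by (simp add: euclidean_product_topology compact_cball_scalar del: PiE_UNIV_domain)
  moreover have "closed B"
    unfolding B_def
    by (intro closed_Collect_all closed_Collect_imp open_Collect_const closed_Collect_le
        continuous_intros continuous_on_product_then_coordinatewise continuous_on_id)
  moreover have "B \<subseteq> PiE UNIV (\<lambda>_ :: 'i. cball (0 :: 'k) 1)"
  proof
    fix f assume "f \<in> B"
    have "norm (f \<iota>) \<le> 1" for \<iota>
      using \<open>f \<in> B\<close> by (auto simp: B_def abs_square_le_1 dest!: spec [of _ "{\<iota>}"])
    then show "f \<in> PiE UNIV (\<lambda>_ :: 'i. cball (0 :: 'k) 1)" by auto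
  qed
  ultimately have "compact B"
    by (metis compact_Int_closed inf.absorb_iff2)
  moreover have "B \<noteq> {}"
    by (auto simp: B_def intro!: exI [of _ "\<lambda>_. 0"])
  moreover have "continuous_on B (\<lambda>f. norm (x (Abs_ell2 f)))"
    unfolding continuous_on_def
  proof (intro ballI tendsto_norm cpt_weak_tendsto [OF x, where C = 1])
    fix f and \<iota> assume f: "f \<in> B"
    show "norm (Abs_ell2 f) \<le> 1" by (rule B_norm [OF f])
    show "\<forall>\<^sub>F s in at f within B. norm (Abs_ell2 s) \<le> 1"
      by (simp add: eventually_at_filter B_norm)
    have "((\<lambda>s. s \<iota>) \<longlongrightarrow> f \<iota>) (at f within B)"
      by (rule continuous_on_tendsto_compose [OF continuous_on_product_coordinates tendsto_ident_at]) auto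
    moreover have "\<forall>\<^sub>F s in at f within B. s \<iota> = Rep_ell2 (Abs_ell2 s) \<iota>"
      by (simp add: eventually_at_filter B_l2)
    ultimately have "((\<lambda>s. Rep_ell2 (Abs_ell2 s) \<iota>) \<longlongrightarrow> f \<iota>) (at f within B)"
      by (rule Lim_transform_eventually)
    then show "((\<lambda>s. Rep_ell2 (Abs_ell2 s) \<iota>) \<longlongrightarrow> Rep_ell2 (Abs_ell2 f) \<iota>) (at f within B)"
      by (simp only: Abs_ell2_inverse' [OF B_l2 [OF f]])
  qed
  ultimately obtain f where f: "f \<in> B" "\<And>g. g \<in> B \<Longrightarrow> norm (x (Abs_ell2 g)) \<le> norm (x (Abs_ell2 f))"
    using continuous_attains_sup [of B "\<lambda>f. norm (x (Abs_ell2 f))"] by blast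
  have "norm (x \<zeta>) \<le> norm (x (Abs_ell2 f)) * norm \<zeta>" for \<zeta>
  proof (cases "\<zeta> = 0")
    case True
    then show ?thesis using kadj_0 [OF adj] by simp
  next
    case False
    let ?z = "kscale (inverse (of_real (norm \<zeta>))) \<zeta>"
    have "norm ?z \<le> 1"
      using False by (simp add: norm_kscale norm_inverse)
    then have "Rep_ell2 ?z \<in> B"
      using norm_ell2_le_iff [of 1 ?z] by (simp add: B_def)
    then have "norm (x ?z) \<le> norm (x (Abs_ell2 f))"
      using f(2) [of "Rep_ell2 ?z"] by (simp add: Rep_ell2_inverse del: Rep_ell2_simps)
    moreover have "norm (x ?z) = norm (x \<zeta>) / norm \<zeta>"
      by (simp add: kadj_kscale [OF adj] norm_kscale norm_inverse divide_inverse mult.commute)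
    ultimately show ?thesis
      using False by (simp add: pos_divide_le_eq)
  qed
  then show ?thesis
    using B_norm [OF f(1)] by blast
qed

text \<open>The zero operator gets the vector \<open>0\<close> and not some unit vector. Thus
  singular vectors vanish together with their singular value, which matches the orthonormality
  relation with \<open>e_proj\<close>.\<close>

definition is_top :: "(('i, 'k::real_or_complex) ell2 \<Rightarrow> ('i, 'k) ell2) \<Rightarrow> ('i, 'k) ell2 \<Rightarrow> bool" where
  "is_top x \<eta> \<longleftrightarrow> (x \<eta> = 0 \<longrightarrow> \<eta> = 0) \<and> (\<eta> \<noteq> 0 \<longrightarrow> norm \<eta> = 1) \<and>
    (\<forall>\<zeta>. norm (x \<zeta>) \<le> norm (x \<eta>) * norm \<zeta>)"

lemma is_top_exists:
  assumes "kadj x y" "cpt x"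
  shows "\<exists>\<eta>. is_top x \<eta>"
proof -
  obtain \<eta> where \<eta>: "norm \<eta> \<le> 1" "\<And>\<zeta>. norm (x \<zeta>) \<le> norm (x \<eta>) * norm \<zeta>"
    using cpt_attains_norm [OF assms] by blast
  show ?thesis
  proof (cases "x \<eta> = 0")
    case True
    then have "is_top x 0"
      using \<eta>(2) kadj_0 [OF assms(1)] by (simp add: is_top_def)
    then show ?thesis ..
  next
    case False
    then have "norm \<eta> \<ge> 1" using \<eta>(2) [of \<eta>] by simp
    then have "is_top x \<eta>" using \<eta> False by (simp add: is_top_def)
    then show ?thesis ..
  qed
qed

text \<open>With \<open>s = norm (x \<eta>)\<close>, the squared distance between the two sides is
  at most \<open>s^4 - 2 * s^4 + s^4 = 0\<close>, since the adjoint obeys the same bound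
  \<open>s\<close> as \<open>x\<close>.\<close>

lemma is_top_adjoint:
  assumes adj: "kadj x y" and top: "is_top x \<eta>"
  shows "y (x \<eta>) = kscale (of_real ((norm (x \<eta>))\<^sup>2)) \<eta>"
proof -
  let ?s = "norm (x \<eta>)" and ?a = "y (x \<eta>)"
  have "norm ?a \<le> ?s * ?s"
    using kadj_bound [OF adj, of ?s "x \<eta>"] top by (simp add: is_top_def)
  then have a: "(norm ?a)\<^sup>2 \<le> ?s ^ 4"
    using power_mono [of "norm ?a" "?s * ?s" 2] by (simp add: power_mult_distrib)
  have i: "inner ?a \<eta> = ?s\<^sup>2"
    using kadj_inner [OF kadj_sym [OF adj], of "x \<eta>" \<eta>] by (simp add: power2_norm_eq_inner)
  have \<eta>: "?s ^ 4 * (norm \<eta>)\<^sup>2 \<le> ?s ^ 4"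
    using top by (cases "\<eta> = 0") (auto simp: is_top_def)
  have "(norm (?a - t *\<^sub>R \<eta>))\<^sup>2 = (norm ?a)\<^sup>2 - 2 * t * inner ?a \<eta> + t\<^sup>2 * (norm \<eta>)\<^sup>2" for t
    unfolding power2_norm_eq_inner inner_diff_left inner_diff_right inner_scaleR_left
      inner_scaleR_right inner_commute [of \<eta> ?a] by (simp add: algebra_simps power2_eq_square)
  then have "(norm (?a - ?s\<^sup>2 *\<^sub>R \<eta>))\<^sup>2
      = (norm ?a)\<^sup>2 - 2 * (?s\<^sup>2 * ?s\<^sup>2) + (?s\<^sup>2)\<^sup>2 * (norm \<eta>)\<^sup>2"
    by (simp add: i)
  also have "\<dots> = (norm ?a)\<^sup>2 - 2 * ?s ^ 4 + ?s ^ 4 * (norm \<eta>)\<^sup>2"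
    by (simp flip: power_add power_mult)
  also have "\<dots> \<le> 0"
    using a \<eta> by linarith
  finally have "?a = ?s\<^sup>2 *\<^sub>R \<eta>" by simp
  then show ?thesis
    by (simp add: scaleR_ell2_def)
qed

text \<open>For linear \<open>x\<close> and a unit vector \<open>\<eta>\<close> this is
  \<open>x\<close> after the projection onto the orthogonal complement of \<open>\<eta>\<close>,
  written so that it is visibly a rank one perturbation of \<open>x\<close>.\<close>

definition deflate ::
  "(('i, 'k::real_or_complex) ell2 \<Rightarrow> ('i, 'k) ell2) \<Rightarrow> ('i, 'k) ell2 \<Rightarrow> ('i, 'k) ell2 \<Rightarrow> ('i, 'k) ell2" where
  "deflate x \<eta> \<zeta> = x \<zeta> - kscale (kinner \<zeta> \<eta>) (x \<eta>)"

lemma kadj_deflate: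
  assumes "kadj x y"
  shows "kadj (deflate x \<eta>) (\<lambda>\<zeta>. y \<zeta> - kscale (kinner \<zeta> (x \<eta>)) \<eta>)"
  unfolding kadj_def deflate_def
  by (simp add: kinner.diff_left kinner.diff_right kadjD [OF assms] kinner_kscale_left
      kinner_kscale_right mult.commute flip: kinner_commute)

lemma cpt_deflate: "cpt x \<Longrightarrow> cpt (deflate x \<eta>)"
proof -
  assume "cpt x"
  have "deflate x \<eta> = (\<lambda>\<zeta>. x \<zeta> + frank 1 (\<lambda>_. - x \<eta>) (\<lambda>_. \<eta>) \<zeta>)"
    by (rule ext) (simp add: deflate_def frank_def kscale.minus_right)
  then show ?thesis
    using cpt_add [OF \<open>cpt x\<close> cpt_frank] by simp
qed

text \<open>All three come from \<open>deflate x \<eta> \<zeta> = x ?z\<close> with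
  \<open>?z\<close> orthogonal to \<open>\<eta>\<close>. The third also uses that
  \<open>\<eta>\<close> is an eigenvector of \<open>y\<close> after \<open>x\<close>, so that
  \<open>x\<close> maps the orthogonal complement of \<open>\<eta>\<close> into that of
  \<open>x \<eta>\<close>.\<close>

lemma deflate_props:
  assumes adj: "kadj x y" and top: "is_top x \<eta>"
  shows "norm (deflate x \<eta> \<zeta>) \<le> norm (x \<eta>) * norm \<zeta>"
    and "deflate x \<eta> \<eta> = 0"
    and "kinner (deflate x \<eta> \<zeta>) (x \<eta>) = 0"
proof -
  let ?z = "\<zeta> - kscale (kinner \<zeta> \<eta>) \<eta>"
  have d: "deflate x \<eta> \<zeta> = x ?z"
    by (simp add: deflate_def kadj_diff [OF adj] kadj_kscale [OF adj])
  have orth: "kinner ?z \<eta> = 0"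
    using top by (cases "\<eta> = 0")
      (auto simp: is_top_def kinner.diff_left kinner_kscale_left kinner_self_norm kinner.zero_right)
  have "inner ?z (kscale (kinner \<zeta> \<eta>) \<eta>) = 0"
    by (simp add: inner_ell2_def kinner_kscale_right orth)
  then have "(norm \<zeta>)\<^sup>2 = (norm ?z)\<^sup>2 + (norm (kscale (kinner \<zeta> \<eta>) \<eta>))\<^sup>2"
    using norm_add_Pythagorean [of ?z "kscale (kinner \<zeta> \<eta>) \<eta>"] by (simp add: orthogonal_def)
  then have "(norm ?z)\<^sup>2 \<le> (norm \<zeta>)\<^sup>2" by simp
  then have "norm ?z \<le> norm \<zeta>"
    by (rule power2_le_imp_le) simp
  then show "norm (deflate x \<eta> \<zeta>) \<le> norm (x \<eta>) * norm \<zeta>"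
    using top d unfolding is_top_def
    by (metis mult_left_mono norm_ge_zero order_trans)
  show "deflate x \<eta> \<eta> = 0"
    using top by (cases "\<eta> = 0")
      (auto simp: deflate_def is_top_def kinner_self_norm kadj_0 [OF adj] kscale.zero_right)
  show "kinner (deflate x \<eta> \<zeta>) (x \<eta>) = 0"
    unfolding d kadjD [OF adj] is_top_adjoint [OF adj top] by (simp add: kinner_kscale_right orth)
qed

primrec svd_op ::
  "(('i, 'k::real_or_complex) ell2 \<Rightarrow> ('i, 'k) ell2) \<Rightarrow> nat \<Rightarrow> ('i, 'k) ell2 \<Rightarrow> ('i, 'k) ell2" where
  "svd_op x 0 = x"
| "svd_op x (Suc n) = deflate (svd_op x n) (SOME \<eta>. is_top (svd_op x n) \<eta>)"

lemma orthogonal_sum_norm: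
  fixes e :: "'j \<Rightarrow> ('i, 'k::real_or_complex) ell2"
  assumes "finite F" "\<And>m n. m \<in> F \<Longrightarrow> n \<in> F \<Longrightarrow> m \<noteq> n \<Longrightarrow> kinner (e m) (e n) = 0"
  shows "(norm (\<Sum>n\<in>F. kscale (c n) (e n)))\<^sup>2 = (\<Sum>n\<in>F. (norm (c n))\<^sup>2 * (norm (e n))\<^sup>2)"
  using assms
proof (induction F)
  case (insert m F)
  have "inner (kscale (c m) (e m)) (\<Sum>n\<in>F. kscale (c n) (e n)) = 0"
    unfolding inner_ell2_def kinner.sum_right kinner_kscale_left kinner_kscale_right
    using insert by (subst sum.neutral) auto
  then have "(norm (kscale (c m) (e m) + (\<Sum>n\<in>F. kscale (c n) (e n))))\<^sup>2
      = (norm (kscale (c m) (e m)))\<^sup>2 + (norm (\<Sum>n\<in>F. kscale (c n) (e n)))\<^sup>2"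
    by (intro norm_add_Pythagorean) (simp add: orthogonal_def)
  then show ?case
    using insert by (simp add: norm_kscale power_mult_distrib)
qed simp

text \<open>There are \<open>N + 1\<close> unknowns and \<open>N\<close> equations, and the last
  equation is solved for an unknown with nonzero coefficient. It serves to find a nonzero
  combination of \<open>N + 1\<close> singular vectors that a given operator of rank
  \<open>N\<close> annihilates.\<close>

lemma homogeneous_solution:
  fixes A :: "nat \<Rightarrow> nat \<Rightarrow> 'k::field"
  shows "\<exists>c. (\<exists>j\<le>N. c j \<noteq> 0) \<and> (\<forall>k<N. (\<Sum>j\<le>N. c j * A j k) = 0)"
proof (induction N arbitrary: A)
  case 0
  show ?case by (intro exI [of _ "\<lambda>_. 1"]) auto
next
  case (Suc N)
  show ?case
  proof (cases "\<exists>j\<le>Suc N. A j N \<noteq> 0")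
    case False
    obtain c where c: "\<exists>j\<le>N. c j \<noteq> 0" "\<And>k. k < N \<Longrightarrow> (\<Sum>j\<le>N. c j * A j k) = 0"
      using Suc.IH by blast
    let ?c = "\<lambda>j. if j \<le> N then c j else 0"
    have "(\<Sum>j\<le>Suc N. ?c j * A j k) = (\<Sum>j\<le>N. c j * A j k)" for k
      by simp
    then have "\<forall>k<Suc N. (\<Sum>j\<le>Suc N. ?c j * A j k) = 0"
      using c(2) False by (simp add: less_Suc_eq)
    moreover obtain j where "j \<le> N" "c j \<noteq> 0" using c(1) by blast
    then have "\<exists>j\<le>Suc N. ?c j \<noteq> 0" by (intro exI [of _ j]) simp
    ultimately show ?thesis by (intro exI [of _ ?c] conjI)
  next
    case True
    then obtain r where r: "r \<le> Suc N" "A r N \<noteq> 0" by blast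
    \<comment> \<open>Enumerates the unknowns other than \<open>r\<close>; \<open>gi\<close> below
      undoes it.\<close>
    define g where "g j = (if j < r then j else Suc j)" for j
    have bij: "bij_betw g {..N} ({..Suc N} - {r})"
      by (rule bij_betw_byWitness [where f' = "\<lambda>j. if j < r then j else j - 1"])
        (use r(1) in \<open>auto simp: g_def\<close>)
    obtain c where c: "\<exists>j\<le>N. c j \<noteq> 0"
      "\<And>k. k < N \<Longrightarrow> (\<Sum>j\<le>N. c j * (A (g j) k - A (g j) N / A r N * A r k)) = 0"
      using Suc.IH [of "\<lambda>j k. A (g j) k - A (g j) N / A r N * A r k"] by blast
    define gi where "gi j = (if j < r then j else j - 1)" for j
    have gi: "gi (g j) = j" for j by (simp add: g_def gi_def)
    have g_ne: "g j \<noteq> r" for j by (simp add: g_def)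
    \<comment> \<open>The value that the last equation forces on the eliminated unknown
      \<open>r\<close>.\<close>
    define cr where "cr = - (\<Sum>j\<le>N. c j * A (g j) N) / A r N"
    let ?c = "\<lambda>j. if j = r then cr else c (gi j)"
    have sum: "(\<Sum>j\<le>Suc N. ?c j * A j k) = cr * A r k + (\<Sum>j\<le>N. c j * A (g j) k)" for k
    proof -
      have "(\<Sum>j\<le>Suc N. ?c j * A j k) = cr * A r k + (\<Sum>j\<in>{..Suc N} - {r}. ?c j * A j k)"
        using r(1) by (subst sum.remove [of _ r]) auto
      also have "(\<Sum>j\<in>{..Suc N} - {r}. ?c j * A j k) = (\<Sum>j\<le>N. ?c (g j) * A (g j) k)"
        by (rule sum.reindex_bij_betw [OF bij, symmetric])
      finally show ?thesis by (simp add: gi g_ne)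
    qed
    have "\<forall>k<Suc N. (\<Sum>j\<le>Suc N. ?c j * A j k) = 0"
    proof (intro allI impI)
      fix k assume that: "k < Suc N"
      show "(\<Sum>j\<le>Suc N. ?c j * A j k) = 0"
      proof (cases "k = N")
        case True
        then show ?thesis using r(2) unfolding sum by (simp add: cr_def)
      next
        case False
        then have "k < N" using that by simp
        have "0 = (\<Sum>j\<le>N. c j * A (g j) k - c j * A (g j) N * (A r k / A r N))"
          using c(2) [OF \<open>k < N\<close>] by (simp add: algebra_simps)
        also have "\<dots> = (\<Sum>j\<le>N. c j * A (g j) k) + cr * A r k"
          by (simp add: sum_subtractf cr_def sum_distrib_right sum_divide_distrib)
        finally show ?thesis unfolding sum by (simp add: add.commute)
      qed
    qed
    moreover from c(1) obtain j where "j \<le> N" "c j \<noteq> 0" by blast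
    then have "\<exists>j\<le>Suc N. ?c j \<noteq> 0"
      by (intro exI [of _ "g j"]) (simp add: gi g_ne, simp add: g_def)
    ultimately show ?thesis by (intro exI [of _ ?c] conjI)
  qed
qed

text \<open>The recursion peels off one singular direction at a time.\<close>

theorem singular_value_decomposition:
  fixes x :: "('i, 'k::real_or_complex) ell2 \<Rightarrow> ('i, 'k) ell2"
  assumes adj: "kadj x y" and x: "cpt x"
  obtains \<xi> \<eta> :: "nat \<Rightarrow> ('i, 'k) ell2" where
    "antimono (apn x)"
    "\<And>n. apn x n = 0 \<Longrightarrow> \<xi> n = 0 \<and> \<eta> n = 0"
    "\<And>n. apn x n \<noteq> 0 \<Longrightarrow> norm (\<xi> n) = 1 \<and> norm (\<eta> n) = 1"
    "\<And>m n. m \<noteq> n \<Longrightarrow> kinner (\<xi> m) (\<xi> n) = 0 \<and> kinner (\<eta> m) (\<eta> n) = 0"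
    "\<And>n. x (\<eta> n) = kscale (of_real (apn x n)) (\<xi> n)"
    "\<And>n. y (\<xi> n) = kscale (of_real (apn x n)) (\<eta> n)"
    "\<And>N \<zeta>. norm (x \<zeta> - (\<Sum>n<N. kscale (of_real (apn x n) * kinner \<zeta> (\<eta> n)) (\<xi> n)))
        \<le> apn x N * norm \<zeta>"
proof -
  define \<eta> where "\<eta> n = (SOME \<eta>. is_top (svd_op x n) \<eta>)" for n
  define \<theta> where "\<theta> n = norm (svd_op x n (\<eta> n))" for n
  \<comment> \<open>As \<open>inverse 0 = 0\<close>, this is \<open>0\<close> when the singular
    value vanishes.\<close>
  define \<xi> where "\<xi> n = kscale (inverse (of_real (\<theta> n))) (svd_op x n (\<eta> n))" for n
  have Suc: "svd_op x (Suc n) = deflate (svd_op x n) (\<eta> n)" for n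
    by (simp add: \<eta>_def)
  have inv: "(\<exists>y. kadj (svd_op x n) y) \<and> cpt (svd_op x n)" for n
  proof (induction n)
    case 0
    then show ?case using adj x by auto
  next
    case (Suc n)
    then show ?case
      unfolding \<open>\<And>n. svd_op x (Suc n) = _\<close> using kadj_deflate cpt_deflate by blast
  qed
  then obtain ya where ya: "\<And>n. kadj (svd_op x n) (ya n)" by metis
  have top: "is_top (svd_op x n) (\<eta> n)" for n
    unfolding \<eta>_def using is_top_exists inv by (metis someI_ex)
  have x_eta: "svd_op x n (\<eta> n) = kscale (of_real (\<theta> n)) (\<xi> n)" for n
    by (cases "\<theta> n = 0") (auto simp: \<xi>_def \<theta>_def kscale.zero_right)
  have \<theta>_nonneg: "0 \<le> \<theta> n" for n by (simp add: \<theta>_def)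
  have zero: "\<xi> n = 0 \<and> \<eta> n = 0" if "\<theta> n = 0" for n
    using that top [of n] by (auto simp: \<xi>_def \<theta>_def is_top_def kscale.zero_right)
  have unit: "norm (\<xi> n) = 1 \<and> norm (\<eta> n) = 1" if "\<theta> n \<noteq> 0" for n
  proof
    show "norm (\<xi> n) = 1"
      using that by (simp add: \<xi>_def norm_kscale norm_inverse \<theta>_def)
    show "norm (\<eta> n) = 1"
      using that top [of n] kadj_0 [OF ya] by (auto simp: \<theta>_def is_top_def)
  qed
  have bound: "norm (svd_op x n \<zeta>) \<le> \<theta> n * norm \<zeta>" for n \<zeta>
    using top [of n] by (simp add: is_top_def \<theta>_def)
  have anti: "antimono \<theta>"
    unfolding antimono_iff_le_Suc
  proof
    fix n
    show "\<theta> (Suc n) \<le> \<theta> n"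
    proof (cases "\<eta> (Suc n) = 0")
      case True
      then show ?thesis
        using \<theta>_nonneg [of n] kadj_0 [OF ya, of "Suc n"] by (simp add: \<theta>_def del: svd_op.simps)
    next
      case False
      then have "norm (\<eta> (Suc n)) = 1" using top [of "Suc n"] by (simp add: is_top_def)
      then show ?thesis
        using deflate_props(1) [OF ya top, of n "\<eta> (Suc n)"] unfolding \<theta>_def Suc by simp
    qed
  qed
  \<comment> \<open>Invariant of the recursion: each deflation kills the earlier right vectors and
    has its range orthogonal to the earlier left vectors. The orthogonality of the new vectors is
    read off from it.\<close>
  have kill: "svd_op x n (\<eta> m) = 0 \<and> (\<forall>\<zeta>. kinner (svd_op x n \<zeta>) (\<xi> m) = 0)
      \<and> kinner (\<eta> m) (\<eta> n) = 0 \<and> kinner (\<xi> m) (\<xi> n) = 0" if "m < n" for m n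
    using that
  proof (induction n)
    case (Suc n)
    have y_xi: "kscale (of_real (\<theta> n)) (\<eta> n) = ya n (\<xi> n)" for n
    proof (cases "\<theta> n = 0")
      case True
      then show ?thesis using zero [of n] kadj_0 [OF kadj_sym [OF ya]] by (simp add: kscale.zero_right)
    next
      case False
      have "ya n (\<xi> n) = kscale (inverse (of_real (\<theta> n)) * of_real ((\<theta> n)\<^sup>2)) (\<eta> n)"
        unfolding \<xi>_def kadj_kscale [OF kadj_sym [OF ya]] is_top_adjoint [OF ya top]
        by (simp add: \<theta>_def)
      also have "inverse (of_real (\<theta> n)) * of_real ((\<theta> n)\<^sup>2) = (of_real (\<theta> n) :: 'k)"
        using False by (simp add: power2_eq_square)
      finally show ?thesis ..
    qed
    have 1: "svd_op x (Suc n) (\<eta> m) = 0"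
    proof (cases "m = n")
      case True
      then show ?thesis unfolding \<open>\<And>n. svd_op x (Suc n) = _\<close>
        using deflate_props(2) [OF ya top] by simp
    next
      case False
      then show ?thesis unfolding \<open>\<And>n. svd_op x (Suc n) = _\<close> deflate_def
        using Suc by (simp add: kscale.zero_left)
    qed
    have 2: "kinner (svd_op x (Suc n) \<zeta>) (\<xi> m) = 0" for \<zeta>
    proof (cases "m = n")
      case True
      then show ?thesis
        unfolding \<open>\<And>n. svd_op x (Suc n) = _\<close> \<xi>_def kinner_kscale_right
        using deflate_props(3) [OF ya top] by simp
    next
      case False
      then show ?thesis unfolding \<open>\<And>n. svd_op x (Suc n) = _\<close> deflate_def
        using Suc by (simp add: kinner.diff_left kinner_kscale_left)
    qed
    have "of_real (\<theta> (Suc n)) * kinner (\<eta> m) (\<eta> (Suc n)) = 0"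
      using 1 kadjD [OF ya, of "Suc n" "\<eta> m" "\<xi> (Suc n)"]
      by (simp add: kinner_kscale_right kinner.zero_left flip: y_xi)
    then have 3: "kinner (\<eta> m) (\<eta> (Suc n)) = 0"
      using zero [of "Suc n"] by (cases "\<theta> (Suc n) = 0") (auto simp: kinner.zero_right)
    have "kinner (\<xi> (Suc n)) (\<xi> m) = 0"
      unfolding \<xi>_def [of "Suc n"] kinner_kscale_left using 2 by simp
    then have 4: "kinner (\<xi> m) (\<xi> (Suc n)) = 0"
      by (metis kinner_commute cnjg_0)
    show ?case using 1 2 3 4 by blast
  qed simp
  have orth: "kinner (\<xi> m) (\<xi> n) = 0 \<and> kinner (\<eta> m) (\<eta> n) = 0" if "m \<noteq> n" for m n
    using kill [of m n] kill [of n m] that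
    by (metis cnjg_0 kinner_commute linorder_neqE_nat)
  have partial: "svd_op x N \<zeta> = x \<zeta> - (\<Sum>n<N. kscale (of_real (\<theta> n) * kinner \<zeta> (\<eta> n)) (\<xi> n))"
    for N \<zeta>
  proof (induction N)
    case (Suc N)
    then show ?case
      unfolding \<open>\<And>n. svd_op x (Suc n) = _\<close> deflate_def x_eta
      by (simp add: mult.commute)
  qed simp
  have x_eta': "x (\<eta> n) = kscale (of_real (\<theta> n)) (\<xi> n)" for n
  proof -
    have "(\<Sum>m<n. kscale (of_real (\<theta> m) * kinner (\<eta> n) (\<eta> m)) (\<xi> m)) = 0"
      using orth by (intro sum.neutral) (auto simp: kscale.zero_left)
    then show ?thesis using partial [of n "\<eta> n"] by (simp add: x_eta)
  qed
  have y_xi: "y (\<xi> n) = kscale (of_real (\<theta> n)) (\<eta> n)" for n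
  proof (cases "\<theta> n = 0")
    case True
    then show ?thesis using zero [of n] kadj_0 [OF kadj_sym [OF adj]] by (simp add: kscale.zero_right)
  next
    case False
    have "kinner \<zeta> (y (\<xi> n)) = kinner \<zeta> (kscale (of_real (\<theta> n)) (\<eta> n))" for \<zeta>
    proof -
      \<comment> \<open>The first \<open>n\<close> terms of the expansion are orthogonal to
        \<open>\<xi> n\<close>, so \<open>x\<close> may be replaced by its \<open>n\<close>-th
        deflation; one further deflation splits off the wanted term and leaves something orthogonal
        to \<open>\<xi> n\<close>.\<close>
      have "kinner (x \<zeta>) (\<xi> n) = kinner (svd_op x n \<zeta>) (\<xi> n)"
        unfolding partial kinner.diff_left kinner.sum_left kinner_kscale_left
        using orth by (subst sum.neutral) auto
      also have "\<dots> = kinner (svd_op x (Suc n) \<zeta>) (\<xi> n) + of_real (\<theta> n) * kinner \<zeta> (\<eta> n)"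
        unfolding Suc deflate_def x_eta using unit [OF False]
        by (simp add: kinner.diff_left kinner_kscale_left kinner_self_norm mult.commute)
      also have "kinner (svd_op x (Suc n) \<zeta>) (\<xi> n) = 0"
        using kill [of n "Suc n"] by simp
      finally show ?thesis by (simp add: kadjD [OF adj] kinner_kscale_right)
    qed
    then show ?thesis by (metis kinner_left_eqI kinner_commute)
  qed
  \<comment> \<open>The partial sum is an approximation of rank \<open>N\<close> with error
    \<open>\<theta> N\<close>. Conversely, an operator of rank \<open>N\<close> kills some nonzero
    combination of \<open>\<eta> 0\<close>, ..., \<open>\<eta> N\<close>, and \<open>x\<close>
    stretches every such combination by at least \<open>\<theta> N\<close>.\<close>
  have apn: "apn x N = \<theta> N" for N
  proof (rule antisym)
    have "rk_approx x N (\<theta> N)"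
      unfolding rk_approx_def frank_def
    proof (intro exI allI)
      show "norm (x \<zeta> - (\<Sum>n<N. kscale (kinner \<zeta> (\<eta> n)) (kscale (of_real (\<theta> n)) (\<xi> n))))
          \<le> \<theta> N * norm \<zeta>" for \<zeta>
        using bound [of N \<zeta>] by (simp add: partial mult.commute)
    qed
    then show "apn x N \<le> \<theta> N" by (rule apn_le [OF \<theta>_nonneg])
    show "\<theta> N \<le> apn x N"
    proof (rule apn_ge [OF x])
      fix \<epsilon> :: real assume "0 \<le> \<epsilon>" "rk_approx x N \<epsilon>"
      then obtain a b where v: "\<And>\<zeta>. norm (x \<zeta> - frank N a b \<zeta>) \<le> \<epsilon> * norm \<zeta>"
        unfolding rk_approx_def by blast
      show "\<theta> N \<le> \<epsilon>"
      proof (cases "\<theta> N = 0")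
        case True
        then show ?thesis using \<open>0 \<le> \<epsilon>\<close> by simp
      next
        case False
        then have pos: "0 < \<theta> n" if "n \<le> N" for n
          using \<theta>_nonneg [of N] antimonoD [OF anti that] by linarith
        obtain c where c: "\<exists>j\<le>N. c j \<noteq> 0"
          "\<And>k. k < N \<Longrightarrow> (\<Sum>j\<le>N. c j * kinner (\<eta> j) (b k)) = 0"
          using homogeneous_solution [of N "\<lambda>j k. kinner (\<eta> j) (b k)"] by blast
        define z where "z = (\<Sum>j\<le>N. kscale (c j) (\<eta> j))"
        have "frank N a b z = 0"
          unfolding frank_def z_def kinner.sum_left kinner_kscale_left
          using c(2) by (simp add: kscale.zero_left)
        then have xz: "norm (x z) \<le> \<epsilon> * norm z" using v [of z] by simp
        have u: "norm (\<eta> n) = 1 \<and> norm (\<xi> n) = 1" if "n \<le> N" for n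
          using unit [of n] pos [OF that] by simp
        have nz: "(norm z)\<^sup>2 = (\<Sum>j\<le>N. (norm (c j))\<^sup>2)"
          unfolding z_def using orth
          by (subst orthogonal_sum_norm) (auto simp: u intro!: sum.cong)
        have "(norm (x z))\<^sup>2 = (\<Sum>j\<le>N. (norm (c j * of_real (\<theta> j)))\<^sup>2)"
          unfolding z_def kadj_sum [OF adj] kadj_kscale [OF adj] x_eta' kscale_kscale
          using orth u by (subst orthogonal_sum_norm) (auto intro!: sum.cong)
        also have "\<dots> \<ge> (\<Sum>j\<le>N. (\<theta> N)\<^sup>2 * (norm (c j))\<^sup>2)"
        proof (rule sum_mono)
          fix j assume "j \<in> {..N}"
          then have "\<theta> N \<le> \<theta> j" using antimonoD [OF anti] by simp
          then have "(\<theta> N)\<^sup>2 \<le> (\<theta> j)\<^sup>2" using \<theta>_nonneg by (intro power_mono) auto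
          then show "(\<theta> N)\<^sup>2 * (norm (c j))\<^sup>2 \<le> (norm (c j * of_real (\<theta> j)))\<^sup>2"
            by (simp add: norm_mult power_mult_distrib mult.commute mult_right_mono)
        qed
        finally have "(\<theta> N * norm z)\<^sup>2 \<le> (norm (x z))\<^sup>2"
          by (simp add: power_mult_distrib nz sum_distrib_left)
        then have "\<theta> N * norm z \<le> norm (x z)"
          by (rule power2_le_imp_le) simp
        then have "\<theta> N * norm z \<le> \<epsilon> * norm z" using xz by linarith
        moreover have "norm z > 0"
        proof -
          obtain j where "j \<le> N" "c j \<noteq> 0" using c(1) by blast
          then have "(\<Sum>j\<le>N. (norm (c j))\<^sup>2) > 0"
            by (intro sum_pos2 [of _ j]) auto
          then show ?thesis using nz by auto
        qed
        ultimately show ?thesis by simp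
      qed
    qed
  qed
  then have "apn x = \<theta>" by (rule ext)
  then show thesis
    using that [of \<xi> \<eta>] anti zero unit orth x_eta' y_xi bound partial by simp
qed

section \<open>Singular values as eigenvalue multiplicities\<close>

lemma apn_antimono: "kadj x y \<Longrightarrow> cpt x \<Longrightarrow> antimono (apn x)"
  using singular_value_decomposition by blast

lemma apn_tendsto_0:
  assumes "kadj x y" "cpt x"
  shows "apn x \<longlonglongrightarrow> 0"
proof (rule LIMSEQ_I)
  fix r :: real assume "r > 0"
  then obtain n where "rk_approx x n (r / 2)"
    using assms(2) unfolding cpt_def by (meson half_gt_zero)
  then have n: "apn x n \<le> r / 2" using \<open>r > 0\<close> by (intro apn_le) auto
  have "norm (apn x m - 0) < r" if "m \<ge> n" for m
    using n antimonoD [OF apn_antimono [OF assms] that] apn_nonneg [OF assms(2), of m] \<open>r > 0\<close>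
    by simp
  then show "\<exists>no. \<forall>n\<ge>no. norm (apn x n - 0) < r" by blast
qed

text \<open>The dimension in \<open>sing_mult\<close> is taken in the space of all functions, so the
  orthonormal vectors are shown to be a basis there, after passing through
  \<open>Rep_ell2\<close>.\<close>

lemma eigenspace_dim:
  fixes e :: "nat \<Rightarrow> ('i, 'k::real_or_complex) ell2"
  assumes A: "finite A" and unit: "\<And>n. n \<in> A \<Longrightarrow> norm (e n) = 1"
    and orth: "\<And>m n. m \<noteq> n \<Longrightarrow> kinner (e m) (e n) = 0"
    and V: "\<And>n. n \<in> A \<Longrightarrow> Rep_ell2 (e n) \<in> V"
    and span: "\<And>f. f \<in> V \<Longrightarrow> \<exists>c. f = Rep_ell2 (\<Sum>n\<in>A. kscale (c n) (e n))"
  shows "vector_space.dim (\<lambda>(c::'k) \<zeta> \<iota>. c * \<zeta> \<iota>) V = card A"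
proof -
  interpret vs: vector_space "\<lambda>(c::'k) (\<zeta> :: 'i \<Rightarrow> 'k) \<iota>. c * \<zeta> \<iota>"
    by standard (auto simp: fun_eq_iff algebra_simps)
  have inj: "inj_on (\<lambda>n. Rep_ell2 (e n)) A"
  proof (rule inj_onI, rule ccontr)
    fix m n assume mn: "m \<in> A" "n \<in> A" "Rep_ell2 (e m) = Rep_ell2 (e n)" "m \<noteq> n"
    then have "kinner (e m) (e m) = 0" using orth by (metis Rep_ell2_inject)
    then show False using unit [OF mn(1)] by (simp add: kinner_self_norm)
  qed
  have Rep_sum: "Rep_ell2 (\<Sum>n\<in>A. kscale (c n) (e n)) = (\<Sum>n\<in>A. (\<lambda>\<iota>. c n * Rep_ell2 (e n) \<iota>))" for c
    using A by (induction A) (auto simp: fun_eq_iff zero_fun_def)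
  show ?thesis
  proof (rule vs.dim_unique [where B = "(\<lambda>n. Rep_ell2 (e n)) ` A"])
    show "(\<lambda>n. Rep_ell2 (e n)) ` A \<subseteq> V" using V by blast
    show "V \<subseteq> vs.span ((\<lambda>n. Rep_ell2 (e n)) ` A)"
    proof
      fix f assume "f \<in> V"
      then obtain c where "f = Rep_ell2 (\<Sum>n\<in>A. kscale (c n) (e n))" using span by blast
      then show "f \<in> vs.span ((\<lambda>n. Rep_ell2 (e n)) ` A)"
        unfolding Rep_sum by (auto intro!: vs.span_sum intro: vs.span_scale [OF vs.span_base])
    qed
    show "vs.independent ((\<lambda>n. Rep_ell2 (e n)) ` A)"
    proof
      assume "vs.dependent ((\<lambda>n. Rep_ell2 (e n)) ` A)"
      then obtain u m where m: "m \<in> A" "u (Rep_ell2 (e m)) \<noteq> 0"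
        and u: "(\<Sum>v\<in>(\<lambda>n. Rep_ell2 (e n)) ` A. (\<lambda>\<iota>. u v * v \<iota>)) = 0"
        using A by (auto simp: vs.dependent_finite)
      have "Rep_ell2 (\<Sum>n\<in>A. kscale (u (Rep_ell2 (e n))) (e n)) = Rep_ell2 0"
        unfolding Rep_sum using u by (simp add: sum.reindex [OF inj] zero_fun_def)
      then have "(\<Sum>n\<in>A. kscale (u (Rep_ell2 (e n))) (e n)) = 0"
        by (simp only: Rep_ell2_inject)
      then have "0 = kinner (\<Sum>n\<in>A. kscale (u (Rep_ell2 (e n))) (e n)) (e m)"
        by (simp only: kinner.zero_left)
      also have "\<dots> = (\<Sum>n\<in>A. if n = m then u (Rep_ell2 (e m)) else 0)"
        unfolding kinner.sum_left kinner_kscale_left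
        using orth unit by (intro sum.cong) (auto simp: kinner_self_norm)
      also have "\<dots> = u (Rep_ell2 (e m))" using A m(1) by simp
      finally show False using m(2) by simp
    qed
    show "card ((\<lambda>n. Rep_ell2 (e n)) ` A) = card A" by (rule card_image [OF inj])
  qed
qed

text \<open>The first index at which two such sequences differ gives a value which they take a different
  number of times.\<close>

lemma decreasing_sequence_unique:
  fixes \<theta> \<theta>' :: "nat \<Rightarrow> real"
  assumes "antimono \<theta>" "\<And>n. 0 \<le> \<theta> n" "antimono \<theta>'" "\<And>n. 0 \<le> \<theta>' n"
    and "\<And>s. s > 0 \<Longrightarrow> finite {n. \<theta> n = s}" "\<And>s. s > 0 \<Longrightarrow> finite {n. \<theta>' n = s}"
    and card: "\<And>s. s > 0 \<Longrightarrow> card {n. \<theta> n = s} = card {n. \<theta>' n = s}"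
  shows "\<theta> = \<theta>'"
proof (rule ccontr)
  have less: False
    if anti: "antimono a" "antimono b" and nn: "\<And>n. 0 \<le> b n" and fin: "\<And>s. s > 0 \<Longrightarrow> finite {n. a n = s}"
      and card: "\<And>s. s > 0 \<Longrightarrow> card {n. a n = s} = card {n. b n = s}"
      and eq: "\<And>m. m < n \<Longrightarrow> a m = b m" and lt: "b n < a n" for a b :: "nat \<Rightarrow> real" and n
  proof -
    have pos: "a n > 0" using nn [of n] lt by linarith
    have "{m. b m = a n} \<subset> {m. a m = a n}"
    proof
      show "{m. b m = a n} \<subseteq> {m. a m = a n}"
      proof
        fix m assume m: "m \<in> {m. b m = a n}"
        have "m < n"
          using antimonoD [OF anti(2), of n m] m lt by (cases "m < n") auto
        then show "m \<in> {m. a m = a n}" using eq m by simp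
      qed
      have "n \<in> {m. a m = a n}" "n \<notin> {m. b m = a n}" using lt by auto
      then show "{m. b m = a n} \<noteq> {m. a m = a n}" by blast
    qed
    then have "card {m. b m = a n} < card {m. a m = a n}"
      by (rule psubset_card_mono [OF fin [OF pos]])
    then show False using card [OF pos] by simp
  qed
  assume "\<theta> \<noteq> \<theta>'"
  then have "\<exists>n. \<theta> n \<noteq> \<theta>' n" by auto
  define n where "n = (LEAST n. \<theta> n \<noteq> \<theta>' n)"
  have n: "\<theta> n \<noteq> \<theta>' n" unfolding n_def by (rule LeastI_ex) fact
  have eq: "\<theta> m = \<theta>' m" if "m < n" for m
    using not_less_Least that unfolding n_def by blast
  show False
  proof (cases "\<theta> n < \<theta>' n")
    case True
    show False by (rule less [of \<theta>' \<theta> n]) (use assms eq True in auto)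
  next
    case False
    show False by (rule less [of \<theta> \<theta>' n]) (use assms eq False n in auto)
  qed
qed

text \<open>Connects the adjoint that \<open>sing_mult\<close> describes, for functions on
  \<open>l2\<close> extended by \<open>0\<close>, with adjoints of operators on the type
  \<open>ell2\<close>.\<close>

lemma adj_l2:
  assumes adj: "kadj x y" and X: "\<And>z. X (Rep_ell2 z) = Rep_ell2 (x z)"
  shows "adj l2 l2_inner X = (\<lambda>f. if f \<in> l2 then Rep_ell2 (y (Abs_ell2 f)) else 0)" (is "_ = ?Y")
  unfolding adj_def
proof (rule the_equality)
  have inner: "l2_inner (X f) g = kinner (x (Abs_ell2 f)) (Abs_ell2 g)" if "f \<in> l2" "g \<in> l2" for f g
    using that X [of "Abs_ell2 f"] by (simp add: kinner.rep_eq)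
  show "is_adjoint l2 l2_inner X ?Y"
    unfolding is_adjoint_def by (simp add: inner kadjD [OF adj]) (simp add: kinner.rep_eq)
  fix v assume v: "is_adjoint l2 l2_inner X v"
  show "v = ?Y"
  proof
    fix f
    show "v f = ?Y f"
    proof (cases "f \<in> l2")
      case True
      then have vf: "v f \<in> l2" using v by (simp add: is_adjoint_def)
      have "kinner z (Abs_ell2 (v f)) = kinner z (y (Abs_ell2 f))" for z
      proof -
        have "kinner z (Abs_ell2 (v f)) = l2_inner (X (Rep_ell2 z)) f"
          using v True vf by (simp add: is_adjoint_def kinner.rep_eq)
        also have "\<dots> = kinner (x z) (Abs_ell2 f)"
          using inner [OF Rep_ell2_l2 True, of z] by (simp only: Rep_ell2_inverse)
        finally show ?thesis by (simp only: kadjD [OF adj])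
      qed
      then have "Abs_ell2 (v f) = y (Abs_ell2 f)"
        by (metis kinner_left_eqI kinner_commute)
      then show ?thesis using True vf by (metis Abs_ell2_inverse')
    qed (use v in \<open>simp add: is_adjoint_def\<close>)
  qed
qed

text \<open>For \<open>s > 0\<close> the eigenspace of \<open>y\<close> after \<open>x\<close> at
  the square of \<open>s\<close> is spanned by the \<open>\<eta> n\<close> with
  \<open>apn x n = s\<close>: once these are projected out of an eigenvector, the rest is orthogonal
  to all \<open>\<eta> n\<close>, hence killed by \<open>x\<close>, yet still satisfies the
  eigenvalue equation. Uniqueness of decreasing sequences then settles the THE in
  \<open>sing_val\<close>.\<close>

theorem sing_val_eq_apn:
  assumes adj: "kadj x y" and x: "cpt x" and X: "\<And>z. X (Rep_ell2 z) = Rep_ell2 (x z)"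
  shows "sing_val X = apn x"
proof -
  obtain \<xi> \<eta> where anti: "antimono (apn x)"
    and zero: "\<And>n. apn x n = 0 \<Longrightarrow> \<xi> n = 0 \<and> \<eta> n = 0"
    and unit: "\<And>n. apn x n \<noteq> 0 \<Longrightarrow> norm (\<xi> n) = 1 \<and> norm (\<eta> n) = 1"
    and orth: "\<And>m n. m \<noteq> n \<Longrightarrow> kinner (\<xi> m) (\<xi> n) = 0 \<and> kinner (\<eta> m) (\<eta> n) = 0"
    and x_eta: "\<And>n. x (\<eta> n) = kscale (of_real (apn x n)) (\<xi> n)"
    and y_xi: "\<And>n. y (\<xi> n) = kscale (of_real (apn x n)) (\<eta> n)"
    and svd: "\<And>N \<zeta>. norm (x \<zeta> - (\<Sum>n<N. kscale (of_real (apn x n) * kinner \<zeta> (\<eta> n)) (\<xi> n)))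
        \<le> apn x N * norm \<zeta>"
    by (rule singular_value_decomposition [OF adj x]) blast
  have lim: "apn x \<longlonglongrightarrow> 0" by (rule apn_tendsto_0 [OF adj x])
  have fin: "finite {n. apn x n = s}" if "s > 0" for s
  proof -
    have "\<forall>\<^sub>F n in sequentially. apn x n < s" using order_tendstoD(2) [OF lim that] .
    then obtain N where "\<And>n. n \<ge> N \<Longrightarrow> apn x n < s" unfolding eventually_sequentially by blast
    then have "n < N" if "apn x n = s" for n
      using that by (cases "n < N") (auto simp: not_less)
    then have "{n. apn x n = s} \<subseteq> {..<N}" by blast
    then show ?thesis by (rule finite_subset) simp
  qed
  have "sing_mult X s = card {n. apn x n = s}" if s: "s > 0" for s
    unfolding sing_mult_def
  proof (rule eigenspace_dim [where e = \<eta>])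
    show "finite {n. apn x n = s}" by (rule fin [OF s])
    show "norm (\<eta> n) = 1" if "n \<in> {n. apn x n = s}" for n using that unit s by auto
    show "kinner (\<eta> m) (\<eta> n) = 0" if "m \<noteq> n" for m n using orth that by blast
    have adjX: "adj l2 l2_inner X (X (Rep_ell2 z)) = Rep_ell2 (y (x z))" for z
      unfolding adj_l2 [OF adj X] by (simp add: X Rep_ell2_inverse)
    have scale: "(\<lambda>\<iota>. of_real (s\<^sup>2) * Rep_ell2 z \<iota>) = Rep_ell2 (kscale (of_real (s\<^sup>2)) z)" for z
      by (rule ext) simp
    have yx: "y (x (\<eta> n)) = kscale (of_real ((apn x n)\<^sup>2)) (\<eta> n)" for n
      by (simp add: x_eta kadj_kscale [OF kadj_sym [OF adj]] y_xi power2_eq_square)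
    show "Rep_ell2 (\<eta> n) \<in> {\<zeta> \<in> l2. adj l2 l2_inner X (X \<zeta>) = (\<lambda>\<iota>. of_real (s\<^sup>2) * \<zeta> \<iota>)}"
      if "n \<in> {n. apn x n = s}" for n
    proof (intro CollectI conjI)
      show "adj l2 l2_inner X (X (Rep_ell2 (\<eta> n))) = (\<lambda>\<iota>. of_real (s\<^sup>2) * Rep_ell2 (\<eta> n) \<iota>)"
        unfolding adjX scale yx using that by simp
    qed simp
    fix f assume f: "f \<in> {\<zeta> \<in> l2. adj l2 l2_inner X (X \<zeta>) = (\<lambda>\<iota>. of_real (s\<^sup>2) * \<zeta> \<iota>)}"
    define z where "z = Abs_ell2 f"
    have fz: "f = Rep_ell2 z" using f by (simp add: z_def)
    have "Rep_ell2 (y (x z)) = Rep_ell2 (kscale (of_real (s\<^sup>2)) z)"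
      using f unfolding fz by (simp only: adjX scale mem_Collect_eq)
    then have eig: "y (x z) = kscale (of_real (s\<^sup>2)) z" by (simp only: Rep_ell2_inject)
    have perp: "kinner z (\<eta> n) = 0" if "apn x n \<noteq> s" for n
    proof (cases "apn x n = 0")
      case True
      then show ?thesis using zero by (simp add: kinner.zero_right)
    next
      case False
      have "of_real (s\<^sup>2) * kinner z (\<eta> n) = kinner (y (x z)) (\<eta> n)"
        by (simp only: eig kinner_kscale_left)
      also have "\<dots> = kinner z (y (x (\<eta> n)))"
        by (metis adj kadjD kadj_sym)
      also have "\<dots> = of_real ((apn x n)\<^sup>2) * kinner z (\<eta> n)"
        by (simp only: yx kinner_kscale_right cnjg_of_real)
      finally have "of_real (s\<^sup>2) * kinner z (\<eta> n) = of_real ((apn x n)\<^sup>2) * kinner z (\<eta> n)" .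
      moreover have "s\<^sup>2 \<noteq> (apn x n)\<^sup>2"
        using s that apn_nonneg [OF x, of n] by (simp add: power2_eq_iff_nonneg)
      ultimately show ?thesis
        by (metis mult_cancel_right of_real_eq_iff)
    qed
    let ?w = "\<Sum>n\<in>{n. apn x n = s}. kscale (kinner z (\<eta> n)) (\<eta> n)"
    define z' where "z' = z - ?w"
    have perp': "kinner z' (\<eta> n) = 0" for n
    proof -
      have "kinner ?w (\<eta> n) = (\<Sum>m\<in>{n. apn x n = s}. if m = n then kinner z (\<eta> n) else 0)"
        unfolding kinner.sum_left kinner_kscale_left using orth unit s
        by (intro sum.cong) (auto simp: kinner_self_norm)
      also have "\<dots> = (if apn x n = s then kinner z (\<eta> n) else 0)"
        using fin [OF s] by simp
      finally show ?thesis using perp [of n] by (simp add: z'_def kinner.diff_left)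
    qed
    \<comment> \<open>All coefficients of \<open>z'\<close> vanish, so only the remainder of the
      expansion is left, and it tends to \<open>0\<close> with \<open>N\<close>.\<close>
    have "norm (x z') \<le> apn x N * norm z'" for N
      using svd [of z' N] by (simp add: perp' kscale.zero_left)
    moreover have "(\<lambda>N. apn x N * norm z') \<longlonglongrightarrow> 0 * norm z'"
      by (intro tendsto_intros lim)
    ultimately have "norm (x z') \<le> 0"
      using LIMSEQ_le_const [of "\<lambda>N. apn x N * norm z'" 0 "norm (x z')"] by simp
    then have "y (x z') = 0" using kadj_0 [OF kadj_sym [OF adj]] by simp
    moreover have "y (x ?w) = kscale (of_real (s\<^sup>2)) ?w"
      unfolding kadj_sum [OF adj] kadj_sum [OF kadj_sym [OF adj]] kadj_kscale [OF adj]
        kadj_kscale [OF kadj_sym [OF adj]] kscale.sum_right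
      by (intro sum.cong) (auto simp: yx mult.commute)
    then have "y (x z') = kscale (of_real (s\<^sup>2)) z'"
      unfolding z'_def kadj_diff [OF adj] kadj_diff [OF kadj_sym [OF adj]]
      by (simp only: eig kscale.diff_right)
    ultimately have "norm (kscale (of_real (s\<^sup>2)) z') = 0" by simp
    then have "z' = 0" using s by (simp add: norm_kscale)
    then have "z = ?w" by (simp add: z'_def)
    then show "\<exists>c. f = Rep_ell2 (\<Sum>n\<in>{n. apn x n = s}. kscale (c n) (\<eta> n))"
      unfolding fz by (intro exI [of _ "\<lambda>n. kinner z (\<eta> n)"] arg_cong [where f = Rep_ell2])
  qed
  then have *: "antimono (apn x) \<and> (\<forall>n. 0 \<le> apn x n) \<and>
      (\<forall>s>0. finite {n. apn x n = s} \<and> card {n. apn x n = s} = sing_mult X s)"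
    using anti apn_nonneg [OF x] fin by simp
  show ?thesis
    unfolding sing_val_def
  proof (rule the_equality)
    fix \<theta> :: "nat \<Rightarrow> real"
    assume "antimono \<theta> \<and> (\<forall>n. 0 \<le> \<theta> n) \<and>
      (\<forall>s>0. finite {n. \<theta> n = s} \<and> card {n. \<theta> n = s} = sing_mult X s)"
    with * show "\<theta> = apn x" by (intro decreasing_sequence_unique [of \<theta> "apn x"]) simp_all
  qed (rule *)
qed

section \<open>Extremally disconnected spaces: lifting bounded functions to continuous ones\<close>

text \<open>A Boolean homomorphism from all subsets to the clopen ones that fixes the clopen subsets.
  For each \<open>t\<close> the sets \<open>A\<close> with \<open>t \<in> h A\<close> form an ultrafilter that converges to \<open>t\<close>, and limits
  along these ultrafilters depend continuously on \<open>t\<close>.\<close>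

definition stone_hom :: "('t::topological_space set \<Rightarrow> 't set) \<Rightarrow> bool" where
  "stone_hom h \<longleftrightarrow> (\<forall>A. open (h A) \<and> closed (h A)) \<and> (\<forall>A B. h (A \<inter> B) = h A \<inter> h B) \<and>
     h {} = {} \<and> (\<forall>A. interior A \<subseteq> h A)"

lemma stone_homD:
  assumes "stone_hom h"
  shows "open (h A)" "closed (h A)" "h (A \<inter> B) = h A \<inter> h B" "h {} = {}" "interior A \<subseteq> h A"
  using assms by (simp_all add: stone_hom_def)

lemma stone_hom_mono: "stone_hom h \<Longrightarrow> A \<subseteq> B \<Longrightarrow> h A \<subseteq> h B"
  unfolding stone_hom_def by (metis inf.absorb_iff2 inf.cobounded1)

text \<open>Here \<open>closure U\<close> is itself open, and intersection with an open set can be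
  moved inside a closure. This makes \<open>closure\<close> multiplicative on open sets, as is
  required of a \<open>stone_hom\<close>.\<close>

lemma closure_Int_open:
  fixes U V :: "'t::topological_space set"
  assumes ed: "\<And>U :: 't set. open U \<Longrightarrow> open (closure U)" and "open U" "open V"
  shows "closure (U \<inter> V) = closure U \<inter> closure V"
proof
  show "closure (U \<inter> V) \<subseteq> closure U \<inter> closure V" by (simp add: closure_mono)
  have "closure U \<inter> closure V \<subseteq> closure (closure U \<inter> V)"
    by (rule open_Int_closure_subset [OF ed [OF \<open>open U\<close>]])
  also have "closure U \<inter> V \<subseteq> closure (U \<inter> V)"
    using open_Int_closure_subset [OF \<open>open V\<close>, of U] by (simp add: Int_commute)
  then have "closure (closure U \<inter> V) \<subseteq> closure (U \<inter> V)"
    by (metis closure_closure closure_mono)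
  finally show "closure U \<inter> closure V \<subseteq> closure (U \<inter> V)" .
qed

text \<open>Zorn's lemma in the pointwise order. The start is \<open>closure (interior A)\<close>; a
  chain is bounded by the closures of its unions, which are multiplicative because members of the
  chain are comparable. A maximal element respects complements, since otherwise it can be
  enlarged.\<close>

lemma stone_hom_exists:
  assumes ed: "\<And>U :: 't::topological_space set. open U \<Longrightarrow> open (closure U)"
  shows "\<exists>h :: 't set \<Rightarrow> 't set. stone_hom h \<and> (\<forall>A. h (- A) = - h A)"
proof -
  have "\<exists>m\<in>Collect stone_hom. \<forall>a\<in>Collect stone_hom. m \<le> a \<longrightarrow> a = (m :: 't set \<Rightarrow> 't set)"
  proof (rule predicate_Zorn)
    show "partial_order_on (Collect stone_hom)
        (relation_of (\<le>) (Collect stone_hom :: ('t set \<Rightarrow> 't set) set))"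
      by (auto simp: partial_order_on_def preorder_on_def refl_on_def trans_def antisym_def
          relation_of_def intro: order_trans)
    fix C assume "C \<in> Chains (relation_of (\<le>) (Collect stone_hom :: ('t set \<Rightarrow> 't set) set))"
    then have C: "\<And>h. h \<in> C \<Longrightarrow> stone_hom h" "\<And>h h'. h \<in> C \<Longrightarrow> h' \<in> C \<Longrightarrow> h \<le> h' \<or> h' \<le> h"
      unfolding Chains_def relation_of_def by auto
    show "\<exists>u\<in>Collect stone_hom. \<forall>a\<in>C. a \<le> u"
    proof (cases "C = {}")
      case True
      have "stone_hom (\<lambda>A. closure (interior A) :: 't set)"
        unfolding stone_hom_def
        by (auto simp: ed closure_Int_open [OF ed] intro: subsetD [OF closure_subset])
      then show ?thesis using True by blast
    next
      case False
      define U where "U A = (\<Union>h\<in>C. h A)" for A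
      have oU: "open (U A)" for A
        using C(1) by (auto simp: U_def stone_hom_def)
      have UI: "U (A \<inter> B) = U A \<inter> U B" for A B
      proof
        show "U (A \<inter> B) \<subseteq> U A \<inter> U B"
          unfolding U_def by (auto simp: stone_homD(3) [OF C(1)])
        show "U A \<inter> U B \<subseteq> U (A \<inter> B)"
        proof
          fix t assume "t \<in> U A \<inter> U B"
          then obtain h h' where h: "h \<in> C" "h' \<in> C" "t \<in> h A" "t \<in> h' B" by (auto simp: U_def)
          then obtain k where "k \<in> C" "t \<in> k A" "t \<in> k B"
            using C(2) [OF h(1,2)] by (auto simp: le_fun_def)
          then show "t \<in> U (A \<inter> B)" by (auto simp: U_def stone_homD(3) [OF C(1)])
        qed
      qed
      have "U {} = {}" using C(1) by (auto simp: U_def stone_hom_def)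
      moreover have "interior A \<subseteq> U A" for A
        using stone_homD(5) [OF C(1)] False by (fastforce simp: U_def)
      ultimately have "stone_hom (\<lambda>A. closure (U A))"
        unfolding stone_hom_def using oU closure_subset
        by (auto simp: ed UI closure_Int_open [OF ed oU oU]) blast
      moreover have "\<forall>h\<in>C. h \<le> (\<lambda>A. closure (U A))"
        using closure_subset by (fastforce simp: le_fun_def U_def)
      ultimately show ?thesis by blast
    qed
  qed
  then obtain h :: "'t set \<Rightarrow> 't set" where h: "stone_hom h" and max: "\<And>k. stone_hom k \<Longrightarrow> h \<le> k \<Longrightarrow> k = h"
    by blast
  have "h (- A) = - h A" for A
  proof (rule ccontr)
    assume ne: "h (- A) \<noteq> - h A"
    have disj: "h A \<inter> h (- A) = {}"
      using h unfolding stone_hom_def by (metis Compl_disjoint)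
    define C where "C = - (h A \<union> h (- A))"
    have "C \<noteq> {}" using ne disj by (auto simp: C_def)
    have C: "open C" "closed C"
      using h by (auto simp: C_def stone_hom_def intro!: open_Un closed_Un)
    \<comment> \<open>On the clopen set \<open>C\<close>, which both \<open>h A\<close> and
      \<open>h (- A)\<close> miss, the set \<open>A\<close> is adjoined to the filters:
      \<open>B\<close> is accepted when \<open>h\<close> accepts the implication
      \<open>B \<union> - A\<close>.\<close>
    define k where "k B = h B \<union> (C \<inter> h (B \<union> - A))" for B
    have "stone_hom k"
      unfolding stone_hom_def
    proof (intro conjI allI)
      fix B D
      show "open (k B)" "closed (k B)"
        using h C by (auto simp: k_def stone_hom_def)
      show "k {} = {}" using h by (auto simp: k_def stone_hom_def C_def)
      show "interior B \<subseteq> k B" using h by (auto simp: k_def stone_hom_def)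
      have "h (B \<union> - A) \<inter> h (D \<union> - A) = h ((B \<inter> D) \<union> - A)"
        using h unfolding stone_hom_def by (metis Un_Int_distrib2)
      moreover have "h B \<subseteq> h (B \<union> - A)" "h D \<subseteq> h (D \<union> - A)"
        using stone_hom_mono [OF h] by auto
      moreover have "h (B \<inter> D) = h B \<inter> h D" using h by (simp add: stone_hom_def)
      ultimately show "k (B \<inter> D) = k B \<inter> k D" unfolding k_def by blast
    qed
    moreover have "h \<le> k" by (auto simp: le_fun_def k_def)
    ultimately have "k = h" by (rule max)
    moreover have "C \<subseteq> h (A \<union> - A)"
      using stone_homD(5) [OF h, of UNIV] by auto
    then have "C \<subseteq> k A" by (auto simp only: k_def)
    ultimately show False using \<open>C \<noteq> {}\<close> by (auto simp: C_def)
  qed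
  with h show ?thesis by blast
qed

text \<open>One homomorphism is fixed for all points at once; this coherence is what lets limits
  depend continuously on the point.\<close>

definition uf :: "'t::topological_space \<Rightarrow> 't filter" where
  "uf t = (let h = SOME h. stone_hom h \<and> (\<forall>A. h (- A) = - h A) in Abs_filter (\<lambda>P. t \<in> h (Collect P)))"

text \<open>Turns an arbitrary bounded function into a continuous one. Boundedness is what
  guarantees that the limits exist.\<close>

definition blift :: "('t::topological_space \<Rightarrow> 'k) \<Rightarrow> 't \<Rightarrow>\<^sub>C 'k::real_or_complex" where
  "blift f = Bcontfun (\<lambda>t. Lim (uf t) f)"

section \<open>Bounded functions and pointwise descriptions of the order\<close>

definition bddf :: "('t \<Rightarrow> 'k::real_normed_vector) \<Rightarrow> bool" where
  "bddf f \<longleftrightarrow> (\<exists>B. \<forall>t. norm (f t) \<le> B)"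

lemma bddf_add: "bddf f \<Longrightarrow> bddf g \<Longrightarrow> bddf (\<lambda>t. f t + g t)"
  unfolding bddf_def by (meson norm_triangle_mono)

lemma bddf_diff: "bddf f \<Longrightarrow> bddf g \<Longrightarrow> bddf (\<lambda>t. f t - g t)"
  unfolding bddf_def by (meson add_mono norm_triangle_ineq4 order_trans)

lemma bddf_mult:
  fixes f g :: "'t \<Rightarrow> 'k::real_normed_algebra"
  assumes "bddf f" "bddf g" shows "bddf (\<lambda>t. f t * g t)"
proof -
  obtain B C where "\<And>t. norm (f t) \<le> B" "\<And>t. norm (g t) \<le> C"
    using assms unfolding bddf_def by blast
  then have "norm (f t * g t) \<le> B * C" for t
    by (meson mult_mono norm_ge_zero norm_mult_ineq order_trans)
  then show ?thesis unfolding bddf_def by blast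
qed

lemma has_sum_diff:
  fixes f g :: "'a \<Rightarrow> 'b::real_normed_vector"
  assumes "(f has_sum a) A" "(g has_sum b) A"
  shows "((\<lambda>x. f x - g x) has_sum (a - b)) A"
  using has_sum_add [OF assms(1) has_sum_bounded_linear [OF bounded_linear_minus [OF bounded_linear_ident] assms(2)]]
  by (simp add: o_def)

lemma continuous_on_clopen_cases:
  assumes "open C" "closed C" "continuous_on UNIV f" "continuous_on UNIV g"
  shows "continuous_on UNIV (\<lambda>t. if t \<in> C then f t else g t)"
proof -
  have "continuous_on (C \<union> - C) (\<lambda>t. if t \<in> C then f t else g t)"
    using assms by (intro continuous_on_cases) (auto intro: continuous_on_subset)
  then show ?thesis by simp
qed

lemma norm_bcontfun_le: "(\<And>t. norm (apply_bcontfun f t) \<le> B) \<Longrightarrow> norm f \<le> B"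
  by (rule norm_bound)

lemma norm_bcontfun_le_iff: "norm f \<le> B \<longleftrightarrow> (\<forall>t. norm (apply_bcontfun f t) \<le> B)"
  by (meson norm_bound norm_bounded order_trans)

lemma apply_bcontfun_sum:
  "apply_bcontfun (\<Sum>i\<in>F. f i) t = (\<Sum>i\<in>F. apply_bcontfun (f i) t)"
  by (induction F rule: infinite_finite_induct) auto

lemma real_e_le_iff: "e_le f g \<longleftrightarrow> (\<forall>t. apply_bcontfun f t \<le> (apply_bcontfun g t :: real))"
  by (simp add: e_le_def e_nonneg_def)

lemma real_e_nonneg_iff: "e_nonneg f \<longleftrightarrow> (\<forall>t. 0 \<le> (apply_bcontfun f t :: real))"
  by (simp add: e_nonneg_def)

lemma real_estar [simp]: "estar f = (f :: 't::topological_space \<Rightarrow>\<^sub>C real)"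
  by (rule bcontfun_eqI) (simp add: cnjg_real_def)

lemma cnjg_fixed:
  assumes "cnjg x = (x :: 'k::real_or_complex)" shows "x = of_real (rpart x)" "ipart x = 0"
proof -
  have "ipart (cnjg x) = - ipart x" by (simp add: ipart_def to_complex_cnjg)
  then show i: "ipart x = 0" using assms by simp
  show "x = of_real (rpart x)" by (rule rpart_ipart_eqI) (simp_all add: i)
qed

lemma e_le_self_adjoint_iff:
  assumes "estar f = f" "estar g = g"
  shows "e_le f g \<longleftrightarrow> (\<forall>t. rpart (apply_bcontfun f t) \<le> rpart (apply_bcontfun g t))"
proof -
  have "apply_bcontfun f t = of_real (rpart (apply_bcontfun f t))"
    "apply_bcontfun g t = of_real (rpart (apply_bcontfun g t))" for t
    using assms by (metis cnjg_fixed(1) estar_apply)+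
  then have "apply_bcontfun (g - f) t
      = of_real (rpart (apply_bcontfun g t) - rpart (apply_bcontfun f t))" for t
    by (metis minus_bcontfun.rep_eq of_real_diff)
  then show ?thesis
    unfolding e_le_def e_nonneg_def scalar_nonneg_iff by (simp add: rpart_diff)
qed

lemma to_complex_decomp:
  fixes u v :: real
  assumes "range (to_complex :: 'k::real_or_complex \<Rightarrow> complex) \<noteq> UNIV \<Longrightarrow> v = 0"
  shows "to_complex (of_real u + imag_unit * of_real v :: 'k) = Complex u v"
proof (cases "range (to_complex :: 'k \<Rightarrow> complex) = UNIV")
  case True
  have "to_complex (imag_unit :: 'k) = \<i>"
    unfolding imag_unit_def if_P [OF True] by (rule f_inv_into_f) (simp only: True UNIV_I)
  then show ?thesis by (simp add: to_complex_add to_complex_mult complex_eq_iff)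
next
  case False
  then show ?thesis using assms by (simp add: complex_eq_iff)
qed

lemma ipart_real:
  "range (to_complex :: 'k::real_or_complex \<Rightarrow> complex) \<noteq> UNIV \<Longrightarrow> ipart (x :: 'k) = 0"
  using range_to_complex [where 'a = 'k] complex_is_Real_iff by (auto simp: ipart_def)

lemma rpart_mult: "rpart (x * y :: 'k::real_or_complex) = rpart x * rpart y - ipart x * ipart y"
  and ipart_mult: "ipart (x * y :: 'k::real_or_complex) = rpart x * ipart y + ipart x * rpart y"
  by (simp_all add: rpart_def ipart_def to_complex_mult)

lemma continuous_on_rpart: "continuous_on UNIV (\<lambda>t. rpart (apply_bcontfun f t))"
  and continuous_on_ipart: "continuous_on UNIV (\<lambda>t. ipart (apply_bcontfun f t))"
  by (rule bounded_linear.continuous_on [OF bounded_linear_rpart] bounded_linear.continuous_on [OF bounded_linear_ipart]; simp)+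

section \<open>Limits along the ultrafilters of a hyperstonian space\<close>

locale hyperstonian_space =
  fixes T :: "'t::t2_space itself"
  assumes hyperstonian: "hyperstonian TYPE('t)"
begin

lemma compact_T: "compact (UNIV :: 't set)"
  using hyperstonian by (simp add: hyperstonian_def)

lemma open_closure: "open U \<Longrightarrow> open (closure U :: 't set)"
  using hyperstonian by (simp add: hyperstonian_def)

lemma apply_Bcontfun:
  assumes "continuous_on UNIV (f :: 't \<Rightarrow> 'k::real_normed_vector)"
  shows "apply_bcontfun (Bcontfun f) = f"
proof (rule Bcontfun_inverse)
  have "bounded (range f)"
    using compact_continuous_image [OF assms compact_T] compact_imp_bounded by blast
  then show "f \<in> bcontfun" using assms by (simp add: bcontfun_def)
qed

lemma eventually_uf:
  obtains h where "stone_hom h" "\<And>A. h (- A) = - h A"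
    "\<And>t P. eventually P (uf t) \<longleftrightarrow> (t :: 't) \<in> h {s. P s}"
proof -
  define h :: "'t set \<Rightarrow> 't set" where "h = (SOME h. stone_hom h \<and> (\<forall>A. h (- A) = - h A))"
  have h: "stone_hom h \<and> (\<forall>A. h (- A) = - h A)"
    unfolding h_def using stone_hom_exists [OF open_closure] by (rule someI_ex)
  have "is_filter (\<lambda>P. t \<in> h (Collect P))" for t
  proof
    show "t \<in> h {s. True}" using h stone_homD(5) [of h UNIV] by auto
    show "t \<in> h {s. P s \<and> Q s}" if "t \<in> h (Collect P)" "t \<in> h (Collect Q)" for P Q
      using that h unfolding stone_hom_def by (simp add: Collect_conj_eq)
    show "t \<in> h (Collect Q)" if "\<forall>x. P x \<longrightarrow> Q x" "t \<in> h (Collect P)" for P Q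
      using that stone_hom_mono [of h "Collect P" "Collect Q"] h by blast
  qed
  then have "eventually P (uf t) \<longleftrightarrow> t \<in> h {s. P s}" for t P
    unfolding uf_def h_def [symmetric] Let_def by (rule eventually_Abs_filter)
  with h show thesis using that by blast
qed

lemma uf_neq_bot [simp]: "uf (t :: 't) \<noteq> bot"
proof -
  obtain h :: "'t set \<Rightarrow> 't set" where "stone_hom h"
    "\<And>t P. eventually P (uf t) \<longleftrightarrow> t \<in> h {s. P s}" by (rule eventually_uf) blast
  then have "\<not> eventually (\<lambda>_. False) (uf t)" by (simp add: stone_hom_def)
  then show ?thesis by (auto simp: trivial_limit_def)
qed

lemma uf_ultra: "eventually P (uf (t :: 't)) \<or> eventually (\<lambda>s. \<not> P s) (uf t)"
proof -
  obtain h :: "'t set \<Rightarrow> 't set" where h: "\<And>A. h (- A) = - h A"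
    "\<And>t P. eventually P (uf t) \<longleftrightarrow> t \<in> h {s. P s}" by (rule eventually_uf) blast
  show ?thesis using h(1) [of "{s. P s}"] by (auto simp: h(2) Collect_neg_eq)
qed

text \<open>The set is \<open>h {s. P s}\<close>. Hence what holds along the ultrafilter at one
  point holds along those of all nearby points.\<close>

lemma open_eventually_uf: "open {t :: 't. eventually P (uf t)}"
proof -
  obtain h :: "'t set \<Rightarrow> 't set" where h: "stone_hom h"
    "\<And>t P. eventually P (uf t) \<longleftrightarrow> t \<in> h {s. P s}" by (rule eventually_uf) blast
  then show ?thesis by (simp add: stone_hom_def)
qed

lemma uf_le_nhds: "uf (t :: 't) \<le> nhds t"
proof -
  obtain h :: "'t set \<Rightarrow> 't set" where h: "stone_hom h"
    "\<And>t P. eventually P (uf t) \<longleftrightarrow> t \<in> h {s. P s}" by (rule eventually_uf) blast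
  have "eventually P (uf t)" if "eventually P (nhds t)" for P
  proof -
    have "\<exists>S. open S \<and> t \<in> S \<and> (\<forall>s\<in>S. P s)"
      using that unfolding eventually_nhds .
    then have "t \<in> interior {s. P s}" unfolding interior_def by auto
    then show ?thesis using h by (auto simp: stone_hom_def)
  qed
  then show ?thesis by (simp add: le_filter_def)
qed

text \<open>Compactness provides a cluster point, and for an ultrafilter a cluster point is a
  limit.\<close>

lemma uf_converges:
  assumes "compact S" "\<And>s. f s \<in> S"
  shows "\<exists>l\<in>S. (f \<longlongrightarrow> (l :: 'k::topological_space)) (uf (t :: 't))"
proof -
  have "filtermap f (uf t) \<noteq> bot" "\<forall>\<^sub>F x in filtermap f (uf t). x \<in> S"
    using assms(2) by (simp_all add: filtermap_bot_iff eventually_filtermap)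
  then obtain l where l: "l \<in> S" "inf (nhds l) (filtermap f (uf t)) \<noteq> bot"
    using assms(1) unfolding compact_filter by blast
  have "(f \<longlongrightarrow> l) (uf t)"
  proof (rule topological_tendstoI, rule ccontr)
    fix U assume U: "open U" "l \<in> U" "\<not> (\<forall>\<^sub>F s in uf t. f s \<in> U)"
    then have "\<forall>\<^sub>F x in filtermap f (uf t). x \<notin> U"
      using uf_ultra [of "\<lambda>s. f s \<in> U" t] by (simp add: eventually_filtermap)
    moreover have "\<forall>\<^sub>F x in nhds l. x \<in> U" using U(1,2) by (rule eventually_nhds_in_open)
    ultimately have "eventually (\<lambda>_. False) (inf (nhds l) (filtermap f (uf t)))"
      unfolding eventually_inf by blast
    then show False using l(2) by (auto simp: trivial_limit_def)
  qed
  with l(1) show ?thesis by blast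
qed

text \<open>For continuity: \<open>f\<close> is within \<open>e / 2\<close> of its limit at
  \<open>t\<close> along \<open>uf t\<close>, hence by \<open>open_eventually_uf\<close> also along
  \<open>uf t'\<close> for \<open>t'\<close> near \<open>t\<close>, so the two limits differ by at
  most \<open>e / 2\<close>.\<close>

lemma blift_tendsto:
  assumes "bddf (f :: 't \<Rightarrow> 'k::real_or_complex)"
  shows "(f \<longlongrightarrow> apply_bcontfun (blift f) t) (uf t)"
proof -
  obtain B where "\<And>s. norm (f s) \<le> B" using assms unfolding bddf_def by blast
  then have lim: "(f \<longlongrightarrow> Lim (uf t) f) (uf t)" for t
    using uf_converges [OF compact_cball_scalar, of f B t] by (auto simp: tendsto_Lim)
  have "continuous_on UNIV (\<lambda>t. Lim (uf t) f)"
    unfolding continuous_on_def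
  proof (intro ballI tendstoI)
    fix t and e :: real assume "e > 0"
    let ?P = "\<lambda>s. dist (f s) (Lim (uf t) f) < e / 2"
    have "t \<in> {t. eventually ?P (uf t)}"
      using tendstoD [OF lim, of "e / 2" t] \<open>e > 0\<close> by (simp del: less_divide_eq_numeral1)
    then have "\<forall>\<^sub>F t' in nhds t. eventually ?P (uf t')"
      using eventually_nhds_in_open [OF open_eventually_uf] by fastforce
    then have "\<forall>\<^sub>F t' in nhds t. dist (Lim (uf t') f) (Lim (uf t) f) < e"
    proof eventually_elim
      case (elim t')
      have "((\<lambda>s. dist (f s) (Lim (uf t) f)) \<longlongrightarrow> dist (Lim (uf t') f) (Lim (uf t) f)) (uf t')"
        by (intro tendsto_intros lim)
      then have "dist (Lim (uf t') f) (Lim (uf t) f) \<le> e / 2"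
        by (rule tendsto_upperbound) (use elim in \<open>auto elim: eventually_mono\<close>)
      then show ?case using \<open>e > 0\<close> by simp
    qed
    then show "\<forall>\<^sub>F t' in at t. dist (Lim (uf t') f) (Lim (uf t) f) < e"
      by (simp add: eventually_nhds_conv_at)
  qed
  from apply_Bcontfun [OF this] lim show ?thesis by (simp add: blift_def)
qed

lemma blift_eqI:
  assumes "bddf (f :: 't \<Rightarrow> 'k::real_or_complex)" "(f \<longlongrightarrow> l) (uf t)"
  shows "apply_bcontfun (blift f) t = l"
  using tendsto_unique [OF uf_neq_bot blift_tendsto [OF assms(1)] assms(2)] .

lemma uf_tendsto_apply: "(apply_bcontfun (f :: 't \<Rightarrow>\<^sub>C 'k::real_normed_vector) \<longlongrightarrow> apply_bcontfun f t) (uf t)"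
proof (rule tendsto_mono [OF uf_le_nhds])
  show "(apply_bcontfun f \<longlongrightarrow> apply_bcontfun f t) (nhds t)"
    using continuous_on_apply_bcontfun [of UNIV f]
    by (simp add: continuous_on_def tendsto_at_iff_tendsto_nhds)
qed

lemma norm_blift_le:
  assumes "\<And>s. norm (f s) \<le> B"
  shows "norm (blift (f :: 't \<Rightarrow> 'k::real_or_complex)) \<le> B"
proof (rule norm_bcontfun_le)
  have "bddf f" using assms unfolding bddf_def by blast
  then have "((\<lambda>s. norm (f s)) \<longlongrightarrow> norm (apply_bcontfun (blift f) t)) (uf t)" for t
    by (intro tendsto_norm blift_tendsto)
  then show "norm (apply_bcontfun (blift f) t) \<le> B" for t
    by (rule tendsto_upperbound) (use assms in auto)
qed

text \<open>Compactness and the Hausdorff property give an open neighbourhood whose closure stays in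
  \<open>U\<close>, and that closure is open by extremal disconnectedness.\<close>

lemma clopen_neighbourhood:
  assumes "open U" "t \<in> (U :: 't set)"
  obtains C where "open C" "closed C" "t \<in> C" "C \<subseteq> U"
proof -
  have "compact (- U)"
    using compact_Int_closed [OF compact_T, of "- U"] assms(1) by (simp add: closed_Compl)
  have "\<exists>V W. open V \<and> open W \<and> t \<in> V \<and> y \<in> W \<and> V \<inter> W = {}" if "y \<in> - U" for y
    using that assms(2) by (intro hausdorff) auto
  then obtain V W where VW: "\<And>y. y \<in> - U \<Longrightarrow> open (V y) \<and> open (W y) \<and> t \<in> V y \<and> y \<in> W y \<and> V y \<inter> W y = {}"
    by metis
  obtain D where D: "D \<subseteq> - U" "finite D" "- U \<subseteq> (\<Union>y\<in>D. W y)"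
    by (rule compactE_image [OF \<open>compact (- U)\<close>, of "- U" W]) (use VW in blast)+
  define V' where "V' = (\<Inter>y\<in>D. V y)"
  have V': "open V'" "t \<in> V'"
    using D VW by (auto simp: V'_def intro!: open_INT)
  have "closure V' \<inter> W y = {}" if "y \<in> D" for y
  proof -
    have "open (W y)" "V y \<inter> W y = {}" using that D(1) VW [of y] by auto
    moreover have "V' \<subseteq> V y" using that by (auto simp: V'_def)
    ultimately have "open (W y)" "V' \<inter> W y = {}" by auto
    then show ?thesis using open_Int_closure_eq_empty [of "W y" V'] by blast
  qed
  then have "closure V' \<subseteq> U" using D(3) by blast
  then show thesis
    using V' open_closure [of V'] closure_subset [of V'] by (intro that [of "closure V'"]) auto
qed

subsection \<open>Normal functionals and weak* sums\<close>

lemma normal_positive_functionalD: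
  assumes "normal_positive_functional \<mu>"
  shows "\<mu> (f + g) = \<mu> f + \<mu> g" "\<mu> (const_bcontfun c * f) = c * \<mu> f"
    "e_nonneg f \<Longrightarrow> scalar_nonneg (\<mu> f)" "\<mu> (f - g) = \<mu> f - \<mu> g" "\<mu> 0 = 0"
proof -
  show add: "\<mu> (f + g) = \<mu> f + \<mu> g" for f g
    using assms by (simp add: normal_positive_functional_def)
  show "\<mu> (const_bcontfun c * f) = c * \<mu> f" "e_nonneg f \<Longrightarrow> scalar_nonneg (\<mu> f)"
    using assms by (auto simp: normal_positive_functional_def)
  show "\<mu> (f - g) = \<mu> f - \<mu> g" using add [of "f - g" g] by simp
  show "\<mu> 0 = 0" using add [of 0 0] by simp
qed

lemma normal_positive_functional_SUP:
  assumes "normal_positive_functional \<mu>" "F \<noteq> {}" "\<forall>f\<in>F. estar f = f"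
    "\<forall>f\<in>F. \<forall>f'\<in>F. \<exists>h\<in>F. e_le f h \<and> e_le f' h" "self_adjoint_lub F g"
  shows "Re (to_complex (\<mu> g)) = (SUP f\<in>F. Re (to_complex (\<mu> f)))"
proof -
  have "\<forall>F g. F \<noteq> {} \<and> (\<forall>f\<in>F. estar f = f) \<and>
      (\<forall>f\<in>F. \<forall>f'\<in>F. \<exists>h\<in>F. e_le f h \<and> e_le f' h) \<and> self_adjoint_lub F g \<longrightarrow>
      Re (to_complex (\<mu> g)) = (SUP f\<in>F. Re (to_complex (\<mu> f)))"
    using assms(1) unfolding normal_positive_functional_def by (elim conjE)
  then show ?thesis
    by (elim allE [of _ F] allE [of _ g] mp) (intro conjI assms)
qed

text \<open>The hypothesis provides normal functionals only on the real algebra. Compressed to a clopen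
  set and extended by linearity they become normal functionals over the given scalars.\<close>

lemma normal_extension:
  fixes C :: "'t set" and \<mu>0 :: "('t \<Rightarrow>\<^sub>C real) \<Rightarrow> real"
  assumes \<mu>0: "normal_positive_functional \<mu>0" and C: "open C" "closed C"
  defines "R \<equiv> \<lambda>f :: 't \<Rightarrow>\<^sub>C 'k::real_or_complex. Bcontfun (\<lambda>t. if t \<in> C then rpart (apply_bcontfun f t) else 0)"
  defines "J \<equiv> \<lambda>f :: 't \<Rightarrow>\<^sub>C 'k. Bcontfun (\<lambda>t. if t \<in> C then ipart (apply_bcontfun f t) else 0)"
  defines "\<mu> \<equiv> \<lambda>f. of_real (\<mu>0 (R f)) + imag_unit * of_real (\<mu>0 (J f)) :: 'k"
  shows "normal_positive_functional \<mu>" "rpart (\<mu> f) = \<mu>0 (R f)" "ipart (\<mu> f) = \<mu>0 (J f)"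
proof -
  have R [simp]: "apply_bcontfun (R f) t = (if t \<in> C then rpart (apply_bcontfun f t) else 0)"
    and J [simp]: "apply_bcontfun (J f) t = (if t \<in> C then ipart (apply_bcontfun f t) else 0)" for f t
    unfolding R_def J_def
    by (subst apply_Bcontfun; simp add: continuous_on_clopen_cases C continuous_on_rpart continuous_on_ipart)+
  note \<mu>0D = normal_positive_functionalD [OF \<mu>0]
  have J0: "J f = 0" if "range (to_complex :: 'k \<Rightarrow> complex) \<noteq> UNIV" for f
    by (rule bcontfun_eqI) (simp add: ipart_real [OF that])
  have c: "to_complex (\<mu> f) = Complex (\<mu>0 (R f)) (\<mu>0 (J f))" for f
    unfolding \<mu>_def using J0 \<mu>0D(5) by (intro to_complex_decomp) simp
  show r: "rpart (\<mu> f) = \<mu>0 (R f)" and i: "ipart (\<mu> f) = \<mu>0 (J f)" for f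
    by (simp_all add: rpart_def ipart_def c)
  have R_add: "R (f + g) = R f + R g" and J_add: "J (f + g) = J f + J g" for f g
    by (rule bcontfun_eqI; simp add: rpart_add ipart_add)+
  have R_mult: "R (const_bcontfun c * f) = const_bcontfun (rpart c) * R f - const_bcontfun (ipart c) * J f"
    and J_mult: "J (const_bcontfun c * f) = const_bcontfun (rpart c) * J f + const_bcontfun (ipart c) * R f"
    for c f
    by (rule bcontfun_eqI; simp add: rpart_mult ipart_mult)+
  show "normal_positive_functional \<mu>"
    unfolding normal_positive_functional_def
  proof (intro conjI allI impI)
    fix f g :: "'t \<Rightarrow>\<^sub>C 'k" and c :: 'k
    show "\<mu> (f + g) = \<mu> f + \<mu> g"
      by (rule rpart_ipart_eqI) (simp_all add: r i rpart_add ipart_add R_add J_add \<mu>0D)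
    show "\<mu> (const_bcontfun c * f) = c * \<mu> f"
      by (rule rpart_ipart_eqI) (simp_all add: r i rpart_mult ipart_mult R_mult J_mult \<mu>0D)
    show "scalar_nonneg (\<mu> f)" if "e_nonneg f"
    proof -
      have f: "apply_bcontfun f t = of_real (rpart (apply_bcontfun f t))" "0 \<le> rpart (apply_bcontfun f t)" for t
        using that by (auto simp: e_nonneg_def scalar_nonneg_iff)
      have "ipart (apply_bcontfun f t) = 0" for t using f(1) ipart_of_real by metis
      then have "J f = 0" by (intro bcontfun_eqI) simp
      then have \<mu>f: "\<mu> f = of_real (\<mu>0 (R f))" using \<mu>0D(5) by (simp add: \<mu>_def)
      have "e_nonneg (R f)" using f(2) by (simp add: real_e_nonneg_iff)
      then have "0 \<le> \<mu>0 (R f)" using \<mu>0D(3) by fastforce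
      then show ?thesis unfolding \<mu>f scalar_nonneg_def by blast
    qed
    fix F :: "('t \<Rightarrow>\<^sub>C 'k) set"
    assume F: "F \<noteq> {} \<and> (\<forall>f\<in>F. estar f = f) \<and>
      (\<forall>f\<in>F. \<forall>f'\<in>F. \<exists>h\<in>F. e_le f h \<and> e_le f' h) \<and> self_adjoint_lub F g"
    then have g: "estar g = g" and ub: "\<And>f. f \<in> F \<Longrightarrow> e_le f g"
      and lub: "\<And>h. estar h = h \<Longrightarrow> (\<And>f. f \<in> F \<Longrightarrow> e_le f h) \<Longrightarrow> e_le g h"
      and sa: "\<And>f. f \<in> F \<Longrightarrow> estar f = f"
      by (auto simp: self_adjoint_lub_def)
    have R_mono: "e_le (R f) (R f')" if "estar f = f" "estar f' = f'" "e_le f f'" for f f'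
      using that(3) unfolding e_le_self_adjoint_iff [OF that(1,2)] real_e_le_iff by simp
    have "self_adjoint_lub (R ` F) (R g)"
      unfolding self_adjoint_lub_def
    proof (intro conjI allI impI ballI)
      show "e_le f (R g)" if "f \<in> R ` F" for f
        using that R_mono sa g ub by blast
      fix h :: "'t \<Rightarrow>\<^sub>C real" assume h: "estar h = h \<and> (\<forall>f\<in>R ` F. e_le f h)"
      obtain f0 where "f0 \<in> F" using F by blast
      \<comment> \<open>The competitor \<open>h\<close> bounds the original family only on
        \<open>C\<close>; elsewhere \<open>g\<close> is used, which is an upper bound
        anyway.\<close>
      define H :: "'t \<Rightarrow>\<^sub>C 'k" where
        "H = Bcontfun (\<lambda>t. of_real (if t \<in> C then apply_bcontfun h t else rpart (apply_bcontfun g t)))"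
      have H [simp]: "apply_bcontfun H t
          = of_real (if t \<in> C then apply_bcontfun h t else rpart (apply_bcontfun g t))" for t
        unfolding H_def
        by (subst apply_Bcontfun)
          (intro continuous_on_of_real continuous_on_clopen_cases C continuous_on_rpart
            continuous_on_apply_bcontfun, rule refl)
      have sH: "estar H = H" by (rule bcontfun_eqI) simp
      have "e_le f H" if "f \<in> F" for f
      proof -
        have "\<forall>t\<in>C. rpart (apply_bcontfun f t) \<le> apply_bcontfun h t"
          using h that by (auto simp: real_e_le_iff split: if_splits)
        moreover have "\<forall>t. rpart (apply_bcontfun f t) \<le> rpart (apply_bcontfun g t)"
          using ub [OF that] by (simp add: e_le_self_adjoint_iff [OF sa [OF that] g])
        ultimately show ?thesis
          unfolding e_le_self_adjoint_iff [OF sa [OF that] sH] by simp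
      qed
      then have "e_le g H" by (rule lub [OF sH])
      then have "\<forall>t\<in>C. rpart (apply_bcontfun g t) \<le> apply_bcontfun h t"
        unfolding e_le_self_adjoint_iff [OF g sH] by (auto split: if_splits)
      moreover have "0 \<le> apply_bcontfun h t" if "t \<notin> C" for t
        using h \<open>f0 \<in> F\<close> that by (auto simp: real_e_le_iff dest!: spec [of _ t] split: if_splits)
      ultimately show "e_le (R g) h" by (simp add: real_e_le_iff)
    qed simp
    moreover have "R ` F \<noteq> {}" "\<forall>f\<in>R ` F. estar f = f" using F by auto
    moreover have "\<forall>f\<in>R ` F. \<forall>f'\<in>R ` F. \<exists>h\<in>R ` F. e_le f h \<and> e_le f' h"
    proof (intro ballI)
      fix f f' assume "f \<in> R ` F" "f' \<in> R ` F"
      then obtain a b where ab: "f = R a" "f' = R b" "a \<in> F" "b \<in> F" by blast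
      then obtain h where "h \<in> F" "e_le a h" "e_le b h" using F by blast
      then show "\<exists>h\<in>R ` F. e_le f h \<and> e_le f' h" using ab R_mono sa by blast
    qed
    ultimately have "Re (to_complex (\<mu>0 (R g))) = (SUP f\<in>R ` F. Re (to_complex (\<mu>0 f)))"
      by (intro normal_positive_functional_SUP [OF \<mu>0])
    then show "Re (to_complex (\<mu> g)) = (SUP f\<in>F. Re (to_complex (\<mu> f)))"
      by (simp add: c to_complex_real_def image_image)
  qed
qed

text \<open>If some real component of the difference is positive at a point, it exceeds half of that
  value on a clopen neighbourhood. A normal functional that does not vanish on the indicator,
  compressed to the neighbourhood and extended to the scalars, then tells \<open>a\<close> and
  \<open>b\<close> apart.\<close>

lemma normal_functionals_separate:
  fixes a b :: "'t \<Rightarrow>\<^sub>C 'k::real_or_complex"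
  assumes eq: "\<And>\<mu>. normal_positive_functional \<mu> \<Longrightarrow> \<mu> a = \<mu> b"
  shows "a = b"
proof (rule ccontr)
  assume "a \<noteq> b"
  have main: False
    if g: "continuous_on UNIV g" and pos: "g t0 > 0"
      and zero: "\<And>\<mu>0 C. normal_positive_functional \<mu>0 \<Longrightarrow> open C \<Longrightarrow> closed C \<Longrightarrow>
        \<mu>0 (Bcontfun (\<lambda>t. if t \<in> C then g t else 0)) = 0" for g :: "'t \<Rightarrow> real" and t0
  proof -
    \<comment> \<open>On a clopen set where \<open>g\<close> exceeds this value, \<open>g\<close>
      cut down to the set dominates \<open>?d\<close> times the indicator; positivity transfers this
      to \<open>\<mu>0\<close>.\<close>
    let ?d = "g t0 / 2"
    have "open {t. ?d < g t}"
      by (rule open_Collect_less [OF continuous_on_const g])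
    moreover have "t0 \<in> {t. ?d < g t}" using pos by simp
    ultimately obtain C where C: "open C" "closed C" "t0 \<in> C" "C \<subseteq> {t. ?d < g t}"
      by (rule clopen_neighbourhood)
    let ?f = "Bcontfun (\<lambda>t. if t \<in> C then g t else 0)"
    let ?i = "Bcontfun (\<lambda>t. if t \<in> C then 1 else 0) :: 't \<Rightarrow>\<^sub>C real"
    have f: "apply_bcontfun ?f = (\<lambda>t. if t \<in> C then g t else 0)"
      and i: "apply_bcontfun ?i = (\<lambda>t. if t \<in> C then 1 else 0)"
      by (rule apply_Bcontfun continuous_on_clopen_cases C g continuous_on_const)+
    have "apply_bcontfun ?i t0 \<noteq> apply_bcontfun 0 t0" using C(3) by (simp add: i)
    then have "?i \<noteq> 0" by metis
    moreover have "e_nonneg ?i" by (simp add: real_e_nonneg_iff i)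
    ultimately obtain \<mu>0 where \<mu>0: "normal_positive_functional \<mu>0" "\<mu>0 ?i \<noteq> 0"
      using hyperstonian unfolding hyperstonian_def by blast
    note \<mu>0D = normal_positive_functionalD [OF \<mu>0(1)]
    have "e_nonneg (?f - const_bcontfun ?d * ?i)" using C(4) by (auto simp: real_e_nonneg_iff f i)
    then have "0 \<le> \<mu>0 (?f - const_bcontfun ?d * ?i)" using \<mu>0D(3) by fastforce
    also have "\<dots> = - ?d * \<mu>0 ?i" using zero [OF \<mu>0(1) C(1,2)] by (simp add: \<mu>0D)
    finally have "\<mu>0 ?i \<le> 0" using pos by (simp add: mult_le_0_iff)
    moreover have "0 \<le> \<mu>0 ?i" using \<mu>0D(3) [OF \<open>e_nonneg ?i\<close>] by simp
    ultimately show False using \<mu>0(2) by simp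
  qed
  let ?r = "\<lambda>t. rpart (apply_bcontfun a t) - rpart (apply_bcontfun b t)"
  let ?j = "\<lambda>t. ipart (apply_bcontfun a t) - ipart (apply_bcontfun b t)"
  have cr: "continuous_on UNIV ?r" and cj: "continuous_on UNIV ?j"
    by (intro continuous_intros continuous_on_rpart continuous_on_ipart)+
  \<comment> \<open>The extension of \<open>\<mu>0\<close> compressed to \<open>C\<close> agrees on
    \<open>a\<close> and \<open>b\<close>; comparing real or imaginary parts shows that
    \<open>\<mu>0\<close> kills the corresponding component of the difference on \<open>C\<close>,
    with either sign.\<close>
  have zero: "\<mu>0 (Bcontfun (\<lambda>t. if t \<in> C then u (apply_bcontfun a t) - u (apply_bcontfun b t) else 0)) = 0
      \<and> \<mu>0 (Bcontfun (\<lambda>t. if t \<in> C then - (u (apply_bcontfun a t) - u (apply_bcontfun b t)) else 0)) = 0"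
    if \<mu>0: "normal_positive_functional \<mu>0" and C: "open C" "closed C" and u: "u = rpart \<or> u = ipart"
    for \<mu>0 C and u :: "'k \<Rightarrow> real"
  proof -
    have cu: "continuous_on UNIV (\<lambda>t. u (apply_bcontfun f t))" for f :: "'t \<Rightarrow>\<^sub>C 'k"
      using u continuous_on_rpart continuous_on_ipart by auto
    let ?B = "\<lambda>f. Bcontfun (\<lambda>t. if t \<in> C then u (apply_bcontfun f t) else 0)"
    have B: "apply_bcontfun (?B f) = (\<lambda>t. if t \<in> C then u (apply_bcontfun f t) else 0)" for f
      by (rule apply_Bcontfun continuous_on_clopen_cases C cu continuous_on_const)+
    have "\<mu>0 (?B a) = \<mu>0 (?B b)"
      using u
    proof
      assume u: "u = rpart"
      show ?thesis
        unfolding u using arg_cong [OF eq [OF normal_extension(1) [OF \<mu>0 C]], of rpart]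
        unfolding normal_extension(2) [OF \<mu>0 C] .
    next
      assume u: "u = ipart"
      show ?thesis
        unfolding u using arg_cong [OF eq [OF normal_extension(1) [OF \<mu>0 C]], of ipart]
        unfolding normal_extension(3) [OF \<mu>0 C] .
    qed
    moreover have "Bcontfun (\<lambda>t. if t \<in> C then u (apply_bcontfun a t) - u (apply_bcontfun b t) else 0)
        = ?B a - ?B b"
      by (rule bcontfun_eqI, subst apply_Bcontfun)
        (intro continuous_on_clopen_cases C continuous_on_const continuous_on_diff cu, simp add: B)
    moreover have "Bcontfun (\<lambda>t. if t \<in> C then - (u (apply_bcontfun a t) - u (apply_bcontfun b t)) else 0)
        = ?B b - ?B a"
      by (rule bcontfun_eqI, subst apply_Bcontfun)
        (intro continuous_on_clopen_cases C continuous_on_const continuous_on_diff continuous_on_minus cu, simp add: B)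
    ultimately show ?thesis
      using normal_positive_functionalD(4) [OF \<mu>0] by simp
  qed
  obtain t where t: "apply_bcontfun a t \<noteq> apply_bcontfun b t"
    using \<open>a \<noteq> b\<close> bcontfun_eqI by blast
  then have "?r t > 0 \<or> - ?r t > 0 \<or> ?j t > 0 \<or> - ?j t > 0"
    using rpart_ipart_eqI [of "apply_bcontfun a t" "apply_bcontfun b t"] by linarith
  then show False
    using main [OF cr, of t] main [OF continuous_on_minus [OF cr], of t]
      main [OF cj, of t] main [OF continuous_on_minus [OF cj], of t] zero by blast
qed

lemma weak_star_sum_unique:
  "has_weak_star_sum f a \<Longrightarrow> weak_star_sum f = (a :: 't \<Rightarrow>\<^sub>C 'k::real_or_complex)"
  unfolding weak_star_sum_def has_weak_star_sum_def
  by (rule the_equality) (use normal_functionals_separate has_sum_unique in blast)+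

text \<open>The pointwise sum need not be continuous, but its lift is the supremum of the directed
  family of finite partial sums in the order of the algebra. Normality of \<open>\<mu>\<close> turns
  this supremum into convergence.\<close>

lemma weak_star_sum_nonneg:
  fixes f :: "'i \<Rightarrow> 't \<Rightarrow>\<^sub>C 'k::real_or_complex" and r :: "'i \<Rightarrow> 't \<Rightarrow> real"
  assumes f: "\<And>\<iota> t. apply_bcontfun (f \<iota>) t = of_real (r \<iota> t)" and r: "\<And>\<iota> t. 0 \<le> r \<iota> t"
    and B: "\<And>F t. finite F \<Longrightarrow> (\<Sum>\<iota>\<in>F. r \<iota> t) \<le> B"
  shows "has_weak_star_sum f (blift (\<lambda>t. of_real (\<Sum>\<^sub>\<infinity>\<iota>. r \<iota> t)))"
proof -
  define s where "s t = (\<Sum>\<^sub>\<infinity>\<iota>. r \<iota> t)" for t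
  have hs: "((\<lambda>\<iota>. r \<iota> t) has_sum s t) UNIV" for t
    unfolding s_def
    by (intro has_sum_infsum nonneg_bdd_above_summable_on r) (auto simp: bdd_above_def intro!: exI [of _ B] B)
  have s_ge: "(\<Sum>\<iota>\<in>F. r \<iota> t) \<le> s t" if "finite F" for F t
    by (rule has_sum_mono_neutral [OF has_sum_finite [OF that] hs]) (auto simp: r)
  have s_le: "s t \<le> b" if "\<And>F. finite F \<Longrightarrow> (\<Sum>\<iota>\<in>F. r \<iota> t) \<le> b" for b t
    by (rule has_sum_le_finite_sums [OF hs]) (auto simp: that)
  have s0: "0 \<le> s t" for t using s_ge [of "{}"] by simp
  have bd: "bddf (\<lambda>t. of_real (s t) :: 'k)"
    unfolding bddf_def using s_le B s0 by (intro exI [of _ B]) (auto simp: abs_of_nonneg)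
  define g where "g = (blift (\<lambda>t. of_real (s t)) :: 't \<Rightarrow>\<^sub>C 'k)"
  define \<S> where "\<S> F = (\<Sum>\<iota>\<in>F. f \<iota>)" for F
  have S: "apply_bcontfun (\<S> F) t = of_real (\<Sum>\<iota>\<in>F. r \<iota> t)" for F t
    by (simp add: \<S>_def apply_bcontfun_sum f)
  have lim: "((\<lambda>u. of_real (s u) :: 'k) \<longlongrightarrow> apply_bcontfun g t) (uf t)" for t
    unfolding g_def by (rule blift_tendsto [OF bd])
  have lim_r: "(s \<longlongrightarrow> rpart (apply_bcontfun g t)) (uf t)" for t
    using tendsto_rpart [OF lim [of t]] by simp
  have g: "apply_bcontfun g t = of_real (rpart (apply_bcontfun g t))" for t
    by (rule tendsto_unique [OF uf_neq_bot lim tendsto_of_real [OF lim_r]])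
  have sg: "estar g = g" by (rule bcontfun_eqI) (metis cnjg_of_real estar_apply g)
  have sS: "estar (\<S> F) = \<S> F" for F
    by (rule bcontfun_eqI) (simp only: S estar_apply cnjg_of_real)
  have S_le_g: "e_le (\<S> F) g" if "finite F" for F
    unfolding e_le_self_adjoint_iff [OF sS sg]
  proof
    fix t
    have "((\<lambda>u. rpart (apply_bcontfun (\<S> F) u)) \<longlongrightarrow> rpart (apply_bcontfun (\<S> F) t)) (uf t)"
      by (intro tendsto_rpart uf_tendsto_apply)
    then show "rpart (apply_bcontfun (\<S> F) t) \<le> rpart (apply_bcontfun g t)"
      by (rule tendsto_le [OF uf_neq_bot lim_r]) (simp add: S s_ge [OF that] del: of_real_sum)
  qed
  have lub: "self_adjoint_lub (\<S> ` Collect finite) g"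
    unfolding self_adjoint_lub_def
  proof (intro conjI allI impI ballI)
    show "e_le h g" if "h \<in> \<S> ` Collect finite" for h using that S_le_g by blast
    fix h :: "'t \<Rightarrow>\<^sub>C 'k" assume h: "estar h = h \<and> (\<forall>f\<in>\<S> ` Collect finite. e_le f h)"
    then have sh: "estar h = h" by blast
    \<comment> \<open>A continuous upper bound of the partial sums dominates the pointwise sum at
      every point, and therefore, in the limit along \<open>uf t\<close>, also its lift.\<close>
    have "s t \<le> rpart (apply_bcontfun h t)" for t
    proof (rule s_le)
      fix F :: "'i set" assume "finite F"
      then have "e_le (\<S> F) h" using h by blast
      then show "(\<Sum>\<iota>\<in>F. r \<iota> t) \<le> rpart (apply_bcontfun h t)"
        unfolding e_le_self_adjoint_iff [OF sS sh] by (simp add: S del: of_real_sum)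
    qed
    then show "e_le g h"
      unfolding e_le_self_adjoint_iff [OF sg sh]
      by (intro allI tendsto_le [OF uf_neq_bot tendsto_rpart [OF uf_tendsto_apply] lim_r]) simp
  qed (rule sg)
  have "((\<lambda>\<iota>. \<mu> (f \<iota>)) has_sum \<mu> g) UNIV" if \<mu>: "normal_positive_functional \<mu>" for \<mu>
  proof -
    note \<mu>D = normal_positive_functionalD [OF \<mu>]
    have \<mu>S: "\<mu> (\<S> F) = (\<Sum>\<iota>\<in>F. \<mu> (f \<iota>))" for F
      unfolding \<S>_def by (induction F rule: infinite_finite_induct) (simp_all add: \<mu>D)
    have nn: "scalar_nonneg (\<mu> (f \<iota>))" for \<iota>
      by (rule \<mu>D(3)) (simp add: e_nonneg_def f scalar_nonneg_iff r)
    then have \<mu>f: "\<mu> (f \<iota>) = of_real (rpart (\<mu> (f \<iota>)))" "0 \<le> rpart (\<mu> (f \<iota>))" for \<iota>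
      unfolding scalar_nonneg_iff by blast+
    have "e_nonneg g"
      unfolding e_nonneg_def scalar_nonneg_iff
      using g s0 by (auto intro!: tendsto_lowerbound [OF lim_r])
    then have \<mu>g: "\<mu> g = of_real (rpart (\<mu> g))" using \<mu>D(3) unfolding scalar_nonneg_iff by blast
    have sum_rp: "rpart (\<mu> (\<S> F)) = (\<Sum>\<iota>\<in>F. rpart (\<mu> (f \<iota>)))" for F
      unfolding \<mu>S by (induction F rule: infinite_finite_induct) (simp_all add: rpart_add)
    have "rpart (\<mu> (\<S> F)) \<le> rpart (\<mu> g)" if "finite F" for F
      using \<mu>D(3) [of "g - \<S> F"] S_le_g [OF that]
      by (simp add: e_le_def \<mu>D scalar_nonneg_iff rpart_diff)
    then have "((\<lambda>\<iota>. rpart (\<mu> (f \<iota>))) has_sum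
        (SUP F\<in>{F. finite F \<and> F \<subseteq> UNIV}. \<Sum>\<iota>\<in>F. rpart (\<mu> (f \<iota>)))) UNIV"
      by (intro nonneg_bdd_above_has_sum \<mu>f) (auto simp: bdd_above_def simp flip: sum_rp)
    also have "(SUP F\<in>{F. finite F \<and> F \<subseteq> UNIV}. \<Sum>\<iota>\<in>F. rpart (\<mu> (f \<iota>)))
        = (SUP f\<in>\<S> ` Collect finite. Re (to_complex (\<mu> f)))"
      by (simp add: image_image rpart_def [symmetric] sum_rp)
    also have "\<dots> = rpart (\<mu> g)"
    proof -
      have "\<exists>h\<in>\<S> ` Collect finite. e_le (\<S> F) h \<and> e_le (\<S> G) h" if "finite F" "finite G" for F G
      proof -
        have "e_le (\<S> F) (\<S> (F \<union> G))" "e_le (\<S> G) (\<S> (F \<union> G))"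
          unfolding e_le_self_adjoint_iff [OF sS sS] using that
          by (auto simp: S r simp del: of_real_sum intro!: sum_mono2)
        then show ?thesis using that by blast
      qed
      then show ?thesis
        unfolding rpart_def
        by (intro normal_positive_functional_SUP [OF \<mu> _ _ _ lub, symmetric]) (auto simp: sS)
    qed
    finally have "((\<lambda>\<iota>. of_real (rpart (\<mu> (f \<iota>))) :: 'k) has_sum of_real (rpart (\<mu> g))) UNIV"
      using has_sum_bounded_linear [OF bounded_linear_of_real] by (fastforce simp: o_def)
    then show ?thesis by (simp only: \<mu>f(1) [symmetric] \<mu>g [symmetric])
  qed
  then show ?thesis
    unfolding has_weak_star_sum_def g_def s_def by blast
qed

lemma nonneg_bounded_sums:
  fixes r :: "'i \<Rightarrow> 't \<Rightarrow> real"
  assumes r: "\<And>\<iota> t. 0 \<le> r \<iota> t" and B: "\<And>F t. finite F \<Longrightarrow> (\<Sum>\<iota>\<in>F. r \<iota> t) \<le> B"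
  shows "((\<lambda>\<iota>. r \<iota> t) has_sum (\<Sum>\<^sub>\<infinity>\<iota>. r \<iota> t)) UNIV"
    and "bddf (\<lambda>t. of_real (\<Sum>\<^sub>\<infinity>\<iota>. r \<iota> t) :: 'k::real_or_complex)"
proof -
  show hs: "((\<lambda>\<iota>. r \<iota> t) has_sum (\<Sum>\<^sub>\<infinity>\<iota>. r \<iota> t)) UNIV" for t
    by (intro has_sum_infsum nonneg_bdd_above_summable_on r) (auto simp: bdd_above_def intro!: exI [of _ B] B)
  have "(\<Sum>\<^sub>\<infinity>\<iota>. r \<iota> t) \<le> B" for t
    by (rule has_sum_le_finite_sums [OF hs]) (auto simp: B)
  moreover have "0 \<le> (\<Sum>\<^sub>\<infinity>\<iota>. r \<iota> t)" for t
    by (rule has_sum_nonneg [OF hs]) (simp add: r)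
  ultimately show "bddf (\<lambda>t. of_real (\<Sum>\<^sub>\<infinity>\<iota>. r \<iota> t) :: 'k)"
    unfolding bddf_def by (intro exI [of _ B]) (auto simp: abs_of_nonneg)
qed

text \<open>Positive and negative parts of the real and imaginary parts reduce this to nonnegative
  families; the bound on absolute sums serves for all four of them.\<close>

lemma has_weak_star_sum_blift:
  fixes f :: "'i \<Rightarrow> 't \<Rightarrow>\<^sub>C 'k::real_or_complex"
  assumes B: "\<And>F t. finite F \<Longrightarrow> (\<Sum>\<iota>\<in>F. norm (apply_bcontfun (f \<iota>) t)) \<le> B"
  shows "has_weak_star_sum f (blift (\<lambda>t. \<Sum>\<^sub>\<infinity>\<iota>. apply_bcontfun (f \<iota>) t))"
proof -
  define part where "part u \<iota> t = max 0 (u (apply_bcontfun (f \<iota>) t))" for u :: "'k \<Rightarrow> real" and \<iota> t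
  define P where "P u \<iota> = (Bcontfun (\<lambda>t. of_real (part u \<iota> t)) :: 't \<Rightarrow>\<^sub>C 'k)" for u \<iota>
  define s where "s u t = (of_real (\<Sum>\<^sub>\<infinity>\<iota>. part u \<iota> t) :: 'k)" for u t
  define U where "U = ({rpart, \<lambda>x. - rpart x, ipart, \<lambda>x. - ipart x} :: ('k \<Rightarrow> real) set)"
  have cont: "continuous_on UNIV (\<lambda>t. u (apply_bcontfun (f \<iota>) t))" if "u \<in> U" for u \<iota>
    using that continuous_on_rpart [of "f \<iota>"] continuous_on_ipart [of "f \<iota>"]
    by (auto simp: U_def intro: continuous_on_minus)
  have le: "u x \<le> norm x" if "u \<in> U" for u x
    using that abs_rpart_le [of x] abs_ipart_le [of x] by (auto simp: U_def)
  have P: "apply_bcontfun (P u \<iota>) t = of_real (part u \<iota> t)" if "u \<in> U" for u \<iota> t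
    unfolding P_def part_def
    by (subst apply_Bcontfun) (intro continuous_on_of_real continuous_on_max continuous_on_const cont [OF that], simp)
  have nn: "0 \<le> part u \<iota> t" for u \<iota> t by (simp add: part_def)
  have bd: "(\<Sum>\<iota>\<in>F. part u \<iota> t) \<le> B" if "u \<in> U" "finite F" for u t F
    by (rule order_trans [OF sum_mono B [OF that(2), of t]]) (simp add: part_def le [OF that(1)])
  have w: "has_weak_star_sum (P u) (blift (s u))" if "u \<in> U" for u
    unfolding s_def by (rule weak_star_sum_nonneg [OF P [OF that] nn bd [OF that]])
  have hs: "((\<lambda>\<iota>. of_real (part u \<iota> t) :: 'k) has_sum s u t) UNIV" if "u \<in> U" for u t
    using has_sum_bounded_linear [OF bounded_linear_of_real nonneg_bounded_sums(1) [where r = "part u" and B = B and t = t]]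
      nn bd [OF that] by (simp add: s_def o_def)
  have sb: "bddf (s u)" if "u \<in> U" for u
    unfolding s_def by (rule nonneg_bounded_sums(2) [OF nn bd [OF that]])
  have U: "rpart \<in> U" "(\<lambda>x. - rpart x) \<in> U" "ipart \<in> U" "(\<lambda>x. - ipart x) \<in> U"
    by (simp_all add: U_def)
  \<comment> \<open>Recombines four quantities indexed by \<open>U\<close> in the way a scalar is
    recovered from its positive and negative parts, so that one expression covers families, sums and
    lifts.\<close>
  let ?comb = "\<lambda>q. q rpart - q (\<lambda>x. - rpart x) + imag_unit * (q ipart - q (\<lambda>x. - ipart x)) :: 'k"
  have decomp: "apply_bcontfun (f \<iota>) t = ?comb (\<lambda>u. of_real (part u \<iota> t))" for \<iota> t
  proof -
    have m: "max 0 a - max 0 (- a) = a" for a :: real by auto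
    show ?thesis
      unfolding part_def of_real_diff [symmetric] m by (rule scalar_decomp)
  qed
  have f: "f \<iota> = P rpart \<iota> - P (\<lambda>x. - rpart x) \<iota>
      + const_bcontfun imag_unit * (P ipart \<iota> - P (\<lambda>x. - ipart x) \<iota>)" for \<iota>
    by (rule bcontfun_eqI) (simp only: decomp P U plus_bcontfun.rep_eq minus_bcontfun.rep_eq
        times_bcontfun_apply const_bcontfun.rep_eq)
  define G where "G = blift (s rpart) - blift (s (\<lambda>x. - rpart x))
      + const_bcontfun imag_unit * (blift (s ipart) - blift (s (\<lambda>x. - ipart x)))"
  have "has_weak_star_sum f G"
    unfolding has_weak_star_sum_def
  proof (intro allI impI)
    fix \<mu> :: "('t \<Rightarrow>\<^sub>C 'k) \<Rightarrow> 'k" assume \<mu>: "normal_positive_functional \<mu>"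
    have *: "((\<lambda>\<iota>. \<mu> (P u \<iota>)) has_sum \<mu> (blift (s u))) UNIV" if "u \<in> U" for u
      using w [OF that] \<mu> by (simp add: has_weak_star_sum_def)
    show "((\<lambda>\<iota>. \<mu> (f \<iota>)) has_sum \<mu> G) UNIV"
      unfolding f G_def normal_positive_functionalD(1,2,4) [OF \<mu>]
      by (intro has_sum_add has_sum_diff has_sum_cmult_right * U)
  qed
  moreover have "blift (\<lambda>t. \<Sum>\<^sub>\<infinity>\<iota>. apply_bcontfun (f \<iota>) t) = G"
  proof -
    have "((\<lambda>\<iota>. apply_bcontfun (f \<iota>) t) has_sum ?comb (\<lambda>u. s u t)) UNIV" for t
      unfolding decomp by (intro has_sum_add has_sum_diff has_sum_cmult_right hs U)
    then have "(\<Sum>\<^sub>\<infinity>\<iota>. apply_bcontfun (f \<iota>) t) = ?comb (\<lambda>u. s u t)" for t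
      by (rule infsumI)
    moreover have "bddf (\<lambda>t. ?comb (\<lambda>u. s u t))"
      by (intro bddf_add bddf_diff bddf_mult sb U) (auto simp: bddf_def)
    ultimately show ?thesis
      unfolding G_def
      by (intro bcontfun_eqI blift_eqI) (auto intro!: tendsto_intros blift_tendsto sb U)
  qed
  ultimately show ?thesis by simp
qed

end

section \<open>The Hilbert modules\<close>

text \<open>\<open>eval_at\<close> with values in the type \<open>ell2\<close>; only for
  \<open>\<xi>\<close> in \<open>modK p\<close> is the family known to be square summable.\<close>

definition fib ::
  "'t::topological_space \<Rightarrow> ('i \<Rightarrow> ('t \<Rightarrow>\<^sub>C 'k::real_or_complex)) \<Rightarrow> ('i, 'k) ell2" where
  "fib t \<xi> = Abs_ell2 (eval_at t \<xi>)"

text \<open>The Radon-Riesz property, by expanding the square of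
  \<open>norm (f s - l)\<close>.\<close>

lemma weak_to_norm_tendsto:
  fixes f :: "'s \<Rightarrow> 'a::real_inner"
  assumes "((\<lambda>s. inner (f s) l) \<longlongrightarrow> inner l l) F" "((\<lambda>s. (norm (f s))\<^sup>2) \<longlongrightarrow> (norm l)\<^sup>2) F"
  shows "(f \<longlongrightarrow> l) F"
proof -
  have "((\<lambda>s. (norm (f s))\<^sup>2 - 2 * inner (f s) l + (norm l)\<^sup>2)
      \<longlongrightarrow> (norm l)\<^sup>2 - 2 * inner l l + (norm l)\<^sup>2) F"
    by (intro tendsto_intros assms)
  moreover have "(norm (f s))\<^sup>2 - 2 * inner (f s) l + (norm l)\<^sup>2 = (norm (f s - l))\<^sup>2" for s
    by (simp add: power2_norm_eq_inner inner_diff_left inner_diff_right inner_commute)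
  ultimately have "((\<lambda>s. (norm (f s - l))\<^sup>2) \<longlongrightarrow> 0) F"
    by (simp add: power2_norm_eq_inner)
  then have "((\<lambda>s. sqrt ((norm (f s - l))\<^sup>2)) \<longlongrightarrow> sqrt 0) F"
    by (rule tendsto_real_sqrt)
  then show ?thesis
    by (simp add: tendsto_norm_zero_iff LIM_zero_iff)
qed

lemma norm_sum_estar_mult:
  fixes \<xi> :: "'i \<Rightarrow> ('t::topological_space \<Rightarrow>\<^sub>C 'k::real_or_complex)"
  shows "apply_bcontfun (\<Sum>\<iota>\<in>F. estar (\<xi> \<iota>) * \<xi> \<iota>) t = of_real (\<Sum>\<iota>\<in>F. (norm (apply_bcontfun (\<xi> \<iota>) t))\<^sup>2)"
proof -
  have "cnjg x * x = of_real ((norm x)\<^sup>2)" for x :: 'k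
    using mult_cnjg_self [of x] by (simp add: mult.commute)
  then show ?thesis by (simp add: apply_bcontfun_sum)
qed

locale hilbert_family = hyperstonian_space T for T :: "'t::t2_space itself" +
  fixes p :: "'i \<Rightarrow> ('t \<Rightarrow>\<^sub>C 'k::real_or_complex)"
  assumes projection_p: "\<And>\<iota>. projection (p \<iota>)"
begin

lemma p_cases: "apply_bcontfun (p \<iota>) t = 0 \<or> apply_bcontfun (p \<iota>) t = 1"
proof -
  have "apply_bcontfun (p \<iota> * p \<iota>) t = apply_bcontfun (p \<iota>) t"
    using projection_p [of \<iota>] by (simp add: projection_def)
  then show ?thesis by auto
qed

lemma estar_p [simp]: "estar (p \<iota>) = p \<iota>" and p_idem [simp]: "p \<iota> * p \<iota> = p \<iota>"
  using projection_p by (simp_all add: projection_def)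

lemma cnjg_p [simp]: "cnjg (apply_bcontfun (p \<iota>) t) = apply_bcontfun (p \<iota>) t"
  using p_cases [of \<iota> t] by auto

lemma range_p_iff: "x \<in> range (\<lambda>x. p \<iota> * x) \<longleftrightarrow> p \<iota> * x = x"
proof
  assume "x \<in> range (\<lambda>x. p \<iota> * x)"
  then obtain y where "x = p \<iota> * y" by blast
  then show "p \<iota> * x = x" by (metis p_idem mult.assoc)
qed (metis rangeI)

text \<open>The supremum norm of the partial sums becomes one bound for all fibres: elements of the
  W*-direct sum are bounded fields of vectors with continuous coordinates.\<close>

lemma modK_iff_sums:
  "\<xi> \<in> modK p \<longleftrightarrow> (\<forall>\<iota>. p \<iota> * \<xi> \<iota> = \<xi> \<iota>) \<and>
     (\<exists>B. \<forall>t F. finite F \<longrightarrow> (\<Sum>\<iota>\<in>F. (norm (apply_bcontfun (\<xi> \<iota>) t))\<^sup>2) \<le> B)"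
proof -
  have "norm (\<Sum>\<iota>\<in>F. estar (\<xi> \<iota>) * \<xi> \<iota>) \<le> B
      \<longleftrightarrow> (\<forall>t. (\<Sum>\<iota>\<in>F. (norm (apply_bcontfun (\<xi> \<iota>) t))\<^sup>2) \<le> B)" for F B
    unfolding norm_bcontfun_le_iff norm_sum_estar_mult norm_of_real
    by (simp add: abs_of_nonneg sum_nonneg)
  then have "(\<exists>B. \<forall>F. finite F \<longrightarrow> norm (\<Sum>\<iota>\<in>F. estar (\<xi> \<iota>) * \<xi> \<iota>) \<le> B)
      \<longleftrightarrow> (\<exists>B. \<forall>t F. finite F \<longrightarrow> (\<Sum>\<iota>\<in>F. (norm (apply_bcontfun (\<xi> \<iota>) t))\<^sup>2) \<le> B)"
    by (intro arg_cong [where f = Ex] ext) auto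
  then show ?thesis unfolding modK_def mem_Collect_eq range_p_iff by (simp only:)
qed

lemma Rep_fib [simp]: "\<xi> \<in> modK p \<Longrightarrow> Rep_ell2 (fib t \<xi>) = eval_at t \<xi>"
  unfolding fib_def
  by (rule Abs_ell2_inverse') (auto simp: modK_iff_sums l2_iff_bounded eval_at_def)

lemma modK_p: "\<xi> \<in> modK p \<Longrightarrow> p \<iota> * \<xi> \<iota> = \<xi> \<iota>"
  by (simp add: modK_iff_sums)

lemma modK_fib_bounded:
  assumes "\<xi> \<in> modK p"
  obtains B where "0 \<le> B" "\<And>t. norm (fib t \<xi>) \<le> B"
proof -
  obtain B where B: "\<And>t F. finite F \<Longrightarrow> (\<Sum>\<iota>\<in>F. (norm (apply_bcontfun (\<xi> \<iota>) t))\<^sup>2) \<le> B"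
    using assms unfolding modK_iff_sums by blast
  have "0 \<le> B" using B [of "{}"] by simp
  have "norm (fib t \<xi>) \<le> sqrt B" for t
    using B \<open>0 \<le> B\<close> by (subst norm_ell2_le_iff) (simp_all add: assms eval_at_def)
  then show thesis using that [of "sqrt B"] \<open>0 \<le> B\<close> by simp
qed

text \<open>The way in which module elements are built from, and computed by, prescribed
  fibres.\<close>

lemma modK_I:
  assumes "\<And>\<iota>. p \<iota> * \<xi> \<iota> = \<xi> \<iota>" "\<And>t \<iota>. apply_bcontfun (\<xi> \<iota>) t = Rep_ell2 (f t) \<iota>" "\<And>t. norm (f t) \<le> B"
  shows "\<xi> \<in> modK p" "fib t \<xi> = f t"
proof -
  have "0 \<le> B" using assms(3) norm_ge_zero order_trans by blast
  then have "(\<Sum>\<iota>\<in>F. (norm (apply_bcontfun (\<xi> \<iota>) t))\<^sup>2) \<le> B\<^sup>2" if "finite F" for F t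
    using assms(3) [of t] that by (simp add: assms(2) norm_ell2_le_iff)
  then show "\<xi> \<in> modK p" using assms(1) unfolding modK_iff_sums by blast
  then show "fib t \<xi> = f t"
    by (intro ell2_eqI) (simp add: eval_at_def assms(2))
qed

lemma modK_0 [simp]: "0 \<in> modK p" and fib_0 [simp]: "fib t (0 :: 'i \<Rightarrow> 't \<Rightarrow>\<^sub>C 'k) = 0"
  using modK_I [of 0 "\<lambda>_. 0" 0] by simp_all

lemma modK_add:
  assumes "\<xi> \<in> modK p" "\<eta> \<in> modK p"
  shows "\<xi> + \<eta> \<in> modK p" "fib t (\<xi> + \<eta>) = fib t \<xi> + fib t \<eta>"
proof -
  obtain B C where "\<And>t. norm (fib t \<xi>) \<le> B" "\<And>t. norm (fib t \<eta>) \<le> C"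
    using modK_fib_bounded [OF assms(1)] modK_fib_bounded [OF assms(2)] by metis
  then have "norm (fib t \<xi> + fib t \<eta>) \<le> B + C" for t
    by (meson norm_triangle_mono)
  from modK_I [OF _ _ this, of "\<xi> + \<eta>"] show "\<xi> + \<eta> \<in> modK p" "fib t (\<xi> + \<eta>) = fib t \<xi> + fib t \<eta>"
    using assms by (simp_all add: eval_at_def modK_p distrib_left)
qed

lemma modK_mult:
  assumes "\<xi> \<in> modK p"
  shows "(\<lambda>\<iota>. \<xi> \<iota> * x) \<in> modK p" "fib t (\<lambda>\<iota>. \<xi> \<iota> * x) = kscale (apply_bcontfun x t) (fib t \<xi>)"
proof -
  obtain B where B: "0 \<le> B" "\<And>t. norm (fib t \<xi>) \<le> B" by (rule modK_fib_bounded [OF assms]) blast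
  have "norm (kscale (apply_bcontfun x t) (fib t \<xi>)) \<le> norm x * B" for t
    unfolding norm_kscale using B norm_bounded by (intro mult_mono) auto
  from modK_I [OF _ _ this, of "\<lambda>\<iota>. \<xi> \<iota> * x"]
  show "(\<lambda>\<iota>. \<xi> \<iota> * x) \<in> modK p" "fib t (\<lambda>\<iota>. \<xi> \<iota> * x) = kscale (apply_bcontfun x t) (fib t \<xi>)"
    using assms by (simp_all add: eval_at_def modK_p mult.commute [of _ "apply_bcontfun x _"] flip: mult.assoc)
qed

lemma modK_diff:
  assumes "\<xi> \<in> modK p" "\<eta> \<in> modK p"
  shows "\<xi> - \<eta> \<in> modK p" "fib t (\<xi> - \<eta>) = fib t \<xi> - fib t \<eta>"
proof -
  have eq: "\<xi> - \<eta> = \<xi> + (\<lambda>\<iota>. \<eta> \<iota> * const_bcontfun (- 1))"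
    by (rule ext, rule bcontfun_eqI) simp
  note add = modK_add [OF assms(1) modK_mult(1) [OF assms(2), of "const_bcontfun (- 1)"]]
  show "\<xi> - \<eta> \<in> modK p" "fib t (\<xi> - \<eta>) = fib t \<xi> - fib t \<eta>"
    unfolding eq add(2) modK_mult(2) [OF assms(2)] by (rule add(1)) (simp add: kscale.minus_left)
qed

lemma modK_eqI:
  assumes "\<xi> \<in> modK p" "\<eta> \<in> modK p" "\<And>t. fib t \<xi> = fib t \<eta>"
  shows "\<xi> = \<eta>"
proof (rule ext, rule bcontfun_eqI)
  fix \<iota> t
  have "eval_at t \<xi> = eval_at t \<eta>" using assms by (metis Rep_fib)
  then show "apply_bcontfun (\<xi> \<iota>) t = apply_bcontfun (\<eta> \<iota>) t"
    by (simp add: eval_at_def fun_eq_iff)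
qed

lemma fib_crd_tendsto:
  assumes "\<xi> \<in> modK p"
  shows "((\<lambda>s. Rep_ell2 (fib s \<xi>) \<iota>) \<longlongrightarrow> Rep_ell2 (fib t \<xi>) \<iota>) (nhds t)"
  using continuous_on_apply_bcontfun [of UNIV "\<xi> \<iota>"]
  by (simp add: assms eval_at_def continuous_on_def tendsto_at_iff_tendsto_nhds)

text \<open>Bounded fibres with continuous coordinates are weakly continuous. By
  \<open>modH_iff\<close> norm continuity is what distinguishes \<open>modH p\<close> inside
  \<open>modK p\<close>.\<close>

lemma fib_weak_tendsto:
  assumes "\<xi> \<in> modK p"
  shows "((\<lambda>s. kinner (fib s \<xi>) b) \<longlongrightarrow> kinner (fib t \<xi>) b) (nhds t)"
proof -
  obtain B where "\<And>t. norm (fib t \<xi>) \<le> B" using modK_fib_bounded [OF assms] by metis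
  then show ?thesis
    by (intro weak_tendsto [where C = B] fib_crd_tendsto assms) auto
qed

section \<open>The inner product of the W*-direct sum\<close>

lemma bddf_kinner_fib:
  assumes "\<xi> \<in> modK p" "\<eta> \<in> modK p"
  shows "bddf (\<lambda>s. kinner (fib s \<xi>) (fib s \<eta>))"
proof -
  obtain B where B: "0 \<le> B" "\<And>t. norm (fib t \<xi>) \<le> B" by (rule modK_fib_bounded [OF assms(1)]) blast
  obtain C where C: "0 \<le> C" "\<And>t. norm (fib t \<eta>) \<le> C" by (rule modK_fib_bounded [OF assms(2)]) blast
  have "norm (kinner (fib t \<xi>) (fib t \<eta>)) \<le> B * C" for t
    by (rule order_trans [OF norm_kinner_le]) (intro mult_mono B C norm_ge_zero)
  then show ?thesis unfolding bddf_def by blast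
qed

text \<open>The estimate \<open>a * b \<le> a^2 + b^2\<close> bounds the absolute sums of the
  products uniformly, so the weak* sum is the lift of the pointwise one, which is the inner product
  of the fibres.\<close>

lemma minner_eq_blift:
  assumes "\<xi> \<in> modK p" "\<eta> \<in> modK p"
  shows "minner \<xi> \<eta> = blift (\<lambda>s. kinner (fib s \<xi>) (fib s \<eta>))"
proof -
  obtain B where B: "\<And>t F. finite F \<Longrightarrow> (\<Sum>\<iota>\<in>F. (norm (apply_bcontfun (\<xi> \<iota>) t))\<^sup>2) \<le> B"
    using assms(1) unfolding modK_iff_sums by blast
  obtain C where C: "\<And>t F. finite F \<Longrightarrow> (\<Sum>\<iota>\<in>F. (norm (apply_bcontfun (\<eta> \<iota>) t))\<^sup>2) \<le> C"
    using assms(2) unfolding modK_iff_sums by blast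
  have "(\<Sum>\<iota>\<in>F. norm (apply_bcontfun (estar (\<eta> \<iota>) * \<xi> \<iota>) t)) \<le> B + C" if "finite F" for F t
  proof -
    have "norm (apply_bcontfun (estar (\<eta> \<iota>) * \<xi> \<iota>) t)
        \<le> (norm (apply_bcontfun (\<xi> \<iota>) t))\<^sup>2 + (norm (apply_bcontfun (\<eta> \<iota>) t))\<^sup>2" for \<iota>
    proof -
      let ?a = "norm (apply_bcontfun (\<xi> \<iota>) t)" and ?b = "norm (apply_bcontfun (\<eta> \<iota>) t)"
      have "2 * (?a * ?b) \<le> ?a\<^sup>2 + ?b\<^sup>2" using sum_squares_bound [of ?a ?b] by simp
      moreover have "0 \<le> ?a * ?b" by simp
      ultimately have "?a * ?b \<le> ?a\<^sup>2 + ?b\<^sup>2" by linarith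
      then show ?thesis by (simp add: norm_mult mult.commute)
    qed
    then have "(\<Sum>\<iota>\<in>F. norm (apply_bcontfun (estar (\<eta> \<iota>) * \<xi> \<iota>) t))
        \<le> (\<Sum>\<iota>\<in>F. (norm (apply_bcontfun (\<xi> \<iota>) t))\<^sup>2 + (norm (apply_bcontfun (\<eta> \<iota>) t))\<^sup>2)"
      by (rule sum_mono)
    also have "\<dots> \<le> B + C" using B [OF that, of t] C [OF that, of t] by (simp add: sum.distrib)
    finally show ?thesis .
  qed
  then have "minner \<xi> \<eta> = blift (\<lambda>t. \<Sum>\<^sub>\<infinity>\<iota>. apply_bcontfun (estar (\<eta> \<iota>) * \<xi> \<iota>) t)"
    unfolding minner_def by (rule weak_star_sum_unique [OF has_weak_star_sum_blift])
  also have "(\<lambda>t. \<Sum>\<^sub>\<infinity>\<iota>. apply_bcontfun (estar (\<eta> \<iota>) * \<xi> \<iota>) t) = (\<lambda>t. kinner (fib t \<xi>) (fib t \<eta>))"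
    using assms by (auto simp: kinner.rep_eq l2_inner_def eval_at_def mult.commute)
  finally show ?thesis .
qed

lemma minner_tendsto:
  assumes "\<xi> \<in> modK p" "\<eta> \<in> modK p"
  shows "((\<lambda>s. kinner (fib s \<xi>) (fib s \<eta>)) \<longlongrightarrow> apply_bcontfun (minner \<xi> \<eta>) t) (uf t)"
  unfolding minner_eq_blift [OF assms] by (rule blift_tendsto [OF bddf_kinner_fib [OF assms]])

text \<open>The algebraic rules for \<open>minner\<close> below come from those for
  \<open>kinner\<close>, which hold in every fibre and pass to limits along the ultrafilter.\<close>

lemma minner_eqI:
  assumes "\<xi> \<in> modK p" "\<eta> \<in> modK p" "((\<lambda>s. kinner (fib s \<xi>) (fib s \<eta>)) \<longlongrightarrow> l) (uf t)"
  shows "apply_bcontfun (minner \<xi> \<eta>) t = l"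
  using tendsto_unique [OF uf_neq_bot minner_tendsto [OF assms(1,2)] assms(3)] .

lemma minner_commute:
  assumes "\<xi> \<in> modK p" "\<eta> \<in> modK p" shows "minner \<eta> \<xi> = estar (minner \<xi> \<eta>)"
proof (rule bcontfun_eqI, rule minner_eqI)
  show "((\<lambda>s. kinner (fib s \<eta>) (fib s \<xi>)) \<longlongrightarrow> apply_bcontfun (estar (minner \<xi> \<eta>)) t) (uf t)" for t
    unfolding kinner_commute [of "fib _ \<eta>"] estar_apply
    by (intro tendsto_cnjg minner_tendsto assms)
qed (fact assms)+

lemma minner_add_left:
  assumes "\<xi> \<in> modK p" "\<xi>' \<in> modK p" "\<eta> \<in> modK p"
  shows "minner (\<xi> + \<xi>') \<eta> = minner \<xi> \<eta> + minner \<xi>' \<eta>"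
  by (rule bcontfun_eqI, rule minner_eqI)
    (simp_all add: assms modK_add kinner_add_left tendsto_add minner_tendsto)

lemma minner_diff_left:
  assumes "\<xi> \<in> modK p" "\<xi>' \<in> modK p" "\<eta> \<in> modK p"
  shows "minner (\<xi> - \<xi>') \<eta> = minner \<xi> \<eta> - minner \<xi>' \<eta>"
  by (rule bcontfun_eqI, rule minner_eqI)
    (simp_all add: assms modK_diff kinner.diff_left tendsto_diff minner_tendsto)

lemma minner_mult_left:
  assumes "\<xi> \<in> modK p" "\<eta> \<in> modK p"
  shows "minner (\<lambda>\<iota>. \<xi> \<iota> * x) \<eta> = minner \<xi> \<eta> * x"
proof (rule bcontfun_eqI, rule minner_eqI)
  fix t
  have "((\<lambda>s. kinner (fib s \<xi>) (fib s \<eta>) * apply_bcontfun x s)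
      \<longlongrightarrow> apply_bcontfun (minner \<xi> \<eta>) t * apply_bcontfun x t) (uf t)"
    by (intro tendsto_mult minner_tendsto uf_tendsto_apply assms)
  then show "((\<lambda>s. kinner (fib s (\<lambda>\<iota>. \<xi> \<iota> * x)) (fib s \<eta>))
      \<longlongrightarrow> apply_bcontfun (minner \<xi> \<eta> * x) t) (uf t)"
    by (simp add: assms modK_mult kinner_kscale_left mult.commute [of "apply_bcontfun x _"])
qed (simp_all add: assms modK_mult)

lemma minner_add_right:
  assumes "\<xi> \<in> modK p" "\<eta> \<in> modK p" "\<eta>' \<in> modK p"
  shows "minner \<xi> (\<eta> + \<eta>') = minner \<xi> \<eta> + minner \<xi> \<eta>'"
  by (rule bcontfun_eqI, rule minner_eqI)
    (simp_all add: assms modK_add kinner_add_right tendsto_add minner_tendsto)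

lemma minner_diff_right:
  assumes "\<xi> \<in> modK p" "\<eta> \<in> modK p" "\<eta>' \<in> modK p"
  shows "minner \<xi> (\<eta> - \<eta>') = minner \<xi> \<eta> - minner \<xi> \<eta>'"
  by (rule bcontfun_eqI, rule minner_eqI)
    (simp_all add: assms modK_diff kinner.diff_right tendsto_diff minner_tendsto)

lemma minner_mult_right:
  assumes "\<xi> \<in> modK p" "\<eta> \<in> modK p"
  shows "minner \<xi> (\<lambda>\<iota>. \<eta> \<iota> * x) = minner \<xi> \<eta> * estar x"
proof -
  have "minner \<xi> (\<lambda>\<iota>. \<eta> \<iota> * x) = estar (minner \<eta> \<xi> * x)"
    using minner_commute [OF modK_mult(1) [OF assms(2)] assms(1)] by (simp add: minner_mult_left assms)
  also have "\<dots> = minner \<xi> \<eta> * estar x"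
    unfolding minner_commute [OF assms(2,1)] by (rule bcontfun_eqI) (simp add: cnjg_mult)
  finally show ?thesis .
qed

lemma mnorm_nonneg [simp]: "0 \<le> mnorm \<xi>"
  by (simp add: mnorm_def)

text \<open>A fibre may be shorter than \<open>minner\<close> suggests but not longer: finite
  partial sums are continuous in the point, and along the ultrafilter they stay below the full inner
  products.\<close>

lemma norm_fib_le:
  assumes "\<xi> \<in> modK p" shows "norm (fib t \<xi>) \<le> mnorm \<xi>"
proof -
  let ?m = "apply_bcontfun (minner \<xi> \<xi>) t"
  have "(\<Sum>\<iota>\<in>F. (norm (Rep_ell2 (fib t \<xi>) \<iota>))\<^sup>2) \<le> (mnorm \<xi>)\<^sup>2" if "finite F" for F
  proof -
    have 1: "((\<lambda>s. \<Sum>\<iota>\<in>F. (norm (Rep_ell2 (fib s \<xi>) \<iota>))\<^sup>2)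
        \<longlongrightarrow> (\<Sum>\<iota>\<in>F. (norm (Rep_ell2 (fib t \<xi>) \<iota>))\<^sup>2)) (uf t)"
      by (intro tendsto_intros tendsto_mono [OF uf_le_nhds fib_crd_tendsto] assms)
    have 2: "((\<lambda>s. rpart (kinner (fib s \<xi>) (fib s \<xi>))) \<longlongrightarrow> rpart ?m) (uf t)"
      by (intro tendsto_rpart minner_tendsto assms)
    have le: "(\<Sum>\<iota>\<in>F. (norm (Rep_ell2 (fib s \<xi>) \<iota>))\<^sup>2) \<le> rpart (kinner (fib s \<xi>) (fib s \<xi>))" for s
      unfolding kinner_self_norm rpart_of_real
      using that norm_ell2_le_iff [of "norm (fib s \<xi>)" "fib s \<xi>"] by auto
    have "(\<Sum>\<iota>\<in>F. (norm (Rep_ell2 (fib t \<xi>) \<iota>))\<^sup>2) \<le> rpart ?m"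
      by (rule tendsto_le [OF uf_neq_bot 2 1 always_eventually [OF allI [OF le]]])
    also have "\<dots> \<le> norm (minner \<xi> \<xi>)"
      using abs_rpart_le [of ?m] norm_bounded [of "minner \<xi> \<xi>" t] by linarith
    finally show ?thesis by (simp add: mnorm_def)
  qed
  then show ?thesis by (subst norm_ell2_le_iff) auto
qed

text \<open>Together with \<open>norm_fib_le\<close> this identifies \<open>mnorm \<xi>\<close> with
  the supremum of the fibre norms, so that norm estimates can be made fibre by fibre.\<close>

lemma mnorm_le:
  assumes "\<xi> \<in> modK p" "\<And>t. norm (fib t \<xi>) \<le> B" shows "mnorm \<xi> \<le> B"
proof -
  have B: "0 \<le> B" using assms(2) norm_ge_zero order_trans by blast
  have "norm (minner \<xi> \<xi>) \<le> B\<^sup>2"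
    unfolding minner_eq_blift [OF assms(1,1)]
    by (rule norm_blift_le) (simp add: kinner_self_norm norm_power assms(2) power_mono)
  then show ?thesis
    using B unfolding mnorm_def by (metis real_sqrt_le_iff real_sqrt_abs abs_of_nonneg)
qed

lemma mnorm_0 [simp]: "mnorm (0 :: 'i \<Rightarrow> 't \<Rightarrow>\<^sub>C 'k) = 0"
  by (rule order.antisym [OF mnorm_le mnorm_nonneg]) simp_all

lemma mnorm_triangle:
  assumes "\<xi> \<in> modK p" "\<eta> \<in> modK p" shows "mnorm (\<xi> + \<eta>) \<le> mnorm \<xi> + mnorm \<eta>"
  by (rule mnorm_le)
    (auto simp: assms modK_add intro!: order_trans [OF norm_triangle_ineq] add_mono norm_fib_le)

lemma mnorm_mult_le:
  assumes "\<xi> \<in> modK p" shows "mnorm (\<lambda>\<iota>. \<xi> \<iota> * x) \<le> mnorm \<xi> * norm x"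
proof (rule mnorm_le [OF modK_mult(1) [OF assms]])
  fix t
  have "norm (apply_bcontfun x t) * norm (fib t \<xi>) \<le> norm x * mnorm \<xi>"
    by (intro mult_mono norm_bounded norm_fib_le assms) auto
  then show "norm (fib t (\<lambda>\<iota>. \<xi> \<iota> * x)) \<le> mnorm \<xi> * norm x"
    by (simp add: modK_mult(2) [OF assms] norm_kscale mult.commute [of "norm x"])
qed

lemma mnorm_real_mult:
  assumes "\<xi> \<in> modK p" shows "mnorm (\<lambda>\<iota>. \<xi> \<iota> * const_bcontfun (of_real r)) = \<bar>r\<bar> * mnorm \<xi>"
proof (rule antisym)
  have n: "norm (const_bcontfun (of_real c) :: 't \<Rightarrow>\<^sub>C 'k) \<le> \<bar>c\<bar>" for c
    by (rule norm_bcontfun_le) simp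
  show "mnorm (\<lambda>\<iota>. \<xi> \<iota> * const_bcontfun (of_real r)) \<le> \<bar>r\<bar> * mnorm \<xi>"
    using mnorm_mult_le [OF assms, of "const_bcontfun (of_real r)"] mult_left_mono [OF n [of r] mnorm_nonneg [of \<xi>]]
    by (simp add: mult.commute)
  show "\<bar>r\<bar> * mnorm \<xi> \<le> mnorm (\<lambda>\<iota>. \<xi> \<iota> * const_bcontfun (of_real r))"
  proof (cases "r = 0")
    case False
    have "mnorm \<xi> \<le> mnorm (\<lambda>\<iota>. \<xi> \<iota> * const_bcontfun (of_real r)) / \<bar>r\<bar>"
    proof (rule mnorm_le [OF assms])
      fix t
      have "\<bar>r\<bar> * norm (fib t \<xi>) \<le> mnorm (\<lambda>\<iota>. \<xi> \<iota> * const_bcontfun (of_real r))"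
        using norm_fib_le [OF modK_mult(1) [OF assms], of t "const_bcontfun (of_real r)"]
        by (simp add: modK_mult assms norm_kscale)
      then show "norm (fib t \<xi>) \<le> mnorm (\<lambda>\<iota>. \<xi> \<iota> * const_bcontfun (of_real r)) / \<bar>r\<bar>"
        using False by (simp add: pos_le_divide_eq mult.commute [of "\<bar>r\<bar>"])
    qed
    then show ?thesis using False by (simp add: pos_le_divide_eq mult.commute [of "\<bar>r\<bar>"])
  qed simp
qed

lemma mnorm_eq_0: "\<xi> \<in> modK p \<Longrightarrow> mnorm \<xi> = 0 \<Longrightarrow> \<xi> = 0"
  by (rule modK_eqI) (use norm_fib_le in fastforce)+

lemma norm_minner_le:
  assumes "\<xi> \<in> modK p" "\<eta> \<in> modK p" shows "norm (minner \<xi> \<eta>) \<le> mnorm \<xi> * mnorm \<eta>"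
  unfolding minner_eq_blift [OF assms]
  by (rule norm_blift_le)
    (auto intro!: order_trans [OF norm_kinner_le] mult_mono norm_fib_le assms)

lemma norm_minner_self: "norm (minner \<xi> \<xi>) = (mnorm \<xi>)\<^sup>2"
  by (simp add: mnorm_def)

text \<open>Although \<open>minner\<close> is a weak* sum, it is the pointwise inner product wherever one of its
  arguments is norm continuous.\<close>

lemma minner_pointwise:
  assumes "\<xi> \<in> modK p" "\<eta> \<in> modK p" "((\<lambda>s. fib s \<xi>) \<longlongrightarrow> fib t \<xi>) (uf t)"
  shows "apply_bcontfun (minner \<xi> \<eta>) t = kinner (fib t \<xi>) (fib t \<eta>)"
proof (rule minner_eqI [OF assms(1,2)])
  obtain C where C: "0 \<le> C" "\<And>t. norm (fib t \<eta>) \<le> C" by (rule modK_fib_bounded [OF assms(2)]) blast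
  have "((\<lambda>s. norm (fib s \<xi> - fib t \<xi>) * C) \<longlongrightarrow> norm (fib t \<xi> - fib t \<xi>) * C) (uf t)"
    by (intro tendsto_mult tendsto_norm tendsto_diff tendsto_const assms)
  then have null: "((\<lambda>s. norm (fib s \<xi> - fib t \<xi>) * C) \<longlongrightarrow> 0) (uf t)" by simp
  have bd: "norm (kinner (fib s \<xi> - fib t \<xi>) (fib s \<eta>)) \<le> norm (fib s \<xi> - fib t \<xi>) * C" for s
    by (rule order_trans [OF norm_kinner_le mult_left_mono [OF C(2)]]) simp
  have "((\<lambda>s. kinner (fib s \<xi> - fib t \<xi>) (fib s \<eta>)) \<longlongrightarrow> 0) (uf t)"
    by (rule Lim_null_comparison [OF always_eventually [OF allI [OF bd]] null])
  moreover have "((\<lambda>s. kinner (fib t \<xi>) (fib s \<eta>)) \<longlongrightarrow> kinner (fib t \<xi>) (fib t \<eta>)) (uf t)"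
    unfolding kinner_commute [of "fib t \<xi>"]
    by (intro tendsto_cnjg tendsto_mono [OF uf_le_nhds fib_weak_tendsto] assms)
  ultimately have "((\<lambda>s. kinner (fib s \<xi> - fib t \<xi>) (fib s \<eta>) + kinner (fib t \<xi>) (fib s \<eta>))
      \<longlongrightarrow> 0 + kinner (fib t \<xi>) (fib t \<eta>)) (uf t)"
    by (rule tendsto_add)
  then show "((\<lambda>s. kinner (fib s \<xi>) (fib s \<eta>)) \<longlongrightarrow> kinner (fib t \<xi>) (fib t \<eta>)) (uf t)"
    by (simp add: kinner.diff_left)
qed

lemma minner_pointwise_right:
  assumes "\<xi> \<in> modK p" "\<eta> \<in> modK p" "((\<lambda>s. fib s \<eta>) \<longlongrightarrow> fib t \<eta>) (uf t)"
  shows "apply_bcontfun (minner \<xi> \<eta>) t = kinner (fib t \<xi>) (fib t \<eta>)"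
  using minner_pointwise [OF assms(2,1,3)] minner_commute [OF assms(2,1)]
  by (simp add: kinner_commute [of "fib t \<xi>"])

text \<open>Norm summability means uniform convergence of the partial sums of squares. If it holds,
  the fibre norms are continuous and weak continuity improves to norm continuity. Conversely the
  tails are continuous and decrease to \<open>0\<close> pointwise, hence uniformly by Dini's
  argument.\<close>

lemma modH_iff: "\<xi> \<in> modH p \<longleftrightarrow> \<xi> \<in> modK p \<and> continuous_on UNIV (\<lambda>t. fib t \<xi>)"
proof
  assume H: "\<xi> \<in> modH p"
  then obtain a where a: "((\<lambda>\<iota>. estar (\<xi> \<iota>) * \<xi> \<iota>) has_sum a) UNIV"
    and pr: "\<And>\<iota>. p \<iota> * \<xi> \<iota> = \<xi> \<iota>"
    unfolding modH_def mem_Collect_eq range_p_iff summable_on_def by blast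
  have ev: "bounded_linear (\<lambda>f :: 't \<Rightarrow>\<^sub>C 'k. apply_bcontfun f t)" for t
    by (rule bounded_linear_intro [where K = 1]) (auto simp: norm_bounded)
  have at: "((\<lambda>\<iota>. of_real ((norm (apply_bcontfun (\<xi> \<iota>) t))\<^sup>2) :: 'k) has_sum apply_bcontfun a t) UNIV" for t
    using has_sum_bounded_linear [OF ev a]
    by (simp add: o_def mult.commute mult_cnjg_self del: of_real_power)
  have at': "((\<lambda>\<iota>. (norm (apply_bcontfun (\<xi> \<iota>) t))\<^sup>2) has_sum rpart (apply_bcontfun a t)) UNIV" for t
    using has_sum_bounded_linear [OF bounded_linear_rpart at] by (simp add: o_def del: of_real_power)
  have "(\<Sum>\<iota>\<in>F. (norm (apply_bcontfun (\<xi> \<iota>) t))\<^sup>2) \<le> norm a" if "finite F" for F t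
  proof -
    have "(\<Sum>\<iota>\<in>F. (norm (apply_bcontfun (\<xi> \<iota>) t))\<^sup>2) \<le> rpart (apply_bcontfun a t)"
      by (rule has_sum_mono_neutral [OF has_sum_finite [OF that] at']) auto
    also have "\<dots> \<le> norm a"
      using abs_rpart_le [of "apply_bcontfun a t"] norm_bounded [of a t] by linarith
    finally show ?thesis .
  qed
  then have K: "\<xi> \<in> modK p" using pr unfolding modK_iff_sums by blast
  have n: "(norm (fib t \<xi>))\<^sup>2 = rpart (apply_bcontfun a t)" for t
    using has_sum_unique [OF norm_ell2_has_sum [of "fib t \<xi>"], of "rpart (apply_bcontfun a t)"] at'
    by (simp add: K eval_at_def)
  have "continuous_on UNIV (\<lambda>t. fib t \<xi>)"
    unfolding continuous_on_def
  proof
    fix t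
    show "((\<lambda>t. fib t \<xi>) \<longlongrightarrow> fib t \<xi>) (at t)"
    proof (rule weak_to_norm_tendsto)
      show "((\<lambda>s. inner (fib s \<xi>) (fib t \<xi>)) \<longlongrightarrow> inner (fib t \<xi>) (fib t \<xi>)) (at t)"
        unfolding inner_ell2_def
        by (intro tendsto_rpart tendsto_mono [OF _ fib_weak_tendsto [OF K]]) (simp add: at_within_def)
      show "((\<lambda>s. (norm (fib s \<xi>))\<^sup>2) \<longlongrightarrow> (norm (fib t \<xi>))\<^sup>2) (at t)"
        unfolding n using continuous_on_rpart [of a] by (simp add: continuous_on_def)
    qed
  qed
  with K show "\<xi> \<in> modK p \<and> continuous_on UNIV (\<lambda>t. fib t \<xi>)" ..
next
  assume "\<xi> \<in> modK p \<and> continuous_on UNIV (\<lambda>t. fib t \<xi>)"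
  then have K: "\<xi> \<in> modK p" and cont: "continuous_on UNIV (\<lambda>t. fib t \<xi>)" by auto
  define tail where "tail F t = (norm (fib t \<xi>))\<^sup>2 - (\<Sum>\<iota>\<in>F. (norm (apply_bcontfun (\<xi> \<iota>) t))\<^sup>2)" for F t
  have tail_cont: "continuous_on UNIV (tail F)" for F
    unfolding tail_def by (intro continuous_intros cont continuous_on_apply_bcontfun)
  have tail_nonneg: "0 \<le> tail F t" if "finite F" for F t
    using norm_ell2_le_iff [of "norm (fib t \<xi>)" "fib t \<xi>"] that by (simp add: tail_def K eval_at_def)
  have tail_mono: "tail G t \<le> tail F t" if "F \<subseteq> G" "finite G" for F G t
    unfolding tail_def using that by (simp add: sum_mono2)
  have small: "\<exists>F. finite F \<and> tail F t < e" if "e > 0" for t and e :: real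
  proof -
    have "\<forall>\<^sub>F F in finite_subsets_at_top UNIV.
        dist (\<Sum>\<iota>\<in>F. (norm (Rep_ell2 (fib t \<xi>) \<iota>))\<^sup>2) ((norm (fib t \<xi>))\<^sup>2) < e"
      using norm_ell2_has_sum [of "fib t \<xi>"] that unfolding has_sum_def by (intro tendstoD) auto
    then obtain F where "finite F" "dist (\<Sum>\<iota>\<in>F. (norm (Rep_ell2 (fib t \<xi>) \<iota>))\<^sup>2) ((norm (fib t \<xi>))\<^sup>2) < e"
      unfolding eventually_finite_subsets_at_top by blast
    then show ?thesis
      by (intro exI [of _ F]) (auto simp: tail_def K eval_at_def dist_real_def abs_if split: if_splits)
  qed
  define a :: "'t \<Rightarrow>\<^sub>C 'k" where "a = Bcontfun (\<lambda>t. of_real ((norm (fib t \<xi>))\<^sup>2))"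
  have a: "apply_bcontfun a = (\<lambda>t. of_real ((norm (fib t \<xi>))\<^sup>2))"
    unfolding a_def by (intro apply_Bcontfun continuous_on_of_real continuous_intros cont)
  have "((\<lambda>\<iota>. estar (\<xi> \<iota>) * \<xi> \<iota>) has_sum a) UNIV"
    unfolding has_sum_def
  proof (rule tendstoI)
    fix e :: real assume "e > 0"
    then have e2: "e / 2 > 0" by simp
    \<comment> \<open>Each point has a finite index set whose tail is small nearby; by compactness
      the union of finitely many of these index sets works everywhere.\<close>
    obtain G where G: "\<And>t. finite (G t)" "\<And>t. tail (G t) t < e / 2" using small [OF e2] by metis
    have "open {s. tail (G t) s < e / 2}" for t
      by (rule open_Collect_less [OF tail_cont continuous_on_const])
    then obtain D where D: "finite D" "UNIV \<subseteq> (\<Union>t\<in>D. {s. tail (G t) s < e / 2})"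
      by (rule compactE_image [OF compact_T, of UNIV "\<lambda>t. {s. tail (G t) s < e / 2}"]) (use G(2) in auto)
    define F where "F = (\<Union>t\<in>D. G t)"
    have "finite F" using D(1) G(1) by (simp add: F_def)
    moreover have "dist (\<Sum>\<iota>\<in>F'. estar (\<xi> \<iota>) * \<xi> \<iota>) a < e" if "finite F'" "F \<subseteq> F'" for F'
    proof -
      have "norm (apply_bcontfun ((\<Sum>\<iota>\<in>F'. estar (\<xi> \<iota>) * \<xi> \<iota>) - a) s) \<le> e / 2" for s
      proof -
        obtain t where t: "t \<in> D" "tail (G t) s < e / 2" using D(2) by blast
        have "tail F' s \<le> tail (G t) s" using t(1) that by (intro tail_mono) (auto simp: F_def)
        moreover have "norm (apply_bcontfun ((\<Sum>\<iota>\<in>F'. estar (\<xi> \<iota>) * \<xi> \<iota>) - a) s) = \<bar>- tail F' s\<bar>"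
          unfolding minus_bcontfun.rep_eq norm_sum_estar_mult a of_real_diff [symmetric] norm_of_real
          by (simp add: tail_def)
        ultimately show ?thesis using t(2) tail_nonneg [OF that(1), of s] by simp
      qed
      then have "norm ((\<Sum>\<iota>\<in>F'. estar (\<xi> \<iota>) * \<xi> \<iota>) - a) \<le> e / 2" by (rule norm_bcontfun_le)
      then show ?thesis using \<open>e > 0\<close> by (simp add: dist_norm)
    qed
    ultimately show "\<forall>\<^sub>F F in finite_subsets_at_top UNIV. dist (\<Sum>\<iota>\<in>F. estar (\<xi> \<iota>) * \<xi> \<iota>) a < e"
      unfolding eventually_finite_subsets_at_top by blast
  qed
  then show "\<xi> \<in> modH p"
    using modK_p [OF K] unfolding modH_def mem_Collect_eq range_p_iff summable_on_def by blast
qed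

end

section \<open>Adjointable operators\<close>

lemma sum_fun_apply: "(\<Sum>k\<in>A. f k) x = (\<Sum>k\<in>A. f k x)"
  by (induction A rule: infinite_finite_induct) auto

lemma mult_const_of_real:
  "f * const_bcontfun (of_real r) = r *\<^sub>R (f :: 't::topological_space \<Rightarrow>\<^sub>C 'k::real_or_complex)"
  by (rule bcontfun_eqI) (simp add: scaleR_conv_of_real mult.commute)

text \<open>The library has completeness of \<open>'t \<Rightarrow>\<^sub>C 'k\<close> only for metric spaces \<open>'t\<close>.\<close>

lemma bcontfun_Cauchy_convergent:
  fixes f :: "nat \<Rightarrow> 't::topological_space \<Rightarrow>\<^sub>C 'k::banach"
  assumes "Cauchy f" shows "\<exists>l. f \<longlonglongrightarrow> l"
proof -
  have "uniformly_Cauchy_on UNIV (\<lambda>n. apply_bcontfun (f n))"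
    unfolding uniformly_Cauchy_on_def
  proof (intro allI impI)
    fix e :: real assume "e > 0"
    then obtain N where N: "\<And>m n. m \<ge> N \<Longrightarrow> n \<ge> N \<Longrightarrow> dist (f m) (f n) < e"
      using assms unfolding Cauchy_def by blast
    have "dist (apply_bcontfun (f m) t) (apply_bcontfun (f n) t) < e" if "m \<ge> N" "n \<ge> N" for m n t
      using N [OF that] norm_bounded [of "f m - f n" t] by (simp add: dist_norm)
    then show "\<exists>M. \<forall>x\<in>UNIV. \<forall>m\<ge>M. \<forall>n\<ge>M. dist (apply_bcontfun (f m) x) (apply_bcontfun (f n) x) < e"
      by blast
  qed
  then obtain l where "uniform_limit UNIV (\<lambda>n. apply_bcontfun (f n)) l sequentially"
    using Cauchy_uniformly_convergent unfolding uniformly_convergent_on_def by blast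
  then show ?thesis using uniform_limit_bcontfunE [OF _ sequentially_bot] by metis
qed

context hilbert_family
begin

text \<open>Results on operators are needed both for \<open>H\<close>, where \<open>u\<close> lives,
  and for \<open>K\<close>, where its decomposition lives; this predicate allows a common
  proof.\<close>

definition hmodule :: "('i \<Rightarrow> 't \<Rightarrow>\<^sub>C 'k) set \<Rightarrow> bool" where
  "hmodule M \<longleftrightarrow> M = modH p \<or> M = modK p"

lemma hmodule_H [simp]: "hmodule (modH p)" and hmodule_K [simp]: "hmodule (modK p)"
  by (simp_all add: hmodule_def)

lemma modH_K: "\<xi> \<in> modH p \<Longrightarrow> \<xi> \<in> modK p"
  by (simp add: modH_iff)

lemma hmodule_K': "hmodule M \<Longrightarrow> \<xi> \<in> M \<Longrightarrow> \<xi> \<in> modK p"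
  unfolding hmodule_def using modH_K by blast

lemma hmodule_add: "hmodule M \<Longrightarrow> \<xi> \<in> M \<Longrightarrow> \<eta> \<in> M \<Longrightarrow> \<xi> + \<eta> \<in> M"
  by (auto simp: hmodule_def modH_iff modK_add continuous_on_add)

lemma hmodule_diff: "hmodule M \<Longrightarrow> \<xi> \<in> M \<Longrightarrow> \<eta> \<in> M \<Longrightarrow> \<xi> - \<eta> \<in> M"
  by (auto simp: hmodule_def modH_iff modK_diff continuous_on_diff)

lemma hmodule_mult: "hmodule M \<Longrightarrow> \<xi> \<in> M \<Longrightarrow> (\<lambda>\<iota>. \<xi> \<iota> * x) \<in> M"
  by (auto simp: hmodule_def modH_iff modK_mult intro!: kscale.continuous_on continuous_on_apply_bcontfun)

lemma hmodule_0: "hmodule M \<Longrightarrow> 0 \<in> M"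
  by (auto simp: hmodule_def modH_iff)

lemma hmodule_sum: "hmodule M \<Longrightarrow> (\<And>k. k \<in> A \<Longrightarrow> f k \<in> M) \<Longrightarrow> (\<Sum>k\<in>A. f k) \<in> M"
  by (induction A rule: infinite_finite_induct) (auto simp: hmodule_0 hmodule_add)

lemma hmodule_scaleR: "hmodule M \<Longrightarrow> \<xi> \<in> M \<Longrightarrow> (\<lambda>\<iota>. r *\<^sub>R \<xi> \<iota>) \<in> M"
  using hmodule_mult [of M \<xi> "const_bcontfun (of_real r)"] by (simp add: mult_const_of_real)

lemma mnorm_scaleR: "\<xi> \<in> modK p \<Longrightarrow> mnorm (\<lambda>\<iota>. r *\<^sub>R \<xi> \<iota>) = \<bar>r\<bar> * mnorm \<xi>"
  using mnorm_real_mult [of \<xi> r] by (simp add: mult_const_of_real)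

lemma minner_scaleR_left: "\<xi> \<in> modK p \<Longrightarrow> \<eta> \<in> modK p \<Longrightarrow> minner (\<lambda>\<iota>. r *\<^sub>R \<xi> \<iota>) \<eta> = r *\<^sub>R minner \<xi> \<eta>"
  using minner_mult_left [of \<xi> \<eta> "const_bcontfun (of_real r)"] by (simp add: mult_const_of_real)

lemma minner_scaleR_right: "\<xi> \<in> modK p \<Longrightarrow> \<eta> \<in> modK p \<Longrightarrow> minner \<xi> (\<lambda>\<iota>. r *\<^sub>R \<eta> \<iota>) = r *\<^sub>R minner \<xi> \<eta>"
  using minner_mult_right [of \<xi> \<eta> "const_bcontfun (of_real r)"]
  by (simp add: mult_const_of_real bcontfun_eqI [of "estar (const_bcontfun (of_real r))" "const_bcontfun (of_real r)"])

lemma minner_eqI_left: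
  assumes M: "hmodule M" and "\<xi> \<in> M" "\<eta> \<in> M" "\<And>\<zeta>. \<zeta> \<in> M \<Longrightarrow> minner \<xi> \<zeta> = minner \<eta> \<zeta>"
  shows "\<xi> = \<eta>"
proof -
  have d: "\<xi> - \<eta> \<in> M" using assms hmodule_diff by blast
  then have "minner (\<xi> - \<eta>) (\<xi> - \<eta>) = 0"
    using assms hmodule_K' [OF M] by (simp add: minner_diff_left)
  then have "mnorm (\<xi> - \<eta>) = 0" by (simp only: mnorm_def norm_zero real_sqrt_zero)
  from mnorm_eq_0 [OF hmodule_K' [OF M d] this] show ?thesis by simp
qed

text \<open>Completeness in the form used by the gliding hump; \<open>3/2 * (1/3) ^ n\<close> is the
  sum of the geometric tail that starts at \<open>n\<close>.\<close>

lemma hmodule_complete: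
  assumes M: "hmodule M" and X: "\<And>n. X n \<in> M" and step: "\<And>n. mnorm (X (Suc n) - X n) \<le> (1/3) ^ n"
  shows "\<exists>\<xi>\<in>M. \<forall>n. mnorm (\<xi> - X n) \<le> 3/2 * (1/3) ^ n"
proof -
  have K: "X n \<in> modK p" for n using X hmodule_K' [OF M] by blast
  have tail: "mnorm (X m - X n) \<le> 3/2 * ((1/3) ^ n - (1/3) ^ m)" if "n \<le> m" for m n
    using that
  proof (induction m rule: dec_induct)
    case (step m)
    have "X (Suc m) - X n = (X (Suc m) - X m) + (X m - X n)" by (simp add: fun_eq_iff)
    then have "mnorm (X (Suc m) - X n) \<le> mnorm (X (Suc m) - X m) + mnorm (X m - X n)"
      using mnorm_triangle K modK_diff(1) by metis
    also have "\<dots> \<le> (1/3) ^ m + 3/2 * ((1/3) ^ n - (1/3) ^ m)"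
      by (intro add_mono assms(3) step.IH)
    also have "\<dots> = 3/2 * ((1/3) ^ n - (1/3) ^ Suc m)" by (simp add: algebra_simps)
    finally show ?case .
  next
    case base
    have "X n - X n = 0" by (simp add: fun_eq_iff)
    then show ?case by (simp only: mnorm_0) simp
  qed
  have tail': "mnorm (X m - X n) \<le> 3/2 * (1/3) ^ n" if "n \<le> m" for m n
    using tail [OF that] by (rule order_trans) simp
  have crd: "norm (\<xi> \<iota>) \<le> mnorm \<xi>" if "\<xi> \<in> modK p" for \<xi> \<iota>
  proof (rule norm_bcontfun_le)
    fix t
    have "norm (apply_bcontfun (\<xi> \<iota>) t) = norm (Rep_ell2 (fib t \<xi>) \<iota>)"
      using that by (simp add: eval_at_def)
    also have "\<dots> \<le> mnorm \<xi>"
      by (rule order_trans [OF norm_Rep_ell2_le norm_fib_le [OF that]])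
    finally show "norm (apply_bcontfun (\<xi> \<iota>) t) \<le> mnorm \<xi>" .
  qed
  have lim0: "(\<lambda>n. 3/2 * (1/3 :: real) ^ n) \<longlonglongrightarrow> 0"
    using tendsto_mult_right_zero [OF LIMSEQ_power_zero [of "1/3 :: real"], of "3/2"] by simp
  have "Cauchy (\<lambda>n. X n \<iota>)" for \<iota>
  proof (rule metric_CauchyI)
    fix e :: real assume "e > 0"
    then have "\<forall>\<^sub>F N in sequentially. 3/2 * (1/3 :: real) ^ N < e / 2"
      by (intro order_tendstoD(2) [OF lim0]) simp
    then obtain N where N: "3/2 * (1/3 :: real) ^ N < e / 2"
      unfolding eventually_sequentially by blast
    have *: "norm (X m \<iota> - X N \<iota>) < e / 2" if "m \<ge> N" for m
      using crd [OF modK_diff(1) [OF K K], of m N \<iota>] tail' [OF that] N by simp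
    have "dist (X m \<iota>) (X n \<iota>) < e" if "m \<ge> N" "n \<ge> N" for m n
      by (rule dist_triangle_half_l [of _ "X N \<iota>"])
        (use * [OF that(1)] * [OF that(2)] in \<open>simp_all only: dist_norm\<close>)
    then show "\<exists>M. \<forall>m\<ge>M. \<forall>n\<ge>M. dist (X m \<iota>) (X n \<iota>) < e" by blast
  qed
  then have "\<exists>l. (\<lambda>n. X n \<iota>) \<longlonglongrightarrow> l" for \<iota>
    by (rule bcontfun_Cauchy_convergent)
  then obtain L where L: "\<And>\<iota>. (\<lambda>n. X n \<iota>) \<longlonglongrightarrow> L \<iota>"
    by metis
  have ev: "bounded_linear (\<lambda>f :: 't \<Rightarrow>\<^sub>C 'k. apply_bcontfun f t)" for t
    by (rule bounded_linear_intro [where K = 1]) (auto simp: norm_bounded)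
  have Lt: "(\<lambda>n. apply_bcontfun (X n \<iota>) t) \<longlonglongrightarrow> apply_bcontfun (L \<iota>) t" for \<iota> t
    by (rule bounded_linear.tendsto [OF ev L])
  \<comment> \<open>The limit is known only coordinatewise, so the tail estimate is carried over on
    finite sets of coordinates; this suffices for the norms of the fibres.\<close>
  have sums: "(\<Sum>\<iota>\<in>F. (norm (apply_bcontfun ((L - X n) \<iota>) t))\<^sup>2) \<le> (3/2 * (1/3) ^ n)\<^sup>2"
    if F: "finite F" for F n t
  proof (rule tendsto_upperbound)
    show "(\<lambda>m. \<Sum>\<iota>\<in>F. (norm (apply_bcontfun (X m \<iota>) t - apply_bcontfun (X n \<iota>) t))\<^sup>2)
        \<longlonglongrightarrow> (\<Sum>\<iota>\<in>F. (norm (apply_bcontfun ((L - X n) \<iota>) t))\<^sup>2)"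
      by (simp, intro tendsto_intros Lt)
    have "(\<Sum>\<iota>\<in>F. (norm (apply_bcontfun (X m \<iota>) t - apply_bcontfun (X n \<iota>) t))\<^sup>2) \<le> (3/2 * (1/3) ^ n)\<^sup>2"
      if "m \<ge> n" for m
    proof -
      have "norm (fib t (X m - X n)) \<le> 3/2 * (1/3) ^ n"
        using norm_fib_le [OF modK_diff(1) [OF K K]] tail' [OF that] by (rule order_trans)
      then have "(\<Sum>\<iota>\<in>F. (norm (Rep_ell2 (fib t (X m - X n)) \<iota>))\<^sup>2) \<le> (3/2 * (1/3) ^ n)\<^sup>2"
        using F by (subst (asm) norm_ell2_le_iff) auto
      then show ?thesis by (simp add: modK_diff(1) [OF K K] eval_at_def del: Rep_ell2_simps)
    qed
    then show "\<forall>\<^sub>F m in sequentially.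
        (\<Sum>\<iota>\<in>F. (norm (apply_bcontfun (X m \<iota>) t - apply_bcontfun (X n \<iota>) t))\<^sup>2) \<le> (3/2 * (1/3) ^ n)\<^sup>2"
      unfolding eventually_sequentially by blast
  qed simp
  have pL: "p \<iota> * L \<iota> = L \<iota>" for \<iota>
  proof (rule LIMSEQ_unique [OF _ L])
    have "(\<lambda>n. p \<iota> * X n \<iota>) \<longlonglongrightarrow> p \<iota> * L \<iota>" by (intro tendsto_intros L)
    then show "(\<lambda>n. X n \<iota>) \<longlonglongrightarrow> p \<iota> * L \<iota>" by (simp add: modK_p K)
  qed
  have LK: "L - X n \<in> modK p" for n
    unfolding modK_iff_sums using sums by (auto simp: right_diff_distrib pL modK_p K)
  have L_n: "mnorm (L - X n) \<le> 3/2 * (1/3) ^ n" for n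
  proof (rule mnorm_le [OF LK])
    show "norm (fib t (L - X n)) \<le> 3/2 * (1/3) ^ n" for t
      using sums [of _ n t] by (subst norm_ell2_le_iff) (simp_all add: LK eval_at_def)
  qed
  have "L = (L - X 0) + X 0" by (simp add: fun_eq_iff)
  then have L_K: "L \<in> modK p" using modK_add(1) [OF LK K] by metis
  have "L \<in> M"
  proof (cases "M = modK p")
    case False
    then have MH: "M = modH p" using M by (auto simp: hmodule_def)
    \<comment> \<open>\<open>mnorm\<close> dominates all fibre norms at once, so the fibres converge
      uniformly and norm continuity survives.\<close>
    have "continuous_on UNIV (\<lambda>t. fib t L)"
    proof (rule uniform_limit_theorem)
      show "\<forall>\<^sub>F n in sequentially. continuous_on UNIV (\<lambda>t. fib t (X n))"
        using X by (simp add: MH modH_iff)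
      show "uniform_limit UNIV (\<lambda>n t. fib t (X n)) (\<lambda>t. fib t L) sequentially"
      proof (rule uniform_limitI)
        fix e :: real assume "e > 0"
        then have "\<forall>\<^sub>F n in sequentially. 3/2 * (1/3 :: real) ^ n < e"
          using order_tendstoD(2) [OF lim0] by simp
        then show "\<forall>\<^sub>F n in sequentially. \<forall>t\<in>UNIV. dist (fib t (X n)) (fib t L) < e"
        proof eventually_elim
          case (elim n)
          show ?case
          proof
            fix t
            have "dist (fib t (X n)) (fib t L) = norm (fib t (L - X n))"
              by (simp add: dist_norm norm_minus_commute modK_diff(2) [OF L_K K])
            also have "\<dots> < e"
              using norm_fib_le [OF LK, of t n] L_n [of n] elim by linarith
            finally show "dist (fib t (X n)) (fib t L) < e" .
          qed
        qed
      qed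
    qed simp
    then show ?thesis by (simp add: MH modH_iff L_K)
  qed (simp add: L_K)
  with L_n show ?thesis by blast
qed

section \<open>Adjoints and automatic boundedness\<close>

lemma adjointableE:
  assumes M: "hmodule M" and u: "u \<in> adjointable M"
  obtains v where "v \<in> adjointable M" "is_adjoint M minner u v" "is_adjoint M minner v u"
proof -
  obtain v where v: "is_adjoint M minner u v" using u by (auto simp: adjointable_def)
  have "minner (v \<xi>) \<eta> = minner \<xi> (u \<eta>)" if "\<xi> \<in> M" "\<eta> \<in> M" for \<xi> \<eta>
  proof -
    have in_K: "v \<xi> \<in> modK p" "u \<eta> \<in> modK p" "\<xi> \<in> modK p" "\<eta> \<in> modK p"
      using that v u hmodule_K' [OF M] by (auto simp: is_adjoint_def adjointable_def)
    have "minner (u \<eta>) \<xi> = minner \<eta> (v \<xi>)" using v that by (simp add: is_adjoint_def)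
    then show ?thesis
      using minner_commute [OF in_K(4,1)] minner_commute [OF in_K(2,3)] by simp
  qed
  then have "is_adjoint M minner v u" using u v by (auto simp: is_adjoint_def adjointable_def)
  then show thesis using that [of v] v by (auto simp: adjointable_def is_adjoint_def)
qed

lemma is_adjointD: "is_adjoint M minner u v \<Longrightarrow> \<xi> \<in> M \<Longrightarrow> \<eta> \<in> M \<Longrightarrow> minner (u \<xi>) \<eta> = minner \<xi> (v \<eta>)"
  by (simp add: is_adjoint_def)

lemma is_adjoint_unique:
  assumes M: "hmodule M" and "is_adjoint M minner u v" "is_adjoint M minner u w"
    and u: "\<And>\<xi>. \<xi> \<in> M \<Longrightarrow> u \<xi> \<in> M"
  shows "v = w"
proof
  fix \<eta>
  show "v \<eta> = w \<eta>"
  proof (cases "\<eta> \<in> M")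
    case True
    have vw: "v \<eta> \<in> M" "w \<eta> \<in> M" using assms True by (auto simp: is_adjoint_def)
    show ?thesis
    proof (rule minner_eqI_left [OF M vw])
      fix \<zeta> assume \<zeta>: "\<zeta> \<in> M"
      have "minner \<zeta> (v \<eta>) = minner \<zeta> (w \<eta>)"
        using is_adjointD [OF assms(2) \<zeta> True] is_adjointD [OF assms(3) \<zeta> True] by simp
      then show "minner (v \<eta>) \<zeta> = minner (w \<eta>) \<zeta>"
        using vw \<zeta> hmodule_K' [OF M] by (metis minner_commute)
    qed
  qed (use assms in \<open>simp add: is_adjoint_def\<close>)
qed

lemma adj_eqI:
  assumes M: "hmodule M" and "is_adjoint M minner u v" "\<And>\<xi>. \<xi> \<in> M \<Longrightarrow> u \<xi> \<in> M"
  shows "adj M minner u = v"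
  unfolding adj_def
  by (rule the_equality) (use assms is_adjoint_unique [OF M] in blast)+

lemma adjointable_in: "u \<in> adjointable M \<Longrightarrow> \<xi> \<in> M \<Longrightarrow> u \<xi> \<in> M"
  and adjointable_out: "u \<in> adjointable M \<Longrightarrow> \<xi> \<notin> M \<Longrightarrow> u \<xi> = 0"
  by (simp_all add: adjointable_def)

lemma adjointable_add_arg:
  assumes M: "hmodule M" and u: "u \<in> adjointable M" and "\<xi> \<in> M" "\<eta> \<in> M"
  shows "u (\<xi> + \<eta>) = u \<xi> + u \<eta>"
proof -
  obtain v where v: "v \<in> adjointable M" "is_adjoint M minner u v" by (rule adjointableE [OF M u])
  note in_M = adjointable_in [OF u] hmodule_add [OF M] adjointable_in [OF v(1)]
  show ?thesis
    using assms(3,4) hmodule_K' [OF M] in_M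
    by (intro minner_eqI_left [OF M]) (simp_all add: minner_add_left is_adjointD [OF v(2)])
qed

lemma adjointable_diff_arg:
  assumes M: "hmodule M" and u: "u \<in> adjointable M" and "\<xi> \<in> M" "\<eta> \<in> M"
  shows "u (\<xi> - \<eta>) = u \<xi> - u \<eta>"
proof -
  obtain v where v: "v \<in> adjointable M" "is_adjoint M minner u v" by (rule adjointableE [OF M u])
  note in_M = adjointable_in [OF u] hmodule_diff [OF M] adjointable_in [OF v(1)]
  show ?thesis
    using assms(3,4) hmodule_K' [OF M] in_M
    by (intro minner_eqI_left [OF M]) (simp_all add: minner_diff_left is_adjointD [OF v(2)])
qed

lemma adjointable_mult_arg:
  assumes M: "hmodule M" and u: "u \<in> adjointable M" and "\<xi> \<in> M"
  shows "u (\<lambda>\<iota>. \<xi> \<iota> * x) = (\<lambda>\<iota>. u \<xi> \<iota> * x)"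
proof -
  obtain v where v: "v \<in> adjointable M" "is_adjoint M minner u v" by (rule adjointableE [OF M u])
  note in_M = adjointable_in [OF u] hmodule_mult [OF M] adjointable_in [OF v(1)]
  show ?thesis
    using assms(3) hmodule_K' [OF M] in_M
    by (intro minner_eqI_left [OF M]) (simp_all add: minner_mult_left is_adjointD [OF v(2)])
qed

lemma adjointable_scaleR_arg:
  assumes M: "hmodule M" and u: "u \<in> adjointable M" and "\<xi> \<in> M"
  shows "u (\<lambda>\<iota>. r *\<^sub>R \<xi> \<iota>) = (\<lambda>\<iota>. r *\<^sub>R u \<xi> \<iota>)"
  using adjointable_mult_arg [OF assms, of "const_bcontfun (of_real r)"] by (simp add: mult_const_of_real)

text \<open>The Hellinger--Toeplitz theorem, by a gliding hump: the functionals \<open>\<langle>u \<cdot> | \<eta>\<rangle>\<close> are each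
  bounded because \<open>u\<close> has an adjoint. If their norms were unbounded, signs could be chosen in
  \<open>\<Sum>n. \<plusminus> 3\<^sup>-\<^sup>n z n\<close>, where \<open>z n\<close> nearly attains the norm of the \<open>n\<close>-th functional, so that they
  are unbounded at its sum.\<close>

theorem adjointable_bounded:
  assumes M: "hmodule M" and u: "u \<in> adjointable M"
  shows "\<exists>B\<ge>0. \<forall>\<xi>\<in>M. mnorm (u \<xi>) \<le> B * mnorm \<xi>"
proof (rule ccontr)
  assume unb: "\<not> ?thesis"
  obtain v where v: "v \<in> adjointable M" "is_adjoint M minner u v" by (rule adjointableE [OF M u])
  note K = hmodule_K' [OF M]
  note in_M = adjointable_in [OF u] adjointable_in [OF v(1)] hmodule_add [OF M] hmodule_diff [OF M]
    hmodule_scaleR [OF M]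
  define T where "T \<eta> \<xi> = norm (minner (u \<xi>) \<eta>)" for \<eta> \<xi>
  have T_u: "T \<eta> \<xi> \<le> mnorm (u \<xi>) * mnorm \<eta>" if "\<xi> \<in> M" "\<eta> \<in> M" for \<xi> \<eta>
    unfolding T_def using that in_M by (intro norm_minner_le K) auto
  have T_v: "T \<eta> \<xi> \<le> mnorm \<xi> * mnorm (v \<eta>)" if "\<xi> \<in> M" "\<eta> \<in> M" for \<xi> \<eta>
    unfolding T_def is_adjointD [OF v(2) that] using that in_M by (intro norm_minner_le K) auto
  have T_scale: "T \<eta> (\<lambda>\<iota>. r *\<^sub>R \<xi> \<iota>) = \<bar>r\<bar> * T \<eta> \<xi>" if "\<xi> \<in> M" "\<eta> \<in> M" for r \<xi> \<eta>
    unfolding T_def adjointable_scaleR_arg [OF M u that(1)] using that in_M K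
    by (simp add: minner_scaleR_left)
  have T_add: "T \<eta> (\<xi> + \<zeta>) \<le> T \<eta> \<xi> + T \<eta> \<zeta>" if "\<xi> \<in> M" "\<zeta> \<in> M" "\<eta> \<in> M" for \<xi> \<zeta> \<eta>
    unfolding T_def adjointable_add_arg [OF M u that(1,2)] using that in_M K
    by (simp add: minner_add_left norm_triangle_ineq)
  have T_diff: "T \<eta> \<xi> - T \<eta> \<zeta> \<le> T \<eta> (\<xi> - \<zeta>)" if "\<xi> \<in> M" "\<zeta> \<in> M" "\<eta> \<in> M" for \<xi> \<zeta> \<eta>
    unfolding T_def adjointable_diff_arg [OF M u that(1,2)] using that in_M K
    by (simp add: minner_diff_left norm_triangle_ineq2)
  \<comment> \<open>The witnesses are \<open>u \<xi>\<close> and \<open>\<xi>\<close>, normalised,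
    where \<open>\<xi>\<close> violates the bound \<open>C\<close>. The norm of \<open>\<xi>\<close>
    is not \<open>0\<close>, since \<open>T_v\<close> would then make \<open>u \<xi>\<close>
    vanish.\<close>
  have big: "\<exists>\<eta>\<in>M. \<exists>z\<in>M. mnorm \<eta> \<le> 1 \<and> mnorm z \<le> 1 \<and> C < T \<eta> z" if "C \<ge> 0" for C
  proof -
    have "\<not> (\<forall>\<xi>\<in>M. mnorm (u \<xi>) \<le> C * mnorm \<xi>)" using unb that by blast
    then have "\<exists>\<xi>\<in>M. C * mnorm \<xi> < mnorm (u \<xi>)" by (simp add: not_le)
    then obtain \<xi> where \<xi>: "\<xi> \<in> M" "C * mnorm \<xi> < mnorm (u \<xi>)" by blast
    let ?a = "mnorm \<xi>" and ?b = "mnorm (u \<xi>)"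
    have b: "?b > 0" using \<xi>(2) that mnorm_nonneg [of \<xi>] by (meson le_less_trans mult_nonneg_nonneg)
    have a: "?a > 0"
    proof (rule ccontr)
      assume "\<not> ?a > 0"
      then have "?a = 0" using mnorm_nonneg [of \<xi>] by linarith
      then show False
        using T_v [OF \<xi>(1) in_M(1) [OF \<xi>(1)]] b by (simp add: T_def norm_minner_self)
    qed
    let ?\<eta> = "\<lambda>\<iota>. (1 / ?b) *\<^sub>R u \<xi> \<iota>" and ?z = "\<lambda>\<iota>. (1 / ?a) *\<^sub>R \<xi> \<iota>"
    have M': "?\<eta> \<in> M" "?z \<in> M"
      by (intro hmodule_scaleR [OF M] \<xi>(1) in_M(1))+
    have "mnorm ?\<eta> \<le> 1" "mnorm ?z \<le> 1" using a b \<xi>(1) in_M K by (simp_all add: mnorm_scaleR)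
    moreover have "T ?\<eta> ?z = ?b / ?a"
      unfolding T_scale [OF \<xi>(1) M'(1)] unfolding T_def using a b \<xi>(1) in_M K
      by (simp add: minner_scaleR_right norm_minner_self power2_eq_square)
    moreover have "C < ?b / ?a" using \<xi>(2) a by (simp add: pos_less_divide_eq)
    ultimately show ?thesis
      by (intro bexI [OF _ M'(1)] bexI [OF _ M'(2)]) simp
  qed
  \<comment> \<open>The vector \<open>z\<close> attains more than \<open>2/3\<close> of the norm of
    the functional, whence the factor \<open>3/2\<close> in the reverse bound. The lower bound
    \<open>4 ^ n\<close> is chosen to outgrow the weights \<open>3 ^ n\<close>.\<close>
  have "\<exists>\<eta> z. \<eta> \<in> M \<and> z \<in> M \<and> mnorm \<eta> \<le> 1 \<and> mnorm z \<le> 1 \<and> 2/3 * 4 ^ n < T \<eta> z \<and>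
      (\<forall>w\<in>M. T \<eta> w \<le> 3/2 * T \<eta> z * mnorm w)" for n :: nat
  proof -
    obtain \<eta> z0 where \<eta>: "\<eta> \<in> M" "z0 \<in> M" "mnorm \<eta> \<le> 1" "mnorm z0 \<le> 1" "4 ^ n < T \<eta> z0"
      using big [of "4 ^ n"] by auto
    let ?S = "{z \<in> M. mnorm z \<le> 1}"
    define N where "N = (SUP z\<in>?S. T \<eta> z)"
    have "T \<eta> z \<le> mnorm (v \<eta>)" if "z \<in> ?S" for z
      using T_v [of z \<eta>] mult_right_mono [of "mnorm z" 1 "mnorm (v \<eta>)"] that \<eta>(1) by auto
    then have bdd: "bdd_above (T \<eta> ` ?S)" by (auto simp: bdd_above_def)
    have "T \<eta> z0 \<le> N" unfolding N_def using \<eta> bdd by (intro cSUP_upper) auto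
    then have N: "4 ^ n < N" "0 < N" using \<eta>(5) zero_less_power [of "4 :: real" n] by linarith+
    have ne: "?S \<noteq> {}" using \<eta> by auto
    have "2/3 * N < N" using N(2) by simp
    then have "\<exists>z\<in>?S. 2/3 * N < T \<eta> z"
      using less_cSUP_iff [OF ne bdd, of "2/3 * N"] unfolding N_def [symmetric] by (rule iffD1 [rotated])
    then obtain z where z: "z \<in> ?S" "2/3 * N < T \<eta> z" by blast
    have "T \<eta> w \<le> 3/2 * T \<eta> z * mnorm w" if w: "w \<in> M" for w
    proof (cases "mnorm w = 0")
      case True
      then show ?thesis using T_v [OF w \<eta>(1)] by simp
    next
      case False
      let ?w = "\<lambda>\<iota>. (1 / mnorm w) *\<^sub>R w \<iota>"
      have "?w \<in> ?S" using w in_M K False by (simp add: mnorm_scaleR)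
      then have "T \<eta> ?w \<le> N" unfolding N_def using bdd by (intro cSUP_upper) auto
      then have "T \<eta> w / mnorm w \<le> N" unfolding T_scale [OF w \<eta>(1)] by simp
      also have "N \<le> 3/2 * T \<eta> z" using z(2) by simp
      finally show ?thesis using False mnorm_nonneg [of w] by (simp add: pos_divide_le_eq)
    qed
    moreover have "2/3 * 4 ^ n < T \<eta> z" using z(2) N(1) by linarith
    ultimately show ?thesis using \<eta> z(1) by auto
  qed
  then obtain E Z where E: "\<And>n. E n \<in> M" "\<And>n. mnorm (E n) \<le> 1" and Z: "\<And>n. Z n \<in> M" "\<And>n. mnorm (Z n) \<le> 1"
    and A: "\<And>n. 2/3 * 4 ^ n < T (E n) (Z n)"
    and near: "\<And>n w. w \<in> M \<Longrightarrow> T (E n) w \<le> 3/2 * T (E n) (Z n) * mnorm w"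
    by metis
  have "\<exists>X. \<forall>n. X n \<in> M \<and> mnorm (X (Suc n) - X n) \<le> (1/3) ^ n \<and>
      (1/3) ^ n * T (E n) (Z n) \<le> T (E n) (X (Suc n))"
  proof -
    have "\<exists>X. \<forall>n. X n \<in> M \<and> (mnorm (X (Suc n) - X n) \<le> (1/3) ^ n \<and>
      (1/3) ^ n * T (E n) (Z n) \<le> T (E n) (X (Suc n)))"
    proof (rule dependent_nat_choice)
      show "\<exists>x. x \<in> M" using hmodule_0 [OF M] by blast
      fix x n assume x: "x \<in> M"
      define w where "w = (\<lambda>\<iota>. (1/3) ^ n *\<^sub>R Z n \<iota>)"
      have w: "w \<in> M" unfolding w_def by (rule hmodule_scaleR [OF M Z(1)])
      have Tw: "T (E n) w = (1/3) ^ n * T (E n) (Z n)"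
        unfolding w_def T_scale [OF Z(1) E(1)] by simp
      have mw: "mnorm w \<le> (1/3) ^ n"
        unfolding w_def using Z K by (simp add: mnorm_scaleR mult_left_le)
      \<comment> \<open>As \<open>2 w = (x + w) - (x - w)\<close>, at least one of the two signs
        keeps the functional as large as it is at \<open>w\<close>.\<close>
      have "T (E n) (w + w) \<le> T (E n) (x + w) + T (E n) (x - w)"
      proof -
        have "w + w = (x + w) - (x - w)" by (simp add: fun_eq_iff)
        then have "T (E n) (w + w) = norm (minner (u (x + w)) (E n) - minner (u (x - w)) (E n))"
          unfolding T_def using adjointable_diff_arg [OF M u, of "x + w" "x - w"] x w E in_M K
          by (simp add: minner_diff_left)
        then show ?thesis unfolding T_def using norm_triangle_ineq4 by metis
      qed
      moreover have "T (E n) (w + w) = 2 * T (E n) w"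
      proof -
        have "w + w = (\<lambda>\<iota>. 2 *\<^sub>R w \<iota>)" by (simp add: fun_eq_iff scaleR_2)
        then show ?thesis using T_scale [OF w E(1), of n 2] by simp
      qed
      ultimately consider "T (E n) w \<le> T (E n) (x + w)" | "T (E n) w \<le> T (E n) (x - w)" by linarith
      then show "\<exists>y. y \<in> M \<and> mnorm (y - x) \<le> (1/3) ^ n \<and> (1/3) ^ n * T (E n) (Z n) \<le> T (E n) y"
      proof cases
        case 1
        have "x + w - x = w" by (simp add: fun_eq_iff)
        then show ?thesis using 1 mw x w in_M Tw by (intro exI [of _ "x + w"]) auto
      next
        case 2
        have "mnorm (x - w - x) = mnorm w"
        proof -
          have "x - w - x = (\<lambda>\<iota>. (- 1) *\<^sub>R w \<iota>)" by (simp add: fun_eq_iff)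
          then show ?thesis using mnorm_scaleR [OF K [OF w], of "- 1"] by simp
        qed
        then show ?thesis using 2 mw x w in_M Tw by (intro exI [of _ "x - w"]) auto
      qed
    qed
    then show ?thesis by blast
  qed
  then obtain X where X: "\<And>n. X n \<in> M" "\<And>n. mnorm (X (Suc n) - X n) \<le> (1/3) ^ n"
    and TX: "\<And>n. (1/3) ^ n * T (E n) (Z n) \<le> T (E n) (X (Suc n))" by blast
  obtain x where x: "x \<in> M" "\<And>n. mnorm (x - X n) \<le> 3/2 * (1/3) ^ n"
    using hmodule_complete [OF M X] by blast
  \<comment> \<open>The terms after the \<open>n\<close>-th have total norm at most
    \<open>1/2 * (1/3) ^ n\<close>, so they change the \<open>n\<close>-th functional by at most
    \<open>3/2 * 1/2 = 3/4\<close> of its guaranteed size. One quarter is left, and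
    \<open>1/4 * 2/3 = 1/6\<close>.\<close>
  have lower: "1/6 * (4/3) ^ n \<le> mnorm (u x)" for n :: nat
  proof -
    let ?A = "T (E n) (Z n)" and ?r = "(1/3 :: real) ^ n"
    have Apos: "0 \<le> ?A" by (simp add: T_def)
    have "T (E n) (x - X (Suc n)) \<le> 3/2 * ?A * mnorm (x - X (Suc n))"
      using x(1) X(1) in_M by (intro near) auto
    also have "\<dots> \<le> 3/2 * ?A * (1/2 * ?r)"
      using x(2) [of "Suc n"] Apos by (intro mult_left_mono) auto
    finally have 1: "T (E n) (x - X (Suc n)) \<le> 3/4 * (?r * ?A)" by (simp add: mult_ac)
    have "T (E n) (X (Suc n)) - T (E n) x \<le> T (E n) (X (Suc n) - x)"
      using x(1) X(1) E(1) by (intro T_diff) auto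
    also have "T (E n) (X (Suc n) - x) = T (E n) (x - X (Suc n))"
    proof -
      have "X (Suc n) - x = (\<lambda>\<iota>. (- 1) *\<^sub>R (x - X (Suc n)) \<iota>)" by (simp add: fun_eq_iff)
      then show ?thesis using T_scale [of "x - X (Suc n)" "E n" "- 1"] x(1) X(1) E(1) in_M by simp
    qed
    finally have "1/4 * (?r * ?A) \<le> T (E n) x" using 1 TX [of n] by linarith
    also have "T (E n) x \<le> mnorm (u x) * mnorm (E n)" using x(1) E(1) by (intro T_u)
    also have "\<dots> \<le> mnorm (u x)" using E(2) [of n] by (simp add: mult_left_le)
    finally have "1/4 * (?r * ?A) \<le> mnorm (u x)" .
    moreover have "?r * (2/3 * 4 ^ n) \<le> ?r * ?A" using A [of n] by (intro mult_left_mono) auto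
    moreover have "?r * (2/3 * 4 ^ n) = 2/3 * (4/3) ^ n" by (simp add: power_divide)
    ultimately show ?thesis by linarith
  qed
  obtain n where "6 * mnorm (u x) < (4/3 :: real) ^ n"
    using real_arch_pow [of "4/3 :: real"] by auto
  then show False using lower [of n] by linarith
qed

text \<open>By \<open>adjointable_bounded\<close> the supremum in \<open>opnorm\<close> is one of a
  bounded set. A vector with \<open>mnorm \<xi> = 0\<close> cannot be normalised and is treated by
  the bound \<open>B\<close>.\<close>

lemma opnorm_bound:
  assumes M: "hmodule M" and u: "u \<in> adjointable M" and \<xi>: "\<xi> \<in> M"
  shows "mnorm (u \<xi>) \<le> opnorm M u * mnorm \<xi>"
proof -
  note K = hmodule_K' [OF M]
  obtain B where B: "0 \<le> B" "\<And>\<xi>. \<xi> \<in> M \<Longrightarrow> mnorm (u \<xi>) \<le> B * mnorm \<xi>"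
    using adjointable_bounded [OF M u] by blast
  show ?thesis
  proof (cases "mnorm \<xi> = 0")
    case True
    then show ?thesis using B(2) [OF \<xi>] by simp
  next
    case False
    let ?z = "\<lambda>\<iota>. (1 / mnorm \<xi>) *\<^sub>R \<xi> \<iota>"
    have z: "?z \<in> M" "mnorm ?z \<le> 1"
      using \<xi> hmodule_scaleR [OF M] K False by (simp_all add: mnorm_scaleR)
    have "bdd_above ((\<lambda>\<xi>. mnorm (u \<xi>)) ` {\<xi> \<in> M. mnorm \<xi> \<le> 1})"
      using B by (auto simp: bdd_above_def intro!: exI [of _ B] intro: order_trans mult_left_le)
    then have "mnorm (u ?z) \<le> opnorm M u"
      unfolding opnorm_def using z by (intro cSUP_upper) auto
    moreover have "mnorm (u ?z) = mnorm (u \<xi>) / mnorm \<xi>"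
      unfolding adjointable_scaleR_arg [OF M u \<xi>] using adjointable_in [OF u \<xi>] K by (simp add: mnorm_scaleR)
    ultimately show ?thesis using False mnorm_nonneg [of \<xi>] by (simp add: pos_divide_le_eq)
  qed
qed

lemma opnorm_le:
  assumes M: "hmodule M" and "0 \<le> B" "\<And>\<xi>. \<xi> \<in> M \<Longrightarrow> mnorm (u \<xi>) \<le> B * mnorm \<xi>"
  shows "opnorm M u \<le> B"
  unfolding opnorm_def
proof (rule cSUP_least)
  show "{\<xi> \<in> M. mnorm \<xi> \<le> 1} \<noteq> {}" using hmodule_0 [OF M] mnorm_0 by (auto intro!: exI [of _ 0])
  show "mnorm (u \<xi>) \<le> B" if "\<xi> \<in> {\<xi> \<in> M. mnorm \<xi> \<le> 1}" for \<xi>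
    using that assms(3) [of \<xi>] mult_left_le [of "mnorm \<xi>" B] assms(2) by force
qed

lemma opnorm_nonneg:
  assumes M: "hmodule M" and u: "u \<in> adjointable M"
  shows "0 \<le> opnorm M u"
proof -
  obtain B where B: "0 \<le> B" "\<And>\<xi>. \<xi> \<in> M \<Longrightarrow> mnorm (u \<xi>) \<le> B * mnorm \<xi>"
    using adjointable_bounded [OF M u] by blast
  have "bdd_above ((\<lambda>\<xi>. mnorm (u \<xi>)) ` {\<xi> \<in> M. mnorm \<xi> \<le> 1})"
    using B by (auto simp: bdd_above_def intro!: exI [of _ B] intro: order_trans mult_left_le)
  moreover have "0 \<in> {\<xi> \<in> M. mnorm \<xi> \<le> 1}"
    by (simp only: mem_Collect_eq hmodule_0 [OF M] mnorm_0 zero_le_one simp_thms)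
  ultimately have "mnorm (u 0) \<le> opnorm M u"
    unfolding opnorm_def by (intro cSUP_upper)
  then show ?thesis using mnorm_nonneg order_trans by blast
qed

lemma adjointableI:
  assumes "\<And>\<xi>. \<xi> \<in> M \<Longrightarrow> u \<xi> \<in> M" "\<And>\<xi>. \<xi> \<notin> M \<Longrightarrow> u \<xi> = 0"
    "\<And>\<xi>. \<xi> \<in> M \<Longrightarrow> v \<xi> \<in> M" "\<And>\<xi>. \<xi> \<notin> M \<Longrightarrow> v \<xi> = 0"
    "\<And>\<xi> \<eta>. \<xi> \<in> M \<Longrightarrow> \<eta> \<in> M \<Longrightarrow> minner (u \<xi>) \<eta> = minner \<xi> (v \<eta>)"
  shows "u \<in> adjointable M" "is_adjoint M minner u v"
  using assms by (auto simp: adjointable_def is_adjoint_def)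

lemma adjointable_add:
  assumes M: "hmodule M" and u: "u \<in> adjointable M" "w \<in> adjointable M"
  shows "u + w \<in> adjointable M"
proof -
  obtain u' where u': "u' \<in> adjointable M" "is_adjoint M minner u u'" by (rule adjointableE [OF M u(1)])
  obtain w' where w': "w' \<in> adjointable M" "is_adjoint M minner w w'" by (rule adjointableE [OF M u(2)])
  note in_M = u [THEN adjointable_in] u'(1) [THEN adjointable_in] w'(1) [THEN adjointable_in]
  note out_M = u [THEN adjointable_out] u'(1) [THEN adjointable_out] w'(1) [THEN adjointable_out]
  show ?thesis
    by (rule adjointableI(1) [of _ _ "u' + w'"])
      (simp_all add: in_M out_M hmodule_add [OF M] hmodule_K' [OF M] minner_add_left minner_add_right
        is_adjointD [OF u'(2)] is_adjointD [OF w'(2)])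
qed

lemma is_adjoint_op_mult:
  assumes M: "hmodule M" and u: "u \<in> adjointable M" and v: "v \<in> adjointable M" "is_adjoint M minner u v"
  shows "op_mult u x \<in> adjointable M" "is_adjoint M minner (op_mult u x) (op_mult v (estar x))"
proof -
  have *: "minner (op_mult u x \<xi>) \<eta> = minner \<xi> (op_mult v (estar x) \<eta>)" if "\<xi> \<in> M" "\<eta> \<in> M" for \<xi> \<eta>
    using that adjointable_in [OF u] adjointable_in [OF v(1)] hmodule_K' [OF M]
    by (simp add: op_mult_def minner_mult_left minner_mult_right is_adjointD [OF v(2)]
        bcontfun_eqI [of "estar (estar x)" x])
  show "op_mult u x \<in> adjointable M" "is_adjoint M minner (op_mult u x) (op_mult v (estar x))"
    by (rule adjointableI [of M "op_mult u x" "op_mult v (estar x)"];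
      use * adjointable_in [OF u] adjointable_in [OF v(1)] adjointable_out [OF u] adjointable_out [OF v(1)]
        in \<open>auto simp: op_mult_def hmodule_mult [OF M] zero_fun_def\<close>)+
qed

lemma adjointable_op_mult:
  assumes M: "hmodule M" and u: "u \<in> adjointable M"
  shows "op_mult u x \<in> adjointable M"
proof -
  obtain v where v: "v \<in> adjointable M" "is_adjoint M minner u v" by (rule adjointableE [OF M u])
  show ?thesis by (rule is_adjoint_op_mult(1) [OF M u v])
qed

lemma adjointable_diff:
  assumes M: "hmodule M" and u: "u \<in> adjointable M" "w \<in> adjointable M"
  shows "u - w \<in> adjointable M"
proof -
  have eq: "u - w = u + op_mult w (const_bcontfun (- 1))"
    by (intro ext bcontfun_eqI) (simp add: op_mult_def)
  show ?thesis unfolding eq by (rule adjointable_add [OF M u(1) adjointable_op_mult [OF M u(2)]])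
qed

lemma rank1_is_adjoint:
  assumes M: "hmodule M" and "\<xi> \<in> M" "\<eta> \<in> M"
  shows "rank1 M \<xi> \<eta> \<in> adjointable M" "is_adjoint M minner (rank1 M \<xi> \<eta>) (rank1 M \<eta> \<xi>)"
proof -
  have *: "minner (rank1 M \<xi> \<eta> \<zeta>) \<zeta>' = minner \<zeta> (rank1 M \<eta> \<xi> \<zeta>')" if "\<zeta> \<in> M" "\<zeta>' \<in> M" for \<zeta> \<zeta>'
  proof -
    note K = hmodule_K' [OF M that(1)] hmodule_K' [OF M that(2)] hmodule_K' [OF M assms(2)] hmodule_K' [OF M assms(3)]
    have "minner (rank1 M \<xi> \<eta> \<zeta>) \<zeta>' = minner \<xi> \<zeta>' * minner \<zeta> \<eta>"
      using that K by (simp add: rank1_def minner_mult_left)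
    also have "\<dots> = minner \<zeta> (rank1 M \<eta> \<xi> \<zeta>')"
      using that K by (simp add: rank1_def minner_mult_right mult.commute flip: minner_commute)
    finally show ?thesis .
  qed
  show "rank1 M \<xi> \<eta> \<in> adjointable M" "is_adjoint M minner (rank1 M \<xi> \<eta>) (rank1 M \<eta> \<xi>)"
    by (rule adjointableI [of M "rank1 M \<xi> \<eta>" "rank1 M \<eta> \<xi>"];
      use * assms in \<open>auto simp: rank1_def hmodule_mult [OF M]\<close>)+
qed

lemma minner_0_left [simp]: "\<eta> \<in> modK p \<Longrightarrow> minner 0 \<eta> = 0"
  and minner_0_right [simp]: "\<eta> \<in> modK p \<Longrightarrow> minner \<eta> 0 = 0"
  by (rule bcontfun_eqI, rule minner_eqI; simp add: kinner.zero_left kinner.zero_right)+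

lemma adjointable_0: "hmodule M \<Longrightarrow> 0 \<in> adjointable M"
  by (rule adjointableI(1) [of _ _ 0]) (auto simp: hmodule_0 hmodule_K')

lemma adjointable_sum:
  "hmodule M \<Longrightarrow> (\<And>k. k \<in> A \<Longrightarrow> f k \<in> adjointable M) \<Longrightarrow> (\<Sum>k\<in>A. f k) \<in> adjointable M"
  by (induction A rule: infinite_finite_induct) (auto simp: adjointable_0 adjointable_add)

lemma adjoint_bound:
  assumes M: "hmodule M" and u: "u \<in> adjointable M" and v: "v \<in> adjointable M" "is_adjoint M minner u v"
    and B: "\<And>\<xi>. \<xi> \<in> M \<Longrightarrow> mnorm (u \<xi>) \<le> B * mnorm \<xi>" and "0 \<le> B" "\<xi> \<in> M"
  shows "mnorm (v \<xi>) \<le> B * mnorm \<xi>"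
proof (cases "mnorm (v \<xi>) = 0")
  case True
  then show ?thesis using assms by simp
next
  case False
  have v\<xi>: "v \<xi> \<in> M" "u (v \<xi>) \<in> M" using adjointable_in u v(1) assms by blast+
  have "(mnorm (v \<xi>))\<^sup>2 = norm (minner (u (v \<xi>)) \<xi>)"
    using is_adjointD [OF v(2) v\<xi>(1) \<open>\<xi> \<in> M\<close>] by (simp add: norm_minner_self)
  also have "\<dots> \<le> mnorm (u (v \<xi>)) * mnorm \<xi>"
    using v\<xi> assms hmodule_K' [OF M] by (intro norm_minner_le) auto
  also have "\<dots> \<le> B * mnorm (v \<xi>) * mnorm \<xi>"
    by (intro mult_right_mono B v\<xi>) simp
  finally have "mnorm (v \<xi>) * mnorm (v \<xi>) \<le> (B * mnorm \<xi>) * mnorm (v \<xi>)"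
    by (simp add: power2_eq_square mult_ac)
  then show ?thesis using False mnorm_nonneg [of "v \<xi>"] by simp
qed

subsection \<open>Compact operators\<close>

text \<open>Coefficients are absorbed into the left vector, so sums of \<open>rank1\<close> without
  coefficients exhaust the span.\<close>

lemma rank1_mult_left:
  "rank1 M (\<lambda>\<iota>. \<xi> \<iota> * x) \<eta> = op_mult (rank1 M \<xi> \<eta>) x"
  by (rule ext)+ (simp add: rank1_def op_mult_def mult.assoc mult.commute [of x])

lemma rank1_spanI:
  fixes M :: "('i \<Rightarrow> 't \<Rightarrow>\<^sub>C 'k) set" and n :: nat
  assumes "\<And>k. k < n \<Longrightarrow> X k \<in> M \<and> Y k \<in> M"
  shows "(\<Sum>k<n. rank1 M (X k) (Y k)) \<in> rank1_span M"
proof -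
  have "op_mult w (const_bcontfun 1) = w" for w :: "('i, 't, 'k) mop"
    by (intro ext bcontfun_eqI) (simp add: op_mult_def)
  moreover define c :: "nat \<Rightarrow> 'k" where "c = (\<lambda>_. 1)"
  ultimately have "(\<Sum>k<n. rank1 M (X k) (Y k))
      = (\<Sum>k<n. op_mult (rank1 M (X k) (Y k)) (const_bcontfun (c k)))"
    by simp
  then show ?thesis unfolding rank1_span_def using assms by blast
qed

lemma rank1_spanE:
  assumes M: "hmodule M" and "w \<in> rank1_span M"
  obtains n X Y where "\<And>k :: nat. k < n \<Longrightarrow> X k \<in> M \<and> Y k \<in> M" "w = (\<Sum>k<n. rank1 M (X k) (Y k))"
proof -
  obtain n X Y c where w: "\<And>k :: nat. k < n \<Longrightarrow> X k \<in> M \<and> Y k \<in> M"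
    "w = (\<Sum>k<n. op_mult (rank1 M (X k) (Y k)) (const_bcontfun (c k)))"
    using assms(2) unfolding rank1_span_def by blast
  show thesis
    by (rule that [of n "\<lambda>k \<iota>. X k \<iota> * const_bcontfun (c k)" Y])
      (use w hmodule_mult [OF M] in \<open>auto simp: rank1_mult_left\<close>)
qed

lemma adjointable_rank1_sum:
  assumes M: "hmodule M" and "\<And>k. k < n \<Longrightarrow> X k \<in> M \<and> Y k \<in> M"
  shows "(\<Sum>k<n :: nat. rank1 M (X k) (Y k)) \<in> adjointable M"
  using assms by (intro adjointable_sum M rank1_is_adjoint(1)) auto

text \<open>Replaces \<open>opnorm\<close> by an inequality on vectors;
  \<open>\<epsilon> / 2\<close> makes up for the strict inequality in the definition.\<close>

lemma compact_opsI:
  assumes M: "hmodule M" and u: "u \<in> adjointable M"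
    and approx: "\<And>\<epsilon>. \<epsilon> > 0 \<Longrightarrow> \<exists>n X Y. (\<forall>k<n :: nat. X k \<in> M \<and> Y k \<in> M) \<and>
      (\<forall>\<xi>\<in>M. mnorm (u \<xi> - (\<Sum>k<n. rank1 M (X k) (Y k)) \<xi>) \<le> \<epsilon> * mnorm \<xi>)"
  shows "u \<in> compact_ops M"
  unfolding compact_ops_def
proof (intro CollectI conjI allI impI u)
  fix \<epsilon> :: real assume "\<epsilon> > 0"
  obtain n X Y where X: "\<forall>k<n :: nat. X k \<in> M \<and> Y k \<in> M"
    "\<forall>\<xi>\<in>M. mnorm (u \<xi> - (\<Sum>k<n. rank1 M (X k) (Y k)) \<xi>) \<le> \<epsilon> / 2 * mnorm \<xi>"
    using approx [of "\<epsilon> / 2"] \<open>\<epsilon> > 0\<close> by auto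
  have "opnorm M (u - (\<Sum>k<n. rank1 M (X k) (Y k))) \<le> \<epsilon> / 2"
    using X(2) \<open>\<epsilon> > 0\<close> by (intro opnorm_le M) auto
  then show "\<exists>v\<in>rank1_span M. opnorm M (u - v) < \<epsilon>"
    using X(1) \<open>\<epsilon> > 0\<close> by (intro bexI [OF _ rank1_spanI [of n X M Y]]) auto
qed

lemma compact_opsD:
  assumes M: "hmodule M" and u: "u \<in> compact_ops M" and "\<epsilon> > 0"
  obtains n X Y where "\<And>k. k < n \<Longrightarrow> X k \<in> M \<and> Y k \<in> M"
    "\<And>\<xi>. \<xi> \<in> M \<Longrightarrow> mnorm (u \<xi> - (\<Sum>k<n :: nat. rank1 M (X k) (Y k)) \<xi>) \<le> \<epsilon> * mnorm \<xi>"
proof -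
  have u': "u \<in> adjointable M" using u by (simp add: compact_ops_def)
  obtain w where w: "w \<in> rank1_span M" "opnorm M (u - w) < \<epsilon>"
    using u \<open>\<epsilon> > 0\<close> unfolding compact_ops_def by blast
  obtain n X Y where X: "\<And>k :: nat. k < n \<Longrightarrow> X k \<in> M \<and> Y k \<in> M" "w = (\<Sum>k<n. rank1 M (X k) (Y k))"
    by (rule rank1_spanE [OF M w(1)]) blast
  have "w \<in> adjointable M" unfolding X(2) by (rule adjointable_rank1_sum [OF M X(1)])
  then have "u - w \<in> adjointable M" by (rule adjointable_diff [OF M u'])
  have "mnorm (u \<xi> - w \<xi>) \<le> \<epsilon> * mnorm \<xi>" if "\<xi> \<in> M" for \<xi>
  proof -
    have "mnorm ((u - w) \<xi>) \<le> opnorm M (u - w) * mnorm \<xi>" by (rule opnorm_bound [OF M]) fact+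
    also have "\<dots> \<le> \<epsilon> * mnorm \<xi>" using w(2) by (intro mult_right_mono) auto
    finally show ?thesis by simp
  qed
  then show thesis using that [of n X Y] X by blast
qed

lemma compact_ops_adjointable: "u \<in> compact_ops M \<Longrightarrow> u \<in> adjointable M"
  by (simp add: compact_ops_def)

lemma compact_ops_add:
  assumes M: "hmodule M" and u: "u \<in> compact_ops M" "w \<in> compact_ops M"
  shows "u + w \<in> compact_ops M"
proof (rule compact_opsI [OF M adjointable_add [OF M u [THEN compact_ops_adjointable]]])
  fix \<epsilon> :: real assume "\<epsilon> > 0"
  then have e2: "\<epsilon> / 2 > 0" by simp
  obtain m X Y where X: "\<And>k. k < m \<Longrightarrow> X k \<in> M \<and> Y k \<in> M"
    "\<And>\<xi>. \<xi> \<in> M \<Longrightarrow> mnorm (u \<xi> - (\<Sum>k<m :: nat. rank1 M (X k) (Y k)) \<xi>) \<le> \<epsilon> / 2 * mnorm \<xi>"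
    by (rule compact_opsD [OF M u(1) e2]) blast
  obtain n X' Y' where X': "\<And>k. k < n \<Longrightarrow> X' k \<in> M \<and> Y' k \<in> M"
    "\<And>\<xi>. \<xi> \<in> M \<Longrightarrow> mnorm (w \<xi> - (\<Sum>k<n :: nat. rank1 M (X' k) (Y' k)) \<xi>) \<le> \<epsilon> / 2 * mnorm \<xi>"
    by (rule compact_opsD [OF M u(2) e2]) blast
  let ?X = "\<lambda>k. if k < m then X k else X' (k - m)" and ?Y = "\<lambda>k. if k < m then Y k else Y' (k - m)"
  let ?a = "\<Sum>k<m. rank1 M (X k) (Y k)" and ?b = "\<Sum>k<n. rank1 M (X' k) (Y' k)"
  have sum: "(\<Sum>k<m + n. rank1 M (?X k) (?Y k)) = ?a + ?b"
    unfolding sum_lessThan_add by simp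
  have "mnorm ((u + w) \<xi> - (\<Sum>k<m + n. rank1 M (?X k) (?Y k)) \<xi>) \<le> \<epsilon> * mnorm \<xi>" if \<xi>: "\<xi> \<in> M" for \<xi>
  proof -
    have ab: "?a \<in> adjointable M" "?b \<in> adjointable M"
      using X(1) X'(1) by (intro adjointable_rank1_sum M; blast)+
    have in_M: "u \<xi> - ?a \<xi> \<in> modK p" "w \<xi> - ?b \<xi> \<in> modK p"
      by (intro hmodule_K' [OF M] hmodule_diff [OF M] adjointable_in [OF _ \<xi>]
          u [THEN compact_ops_adjointable] ab)+
    have "(u + w) \<xi> - (?a + ?b) \<xi> = (u \<xi> - ?a \<xi>) + (w \<xi> - ?b \<xi>)" by simp
    then have "mnorm ((u + w) \<xi> - (?a + ?b) \<xi>) \<le> mnorm (u \<xi> - ?a \<xi>) + mnorm (w \<xi> - ?b \<xi>)"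
      using mnorm_triangle [OF in_M] by (simp only:)
    also have "\<dots> \<le> \<epsilon> * mnorm \<xi>" using X(2) [OF \<xi>] X'(2) [OF \<xi>] by simp
    finally show ?thesis unfolding sum .
  qed
  moreover have "\<forall>k<m + n. ?X k \<in> M \<and> ?Y k \<in> M" using X(1) X'(1) by auto
  ultimately show "\<exists>n X Y. (\<forall>k<n :: nat. X k \<in> M \<and> Y k \<in> M) \<and>
      (\<forall>\<xi>\<in>M. mnorm ((u + w) \<xi> - (\<Sum>k<n. rank1 M (X k) (Y k)) \<xi>) \<le> \<epsilon> * mnorm \<xi>)"
    by (intro exI [of _ "m + n"] exI [of _ ?X] exI [of _ ?Y] conjI ballI)
qed

lemma compact_ops_op_mult:
  assumes M: "hmodule M" and u: "u \<in> compact_ops M"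
  shows "op_mult u x \<in> compact_ops M"
proof (rule compact_opsI [OF M adjointable_op_mult [OF M compact_ops_adjointable [OF u]]])
  fix \<epsilon> :: real assume "\<epsilon> > 0"
  then have e: "\<epsilon> / (norm x + 1) > 0" by (simp add: add_nonneg_pos)
  obtain n X Y where X: "\<And>k. k < n \<Longrightarrow> X k \<in> M \<and> Y k \<in> M"
    "\<And>\<xi>. \<xi> \<in> M \<Longrightarrow> mnorm (u \<xi> - (\<Sum>k<n :: nat. rank1 M (X k) (Y k)) \<xi>) \<le> \<epsilon> / (norm x + 1) * mnorm \<xi>"
    by (rule compact_opsD [OF M u e]) blast
  let ?w = "\<Sum>k<n. rank1 M (X k) (Y k)" and ?X = "\<lambda>k \<iota>. X k \<iota> * x"
  have "mnorm (op_mult u x \<xi> - (\<Sum>k<n. rank1 M (?X k) (Y k)) \<xi>) \<le> \<epsilon> * mnorm \<xi>" if \<xi>: "\<xi> \<in> M" for \<xi>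
  proof -
    have "(\<Sum>k<n. rank1 M (?X k) (Y k)) \<xi> = (\<lambda>\<iota>. ?w \<xi> \<iota> * x)"
      by (rule ext) (simp add: rank1_mult_left sum_fun_apply op_mult_def sum_distrib_right)
    then have "op_mult u x \<xi> - (\<Sum>k<n. rank1 M (?X k) (Y k)) \<xi> = (\<lambda>\<iota>. (u \<xi> - ?w \<xi>) \<iota> * x)"
      by (simp add: op_mult_def fun_eq_iff left_diff_distrib)
    moreover have "?w \<in> adjointable M"
      using X(1) by (intro adjointable_rank1_sum M)
    then have "u \<xi> - ?w \<xi> \<in> modK p"
      by (intro hmodule_K' [OF M] hmodule_diff [OF M] adjointable_in [OF _ \<xi>] compact_ops_adjointable [OF u])
    ultimately have "mnorm (op_mult u x \<xi> - (\<Sum>k<n. rank1 M (?X k) (Y k)) \<xi>) \<le> mnorm (u \<xi> - ?w \<xi>) * norm x"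
      using mnorm_mult_le [of "u \<xi> - ?w \<xi>" x] by (simp only:)
    also have "\<dots> \<le> \<epsilon> / (norm x + 1) * mnorm \<xi> * norm x"
      by (intro mult_right_mono X(2) \<xi>) simp
    also have "\<dots> = (\<epsilon> * norm x / (norm x + 1)) * mnorm \<xi>" by simp
    also have "\<dots> \<le> \<epsilon> * mnorm \<xi>"
    proof (intro mult_right_mono)
      show "\<epsilon> * norm x / (norm x + 1) \<le> \<epsilon>"
        using \<open>\<epsilon> > 0\<close> norm_ge_zero [of x] by (simp add: divide_le_eq add_nonneg_pos distrib_left)
    qed simp
    finally show ?thesis .
  qed
  moreover have "\<forall>k<n. ?X k \<in> M \<and> Y k \<in> M" using X(1) hmodule_mult [OF M] by auto
  ultimately show "\<exists>n X Y. (\<forall>k<n :: nat. X k \<in> M \<and> Y k \<in> M) \<and>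
      (\<forall>\<xi>\<in>M. mnorm (op_mult u x \<xi> - (\<Sum>k<n. rank1 M (X k) (Y k)) \<xi>) \<le> \<epsilon> * mnorm \<xi>)"
    by (intro exI [of _ n] exI [of _ ?X] exI [of _ Y] conjI ballI)
qed

lemma is_adjoint_diff:
  assumes M: "hmodule M" and "u \<in> adjointable M" "v \<in> adjointable M" "is_adjoint M minner u v"
    and "u' \<in> adjointable M" "v' \<in> adjointable M" "is_adjoint M minner u' v'"
  shows "is_adjoint M minner (u - u') (v - v')"
  by (rule adjointableI(2))
    (use assms in \<open>auto simp: adjointable_in adjointable_out hmodule_diff hmodule_K' [OF M]
        minner_diff_left minner_diff_right is_adjointD\<close>)

lemma is_adjoint_add:
  assumes M: "hmodule M" and "u \<in> adjointable M" "v \<in> adjointable M" "is_adjoint M minner u v"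
    and "u' \<in> adjointable M" "v' \<in> adjointable M" "is_adjoint M minner u' v'"
  shows "is_adjoint M minner (u + u') (v + v')"
  by (rule adjointableI(2))
    (use assms in \<open>auto simp: adjointable_in adjointable_out hmodule_add hmodule_K' [OF M]
        minner_add_left minner_add_right is_adjointD\<close>)

lemma is_adjoint_sum:
  assumes M: "hmodule M" and "\<And>k. k \<in> A \<Longrightarrow> f k \<in> adjointable M \<and> g k \<in> adjointable M \<and> is_adjoint M minner (f k) (g k)"
  shows "is_adjoint M minner (\<Sum>k\<in>A. f k) (\<Sum>k\<in>A. g k)"
  using assms(2)
proof (induction A rule: infinite_finite_induct)
  case (insert x F)
  have "(\<Sum>k\<in>F. f k) \<in> adjointable M" "(\<Sum>k\<in>F. g k) \<in> adjointable M"
    using insert.prems by (intro adjointable_sum M; blast)+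
  then show ?case
    unfolding sum.insert [OF insert.hyps] using insert.IH insert.prems
    by (intro is_adjoint_add M) auto
qed (auto simp: is_adjoint_def hmodule_0 [OF M] hmodule_K' [OF M])

text \<open>Exchanging \<open>X\<close> and \<open>Y\<close> gives the adjoint of the approximating
  sum, and the adjoint of the error obeys the same bound.\<close>

lemma compact_ops_adjoint:
  assumes M: "hmodule M" and u: "u \<in> compact_ops M" and v: "v \<in> adjointable M" "is_adjoint M minner u v"
  shows "v \<in> compact_ops M"
proof (rule compact_opsI [OF M v(1)])
  fix \<epsilon> :: real assume "\<epsilon> > 0"
  note u' = compact_ops_adjointable [OF u]
  obtain n X Y where X: "\<And>k. k < n \<Longrightarrow> X k \<in> M \<and> Y k \<in> M"
    "\<And>\<xi>. \<xi> \<in> M \<Longrightarrow> mnorm (u \<xi> - (\<Sum>k<n :: nat. rank1 M (X k) (Y k)) \<xi>) \<le> \<epsilon> * mnorm \<xi>"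
    by (rule compact_opsD [OF M u \<open>\<epsilon> > 0\<close>]) blast
  let ?a = "\<Sum>k<n. rank1 M (X k) (Y k)" and ?b = "\<Sum>k<n. rank1 M (Y k) (X k)"
  have ab: "?a \<in> adjointable M" "?b \<in> adjointable M"
    using X(1) by (intro adjointable_rank1_sum M; blast)+
  have "is_adjoint M minner ?a ?b"
    using X(1) rank1_is_adjoint [OF M] by (intro is_adjoint_sum M) auto
  then have *: "is_adjoint M minner (u - ?a) (v - ?b)"
    by (intro is_adjoint_diff M u' v ab)
  have "mnorm ((u - ?a) \<xi>) \<le> \<epsilon> * mnorm \<xi>" if "\<xi> \<in> M" for \<xi>
    using X(2) [OF that] by simp
  then have "mnorm ((v - ?b) \<xi>) \<le> \<epsilon> * mnorm \<xi>" if "\<xi> \<in> M" for \<xi>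
    by (rule adjoint_bound [OF M adjointable_diff [OF M u' ab(1)] adjointable_diff [OF M v(1) ab(2)] *
          _ less_imp_le [OF \<open>\<epsilon> > 0\<close>] that])
  then show "\<exists>n X Y. (\<forall>k<n :: nat. X k \<in> M \<and> Y k \<in> M) \<and>
      (\<forall>\<xi>\<in>M. mnorm (v \<xi> - (\<Sum>k<n. rank1 M (X k) (Y k)) \<xi>) \<le> \<epsilon> * mnorm \<xi>)"
    using X(1) by (intro exI [of _ n] exI [of _ Y] exI [of _ X]) auto
qed

end

section \<open>Fibres of operators\<close>

text \<open>Fubini for the double family \<open>f\<close>: its sums over \<open>\<iota>\<close> are
  the weighted inner products \<open>kinner (\<xi> n) (\<eta> n)\<close>, and its sums over
  \<open>n\<close> are the diagonal entries of \<open>x\<close>. As the diagonal is determined by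
  \<open>x\<close> alone, all expansions of this kind give the same value.\<close>

lemma diagonal_sum_of_decomposition:
  fixes \<xi> \<eta> :: "nat \<Rightarrow> ('i, 'k::real_or_complex) ell2"
  assumes c: "\<And>n. 0 \<le> c n" "c summable_on UNIV"
    and unit: "\<And>n. norm (\<xi> n) \<le> 1" "\<And>n. norm (\<eta> n) \<le> 1"
    and x: "\<And>z. (\<lambda>N. \<Sum>n<N. kscale (of_real (c n) * kinner z (\<eta> n)) (\<xi> n)) \<longlonglongrightarrow> x z"
  shows "((\<lambda>\<iota>. Rep_ell2 (x (unit_vec \<iota>)) \<iota>) has_sum (\<Sum>\<^sub>\<infinity>n. of_real (c n) * kinner (\<xi> n) (\<eta> n))) UNIV"
proof -
  define f where "f n \<iota> = of_real (c n) * (Rep_ell2 (\<xi> n) \<iota> * cnjg (Rep_ell2 (\<eta> n) \<iota>))" for n \<iota>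
  have inner: "(\<Sum>\<iota>\<in>B. norm (Rep_ell2 (\<xi> n) \<iota>) * norm (Rep_ell2 (\<eta> n) \<iota>)) \<le> 1" if "finite B" for n B
  proof -
    have "2 * (\<Sum>\<iota>\<in>B. norm (Rep_ell2 (\<xi> n) \<iota>) * norm (Rep_ell2 (\<eta> n) \<iota>))
        \<le> (\<Sum>\<iota>\<in>B. (norm (Rep_ell2 (\<xi> n) \<iota>))\<^sup>2 + (norm (Rep_ell2 (\<eta> n) \<iota>))\<^sup>2)"
      unfolding sum_distrib_left by (intro sum_mono) (metis mult.assoc sum_squares_bound)
    also have "\<dots> \<le> 1 + 1"
      unfolding sum.distrib
      using norm_ell2_le_iff [of 1 "\<xi> n"] norm_ell2_le_iff [of 1 "\<eta> n"] unit that
      by (intro add_mono) auto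
    finally show ?thesis by simp
  qed
  have abs: "(\<lambda>(n, \<iota>). norm (f n \<iota>)) summable_on UNIV \<times> UNIV"
  proof (rule nonneg_bdd_above_summable_on)
    show "bdd_above (sum (\<lambda>(n, \<iota>). norm (f n \<iota>)) ` {F. F \<subseteq> UNIV \<times> UNIV \<and> finite F})"
      unfolding bdd_above_def
    proof (intro exI [of _ "\<Sum>\<^sub>\<infinity>n. c n"] ballI)
      fix s assume "s \<in> sum (\<lambda>(n, \<iota>). norm (f n \<iota>)) ` {F. F \<subseteq> UNIV \<times> UNIV \<and> finite F}"
      then obtain F where F: "finite F" "s = (\<Sum>(n, \<iota>)\<in>F. norm (f n \<iota>))" by auto
      \<comment> \<open>A finite set of pairs is enlarged to a rectangle, where the sum over
        \<open>\<iota>\<close> is at most \<open>c n\<close>.\<close>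
      have "s \<le> (\<Sum>(n, \<iota>)\<in>fst ` F \<times> snd ` F. norm (f n \<iota>))"
        unfolding F(2) using F(1) by (intro sum_mono2) (auto simp: subset_fst_snd intro: rev_image_eqI)
      also have "\<dots> = (\<Sum>n\<in>fst ` F. \<Sum>\<iota>\<in>snd ` F. norm (f n \<iota>))"
        by (simp add: sum.cartesian_product)
      also have "\<dots> = (\<Sum>n\<in>fst ` F. c n * (\<Sum>\<iota>\<in>snd ` F. norm (Rep_ell2 (\<xi> n) \<iota>) * norm (Rep_ell2 (\<eta> n) \<iota>)))"
        by (simp add: f_def norm_mult c(1) sum_distrib_left)
      also have "\<dots> \<le> (\<Sum>n\<in>fst ` F. c n)"
        using F(1) by (intro sum_mono mult_left_le inner c) auto
      also have "\<dots> \<le> (\<Sum>\<^sub>\<infinity>n. c n)"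
        using F(1) c by (intro finite_sum_le_infsum) auto
      finally show "s \<le> (\<Sum>\<^sub>\<infinity>n. c n)" .
    qed
  qed auto
  then have "(\<lambda>q. norm (case q of (n, \<iota>) \<Rightarrow> f n \<iota>)) summable_on UNIV \<times> UNIV"
    by (simp add: case_prod_unfold)
  then have sf: "(\<lambda>(n, \<iota>). f n \<iota>) summable_on UNIV \<times> UNIV"
    by (rule abs_summable_summable)
  have row: "(\<lambda>\<iota>. f n \<iota>) summable_on UNIV" "(\<Sum>\<^sub>\<infinity>\<iota>. f n \<iota>) = of_real (c n) * kinner (\<xi> n) (\<eta> n)" for n
    using has_sum_cmult_right [OF kinner_has_sum [of "\<xi> n" "\<eta> n"], of "of_real (c n)"]
    by (auto simp: f_def summable_on_def intro: infsumI)
  have swap: "(\<lambda>(\<iota>, n). f n \<iota>) summable_on UNIV \<times> UNIV"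
    using sf by (subst summable_on_swap) simp
  have col: "(\<lambda>n. f n \<iota>) summable_on UNIV" for \<iota>
  proof (rule abs_summable_summable, rule summable_on_comparison_test [OF c(2)])
    fix n
    have "norm (Rep_ell2 (\<xi> n) \<iota>) * norm (Rep_ell2 (\<eta> n) \<iota>) \<le> 1"
      using inner [of "{\<iota>}" n] by simp
    then show "norm (f n \<iota>) \<le> c n"
      using c(1) [of n] by (simp add: f_def norm_mult mult_left_le)
  qed simp
  have diag: "(\<Sum>\<^sub>\<infinity>n. f n \<iota>) = Rep_ell2 (x (unit_vec \<iota>)) \<iota>" for \<iota>
  proof (rule LIMSEQ_unique)
    have "(\<lambda>n. f n \<iota>) sums (\<Sum>\<^sub>\<infinity>n. f n \<iota>)"
      by (rule has_sum_imp_sums [OF has_sum_infsum [OF col]])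
    then show "(\<lambda>N. \<Sum>n<N. f n \<iota>) \<longlonglongrightarrow> (\<Sum>\<^sub>\<infinity>n. f n \<iota>)" by (simp add: sums_def)
    have "kinner (unit_vec \<iota>) y = cnjg (Rep_ell2 y \<iota>)" for y :: "('i, 'k) ell2"
      by (metis kinner_commute kinner_unit_vec)
    then have "Rep_ell2 (\<Sum>n<N. kscale (of_real (c n) * kinner (unit_vec \<iota>) (\<eta> n)) (\<xi> n)) \<iota> = (\<Sum>n<N. f n \<iota>)" for N
      by (simp add: Rep_ell2_sum f_def mult_ac)
    then show "(\<lambda>N. \<Sum>n<N. f n \<iota>) \<longlonglongrightarrow> Rep_ell2 (x (unit_vec \<iota>)) \<iota>"
      using Rep_ell2_tendsto [OF x [of "unit_vec \<iota>"], of \<iota>] by simp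
  qed
  have "(\<lambda>\<iota>. \<Sum>\<^sub>\<infinity>n. f n \<iota>) summable_on UNIV"
    by (rule summable_on_Sigma_banach [of "\<lambda>\<iota> n. f n \<iota>" UNIV "\<lambda>_. UNIV"]) (use swap in simp)
  then have "((\<lambda>\<iota>. \<Sum>\<^sub>\<infinity>n. f n \<iota>) has_sum (\<Sum>\<^sub>\<infinity>\<iota>. \<Sum>\<^sub>\<infinity>n. f n \<iota>)) UNIV"
    by (rule has_sum_infsum)
  also have "(\<Sum>\<^sub>\<infinity>\<iota>. \<Sum>\<^sub>\<infinity>n. f n \<iota>) = (\<Sum>\<^sub>\<infinity>n. \<Sum>\<^sub>\<infinity>\<iota>. f n \<iota>)"
    by (rule infsum_swap_banach [OF sf, symmetric])
  finally show ?thesis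
    unfolding diag row(2) .
qed

context hyperstonian_space
begin

text \<open>Norm summability is uniform smallness of tails, and at every point the tail of
  \<open>f\<close> is at most that of \<open>g\<close>, hence at most the norm of the tail of
  \<open>g\<close>.\<close>

lemma bcontfun_summable_comparison:
  fixes f :: "'j \<Rightarrow> 't \<Rightarrow>\<^sub>C 'k::real_or_complex" and g :: "'j \<Rightarrow> 't \<Rightarrow>\<^sub>C 'k"
  assumes g: "g summable_on UNIV" and r: "\<And>j t. apply_bcontfun (g j) t = of_real (r j t)"
    and le: "\<And>j t. norm (apply_bcontfun (f j) t) \<le> r j t"
  shows "f summable_on UNIV"
proof -
  have ev: "bounded_linear (\<lambda>f :: 't \<Rightarrow>\<^sub>C 'k. apply_bcontfun f t)" for t
    by (rule bounded_linear_intro [where K = 1]) (auto simp: norm_bounded)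
  obtain G where G: "(g has_sum G) UNIV" using g by (auto simp: summable_on_def)
  have Gt: "((\<lambda>j. of_real (r j t) :: 'k) has_sum apply_bcontfun G t) UNIV" for t
    using has_sum_bounded_linear [OF ev G] by (simp add: o_def r)
  have rt: "((\<lambda>j. r j t) has_sum rpart (apply_bcontfun G t)) UNIV" for t
    using has_sum_bounded_linear [OF bounded_linear_rpart Gt] by (simp add: o_def)
  have nt: "(\<lambda>j. norm (apply_bcontfun (f j) t)) summable_on UNIV" for t
    by (rule summable_on_comparison_test [of "\<lambda>j. r j t"]) (use rt le in \<open>auto simp: summable_on_def\<close>)
  have ft: "((\<lambda>j. apply_bcontfun (f j) t) has_sum (\<Sum>\<^sub>\<infinity>j. apply_bcontfun (f j) t)) UNIV" for t
    by (rule has_sum_infsum [OF abs_summable_summable [OF nt]])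
  define F where "F t = (\<Sum>\<^sub>\<infinity>j. apply_bcontfun (f j) t)" for t
  have tail: "norm (F t - (\<Sum>j\<in>A. apply_bcontfun (f j) t)) \<le> norm (G - (\<Sum>j\<in>A. g j))" if A: "finite A" for A t
  proof -
    have "((\<lambda>j. apply_bcontfun (f j) t) has_sum (F t - (\<Sum>j\<in>A. apply_bcontfun (f j) t))) (UNIV - A)"
      unfolding F_def by (intro has_sum_Diff ft has_sum_finite A) auto
    moreover have s: "((\<lambda>j. r j t) has_sum (rpart (apply_bcontfun G t) - (\<Sum>j\<in>A. r j t))) (UNIV - A)"
      by (intro has_sum_Diff rt has_sum_finite A) auto
    ultimately have "norm (F t - (\<Sum>j\<in>A. apply_bcontfun (f j) t)) \<le> rpart (apply_bcontfun G t) - (\<Sum>j\<in>A. r j t)"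
      by (rule norm_infsum_le) (rule le)
    also have "\<dots> = rpart (apply_bcontfun (G - (\<Sum>j\<in>A. g j)) t)"
      by (simp add: apply_bcontfun_sum r rpart_diff flip: of_real_sum)
    also have "\<dots> \<le> norm (G - (\<Sum>j\<in>A. g j))"
      using abs_rpart_le norm_bounded order_trans abs_ge_self by metis
    finally show ?thesis .
  qed
  have "((\<lambda>A. norm (G - (\<Sum>j\<in>A. g j))) \<longlongrightarrow> norm (G - G)) (finite_subsets_at_top UNIV)"
    using G unfolding has_sum_def by (intro tendsto_intros)
  then have null: "((\<lambda>A. norm (G - (\<Sum>j\<in>A. g j))) \<longlongrightarrow> 0) (finite_subsets_at_top UNIV)" by simp
  have "uniform_limit UNIV (\<lambda>A t. apply_bcontfun (\<Sum>j\<in>A. f j) t) F (finite_subsets_at_top UNIV)"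
  proof (rule uniform_limitI)
    fix e :: real assume "e > 0"
    then have "\<forall>\<^sub>F A in finite_subsets_at_top UNIV. norm (G - (\<Sum>j\<in>A. g j)) < e"
      using order_tendstoD(2) [OF null] by blast
    moreover have "\<forall>\<^sub>F A in finite_subsets_at_top UNIV. finite (A :: 'j set)"
      unfolding eventually_finite_subsets_at_top by auto
    ultimately show "\<forall>\<^sub>F A in finite_subsets_at_top UNIV. \<forall>t\<in>UNIV. dist (apply_bcontfun (\<Sum>j\<in>A. f j) t) (F t) < e"
    proof eventually_elim
      case (elim A)
      then show ?case
        using tail [of A] by (auto simp: apply_bcontfun_sum dist_norm norm_minus_commute intro: le_less_trans)
    qed
  qed
  then obtain L where "(sum f \<longlongrightarrow> L) (finite_subsets_at_top UNIV)"
    by (rule uniform_limit_bcontfunE) auto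
  then show ?thesis unfolding summable_on_def has_sum_def by blast
qed

end

context hilbert_family
begin

section \<open>Constant sections and fibre operators\<close>

lemma modH_fib_tendsto: "\<xi> \<in> modH p \<Longrightarrow> ((\<lambda>s. fib s \<xi>) \<longlongrightarrow> fib t \<xi>) (nhds t)"
  using tendsto_at_iff_tendsto_nhds [of "\<lambda>s. fib s \<xi>" t] by (simp add: modH_iff continuous_on_def)

lemma minner_H_left:
  "\<xi> \<in> modH p \<Longrightarrow> \<eta> \<in> modK p \<Longrightarrow> apply_bcontfun (minner \<xi> \<eta>) t = kinner (fib t \<xi>) (fib t \<eta>)"
  by (rule minner_pointwise [OF modH_K _ tendsto_mono [OF uf_le_nhds modH_fib_tendsto]])

definition psiv :: "('i, 'k) ell2 \<Rightarrow> 'i \<Rightarrow> 't \<Rightarrow>\<^sub>C 'k" where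
  "psiv z = psi p (Rep_ell2 z)"

lemma psiv:
  shows psiv_K: "psiv z \<in> modK p"
    and Rep_fib_psiv: "Rep_ell2 (fib t (psiv z)) \<iota> = apply_bcontfun (p \<iota>) t * Rep_ell2 z \<iota>"
    and norm_fib_psiv: "norm (fib t (psiv z)) \<le> norm z"
proof -
  define f where "f s = Abs_ell2 (\<lambda>\<iota>. apply_bcontfun (p \<iota>) s * Rep_ell2 z \<iota>)" for s
  have n1: "norm (apply_bcontfun (p \<iota>) s) \<le> 1" for \<iota> s using p_cases [of \<iota> s] by auto
  have f: "Rep_ell2 (f s) \<iota> = apply_bcontfun (p \<iota>) s * Rep_ell2 z \<iota>" for s \<iota>
    unfolding f_def by (subst Abs_ell2_inverse' [OF l2_mult_bounded [OF Rep_ell2_l2 n1]]) simp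
  have nf: "norm (f s) \<le> norm z" for s
    unfolding norm_ell2_le_iff [OF norm_ge_zero]
  proof (intro allI impI)
    fix F :: "'i set" assume "finite F"
    have "(\<Sum>\<iota>\<in>F. (norm (Rep_ell2 (f s) \<iota>))\<^sup>2) \<le> (\<Sum>\<iota>\<in>F. (norm (Rep_ell2 z \<iota>))\<^sup>2)"
      by (intro sum_mono power_mono) (auto simp: f norm_mult intro: mult_left_le_one_le n1)
    also have "\<dots> \<le> (norm z)\<^sup>2" using norm_ell2_le_iff [of "norm z" z] \<open>finite F\<close> by simp
    finally show "(\<Sum>\<iota>\<in>F. (norm (Rep_ell2 (f s) \<iota>))\<^sup>2) \<le> (norm z)\<^sup>2" .
  qed
  have pp: "p \<iota> * psiv z \<iota> = psiv z \<iota>" for \<iota>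
  proof (rule bcontfun_eqI)
    show "apply_bcontfun (p \<iota> * psiv z \<iota>) t = apply_bcontfun (psiv z \<iota>) t" for t
      using p_cases [of \<iota> t] by (auto simp: psiv_def psi_def)
  qed
  have "apply_bcontfun (psiv z \<iota>) s = Rep_ell2 (f s) \<iota>" for s \<iota> by (simp add: psiv_def psi_def f mult.commute)
  from modK_I [OF pp this nf] show "psiv z \<in> modK p"
    "Rep_ell2 (fib t (psiv z)) \<iota> = apply_bcontfun (p \<iota>) t * Rep_ell2 z \<iota>"
    "norm (fib t (psiv z)) \<le> norm z"
    using f nf by metis+
qed

text \<open>The fibre of \<open>psiv z\<close> is the projection of \<open>z\<close> to the
  coordinates where \<open>p \<iota>\<close> is \<open>1\<close> at \<open>t\<close>, and the fibres
  of module elements already lie there.\<close>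

lemma kinner_fib_psiv_self:
  assumes "\<xi> \<in> modK p"
  shows "kinner (fib t \<xi>) (fib t (psiv z)) = kinner (fib t \<xi>) z"
proof -
  have "apply_bcontfun (p \<iota>) t * apply_bcontfun (\<xi> \<iota>) t = apply_bcontfun (\<xi> \<iota>) t" for \<iota>
    using arg_cong [OF modK_p [OF assms, of \<iota>], of "\<lambda>f. apply_bcontfun f t"] by simp
  then have "Rep_ell2 (fib t \<xi>) \<iota> * cnjg (Rep_ell2 (fib t (psiv z)) \<iota>) = Rep_ell2 (fib t \<xi>) \<iota> * cnjg (Rep_ell2 z \<iota>)" for \<iota>
    by (simp add: Rep_fib_psiv cnjg_mult assms eval_at_def del: Rep_ell2_simps flip: mult.assoc)
  then show ?thesis
    by (intro kinner_eqI) (simp only: kinner_has_sum)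
qed

lemma kinner_psiv_fib: "\<xi> \<in> modK p \<Longrightarrow> kinner (fib t (psiv z)) (fib t \<xi>) = kinner z (fib t \<xi>)"
  using kinner_fib_psiv_self [of \<xi> t z] by (metis kinner_commute)

text \<open>The square of the norm of a projected vector is its inner product with the fixed vector
  \<open>z\<close>, hence continuous by weak continuity; Radon-Riesz gives norm continuity.\<close>

lemma psiv_H: "psiv z \<in> modH p"
  unfolding modH_iff continuous_on_def
proof (intro conjI ballI psiv_K)
  fix t
  let ?w = "fib t (psiv z)"
  have weak: "((\<lambda>s. kinner (fib s (psiv z)) b) \<longlongrightarrow> kinner ?w b) (at t)" for b
    by (rule tendsto_mono [OF _ fib_weak_tendsto [OF psiv_K]]) (simp add: at_within_def)
  have sq: "(norm (fib s (psiv z)))\<^sup>2 = rpart (kinner (fib s (psiv z)) z)" for s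
    using arg_cong [OF kinner_fib_psiv_self [OF psiv_K, of s z z], of rpart]
    by (simp add: kinner_self_norm del: of_real_power)
  show "((\<lambda>s. fib s (psiv z)) \<longlongrightarrow> ?w) (at t)"
  proof (rule weak_to_norm_tendsto)
    show "((\<lambda>s. inner (fib s (psiv z)) ?w) \<longlongrightarrow> inner ?w ?w) (at t)"
      unfolding inner_ell2_def by (intro tendsto_rpart weak)
    show "((\<lambda>s. (norm (fib s (psiv z)))\<^sup>2) \<longlongrightarrow> (norm ?w)\<^sup>2) (at t)"
      unfolding sq by (intro tendsto_rpart weak)
  qed
qed

lemma mnorm_psiv: "mnorm (psiv z) \<le> norm z"
  by (rule mnorm_le [OF psiv_K norm_fib_psiv])

text \<open>Every fibre value is taken by the constant section through it, so fibre operators can be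
  evaluated on module elements.\<close>

lemma psiv_fib:
  assumes "\<xi> \<in> modK p" shows "fib t (psiv (fib t \<xi>)) = fib t \<xi>"
proof (rule kinner_left_eqI)
  fix z
  have "kinner (fib t (psiv (fib t \<xi>))) z = kinner (fib t (psiv (fib t \<xi>))) (fib t (psiv z))"
    by (rule kinner_fib_psiv_self [OF psiv_K, symmetric])
  also have "\<dots> = kinner (fib t \<xi>) (fib t (psiv z))" by (rule kinner_psiv_fib [OF psiv_K])
  also have "\<dots> = kinner (fib t \<xi>) z" by (rule kinner_fib_psiv_self [OF assms])
  finally show "kinner (fib t (psiv (fib t \<xi>))) z = kinner (fib t \<xi>) z" .
qed

definition Phi :: "'t \<Rightarrow> ('i, 't, 'k) mop \<Rightarrow> ('i, 'k) ell2 \<Rightarrow> ('i, 'k) ell2" where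
  "Phi t u z = fib t (u (psiv z))"

text \<open>Pairing with the constant section \<open>psiv w\<close> evaluates the adjointness
  relation at \<open>t\<close>; both inner products are pointwise because their left arguments lie
  in \<open>modH p\<close>.\<close>

lemma fib_adjoint:
  assumes u: "u \<in> adjointable (modH p)" "v \<in> adjointable (modH p)" "is_adjoint (modH p) minner u v"
    and \<zeta>: "\<zeta> \<in> modH p"
  shows "kinner (fib t (u \<zeta>)) w = kinner (fib t \<zeta>) (Phi t v w)"
proof -
  have in_H: "u \<zeta> \<in> modH p" "v (psiv w) \<in> modH p"
    using adjointable_in u \<zeta> psiv_H by blast+
  have "kinner (fib t (u \<zeta>)) w = apply_bcontfun (minner (u \<zeta>) (psiv w)) t"
    using kinner_fib_psiv_self [OF modH_K [OF in_H(1)]] minner_H_left [OF in_H(1) psiv_K] by simp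
  also have "minner (u \<zeta>) (psiv w) = minner \<zeta> (v (psiv w))"
    by (rule is_adjointD [OF u(3) \<zeta> psiv_H])
  also have "apply_bcontfun \<dots> t = kinner (fib t \<zeta>) (Phi t v w)"
    using minner_H_left [OF \<zeta> modH_K [OF in_H(2)]] by (simp add: Phi_def)
  finally show ?thesis .
qed

text \<open>By \<open>fib_adjoint\<close>, inner products with \<open>fib t (u \<zeta>)\<close>
  depend on \<open>\<zeta>\<close> only through its fibre at \<open>t\<close>, so
  \<open>\<zeta>\<close> may be exchanged for the constant section with that fibre.\<close>

lemma fib_eq_Phi:
  assumes u: "u \<in> adjointable (modH p)" and \<zeta>: "\<zeta> \<in> modH p"
  shows "fib t (u \<zeta>) = Phi t u (fib t \<zeta>)"
proof -
  obtain v where v: "v \<in> adjointable (modH p)" "is_adjoint (modH p) minner u v"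
    by (rule adjointableE [OF hmodule_H u])
  show ?thesis
    unfolding Phi_def
    by (rule kinner_left_eqI) (simp add: fib_adjoint [OF u v] \<zeta> psiv_H psiv_fib modH_K)
qed

lemma kadj_Phi:
  assumes u: "u \<in> adjointable (modH p)" "v \<in> adjointable (modH p)" "is_adjoint (modH p) minner u v"
  shows "kadj (Phi t u) (Phi t v)"
  unfolding kadj_def
proof (intro allI)
  fix z w
  have "v (psiv w) \<in> modK p" using adjointable_in u(2) psiv_H modH_K by blast
  then show "kinner (Phi t u z) w = kinner z (Phi t v w)"
    using fib_adjoint [OF u psiv_H, of t z w] kinner_psiv_fib [of "v (psiv w)" t z] by (simp add: Phi_def)
qed

text \<open>One approximation in the module serves all fibres, with the same rank and with vectors
  that depend norm continuously on the point.\<close>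

lemma Phi_approx:
  assumes u: "u \<in> compact_ops (modH p)" and "\<epsilon> > 0"
  obtains n X Y where "\<And>k. k < n \<Longrightarrow> X k \<in> modH p \<and> Y k \<in> modH p"
    "\<And>t z. norm (Phi t u z - frank n (\<lambda>k. fib t (X k)) (\<lambda>k. fib t (Y k)) z) \<le> \<epsilon> * norm z"
proof -
  obtain n X Y where X: "\<And>k. k < n \<Longrightarrow> X k \<in> modH p \<and> Y k \<in> modH p"
    "\<And>\<xi>. \<xi> \<in> modH p \<Longrightarrow> mnorm (u \<xi> - (\<Sum>k<n :: nat. rank1 (modH p) (X k) (Y k)) \<xi>) \<le> \<epsilon> * mnorm \<xi>"
    by (rule compact_opsD [OF hmodule_H assms]) blast
  have "norm (Phi t u z - frank n (\<lambda>k. fib t (X k)) (\<lambda>k. fib t (Y k)) z) \<le> \<epsilon> * norm z" for t z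
  proof -
    let ?w = "(\<Sum>k<n. rank1 (modH p) (X k) (Y k)) (psiv z)"
    have w: "?w = (\<Sum>k<n. (\<lambda>\<iota>. X k \<iota> * minner (psiv z) (Y k)))"
      by (simp add: sum_fun_apply rank1_def psiv_H)
    have fib_sum: "m \<le> n \<Longrightarrow> (\<Sum>k<m. (\<lambda>\<iota>. X k \<iota> * minner (psiv z) (Y k))) \<in> modK p \<and>
        fib t (\<Sum>k<m. (\<lambda>\<iota>. X k \<iota> * minner (psiv z) (Y k))) = frank m (\<lambda>k. fib t (X k)) (\<lambda>k. fib t (Y k)) z" for m
    proof (induction m)
      case 0
      then show ?case using modK_0 fib_0 by (simp add: frank_def zero_fun_def)
    next
      case (Suc m)
      then have H: "X m \<in> modK p" "Y m \<in> modK p" using X(1) modH_K by auto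
      have "fib t (\<lambda>\<iota>. X m \<iota> * minner (psiv z) (Y m)) = kscale (kinner z (fib t (Y m))) (fib t (X m))"
        by (simp add: modK_mult H minner_H_left psiv_H kinner_psiv_fib)
      moreover from Suc have IH: "(\<Sum>k<m. (\<lambda>\<iota>. X k \<iota> * minner (psiv z) (Y k))) \<in> modK p"
        "fib t (\<Sum>k<m. (\<lambda>\<iota>. X k \<iota> * minner (psiv z) (Y k))) = frank m (\<lambda>k. fib t (X k)) (\<lambda>k. fib t (Y k)) z"
        by simp_all
      ultimately show ?case
        unfolding sum.lessThan_Suc modK_add(2) [OF IH(1) modK_mult(1) [OF H(1)]] IH(2)
        using modK_add(1) [OF IH(1) modK_mult(1) [OF H(1)]] by (simp only: frank_def sum.lessThan_Suc)
    qed
    have uz: "u (psiv z) \<in> modK p"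
      using compact_ops_adjointable [OF u] adjointable_in psiv_H modH_K by blast
    have "norm (Phi t u z - frank n (\<lambda>k. fib t (X k)) (\<lambda>k. fib t (Y k)) z) = norm (fib t (u (psiv z) - ?w))"
      using fib_sum [of n] uz by (simp add: Phi_def w modK_diff(2))
    also have "\<dots> \<le> mnorm (u (psiv z) - ?w)"
      using fib_sum [of n] uz by (intro norm_fib_le modK_diff) (simp_all add: w)
    also have "\<dots> \<le> \<epsilon> * mnorm (psiv z)" by (rule X(2) [OF psiv_H])
    also have "\<dots> \<le> \<epsilon> * norm z" using \<open>\<epsilon> > 0\<close> mnorm_psiv by (intro mult_left_mono) auto
    finally show ?thesis .
  qed
  with X(1) show thesis using that by blast
qed

lemma cpt_Phi: "u \<in> compact_ops (modH p) \<Longrightarrow> cpt (Phi t u)"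
  unfolding cpt_def rk_approx_def by (metis Phi_approx)

lemma norm_frank_diff_le:
  "norm (frank n a b z - frank n a' b' z)
    \<le> (\<Sum>k<n. norm (a k - a' k) * norm (b k) + norm (a' k) * norm (b k - b' k)) * norm z"
proof -
  have "frank n a b z - frank n a' b' z
      = (\<Sum>k<n. kscale (kinner z (b k)) (a k - a' k) + kscale (kinner z (b k - b' k)) (a' k))"
    unfolding frank_def sum_subtractf [symmetric]
    by (intro sum.cong) (simp_all add: kscale.diff_right kscale.diff_left kinner.diff_right)
  also have "norm \<dots> \<le> (\<Sum>k<n. (norm (a k - a' k) * norm (b k) + norm (a' k) * norm (b k - b' k)) * norm z)"
  proof (rule sum_norm_le)
    fix k
    have "norm (kinner z (b k)) * norm (a k - a' k) \<le> (norm z * norm (b k)) * norm (a k - a' k)"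
      by (intro mult_right_mono norm_kinner_le) simp
    moreover have "norm (kinner z (b k - b' k)) * norm (a' k) \<le> (norm z * norm (b k - b' k)) * norm (a' k)"
      by (intro mult_right_mono norm_kinner_le) simp
    ultimately show "norm (kscale (kinner z (b k)) (a k - a' k) + kscale (kinner z (b k - b' k)) (a' k))
        \<le> (norm (a k - a' k) * norm (b k) + norm (a' k) * norm (b k - b' k)) * norm z"
      by (intro norm_triangle_le) (simp add: norm_kscale algebra_simps)
  qed
  finally show ?thesis by (simp add: sum_distrib_right)
qed

text \<open>The finite rank approximants from \<open>Phi_approx\<close> vary norm continuously, and
  their error is uniform in the point; each of the three differences takes
  \<open>\<epsilon> / 3\<close>.\<close>

lemma Phi_norm_continuous:
  assumes u: "u \<in> compact_ops (modH p)" and "\<epsilon> > 0"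
  shows "\<forall>\<^sub>F s in nhds t. \<forall>z. norm (Phi s u z - Phi t u z) \<le> \<epsilon> * norm z"
proof -
  have e: "\<epsilon> / 3 > 0" using \<open>\<epsilon> > 0\<close> by simp
  obtain n X Y where X: "\<And>k. k < n \<Longrightarrow> X k \<in> modH p \<and> Y k \<in> modH p"
    "\<And>t z. norm (Phi t u z - frank n (\<lambda>k. fib t (X k)) (\<lambda>k. fib t (Y k)) z) \<le> \<epsilon> / 3 * norm z"
    by (rule Phi_approx [OF u e]) blast
  let ?g = "\<lambda>s. \<Sum>k<n. norm (fib s (X k) - fib t (X k)) * norm (fib s (Y k)) + norm (fib t (X k)) * norm (fib s (Y k) - fib t (Y k))"
  have "(?g \<longlongrightarrow> ?g t) (nhds t)"
    using X(1) by (intro tendsto_intros modH_fib_tendsto) auto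
  then have "(?g \<longlongrightarrow> 0) (nhds t)" by simp
  then have "\<forall>\<^sub>F s in nhds t. ?g s < \<epsilon> / 3" by (rule order_tendstoD(2) [OF _ e])
  then show ?thesis
  proof eventually_elim
    case (elim s)
    show ?case
    proof
      fix z
      let ?f = "\<lambda>s. frank n (\<lambda>k. fib s (X k)) (\<lambda>k. fib s (Y k)) z"
      have "norm (?f s - ?f t) \<le> ?g s * norm z" by (rule norm_frank_diff_le)
      also have "\<dots> \<le> \<epsilon> / 3 * norm z" using elim by (intro mult_right_mono) auto
      finally have 1: "norm (?f s - ?f t) \<le> \<epsilon> / 3 * norm z" .
      have eq: "Phi s u z - Phi t u z = (Phi s u z - ?f s) + (?f s - ?f t) - (Phi t u z - ?f t)" by simp
      have "norm (Phi s u z - Phi t u z) \<le> norm (Phi s u z - ?f s) + norm (?f s - ?f t) + norm (Phi t u z - ?f t)"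
        unfolding eq using norm_triangle_ineq4 [of "(Phi s u z - ?f s) + (?f s - ?f t)" "Phi t u z - ?f t"]
          norm_triangle_ineq [of "Phi s u z - ?f s" "?f s - ?f t"] by linarith
      then show "norm (Phi s u z - Phi t u z) \<le> \<epsilon> * norm z"
        using 1 X(2) [of s z] X(2) [of t z] by linarith
    qed
  qed
qed

text \<open>Both operator and vector move. Norm continuity absorbs the change of operator, and
  compactness of the single operator at \<open>t\<close> deals with the vectors.\<close>

lemma Phi_weak_tendsto:
  assumes u: "u \<in> compact_ops (modH p)" and F: "F \<le> nhds t"
    and bnd: "\<forall>\<^sub>F s in F. norm (f s) \<le> C" "norm l \<le> C"
    and crd: "\<And>\<iota>. ((\<lambda>s. Rep_ell2 (f s) \<iota>) \<longlongrightarrow> Rep_ell2 l \<iota>) F"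
  shows "((\<lambda>s. Phi s u (f s)) \<longlongrightarrow> Phi t u l) F"
proof -
  have C: "C \<ge> 0" using bnd(2) norm_ge_zero order_trans by blast
  have 1: "((\<lambda>s. Phi t u (f s)) \<longlongrightarrow> Phi t u l) F"
    by (rule cpt_weak_tendsto [OF cpt_Phi [OF u] bnd crd])
  have 2: "((\<lambda>s. Phi s u (f s) - Phi t u (f s)) \<longlongrightarrow> 0) F"
  proof (rule tendstoI)
    fix e :: real assume "e > 0"
    define d where "d = (e / 2) / (C + 1)"
    have "d > 0" using \<open>e > 0\<close> C by (simp add: d_def)
    moreover have "C + 1 \<noteq> 0" using C by simp
    then have "d * (C + 1) = e / 2"
      using nonzero_eq_divide_eq [of "C + 1" d "e / 2"] d_def by blast
    ultimately have "d * C < e" using \<open>e > 0\<close> unfolding distrib_left by linarith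
    have "\<forall>\<^sub>F s in F. \<forall>z. norm (Phi s u z - Phi t u z) \<le> d * norm z"
      using filter_leD [OF F Phi_norm_continuous [OF u \<open>d > 0\<close>]] .
    then show "\<forall>\<^sub>F s in F. dist (Phi s u (f s) - Phi t u (f s)) 0 < e"
      using bnd(1)
    proof eventually_elim
      case (elim s)
      have "norm (Phi s u (f s) - Phi t u (f s)) \<le> d * norm (f s)" using elim(1) by blast
      also have "\<dots> \<le> d * C" using elim(2) \<open>d > 0\<close> by (intro mult_left_mono) auto
      finally show ?case using \<open>d * C < e\<close> by simp
    qed
  qed
  from tendsto_add [OF 2 1] show ?thesis by simp
qed

lemma obtain_adjoint:
  assumes "u \<in> compact_ops (modH p)"
  obtains v where "v \<in> compact_ops (modH p)" "is_adjoint (modH p) minner u v" "\<And>t. kadj (Phi t u) (Phi t v)"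
proof -
  obtain v where "v \<in> adjointable (modH p)" "is_adjoint (modH p) minner u v"
    by (rule adjointableE [OF hmodule_H compact_ops_adjointable [OF assms]])
  then show thesis
    using that compact_ops_adjoint [OF hmodule_H assms] kadj_Phi [OF compact_ops_adjointable [OF assms]] by blast
qed

section \<open>Singular values as functions of the point\<close>

lemma sing_val_phi:
  assumes u: "u \<in> compact_ops (modH p)"
  shows "sing_val (phi p t u) = apn (Phi t u)"
proof -
  obtain v where v: "\<And>t. kadj (Phi t u) (Phi t v)" by (rule obtain_adjoint [OF u]) blast
  have "u (psiv z) \<in> modK p" for z
    using compact_ops_adjointable [OF u] adjointable_in psiv_H modH_K by blast
  then have "phi p t u (Rep_ell2 z) = Rep_ell2 (Phi t u z)" for z
    by (simp add: phi_def Phi_def flip: psiv_def)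
  then show ?thesis by (rule sing_val_eq_apn [OF v cpt_Phi [OF u]])
qed

lemma apn_Phi_continuous:
  assumes u: "u \<in> compact_ops (modH p)"
  shows "continuous_on UNIV (\<lambda>t. apn (Phi t u) n)"
  unfolding continuous_on_def
proof (intro ballI tendstoI)
  fix t and e :: real assume "e > 0"
  then have "\<forall>\<^sub>F s in nhds t. \<forall>z. norm (Phi s u z - Phi t u z) \<le> e / 2 * norm z"
    by (intro Phi_norm_continuous u) simp
  then have "\<forall>\<^sub>F s in nhds t. dist (apn (Phi s u) n) (apn (Phi t u) n) < e"
  proof eventually_elim
    case (elim s)
    have "apn (Phi s u) n \<le> apn (Phi t u) n + e / 2"
      using elim \<open>e > 0\<close> by (intro apn_perturb cpt_Phi u) auto
    moreover have "apn (Phi t u) n \<le> apn (Phi s u) n + e / 2"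
      using elim \<open>e > 0\<close> by (intro apn_perturb cpt_Phi u) (auto simp: norm_minus_commute)
    ultimately show ?case using \<open>e > 0\<close> by (simp add: dist_real_def)
  qed
  then show "\<forall>\<^sub>F s in at t. dist (apn (Phi s u) n) (apn (Phi t u) n) < e"
    by (simp add: eventually_nhds_conv_at)
qed

lemma theta_apply:
  assumes u: "u \<in> compact_ops (modH p)"
  shows "apply_bcontfun (theta p u n) t = of_real (apn (Phi t u) n)"
  unfolding theta_def sing_val_phi [OF u]
  by (subst apply_Bcontfun) (intro continuous_on_of_real apn_Phi_continuous u, simp)

lemma U_set_eq: "u \<in> compact_ops (modH p) \<Longrightarrow> U_set p u n = {t. apn (Phi t u) n \<noteq> 0}"
  by (simp add: U_set_def sing_val_phi)

lemma open_U_set: "u \<in> compact_ops (modH p) \<Longrightarrow> open (U_set p u n)"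
  unfolding U_set_eq using apn_Phi_continuous by (intro open_Collect_neq) auto

lemma e_proj_apply:
  assumes u: "u \<in> compact_ops (modH p)"
  shows "apply_bcontfun (e_proj p u n) t = indicator (closure (U_set p u n)) t"
proof -
  have "indicator (closure (U_set p u n)) = (\<lambda>t. if t \<in> closure (U_set p u n) then 1 else 0 :: 'k)"
    by (auto simp: fun_eq_iff)
  moreover have "continuous_on UNIV (\<lambda>t. if t \<in> closure (U_set p u n) then 1 else 0 :: 'k)"
    by (intro continuous_on_clopen_cases open_closure open_U_set u) auto
  ultimately show ?thesis unfolding e_proj_def by (simp add: apply_Bcontfun)
qed

text \<open>A finite rank approximation of \<open>u\<close> bounds the rank in all fibres at once,
  so the singular values decay uniformly.\<close>

lemma norm_theta_null:
  assumes u: "u \<in> compact_ops (modH p)"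
  shows "(\<lambda>n. norm (theta p u n)) \<longlonglongrightarrow> 0"
proof (rule LIMSEQ_I)
  fix r :: real assume "r > 0"
  then have r: "r / 2 > 0" by simp
  obtain m X Y where X: "\<And>t z. norm (Phi t u z - frank m (\<lambda>k. fib t (X k)) (\<lambda>k. fib t (Y k)) z) \<le> r / 2 * norm z"
    by (rule Phi_approx [OF u r]) blast
  obtain v where v: "\<And>t. kadj (Phi t u) (Phi t v)" by (rule obtain_adjoint [OF u]) blast
  have "norm (theta p u n) \<le> r / 2" if "n \<ge> m" for n
  proof (rule norm_bcontfun_le)
    fix t
    have "apn (Phi t u) n \<le> apn (Phi t u) m"
      using antimonoD [OF apn_antimono [OF v cpt_Phi [OF u]] that] .
    also have "rk_approx (Phi t u) m (r / 2)"
      unfolding rk_approx_def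
      by (intro exI [of _ "\<lambda>k. fib t (X k)"] exI [of _ "\<lambda>k. fib t (Y k)"] allI X)
    then have "apn (Phi t u) m \<le> r / 2" using r by (intro apn_le) auto
    finally show "norm (apply_bcontfun (theta p u n) t) \<le> r / 2"
      by (simp add: theta_apply u apn_nonneg cpt_Phi)
  qed
  then show "\<exists>no. \<forall>n\<ge>no. norm (norm (theta p u n) - 0) < r" using \<open>r > 0\<close>
    by (intro exI [of _ m]) force
qed

end

section \<open>Existence of Schatten decompositions\<close>

context hilbert_family
begin

lemma modK_sum:
  "(\<And>k. k \<in> A \<Longrightarrow> f k \<in> modK p) \<Longrightarrow> fib t (\<Sum>k\<in>A. f k) = (\<Sum>k\<in>A. fib t (f k))"
proof (induction A rule: infinite_finite_induct)
  case (insert k A)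
  have "(\<Sum>k\<in>A. f k) \<in> modK p" using insert.prems by (intro hmodule_sum) auto
  moreover have "f k \<in> modK p" "fib t (\<Sum>k\<in>A. f k) = (\<Sum>k\<in>A. fib t (f k))"
    using insert.prems insert.IH by auto
  ultimately show ?case
    by (simp only: sum.insert [OF insert.hyps(1,2)] modK_add(2))
next
  case (infinite A)
  then show ?case by (simp only: sum.infinite fib_0 not_False_eq_True)
qed (simp only: sum.empty fib_0)

lemma Phi_range:
  assumes "u \<in> adjointable (modH p)"
  shows "apply_bcontfun (p \<iota>) t * Rep_ell2 (Phi t u z) \<iota> = Rep_ell2 (Phi t u z) \<iota>"
proof -
  have K: "u (psiv z) \<in> modK p" using assms adjointable_in psiv_H modH_K by blast
  show ?thesis
    using arg_cong [OF modK_p [OF K, of \<iota>], of "\<lambda>f. apply_bcontfun f t"] by (simp add: Phi_def K eval_at_def)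
qed

definition vlift :: "('t \<Rightarrow> ('i, 'k) ell2) \<Rightarrow> 'i \<Rightarrow> 't \<Rightarrow>\<^sub>C 'k" where
  "vlift g \<iota> = blift (\<lambda>s. Rep_ell2 (g s) \<iota>)"

text \<open>Each condition involves finitely many coordinates at a time and hence passes to limits
  along the ultrafilter. No continuity of \<open>g\<close> is assumed, and the convergence obtained
  is coordinatewise only.\<close>

lemma vlift:
  assumes B: "\<And>s. norm (g s) \<le> B" and pg: "\<And>s \<iota>. apply_bcontfun (p \<iota>) s * Rep_ell2 (g s) \<iota> = Rep_ell2 (g s) \<iota>"
  shows "vlift g \<in> modK p" "((\<lambda>s. Rep_ell2 (g s) \<iota>) \<longlongrightarrow> Rep_ell2 (fib t (vlift g)) \<iota>) (uf t)"
    "norm (fib t (vlift g)) \<le> B"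
proof -
  have bd: "bddf (\<lambda>s. Rep_ell2 (g s) \<iota>)" for \<iota>
    unfolding bddf_def by (intro exI [of _ B] allI order_trans [OF norm_Rep_ell2_le B])
  have lim: "((\<lambda>s. Rep_ell2 (g s) \<iota>) \<longlongrightarrow> apply_bcontfun (vlift g \<iota>) t) (uf t)" for \<iota> t
    unfolding vlift_def by (rule blift_tendsto [OF bd])
  have B0: "0 \<le> B" using B norm_ge_zero order_trans by blast
  have sums: "(\<Sum>\<iota>\<in>F. (norm (apply_bcontfun (vlift g \<iota>) t))\<^sup>2) \<le> B\<^sup>2" if "finite F" for F t
  proof (rule tendsto_upperbound)
    show "((\<lambda>s. \<Sum>\<iota>\<in>F. (norm (Rep_ell2 (g s) \<iota>))\<^sup>2) \<longlongrightarrow> (\<Sum>\<iota>\<in>F. (norm (apply_bcontfun (vlift g \<iota>) t))\<^sup>2)) (uf t)"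
      by (intro tendsto_intros lim)
    show "\<forall>\<^sub>F s in uf t. (\<Sum>\<iota>\<in>F. (norm (Rep_ell2 (g s) \<iota>))\<^sup>2) \<le> B\<^sup>2"
      using B norm_ell2_le_iff [OF B0] that by (intro always_eventually) auto
  qed simp
  have pv: "p \<iota> * vlift g \<iota> = vlift g \<iota>" for \<iota>
  proof (rule bcontfun_eqI)
    fix t
    have "((\<lambda>s. apply_bcontfun (p \<iota>) s * Rep_ell2 (g s) \<iota>)
        \<longlongrightarrow> apply_bcontfun (p \<iota>) t * apply_bcontfun (vlift g \<iota>) t) (uf t)"
      by (intro tendsto_mult uf_tendsto_apply lim)
    then show "apply_bcontfun (p \<iota> * vlift g \<iota>) t = apply_bcontfun (vlift g \<iota>) t"
      unfolding pg times_bcontfun_apply by (rule tendsto_unique [OF uf_neq_bot _ lim])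
  qed
  show K: "vlift g \<in> modK p"
    unfolding modK_iff_sums by (intro conjI allI impI exI [of _ "B\<^sup>2"] pv sums)
  show "((\<lambda>s. Rep_ell2 (g s) \<iota>) \<longlongrightarrow> Rep_ell2 (fib t (vlift g)) \<iota>) (uf t)"
    using lim by (simp add: K eval_at_def)
  show "norm (fib t (vlift g)) \<le> B"
    using sums by (simp add: norm_ell2_le_iff [OF B0] K eval_at_def)
qed

text \<open>The compact operator \<open>Phi t w\<close> turns the coordinatewise convergence of the lifted singular vectors
  into norm convergence, wherever the singular value does not vanish.\<close>

lemma vlift_singular_vectors:
  assumes w: "w \<in> compact_ops (modH p)" and \<theta>: "continuous_on UNIV \<theta>"
    and n1: "\<And>s. norm (a s) \<le> 1" "\<And>s. norm (b s) \<le> 1"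
    and pa: "\<And>s \<iota>. apply_bcontfun (p \<iota>) s * Rep_ell2 (a s) \<iota> = Rep_ell2 (a s) \<iota>"
    and pb: "\<And>s \<iota>. apply_bcontfun (p \<iota>) s * Rep_ell2 (b s) \<iota> = Rep_ell2 (b s) \<iota>"
    and ab: "\<And>s. Phi s w (b s) = kscale (of_real (\<theta> s)) (a s)"
    and t: "\<theta> t \<noteq> 0"
  shows "(a \<longlongrightarrow> fib t (vlift a)) (uf t)"
    and "((\<lambda>s. fib s (vlift a)) \<longlongrightarrow> fib t (vlift a)) (nhds t)"
proof -
  note A = vlift [of a, OF n1(1) pa] and B = vlift [of b, OF n1(2) pb]
  have \<theta>t: "((\<lambda>s. of_real (\<theta> s) :: 'k) \<longlongrightarrow> of_real (\<theta> t)) (nhds t)" for t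
    using \<theta> tendsto_at_iff_tendsto_nhds [of \<theta> t] by (intro tendsto_of_real) (simp add: continuous_on_def)
  have lim: "((\<lambda>s. kscale (of_real (\<theta> s)) (a s)) \<longlongrightarrow> Phi t w (fib t (vlift b))) (uf t)" for t
    unfolding ab [symmetric]
    by (rule Phi_weak_tendsto [OF w uf_le_nhds _ B(3) B(2)]) (simp add: n1)
  \<comment> \<open>The norm limit from \<open>lim\<close> and the coordinatewise limit must
    coincide, so the lifted vectors satisfy the singular vector equation at every point.\<close>
  have eq: "Phi t w (fib t (vlift b)) = kscale (of_real (\<theta> t)) (fib t (vlift a))" for t
  proof (rule ell2_eqI)
    fix \<iota>
    have "((\<lambda>s. of_real (\<theta> s) * Rep_ell2 (a s) \<iota>) \<longlongrightarrow> of_real (\<theta> t) * Rep_ell2 (fib t (vlift a)) \<iota>) (uf t)"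
      by (intro tendsto_mult tendsto_mono [OF uf_le_nhds \<theta>t] A)
    moreover have "((\<lambda>s. of_real (\<theta> s) * Rep_ell2 (a s) \<iota>) \<longlongrightarrow> Rep_ell2 (Phi t w (fib t (vlift b))) \<iota>) (uf t)"
      using Rep_ell2_tendsto [OF lim [of t], of \<iota>] by simp
    ultimately show "Rep_ell2 (Phi t w (fib t (vlift b))) \<iota> = Rep_ell2 (kscale (of_real (\<theta> t)) (fib t (vlift a))) \<iota>"
      using tendsto_unique [OF uf_neq_bot] by (simp del: Rep_fib)
  qed
  have ev: "\<forall>\<^sub>F s in nhds t. \<theta> s \<noteq> 0"
  proof -
    have "open {s. \<theta> s \<noteq> 0}" by (rule open_Collect_neq [OF \<theta> continuous_on_const])
    then show ?thesis using eventually_nhds_in_open [of "{s. \<theta> s \<noteq> 0}" t] t by simp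
  qed
  have inv: "((\<lambda>s. inverse (of_real (\<theta> s)) :: 'k) \<longlongrightarrow> inverse (of_real (\<theta> t))) (nhds t)"
    using t by (intro tendsto_inverse \<theta>t) simp
  have cancel: "kscale (inverse (of_real (\<theta> s))) (kscale (of_real (\<theta> s)) x) = x" if "\<theta> s \<noteq> 0" for s and x :: "('i, 'k) ell2"
    using that by simp
  have "((\<lambda>s. kscale (inverse (of_real (\<theta> s))) (kscale (of_real (\<theta> s)) (a s)))
      \<longlongrightarrow> kscale (inverse (of_real (\<theta> t))) (kscale (of_real (\<theta> t)) (fib t (vlift a)))) (uf t)"
    using lim [of t] unfolding eq by (rule kscale.tendsto [OF tendsto_mono [OF uf_le_nhds inv]])
  then show "(a \<longlongrightarrow> fib t (vlift a)) (uf t)"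
    unfolding cancel [OF t]
    by (rule Lim_transform_eventually) (rule filter_leD [OF uf_le_nhds], rule eventually_mono [OF ev cancel])
  \<comment> \<open>The lift of \<open>b\<close> has continuous coordinates, so the same compactness
    argument now runs along neighbourhoods; dividing by the singular value gives norm continuity of
    the lift of \<open>a\<close>.\<close>
  have "((\<lambda>s. Phi s w (fib s (vlift b))) \<longlongrightarrow> Phi t w (fib t (vlift b))) (nhds t)"
    by (rule Phi_weak_tendsto [OF w order_refl _ B(3) fib_crd_tendsto [OF B(1)]]) (simp add: B(3))
  then have "((\<lambda>s. kscale (inverse (of_real (\<theta> s))) (kscale (of_real (\<theta> s)) (fib s (vlift a))))
      \<longlongrightarrow> kscale (inverse (of_real (\<theta> t))) (kscale (of_real (\<theta> t)) (fib t (vlift a)))) (nhds t)"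
    unfolding eq by (rule kscale.tendsto [OF inv])
  then show "((\<lambda>s. fib s (vlift a)) \<longlongrightarrow> fib t (vlift a)) (nhds t)"
    unfolding cancel [OF t]
    by (rule Lim_transform_eventually) (rule eventually_mono [OF ev cancel])
qed

lemma U_set_antimono:
  assumes u: "u \<in> compact_ops (modH p)" and "m \<le> n"
  shows "U_set p u n \<subseteq> U_set p u m"
proof -
  obtain v where v: "\<And>t. kadj (Phi t u) (Phi t v)" by (rule obtain_adjoint [OF u]) blast
  show ?thesis
  proof
    fix t assume "t \<in> U_set p u n"
    moreover have "apn (Phi t u) n \<le> apn (Phi t u) m"
      using antimonoD [OF apn_antimono [OF v cpt_Phi [OF u]] \<open>m \<le> n\<close>] .
    ultimately show "t \<in> U_set p u m"
      using apn_nonneg [OF cpt_Phi [OF u], of t n] by (simp add: U_set_eq [OF u])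
  qed
qed

text \<open>On \<open>U_set p u n\<close> the vectors converge in norm along the ultrafilter, so
  orthonormality survives there. It extends to the closure because both sides are continuous, and
  outside the closure the lifted vectors vanish.\<close>

lemma vlift_orthonormal:
  assumes u: "u \<in> compact_ops (modH p)"
    and zero: "\<And>s n. s \<notin> U_set p u n \<Longrightarrow> a n s = 0"
    and unit: "\<And>s n. s \<in> U_set p u n \<Longrightarrow> norm (a n s) = 1"
    and orth: "\<And>s m n. m \<noteq> n \<Longrightarrow> kinner (a m s) (a n s) = 0"
    and pa: "\<And>s n \<iota>. apply_bcontfun (p \<iota>) s * Rep_ell2 (a n s) \<iota> = Rep_ell2 (a n s) \<iota>"
    and lim: "\<And>t n. t \<in> U_set p u n \<Longrightarrow> (a n \<longlongrightarrow> fib t (vlift (a n))) (uf t)"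
    and cont: "\<And>t n. t \<in> U_set p u n \<Longrightarrow> ((\<lambda>s. fib s (vlift (a n))) \<longlongrightarrow> fib t (vlift (a n))) (nhds t)"
  shows "u_orthonormal p u (\<lambda>n. vlift (a n))"
proof -
  have n1: "norm (a n s) \<le> 1" for n s using zero [of s n] unit [of s n] by (cases "s \<in> U_set p u n") auto
  note A = vlift [of "a _", OF n1 pa]
  have U_sub: "s \<in> - closure (U_set p u n) \<Longrightarrow> s \<notin> U_set p u n" for s n
    using closure_subset [of "U_set p u n"] by blast
  have off: "fib t (vlift (a n)) = 0" if "t \<notin> closure (U_set p u n)" for t n
  proof (rule ell2_eqI)
    fix \<iota>
    have "\<forall>\<^sub>F s in uf t. s \<in> - closure (U_set p u n)"
      using filter_leD [OF uf_le_nhds eventually_nhds_in_open [of "- closure (U_set p u n)" t]] that by auto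
    then have "\<forall>\<^sub>F s in uf t. 0 = Rep_ell2 (a n s) \<iota>"
      by (rule eventually_mono) (simp only: zero [OF U_sub] zero_ell2.rep_eq)
    then have "((\<lambda>s. Rep_ell2 (a n s) \<iota>) \<longlongrightarrow> 0) (uf t)"
      by (rule Lim_transform_eventually [OF tendsto_const])
    then show "Rep_ell2 (fib t (vlift (a n))) \<iota> = Rep_ell2 0 \<iota>"
      using tendsto_unique [OF uf_neq_bot A(2)] by simp
  qed
  have "minner (vlift (a m)) (vlift (a n)) = (if m = n then e_proj p u n else 0)" (is "?f = ?g")
    if "m \<le> n" for m n
  proof (rule bcontfun_eqI)
    fix t
    have on_U: "apply_bcontfun ?f t = apply_bcontfun ?g t" if t: "t \<in> U_set p u n" for t
    proof -
      \<comment> \<open>The sets decrease with the index, so at points of the smaller one both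
        lifted vectors are norm limits.\<close>
      have tm: "t \<in> U_set p u m" using U_set_antimono [OF u \<open>m \<le> n\<close>] t by blast
      have f: "apply_bcontfun ?f t = kinner (fib t (vlift (a m))) (fib t (vlift (a n)))"
        by (rule minner_pointwise_right [OF A(1) A(1) tendsto_mono [OF uf_le_nhds cont [OF t]]])
      have k: "((\<lambda>s. kinner (a m s) (a n s)) \<longlongrightarrow> apply_bcontfun ?f t) (uf t)"
        unfolding f by (intro kinner.tendsto lim t tm)
      have "t \<in> closure (U_set p u n)" using t closure_subset by blast
      then have g: "apply_bcontfun ?g t = (if m = n then 1 else 0)" by (simp add: e_proj_apply u)
      have "\<forall>\<^sub>F s in uf t. s \<in> U_set p u n"
        by (rule filter_leD [OF uf_le_nhds eventually_nhds_in_open [OF open_U_set [OF u] t]])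
      then have "\<forall>\<^sub>F s in uf t. kinner (a m s) (a n s) = apply_bcontfun ?g t"
        by (rule eventually_mono) (use orth unit in \<open>auto simp: g kinner_self_norm\<close>)
      then have "((\<lambda>s. apply_bcontfun ?g t) \<longlongrightarrow> apply_bcontfun ?f t) (uf t)"
        by (rule Lim_transform_eventually [OF k])
      then show ?thesis using tendsto_unique [OF uf_neq_bot _ tendsto_const] by metis
    qed
    show "apply_bcontfun ?f t = apply_bcontfun ?g t"
    proof (cases "t \<in> closure (U_set p u n)")
      case True
      have "closed {t. apply_bcontfun ?f t = apply_bcontfun ?g t}"
        by (intro closed_Collect_eq continuous_on_apply_bcontfun)
      then have "closure (U_set p u n) \<subseteq> {t. apply_bcontfun ?f t = apply_bcontfun ?g t}"
        using on_U by (intro closure_minimal) auto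
      then show ?thesis using True by blast
    next
      case False
      have "\<forall>\<^sub>F s in uf t. s \<in> - closure (U_set p u n)"
        using filter_leD [OF uf_le_nhds eventually_nhds_in_open [of "- closure (U_set p u n)" t]] False by auto
      then have "\<forall>\<^sub>F s in uf t. 0 = kinner (fib s (vlift (a m))) (fib s (vlift (a n)))"
        by (rule eventually_mono) (simp add: off kinner.zero_right)
      then have "apply_bcontfun ?f t = 0"
        by (intro minner_eqI A(1) Lim_transform_eventually [OF tendsto_const])
      then show ?thesis using False by (simp add: e_proj_apply u)
    qed
  qed
  moreover have "((\<lambda>s. l2_norm (eval_at s (vlift (a n)) - eval_at t (vlift (a n)))) \<longlongrightarrow> 0) (at t within U_set p u n)"
    if t: "t \<in> U_set p u n" for n t
  proof -
    have "eval_at s (vlift (a n)) - eval_at t (vlift (a n)) = Rep_ell2 (fib s (vlift (a n)) - fib t (vlift (a n)))" for s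
      by (rule ext) (simp add: A(1))
    then have "l2_norm (eval_at s (vlift (a n)) - eval_at t (vlift (a n))) = norm (fib s (vlift (a n)) - fib t (vlift (a n)))" for s
      by (simp only: l2_norm_Rep_ell2)
    moreover have "((\<lambda>s. fib s (vlift (a n)) - fib t (vlift (a n))) \<longlongrightarrow> fib t (vlift (a n)) - fib t (vlift (a n))) (at t within U_set p u n)"
      by (intro tendsto_diff tendsto_const tendsto_mono [OF _ cont [OF t]]) (simp add: at_within_def)
    ultimately show ?thesis using tendsto_norm by fastforce
  qed
  ultimately show ?thesis unfolding u_orthonormal_def using A(1) by blast
qed

text \<open>The extension of \<open>u\<close> to the W*-direct sum acts fibrewise.\<close>

definition extK :: "('i, 't, 'k) mop \<Rightarrow> ('i, 't, 'k) mop" where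
  "extK u \<zeta> = (if \<zeta> \<in> modK p then (\<lambda>\<iota>. Bcontfun (\<lambda>t. Rep_ell2 (Phi t u (fib t \<zeta>)) \<iota>)) else 0)"

text \<open>The fibres of \<open>\<zeta>\<close> are only weakly continuous, but the compact fibre
  operators map them to a norm continuous field, so the coordinates are continuous.\<close>

lemma extK:
  assumes u: "u \<in> compact_ops (modH p)" and \<zeta>: "\<zeta> \<in> modK p"
  shows "extK u \<zeta> \<in> modK p" "fib t (extK u \<zeta>) = Phi t u (fib t \<zeta>)"
proof -
  note ua = compact_ops_adjointable [OF u]
  obtain B where B: "0 \<le> B" "\<And>\<xi>. \<xi> \<in> modH p \<Longrightarrow> mnorm (u \<xi>) \<le> B * mnorm \<xi>"
    using adjointable_bounded [OF hmodule_H ua] by blast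
  obtain C where C: "0 \<le> C" "\<And>t. norm (fib t \<zeta>) \<le> C" by (rule modK_fib_bounded [OF \<zeta>]) blast
  have nb: "norm (Phi t u (fib t \<zeta>)) \<le> B * C" for t
  proof -
    have "norm (Phi t u (fib t \<zeta>)) \<le> mnorm (u (psiv (fib t \<zeta>)))"
      unfolding Phi_def by (intro norm_fib_le modH_K adjointable_in [OF ua] psiv_H)
    also have "\<dots> \<le> B * mnorm (psiv (fib t \<zeta>))" by (rule B(2) [OF psiv_H])
    also have "\<dots> \<le> B * C" using B(1) order_trans [OF mnorm_psiv C(2)] by (intro mult_left_mono)
    finally show ?thesis .
  qed
  have "continuous_on UNIV (\<lambda>t. Rep_ell2 (Phi t u (fib t \<zeta>)) \<iota>)" for \<iota>
    unfolding continuous_on_def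
  proof
    fix t
    have "((\<lambda>s. Phi s u (fib s \<zeta>)) \<longlongrightarrow> Phi t u (fib t \<zeta>)) (at t)"
      by (rule Phi_weak_tendsto [OF u _ _ C(2) tendsto_mono [OF _ fib_crd_tendsto [OF \<zeta>]]])
        (simp_all add: at_within_def C(2))
    then show "((\<lambda>t. Rep_ell2 (Phi t u (fib t \<zeta>)) \<iota>) \<longlongrightarrow> Rep_ell2 (Phi t u (fib t \<zeta>)) \<iota>) (at t)"
      by (rule Rep_ell2_tendsto)
  qed
  then have app: "apply_bcontfun (extK u \<zeta> \<iota>) t = Rep_ell2 (Phi t u (fib t \<zeta>)) \<iota>" for \<iota> t
    unfolding extK_def using \<zeta> by (simp add: apply_Bcontfun)
  have "p \<iota> * extK u \<zeta> \<iota> = extK u \<zeta> \<iota>" for \<iota>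
    by (rule bcontfun_eqI) (simp add: app Phi_range ua)
  from modK_I [OF this app nb] show "extK u \<zeta> \<in> modK p" "fib t (extK u \<zeta>) = Phi t u (fib t \<zeta>)" by auto
qed

lemma extK_adjointable:
  assumes u: "u \<in> compact_ops (modH p)"
  shows "extK u \<in> adjointable (modK p)"
proof -
  obtain v where v: "v \<in> compact_ops (modH p)" "\<And>t. kadj (Phi t u) (Phi t v)"
    by (rule obtain_adjoint [OF u]) blast
  show ?thesis
  proof (rule adjointableI(1) [of _ _ "extK v"])
    fix \<xi> \<eta> assume *: "\<xi> \<in> modK p" "\<eta> \<in> modK p"
    show "minner (extK u \<xi>) \<eta> = minner \<xi> (extK v \<eta>)"
      unfolding minner_eq_blift [OF extK(1) [OF u *(1)] *(2)] minner_eq_blift [OF *(1) extK(1) [OF v(1) *(2)]]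
        extK(2) [OF u *(1)] extK(2) [OF v(1) *(2)] kadjD [OF v(2)] ..
  qed (simp_all add: extK u v(1), simp_all add: extK_def)
qed

lemma extK_restrict:
  assumes u: "u \<in> compact_ops (modH p)" and \<zeta>: "\<zeta> \<in> modH p"
  shows "extK u \<zeta> = u \<zeta>"
proof (rule modK_eqI)
  show "extK u \<zeta> \<in> modK p" by (rule extK(1) [OF u modH_K [OF \<zeta>]])
  show "u \<zeta> \<in> modK p" by (intro modH_K adjointable_in [OF compact_ops_adjointable [OF u] \<zeta>])
  show "fib t (extK u \<zeta>) = fib t (u \<zeta>)" for t
    unfolding extK(2) [OF u modH_K [OF \<zeta>]] fib_eq_Phi [OF compact_ops_adjointable [OF u] \<zeta>] ..
qed

text \<open>The remainder after \<open>N\<close> terms is at most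
  \<open>?\<theta> s N * norm z\<close> in every fibre. This estimate survives the lift, so the
  remainder in \<open>opnorm\<close> is at most \<open>norm (theta p u N)\<close>, which tends to
  \<open>0\<close>.\<close>

theorem schatten_decomposition_exists:
  assumes u: "u \<in> compact_ops (modH p)"
  shows "\<exists>\<xi> \<eta>. schatten_decomposition p u \<xi> \<eta>"
proof -
  obtain v where v: "v \<in> compact_ops (modH p)" "\<And>t. kadj (Phi t u) (Phi t v)"
    by (rule obtain_adjoint [OF u]) blast
  let ?\<theta> = "\<lambda>s. apn (Phi s u)"
  define svd where "svd s \<xi> \<eta> \<longleftrightarrow>
      (\<forall>n. ?\<theta> s n = 0 \<longrightarrow> \<xi> n = 0 \<and> \<eta> n = 0) \<and>
      (\<forall>n. ?\<theta> s n \<noteq> 0 \<longrightarrow> norm (\<xi> n) = 1 \<and> norm (\<eta> n) = 1) \<and>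
      (\<forall>m n. m \<noteq> n \<longrightarrow> kinner (\<xi> m) (\<xi> n) = 0 \<and> kinner (\<eta> m) (\<eta> n) = 0) \<and>
      (\<forall>n. Phi s u (\<eta> n) = kscale (of_real (?\<theta> s n)) (\<xi> n)) \<and>
      (\<forall>n. Phi s v (\<xi> n) = kscale (of_real (?\<theta> s n)) (\<eta> n)) \<and>
      (\<forall>N z. norm (Phi s u z - (\<Sum>n<N. kscale (of_real (?\<theta> s n) * kinner z (\<eta> n)) (\<xi> n))) \<le> ?\<theta> s N * norm z)"
    for s and \<xi> \<eta> :: "nat \<Rightarrow> ('i, 'k) ell2"
  have "\<exists>\<xi> \<eta>. svd s \<xi> \<eta>" for s
    unfolding svd_def by (rule singular_value_decomposition [OF v(2) cpt_Phi [OF u]]) blast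
  then obtain x e where "\<And>s. svd s (x s) (e s)" by metis
  note svd = this [unfolded svd_def]
  define a where "a n s = x s n" for n s
  define b where "b n s = e s n" for n s
  have zero: "a n s = 0" "b n s = 0" if "s \<notin> U_set p u n" for n s
    using svd [of s] that by (auto simp: a_def b_def U_set_eq u)
  have unit: "norm (a n s) = 1" "norm (b n s) = 1" if "s \<in> U_set p u n" for n s
    using svd [of s] that by (auto simp: a_def b_def U_set_eq u)
  have n1: "norm (a n s) \<le> 1" "norm (b n s) \<le> 1" for n s
    using zero [of s n] unit [of s n] by (cases "s \<in> U_set p u n"; simp)+
  have orth: "kinner (a m s) (a n s) = 0" "kinner (b m s) (b n s) = 0" if "m \<noteq> n" for m n s
    using svd [of s] that by (auto simp: a_def b_def)
  have ub: "Phi s u (b n s) = kscale (of_real (?\<theta> s n)) (a n s)"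
    and va: "Phi s v (a n s) = kscale (of_real (?\<theta> s n)) (b n s)" for n s
    using svd [of s] by (auto simp: a_def b_def)
  have bound: "norm (Phi s u z - (\<Sum>n<N. kscale (of_real (?\<theta> s n) * kinner z (b n s)) (a n s))) \<le> ?\<theta> s N * norm z" for s N z
    using svd [of s] by (auto simp: a_def b_def)
  \<comment> \<open>Lifted vectors must respect the projections: where the singular value is
    nonzero, the vector is a multiple of a value of a fibre operator; elsewhere it is
    \<open>0\<close>.\<close>
  have range: "apply_bcontfun (p \<iota>) s * Rep_ell2 c \<iota> = Rep_ell2 c \<iota>"
    if "?\<theta> s n = 0 \<Longrightarrow> c = 0" "Phi s w d = kscale (of_real (?\<theta> s n)) c" "w \<in> compact_ops (modH p)" for s n c w d \<iota>
  proof (cases "?\<theta> s n = 0")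
    case False
    have "apply_bcontfun (p \<iota>) s * (of_real (?\<theta> s n) * Rep_ell2 c \<iota>) = of_real (?\<theta> s n) * Rep_ell2 c \<iota>"
      using Phi_range [OF compact_ops_adjointable [OF that(3)], of \<iota> s d] unfolding that(2) by simp
    then show ?thesis using False by (simp add: mult.left_commute)
  qed (use that in simp)
  have pa: "apply_bcontfun (p \<iota>) s * Rep_ell2 (a n s) \<iota> = Rep_ell2 (a n s) \<iota>" for n s \<iota>
    by (rule range [OF _ ub u]) (use zero in \<open>simp add: U_set_eq u\<close>)
  have pb: "apply_bcontfun (p \<iota>) s * Rep_ell2 (b n s) \<iota> = Rep_ell2 (b n s) \<iota>" for n s \<iota>
    by (rule range [OF _ va v(1)]) (use zero in \<open>simp add: U_set_eq u\<close>)
  note A = vlift [of "a _", OF n1(1) pa] and B = vlift [of "b _", OF n1(2) pb]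
  have limA: "(a n \<longlongrightarrow> fib t (vlift (a n))) (uf t)" "((\<lambda>s. fib s (vlift (a n))) \<longlongrightarrow> fib t (vlift (a n))) (nhds t)"
    if "t \<in> U_set p u n" for t n
    using vlift_singular_vectors [OF u apn_Phi_continuous [OF u] n1 pa pb ub] that by (simp_all add: U_set_eq u)
  \<comment> \<open>The left and right vectors exchange roles, with the adjoint \<open>v\<close> in
    place of \<open>u\<close>.\<close>
  have limB: "(b n \<longlongrightarrow> fib t (vlift (b n))) (uf t)" "((\<lambda>s. fib s (vlift (b n))) \<longlongrightarrow> fib t (vlift (b n))) (nhds t)"
    if "t \<in> U_set p u n" for t n
    using vlift_singular_vectors [OF v(1) apn_Phi_continuous [OF u] n1(2,1) pb pa va] that by (simp_all add: U_set_eq u)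
  have ua: "u_orthonormal p u (\<lambda>n. vlift (a n))"
    by (rule vlift_orthonormal [OF u zero(1) unit(1) orth(1) pa limA])
  have uB: "u_orthonormal p u (\<lambda>n. vlift (b n))"
    by (rule vlift_orthonormal [OF u zero(2) unit(2) orth(2) pb limB])
  have \<theta>t: "((\<lambda>s. ?\<theta> s n) \<longlongrightarrow> ?\<theta> t n) (uf t)" for n t
    using apn_Phi_continuous [OF u, of n] tendsto_at_iff_tendsto_nhds [of "\<lambda>s. ?\<theta> s n" t]
    by (intro tendsto_mono [OF uf_le_nhds]) (simp add: continuous_on_def)
  have lbound: "norm (Phi t u z - (\<Sum>n<N. kscale (of_real (?\<theta> t n) * kinner z (fib t (vlift (b n)))) (fib t (vlift (a n)))))
      \<le> ?\<theta> t N * norm z" for t N z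
  proof (rule tendsto_le [OF uf_neq_bot])
    \<comment> \<open>Where the singular value vanishes at \<open>t\<close> the vectors need not
      converge, but they are bounded and their coefficient tends to \<open>0\<close>.\<close>
    have tm: "((\<lambda>s. kscale (of_real (?\<theta> s n) * kinner z (b n s)) (a n s))
        \<longlongrightarrow> kscale (of_real (?\<theta> t n) * kinner z (fib t (vlift (b n)))) (fib t (vlift (a n)))) (uf t)" for n
    proof (cases "t \<in> U_set p u n")
      case True
      then show ?thesis
        by (intro kscale.tendsto tendsto_mult tendsto_of_real \<theta>t kinner.tendsto tendsto_const limA limB)
    next
      case False
      then have t0: "?\<theta> t n = 0" by (simp add: U_set_eq u)
      have "((\<lambda>s. ?\<theta> s n * norm z) \<longlongrightarrow> 0 * norm z) (uf t)"
        using \<theta>t [of n t] unfolding t0 by (intro tendsto_mult tendsto_const)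
      then have "((\<lambda>s. ?\<theta> s n * norm z) \<longlongrightarrow> 0) (uf t)" by simp
      moreover have "norm (kscale (of_real (?\<theta> s n) * kinner z (b n s)) (a n s)) \<le> ?\<theta> s n * norm z" for s
      proof -
        have "norm (kinner z (b n s)) * norm (a n s) \<le> norm z * norm (b n s) * norm (a n s)"
          by (intro mult_right_mono norm_kinner_le) simp
        also have "\<dots> \<le> norm z * 1 * 1" using n1 by (intro mult_mono) auto
        finally show ?thesis
          using apn_nonneg [OF cpt_Phi [OF u], of s n]
          by (simp add: norm_kscale norm_mult mult.assoc mult_left_mono)
      qed
      ultimately have "((\<lambda>s. kscale (of_real (?\<theta> s n) * kinner z (b n s)) (a n s)) \<longlongrightarrow> 0) (uf t)"
        by (rule Lim_null_comparison [OF always_eventually [OF allI], rotated])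
      then show ?thesis by (simp add: t0 kscale.zero_left)
    qed
    show "((\<lambda>s. norm (Phi s u z - (\<Sum>n<N. kscale (of_real (?\<theta> s n) * kinner z (b n s)) (a n s))))
        \<longlongrightarrow> norm (Phi t u z - (\<Sum>n<N. kscale (of_real (?\<theta> t n) * kinner z (fib t (vlift (b n)))) (fib t (vlift (a n)))))) (uf t)"
      by (intro tendsto_norm tendsto_diff tendsto_sum tm Phi_weak_tendsto [OF u uf_le_nhds, where C = "norm z"]) simp_all
    show "((\<lambda>s. ?\<theta> s N * norm z) \<longlongrightarrow> ?\<theta> t N * norm z) (uf t)"
      by (intro tendsto_mult tendsto_const \<theta>t)
    show "\<forall>\<^sub>F s in uf t. norm (Phi s u z - (\<Sum>n<N. kscale (of_real (?\<theta> s n) * kinner z (b n s)) (a n s))) \<le> ?\<theta> s N * norm z"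
      by (intro always_eventually allI bound)
  qed
  define S where "S N = (\<Sum>n<N. op_mult (rank1 (modK p) (vlift (a n)) (vlift (b n))) (theta p u n))" for N
  have S_bound: "mnorm (extK u \<zeta> - S N \<zeta>) \<le> norm (theta p u N) * mnorm \<zeta>" if \<zeta>: "\<zeta> \<in> modK p" for \<zeta> N
  proof -
    define f where "f n = (\<lambda>\<iota>. vlift (a n) \<iota> * (minner \<zeta> (vlift (b n)) * theta p u n))" for n
    have fK: "f n \<in> modK p" for n unfolding f_def by (rule modK_mult(1) [OF A(1)])
    have S: "S N \<zeta> = (\<Sum>n<N. f n)"
      unfolding S_def
      by (subst sum_fun_apply, intro sum.cong refl) (use \<zeta> in \<open>simp add: op_mult_def rank1_def f_def mult.assoc\<close>)
    have SK: "S N \<zeta> \<in> modK p" unfolding S by (intro hmodule_sum hmodule_K fK)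
    \<comment> \<open>On \<open>U_set p u n\<close> the lifted right vector is norm continuous, so
      \<open>minner\<close> is pointwise; off it the factor \<open>theta p u n\<close> makes both
      sides \<open>0\<close>.\<close>
    have fib_f: "fib t (f n) = kscale (of_real (?\<theta> t n) * kinner (fib t \<zeta>) (fib t (vlift (b n)))) (fib t (vlift (a n)))" for t n
    proof (cases "t \<in> U_set p u n")
      case True
      have "apply_bcontfun (minner \<zeta> (vlift (b n))) t = kinner (fib t \<zeta>) (fib t (vlift (b n)))"
        by (rule minner_pointwise_right [OF \<zeta> B(1) tendsto_mono [OF uf_le_nhds limB(2) [OF True]]])
      then show ?thesis
        unfolding f_def modK_mult(2) [OF A(1)] by (simp add: theta_apply u mult.commute)
    next
      case False
      then have "?\<theta> t n = 0" by (simp add: U_set_eq u)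
      then show ?thesis
        unfolding f_def modK_mult(2) [OF A(1)] by (simp add: theta_apply u kscale.zero_left)
    qed
    show ?thesis
    proof (rule mnorm_le)
      show "extK u \<zeta> - S N \<zeta> \<in> modK p" by (intro modK_diff extK u \<zeta> SK)
      fix t
      have "norm (fib t (extK u \<zeta> - S N \<zeta>)) \<le> ?\<theta> t N * norm (fib t \<zeta>)"
        unfolding modK_diff(2) [OF extK(1) [OF u \<zeta>] SK] extK(2) [OF u \<zeta>]
        unfolding S modK_sum [OF fK] fib_f by (rule lbound)
      also have "\<dots> \<le> norm (theta p u N) * mnorm \<zeta>"
      proof (rule mult_mono)
        show "?\<theta> t N \<le> norm (theta p u N)"
          using norm_bounded [of "theta p u N" t] by (simp add: theta_apply u apn_nonneg cpt_Phi)
      qed (simp_all add: norm_fib_le \<zeta>)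
      finally show "norm (fib t (extK u \<zeta> - S N \<zeta>)) \<le> norm (theta p u N) * mnorm \<zeta>" .
    qed
  qed
  have "extK u \<in> compact_ops (modK p)"
  proof (rule compact_opsI [OF hmodule_K extK_adjointable [OF u]])
    fix \<epsilon> :: real assume "\<epsilon> > 0"
    then have "\<forall>\<^sub>F n in sequentially. norm (theta p u n) < \<epsilon>"
      by (rule order_tendstoD(2) [OF norm_theta_null [OF u]])
    then obtain N where N: "norm (theta p u N) < \<epsilon>" unfolding eventually_sequentially by blast
    let ?X = "\<lambda>n \<iota>. vlift (a n) \<iota> * theta p u n" and ?Y = "\<lambda>n. vlift (b n)"
    have S: "(\<Sum>n<N. rank1 (modK p) (?X n) (?Y n)) = S N"
      unfolding S_def rank1_mult_left ..
    have "mnorm (extK u \<xi> - S N \<xi>) \<le> \<epsilon> * mnorm \<xi>" if "\<xi> \<in> modK p" for \<xi>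
      using S_bound [OF that, of N] mult_right_mono [OF less_imp_le [OF N] mnorm_nonneg [of \<xi>]] by linarith
    moreover have "\<forall>k<N. ?X k \<in> modK p \<and> ?Y k \<in> modK p"
      using modK_mult(1) [OF A(1)] B(1) by blast
    ultimately show "\<exists>n X Y. (\<forall>k<n :: nat. X k \<in> modK p \<and> Y k \<in> modK p) \<and>
      (\<forall>\<xi>\<in>modK p. mnorm (extK u \<xi> - (\<Sum>k<n. rank1 (modK p) (X k) (Y k)) \<xi>) \<le> \<epsilon> * mnorm \<xi>)"
      unfolding S [symmetric] by (intro exI [of _ N] exI [of _ ?X] exI [of _ ?Y] conjI ballI)
  qed
  moreover have "(\<lambda>N. opnorm (modK p) (extK u - S N)) \<longlonglongrightarrow> 0"
  proof (rule Lim_null_comparison [OF always_eventually [OF allI] norm_theta_null [OF u]])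
    fix N
    have K: "S N \<in> adjointable (modK p)"
      unfolding S_def
      by (intro adjointable_sum hmodule_K adjointable_op_mult rank1_is_adjoint A(1) B(1))
    have "opnorm (modK p) (extK u - S N) \<le> norm (theta p u N)"
      by (intro opnorm_le hmodule_K) (simp_all add: S_bound)
    moreover have "0 \<le> opnorm (modK p) (extK u - S N)"
      by (rule opnorm_nonneg [OF hmodule_K adjointable_diff [OF hmodule_K extK_adjointable [OF u] K]])
    ultimately show "norm (opnorm (modK p) (extK u - S N)) \<le> norm (theta p u N)" by simp
  qed
  ultimately show ?thesis
    unfolding schatten_decomposition_def S_def
    using ua uB extK_restrict [OF u] by blast
qed

end

section \<open>The trace\<close>

context hilbert_family
begin

section \<open>Algebraic operations on the trace class\<close>

lemma Phi_add:
  assumes "u \<in> adjointable (modH p)" "w \<in> adjointable (modH p)"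
  shows "Phi t (u + w) z = Phi t u z + Phi t w z"
proof -
  have "u (psiv z) \<in> modK p" "w (psiv z) \<in> modK p"
    using assms adjointable_in psiv_H modH_K by blast+
  then show ?thesis using modK_add(2) by (simp add: Phi_def)
qed

lemma Phi_op_mult:
  assumes "u \<in> adjointable (modH p)"
  shows "Phi t (op_mult u x) z = kscale (apply_bcontfun x t) (Phi t u z)"
proof -
  have "u (psiv z) \<in> modK p"
    using assms adjointable_in psiv_H modH_K by blast
  then show ?thesis using modK_mult(2) by (simp add: Phi_def op_mult_def)
qed

lemma bounded_linear_apply: "bounded_linear (\<lambda>f :: 't \<Rightarrow>\<^sub>C 'k. apply_bcontfun f t)"
  by (rule bounded_linear_intro [where K = 1]) (auto simp: norm_bounded)

lemma trace_class_compact: "u \<in> trace_class p \<Longrightarrow> u \<in> compact_ops (modH p)"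
  by (simp add: trace_class_def)

lemma trace_class_adjointable: "u \<in> trace_class p \<Longrightarrow> u \<in> adjointable (modH p)"
  by (intro compact_ops_adjointable trace_class_compact)

lemma sum_theta:
  assumes u: "u \<in> trace_class p"
  shows "apn (Phi t u) summable_on UNIV"
    and "apply_bcontfun (\<Sum>\<^sub>\<infinity>n. theta p u n) t = of_real (\<Sum>\<^sub>\<infinity>n. apn (Phi t u) n)"
proof -
  have hs: "(theta p u has_sum (\<Sum>\<^sub>\<infinity>n. theta p u n)) UNIV"
    using u unfolding trace_class_def by (intro has_sum_infsum) auto
  have *: "((\<lambda>n. of_real (apn (Phi t u) n)) has_sum apply_bcontfun (\<Sum>\<^sub>\<infinity>n. theta p u n) t) UNIV"
    using has_sum_bounded_linear [OF bounded_linear_apply [of t] hs]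
    by (simp add: o_def theta_apply trace_class_compact u)
  have r: "(apn (Phi t u) has_sum rpart (apply_bcontfun (\<Sum>\<^sub>\<infinity>n. theta p u n) t)) UNIV"
    using has_sum_bounded_linear [OF bounded_linear_rpart *] by (simp add: o_def)
  then show s: "apn (Phi t u) summable_on UNIV" by (auto simp: summable_on_def)
  have "((\<lambda>n. of_real (apn (Phi t u) n) :: 'k) has_sum of_real (\<Sum>\<^sub>\<infinity>n. apn (Phi t u) n)) UNIV"
    using has_sum_bounded_linear [OF bounded_linear_of_real has_sum_infsum [OF s]] by (simp add: o_def)
  then show "apply_bcontfun (\<Sum>\<^sub>\<infinity>n. theta p u n) t = of_real (\<Sum>\<^sub>\<infinity>n. apn (Phi t u) n)"
    using * has_sum_unique by blast
qed

lemma trace_classI: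
  fixes g :: "nat \<Rightarrow> 't \<Rightarrow>\<^sub>C 'k"
  assumes u: "u \<in> compact_ops (modH p)" and g: "g summable_on UNIV"
    "\<And>n t. apply_bcontfun (g n) t = of_real (r n t)" and le: "\<And>n t. apn (Phi t u) n \<le> r n t"
  shows "u \<in> trace_class p"
  unfolding trace_class_def
proof (intro CollectI conjI u bcontfun_summable_comparison [OF g])
  show "norm (apply_bcontfun (theta p u n) t) \<le> r n t" for n t
    using le [of t n] apn_nonneg [OF cpt_Phi [OF u]] by (simp add: theta_apply u)
qed

text \<open>By \<open>apn_add\<close> with equal indices, the \<open>n\<close>-th singular value of
  the sum is at most the sum of those with index \<open>n div 2\<close>.\<close>

lemma trace_class_add:
  assumes u: "u \<in> trace_class p" and w: "w \<in> trace_class p"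
  shows "u + w \<in> trace_class p"
proof -
  \<comment> \<open>Every term occurs twice, at an even and at an odd index.\<close>
  have half: "(\<lambda>n. f (n div 2)) summable_on UNIV" if "f summable_on UNIV" for f :: "nat \<Rightarrow> 't \<Rightarrow>\<^sub>C 'k"
  proof -
    have "(\<lambda>n. f (n div 2)) summable_on range (\<lambda>n. 2 * n)"
      using that by (subst summable_on_reindex) (auto simp: inj_on_def o_def)
    moreover have "(\<lambda>n. f (n div 2)) summable_on range (\<lambda>n. 2 * n + 1)"
      using that by (subst summable_on_reindex) (auto simp: inj_on_def o_def)
    moreover have "range (\<lambda>n :: nat. 2 * n) \<inter> range (\<lambda>n. 2 * n + 1) = {}"
      by (auto simp: image_iff) presburger
    ultimately have "(\<lambda>n. f (n div 2)) summable_on (range (\<lambda>n. 2 * n) \<union> range (\<lambda>n. 2 * n + 1))"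
      by (rule summable_on_Un_disjoint)
    moreover have "range (\<lambda>n :: nat. 2 * n) \<union> range (\<lambda>n. 2 * n + 1) = UNIV"
      by (auto simp: image_iff) presburger
    ultimately show ?thesis by simp
  qed
  note uc = trace_class_compact [OF u] and wc = trace_class_compact [OF w]
  have uw: "u + w \<in> compact_ops (modH p)" by (rule compact_ops_add [OF hmodule_H uc wc])
  obtain v where v: "\<And>t. kadj (Phi t (u + w)) (Phi t v)" by (rule obtain_adjoint [OF uw]) blast
  show ?thesis
  proof (rule trace_classI [OF uw])
    show "(\<lambda>n. theta p u (n div 2) + theta p w (n div 2)) summable_on UNIV"
      using u w by (intro summable_on_add half) (auto simp: trace_class_def)
    fix n t
    show "apply_bcontfun (theta p u (n div 2) + theta p w (n div 2)) t
        = of_real (apn (Phi t u) (n div 2) + apn (Phi t w) (n div 2))"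
      by (simp add: theta_apply uc wc)
    have eq: "Phi t (u + w) = (\<lambda>z. Phi t u z + Phi t w z)"
      by (rule ext) (rule Phi_add [OF trace_class_adjointable [OF u] trace_class_adjointable [OF w]])
    have "apn (Phi t (u + w)) n \<le> apn (Phi t (u + w)) (n div 2 + n div 2)"
      by (rule antimonoD [OF apn_antimono [OF v cpt_Phi [OF uw]]]) presburger
    also have "\<dots> \<le> apn (Phi t u) (n div 2) + apn (Phi t w) (n div 2)"
      unfolding eq by (rule apn_add [OF cpt_Phi [OF uc] cpt_Phi [OF wc]])
    finally show "apn (Phi t (u + w)) n \<le> apn (Phi t u) (n div 2) + apn (Phi t w) (n div 2)" .
  qed
qed

lemma trace_class_op_mult:
  assumes u: "u \<in> trace_class p"
  shows "op_mult u x \<in> trace_class p"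
proof -
  note uc = trace_class_compact [OF u]
  have ux: "op_mult u x \<in> compact_ops (modH p)" by (rule compact_ops_op_mult [OF hmodule_H uc])
  show ?thesis
  proof (rule trace_classI [OF ux])
    have "bounded_linear (\<lambda>f :: 't \<Rightarrow>\<^sub>C 'k. norm x *\<^sub>R f)"
      by (rule bounded_linear_scaleR_right)
    from summable_on_bounded_linear [OF this] u
    show "(\<lambda>n. norm x *\<^sub>R theta p u n) summable_on UNIV"
      by (auto simp: trace_class_def o_def)
    fix n t
    show "apply_bcontfun (norm x *\<^sub>R theta p u n) t = of_real (norm x * apn (Phi t u) n)"
      by (simp add: theta_apply uc scaleR_conv_of_real)
    have "apn (Phi t (op_mult u x)) n \<le> norm (apply_bcontfun x t) * apn (Phi t u) n"
      using apn_kscale_le [OF cpt_Phi [OF uc], of "apply_bcontfun x t" t n]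
      by (simp add: Phi_op_mult [OF trace_class_adjointable [OF u], abs_def])
    also have "\<dots> \<le> norm x * apn (Phi t u) n"
      by (intro mult_right_mono norm_bounded apn_nonneg cpt_Phi uc)
    finally show "apn (Phi t (op_mult u x)) n \<le> norm x * apn (Phi t u) n" .
  qed
qed

lemma trace_class_adjoint:
  assumes u: "u \<in> trace_class p" and v: "v \<in> adjointable (modH p)" "is_adjoint (modH p) minner u v"
  shows "v \<in> trace_class p"
proof (rule trace_classI [OF compact_ops_adjoint [OF hmodule_H trace_class_compact [OF u] v]])
  show "theta p u summable_on UNIV" using u by (simp add: trace_class_def)
  show "apply_bcontfun (theta p u n) t = of_real (apn (Phi t u) n)" for n t
    by (rule theta_apply [OF trace_class_compact [OF u]])
  show "apn (Phi t v) n \<le> apn (Phi t u) n" for n t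
    using apn_kadj [OF kadj_Phi [OF trace_class_adjointable [OF u] v]] by simp
qed

text \<open>An arbitrary Schatten decomposition restricts at \<open>t\<close> to an expansion of
  \<open>Phi t u\<close> by vectors of the unit ball, to which
  \<open>diagonal_sum_of_decomposition\<close> applies.\<close>

lemma decomposition_diagonal_sum:
  assumes u: "u \<in> trace_class p" and dec: "schatten_decomposition p u \<xi> \<eta>"
    and a: "((\<lambda>n. theta p u n * minner (\<xi> n) (\<eta> n)) has_sum a) UNIV"
  shows "((\<lambda>\<iota>. Rep_ell2 (Phi t u (unit_vec \<iota>)) \<iota>) has_sum apply_bcontfun a t) UNIV"
proof -
  note uc = trace_class_compact [OF u]
  have K: "\<xi> n \<in> modK p" "\<eta> n \<in> modK p" for n
    using dec by (auto simp: schatten_decomposition_def u_orthonormal_def)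
  \<comment> \<open>The fibres at \<open>t\<close> need not be orthonormal, but since
    \<open>e_proj\<close> has norm at most \<open>1\<close> they lie in the unit ball.\<close>
  have unit: "norm (fib t (\<zeta> n)) \<le> 1" if "u_orthonormal p u \<zeta>" for \<zeta> n
  proof -
    have "\<zeta> n \<in> modK p" and e: "minner (\<zeta> n) (\<zeta> n) = e_proj p u n"
      using that by (auto simp: u_orthonormal_def)
    have "norm (e_proj p u n) \<le> 1"
      by (rule norm_bcontfun_le) (simp add: e_proj_apply uc indicator_def)
    then have "mnorm (\<zeta> n) \<le> 1" by (simp add: mnorm_def e)
    then show ?thesis using norm_fib_le [OF \<open>\<zeta> n \<in> modK p\<close>, of t] by linarith
  qed
  have cont: "((\<lambda>s. fib s (\<xi> n)) \<longlongrightarrow> fib t (\<xi> n)) (nhds t)" if t: "t \<in> U_set p u n" for n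
  proof -
    have "((\<lambda>s. l2_norm (eval_at s (\<xi> n) - eval_at t (\<xi> n))) \<longlongrightarrow> 0) (at t within U_set p u n)"
      using dec t by (simp add: schatten_decomposition_def u_orthonormal_def)
    moreover have "eval_at s (\<xi> n) - eval_at t (\<xi> n) = Rep_ell2 (fib s (\<xi> n) - fib t (\<xi> n))" for s
      by (rule ext) (simp add: K)
    then have "l2_norm (eval_at s (\<xi> n) - eval_at t (\<xi> n)) = norm (fib s (\<xi> n) - fib t (\<xi> n))" for s
      by (simp only: l2_norm_Rep_ell2)
    ultimately have "((\<lambda>s. norm (fib s (\<xi> n) - fib t (\<xi> n))) \<longlongrightarrow> 0) (at t)"
      by (simp add: at_within_open [OF t open_U_set [OF uc]])
    then have "((\<lambda>s. fib s (\<xi> n)) \<longlongrightarrow> fib t (\<xi> n)) (at t)"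
      by (rule LIM_zero_cancel [OF tendsto_norm_zero_cancel])
    then show ?thesis using tendsto_at_iff_tendsto_nhds [of "\<lambda>s. fib s (\<xi> n)" t] by simp
  qed
  let ?c = "apn (Phi t u)" and ?x = "\<lambda>n. fib t (\<xi> n)" and ?y = "\<lambda>n. fib t (\<eta> n)"
  \<comment> \<open>Where the singular value is nonzero, \<open>\<xi> n\<close> is norm continuous
    and \<open>minner\<close> is pointwise; elsewhere both sides vanish.\<close>
  have term_eq: "apply_bcontfun (theta p u n * minner (\<xi> n) (\<eta> n)) t = of_real (?c n) * kinner (?x n) (?y n)" for n
  proof (cases "t \<in> U_set p u n")
    case True
    have "apply_bcontfun (minner (\<xi> n) (\<eta> n)) t = kinner (?x n) (?y n)"
      by (rule minner_pointwise [OF K tendsto_mono [OF uf_le_nhds cont [OF True]]])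
    then show ?thesis by (simp add: theta_apply uc)
  qed (simp add: theta_apply uc U_set_eq)
  have "((\<lambda>n. of_real (?c n) * kinner (?x n) (?y n)) has_sum apply_bcontfun a t) UNIV"
    using has_sum_bounded_linear [OF bounded_linear_apply [of t] a] unfolding o_def term_eq .
  then have a_t: "apply_bcontfun a t = (\<Sum>\<^sub>\<infinity>n. of_real (?c n) * kinner (?x n) (?y n))"
    by (rule infsumI [symmetric])
  obtain v where v: "v \<in> compact_ops (modK p)" "\<And>\<zeta>. \<zeta> \<in> modH p \<Longrightarrow> v \<zeta> = u \<zeta>"
    "(\<lambda>N. opnorm (modK p) (v - (\<Sum>n<N. op_mult (rank1 (modK p) (\<xi> n) (\<eta> n)) (theta p u n)))) \<longlonglongrightarrow> 0"
    using dec unfolding schatten_decomposition_def by blast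
  \<comment> \<open>Convergence in \<open>opnorm\<close> on \<open>K\<close> is tested on the
    constant section \<open>psiv z\<close>; it lies in \<open>modH p\<close>, where \<open>v\<close>
    agrees with \<open>u\<close> and \<open>minner\<close> is pointwise.\<close>
  have approx: "(\<lambda>N. \<Sum>n<N. kscale (of_real (?c n) * kinner z (?y n)) (?x n)) \<longlonglongrightarrow> Phi t u z" for z
  proof -
    define S where "S N = (\<Sum>n<N. op_mult (rank1 (modK p) (\<xi> n) (\<eta> n)) (theta p u n))" for N
    have SA: "S N \<in> adjointable (modK p)" for N
      unfolding S_def by (intro adjointable_sum hmodule_K adjointable_op_mult rank1_is_adjoint K)
    have vS: "v - S N \<in> adjointable (modK p)" for N
      by (intro adjointable_diff hmodule_K SA compact_ops_adjointable v)
    define f where "f n = (\<lambda>\<iota>. \<xi> n \<iota> * (minner (psiv z) (\<eta> n) * theta p u n))" for n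
    have fK: "f n \<in> modK p" for n unfolding f_def by (rule modK_mult(1) [OF K(1)])
    have S: "S N (psiv z) = (\<Sum>n<N. f n)" for N
      unfolding S_def
      by (subst sum_fun_apply, intro sum.cong refl) (simp add: op_mult_def rank1_def f_def mult.assoc psiv_K)
    have fib_f: "fib t (f n) = kscale (of_real (?c n) * kinner z (?y n)) (?x n)" for n
      unfolding f_def modK_mult(2) [OF K(1)]
      by (simp add: minner_H_left psiv_H K kinner_psiv_fib theta_apply uc mult.commute)
    have uK: "u (psiv z) \<in> modK p"
      by (intro modH_K adjointable_in [OF compact_ops_adjointable [OF uc]] psiv_H)
    have SK: "S N (psiv z) \<in> modK p" for N unfolding S by (intro hmodule_sum hmodule_K fK)
    have eq: "fib t ((v - S N) (psiv z)) = Phi t u z - (\<Sum>n<N. kscale (of_real (?c n) * kinner z (?y n)) (?x n))" for N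
    proof -
      have "(v - S N) (psiv z) = u (psiv z) - S N (psiv z)" using v(2) [OF psiv_H] by simp
      then show ?thesis
        by (simp only: modK_diff(2) [OF uK SK] Phi_def) (simp only: S modK_sum [OF fK] fib_f)
    qed
    have bd: "norm (Phi t u z - (\<Sum>n<N. kscale (of_real (?c n) * kinner z (?y n)) (?x n)))
        \<le> opnorm (modK p) (v - S N) * mnorm (psiv z)" for N
      unfolding eq [symmetric]
      by (rule order_trans [OF norm_fib_le opnorm_bound [OF hmodule_K vS psiv_K]])
        (rule adjointable_in [OF vS psiv_K])
    have null: "(\<lambda>N. opnorm (modK p) (v - S N) * mnorm (psiv z)) \<longlonglongrightarrow> 0"
      using v(3) unfolding S_def [symmetric] by (rule tendsto_mult_left_zero)
    have "(\<lambda>N. Phi t u z - (\<Sum>n<N. kscale (of_real (?c n) * kinner z (?y n)) (?x n))) \<longlonglongrightarrow> 0"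
      by (rule Lim_null_comparison [OF always_eventually [OF allI [OF bd]] null])
    then have "(\<lambda>N. Phi t u z - (Phi t u z - (\<Sum>n<N. kscale (of_real (?c n) * kinner z (?y n)) (?x n)))) \<longlonglongrightarrow> Phi t u z - 0"
      by (intro tendsto_diff tendsto_const)
    then show ?thesis by simp
  qed
  show ?thesis
    unfolding a_t
    by (rule diagonal_sum_of_decomposition [OF apn_nonneg [OF cpt_Phi [OF uc]] sum_theta(1) [OF u] _ _ approx])
      (use dec unit in \<open>auto simp: schatten_decomposition_def\<close>)
qed

text \<open>The right-hand side is linear in \<open>u\<close> and does not involve a Schatten decomposition.\<close>

theorem tr_has_sum:
  assumes u: "u \<in> trace_class p"
  shows "((\<lambda>\<iota>. Rep_ell2 (Phi t u (unit_vec \<iota>)) \<iota>) has_sum apply_bcontfun (tr p u) t) UNIV"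
proof -
  note uc = trace_class_compact [OF u]
  obtain \<xi> \<eta> where dec: "schatten_decomposition p u \<xi> \<eta>"
    using schatten_decomposition_exists [OF uc] by blast
  have le1: "mnorm (\<zeta> n) \<le> 1" "\<zeta> n \<in> modK p" if "u_orthonormal p u \<zeta>" for \<zeta> n
  proof -
    have "norm (e_proj p u n) \<le> 1"
      by (rule norm_bcontfun_le) (simp add: e_proj_apply uc indicator_def)
    then show "mnorm (\<zeta> n) \<le> 1" "\<zeta> n \<in> modK p" using that by (auto simp: mnorm_def u_orthonormal_def)
  qed
  \<comment> \<open>By Cauchy-Schwarz the factors \<open>minner (\<xi> n) (\<eta> n)\<close> have
    norm at most \<open>1\<close>, so the series is dominated by the summable
    \<open>theta p u\<close>.\<close>
  have "(\<lambda>n. theta p u n * minner (\<xi> n) (\<eta> n)) summable_on UNIV"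
  proof (rule bcontfun_summable_comparison)
    show "theta p u summable_on UNIV" using u by (simp add: trace_class_def)
    fix n t
    show "apply_bcontfun (theta p u n) t = of_real (apn (Phi t u) n)" by (rule theta_apply [OF uc])
    have ort: "u_orthonormal p u \<xi>" "u_orthonormal p u \<eta>" using dec by (auto simp: schatten_decomposition_def)
    have "norm (minner (\<xi> n) (\<eta> n)) \<le> mnorm (\<xi> n) * mnorm (\<eta> n)" by (intro norm_minner_le le1 ort)
    also have "\<dots> \<le> 1 * 1" by (intro mult_mono le1 ort) auto
    finally have "norm (apply_bcontfun (minner (\<xi> n) (\<eta> n)) t) \<le> 1"
      using norm_bounded [of "minner (\<xi> n) (\<eta> n)" t] by linarith
    then show "norm (apply_bcontfun (theta p u n * minner (\<xi> n) (\<eta> n)) t) \<le> apn (Phi t u) n"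
      using apn_nonneg [OF cpt_Phi [OF uc], of t n] by (simp add: theta_apply uc norm_mult mult_left_le)
  qed
  then obtain a where a: "((\<lambda>n. theta p u n * minner (\<xi> n) (\<eta> n)) has_sum a) UNIV"
    by (auto simp: summable_on_def)
  have "tr p u = a"
    unfolding tr_def
  proof (rule the_equality)
    show "\<exists>\<xi> \<eta>. schatten_decomposition p u \<xi> \<eta> \<and> ((\<lambda>n. theta p u n * minner (\<xi> n) (\<eta> n)) has_sum a) UNIV"
      using dec a by blast
    fix b assume "\<exists>\<xi> \<eta>. schatten_decomposition p u \<xi> \<eta> \<and> ((\<lambda>n. theta p u n * minner (\<xi> n) (\<eta> n)) has_sum b) UNIV"
    then show "b = a"
      using decomposition_diagonal_sum [OF u] dec a has_sum_unique by (intro bcontfun_eqI) blast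
  qed
  with decomposition_diagonal_sum [OF u dec a] show ?thesis by simp
qed

section \<open>Linearity, norm and positivity of the trace\<close>

lemma tr_eqI:
  assumes "u \<in> trace_class p" "\<And>t. ((\<lambda>\<iota>. Rep_ell2 (Phi t u (unit_vec \<iota>)) \<iota>) has_sum apply_bcontfun a t) UNIV"
  shows "tr p u = a"
  using tr_has_sum [OF assms(1)] assms(2) has_sum_unique by (intro bcontfun_eqI) blast

lemma tr_add:
  assumes "u \<in> trace_class p" "w \<in> trace_class p"
  shows "tr p (u + w) = tr p u + tr p w"
  by (rule tr_eqI [OF trace_class_add [OF assms]])
    (use has_sum_add [OF tr_has_sum [OF assms(1)] tr_has_sum [OF assms(2)]] assms
      in \<open>simp add: Phi_add trace_class_adjointable\<close>)

lemma tr_op_mult: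
  assumes "u \<in> trace_class p"
  shows "tr p (op_mult u x) = tr p u * x"
proof (rule tr_eqI [OF trace_class_op_mult [OF assms]])
  show "((\<lambda>\<iota>. Rep_ell2 (Phi t (op_mult u x) (unit_vec \<iota>)) \<iota>) has_sum apply_bcontfun (tr p u * x) t) UNIV" for t
    using has_sum_cmult_right [OF tr_has_sum [OF assms, of t], of "apply_bcontfun x t"] assms
    by (simp add: Phi_op_mult trace_class_adjointable mult.commute)
qed

lemma tr_adjoint:
  assumes u: "u \<in> trace_class p" and v: "v \<in> adjointable (modH p)" "is_adjoint (modH p) minner u v"
  shows "tr p v = estar (tr p u)"
proof (rule tr_eqI [OF trace_class_adjoint [OF assms]])
  fix t
  have "Rep_ell2 (Phi t v (unit_vec \<iota>)) \<iota> = cnjg (Rep_ell2 (Phi t u (unit_vec \<iota>)) \<iota>)" for \<iota>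
    unfolding kinner_unit_vec [symmetric] kadjD [OF kadj_Phi [OF trace_class_adjointable [OF u] v]]
    by (metis kinner_commute)
  then show "((\<lambda>\<iota>. Rep_ell2 (Phi t v (unit_vec \<iota>)) \<iota>) has_sum apply_bcontfun (estar (tr p u)) t) UNIV"
    using has_sum_bounded_linear [OF bounded_linear_cnjg tr_has_sum [OF u, of t]] by (simp add: o_def)
qed

text \<open>By \<open>tr_has_sum\<close> the value at \<open>t\<close> is the diagonal sum of one
  operator, so singular vectors chosen for this operator alone compute it.\<close>

lemma tr_singular_vectors:
  assumes u: "u \<in> trace_class p" and v: "kadj (Phi t u) y"
  obtains \<xi> \<eta> where
    "apply_bcontfun (tr p u) t = (\<Sum>\<^sub>\<infinity>n. of_real (apn (Phi t u) n) * kinner (\<xi> n) (\<eta> n))"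
    "\<And>n. norm (\<xi> n) \<le> 1" "\<And>n. norm (\<eta> n) \<le> 1"
    "\<And>n. apn (Phi t u) n \<noteq> 0 \<Longrightarrow> norm (\<eta> n) = 1"
    "\<And>n. Phi t u (\<eta> n) = kscale (of_real (apn (Phi t u) n)) (\<xi> n)"
    "\<And>n. y (\<xi> n) = kscale (of_real (apn (Phi t u) n)) (\<eta> n)"
proof -
  note x = cpt_Phi [OF trace_class_compact [OF u], of t]
  obtain \<xi> \<eta> where zero: "\<And>n. apn (Phi t u) n = 0 \<Longrightarrow> \<xi> n = 0 \<and> \<eta> n = 0"
    and unit: "\<And>n. apn (Phi t u) n \<noteq> 0 \<Longrightarrow> norm (\<xi> n) = 1 \<and> norm (\<eta> n) = 1"
    and xy: "\<And>n. Phi t u (\<eta> n) = kscale (of_real (apn (Phi t u) n)) (\<xi> n)"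
      "\<And>n. y (\<xi> n) = kscale (of_real (apn (Phi t u) n)) (\<eta> n)"
    and svd: "\<And>N \<zeta>. norm (Phi t u \<zeta> - (\<Sum>n<N. kscale (of_real (apn (Phi t u) n) * kinner \<zeta> (\<eta> n)) (\<xi> n)))
        \<le> apn (Phi t u) N * norm \<zeta>"
    by (rule singular_value_decomposition [OF v x]) blast
  have n1: "norm (\<xi> n) \<le> 1" "norm (\<eta> n) \<le> 1" for n
    using zero [of n] unit [of n] by (cases "apn (Phi t u) n = 0"; simp)+
  have lim: "(\<lambda>N. \<Sum>n<N. kscale (of_real (apn (Phi t u) n) * kinner z (\<eta> n)) (\<xi> n)) \<longlonglongrightarrow> Phi t u z" for z
  proof -
    have null: "(\<lambda>N. apn (Phi t u) N * norm z) \<longlonglongrightarrow> 0"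
      by (rule tendsto_mult_left_zero [OF apn_tendsto_0 [OF v x]])
    have "(\<lambda>N. Phi t u z - (\<Sum>n<N. kscale (of_real (apn (Phi t u) n) * kinner z (\<eta> n)) (\<xi> n))) \<longlonglongrightarrow> 0"
      by (rule Lim_null_comparison [OF always_eventually [OF allI [OF svd]] null])
    then have "(\<lambda>N. Phi t u z - (Phi t u z - (\<Sum>n<N. kscale (of_real (apn (Phi t u) n) * kinner z (\<eta> n)) (\<xi> n)))) \<longlonglongrightarrow> Phi t u z - 0"
      by (intro tendsto_diff tendsto_const)
    then show ?thesis by simp
  qed
  have "apply_bcontfun (tr p u) t = (\<Sum>\<^sub>\<infinity>n. of_real (apn (Phi t u) n) * kinner (\<xi> n) (\<eta> n))"
    by (rule has_sum_unique [OF tr_has_sum [OF u] diagonal_sum_of_decomposition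
        [OF apn_nonneg [OF x] sum_theta(1) [OF u] n1 lim]])
  then show thesis using that n1 unit xy by blast
qed

lemma norm_tr_le:
  assumes u: "u \<in> trace_class p"
  shows "norm (tr p u) \<le> trace_norm p u"
proof (rule norm_bcontfun_le)
  fix t
  obtain v where v: "\<And>t. kadj (Phi t u) (Phi t v)" by (rule obtain_adjoint [OF trace_class_compact [OF u]]) blast
  let ?c = "apn (Phi t u)"
  note c = apn_nonneg [OF cpt_Phi [OF trace_class_compact [OF u]], of t] and sum = sum_theta [OF u, of t]
  obtain \<xi> \<eta> :: "nat \<Rightarrow> ('i, 'k) ell2" where
    tr: "apply_bcontfun (tr p u) t = (\<Sum>\<^sub>\<infinity>n. of_real (?c n) * kinner (\<xi> n) (\<eta> n))"
    and n1: "\<And>n. norm (\<xi> n) \<le> 1" "\<And>n. norm (\<eta> n) \<le> 1"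
    by (rule tr_singular_vectors [OF u v [of t]]) blast
  have le: "norm (of_real (?c n) * kinner (\<xi> n) (\<eta> n)) \<le> ?c n" for n
  proof -
    have "norm (kinner (\<xi> n) (\<eta> n)) \<le> 1 * 1"
      by (rule order_trans [OF norm_kinner_le]) (intro mult_mono n1, auto)
    then show ?thesis using c [of n] by (simp add: norm_mult mult_left_le)
  qed
  have abs: "(\<lambda>n. norm (of_real (?c n) * kinner (\<xi> n) (\<eta> n))) summable_on UNIV"
    by (rule summable_on_comparison_test [OF sum(1)]) (use le in auto)
  have "norm (apply_bcontfun (tr p u) t) \<le> (\<Sum>\<^sub>\<infinity>n. ?c n)"
    unfolding tr by (rule norm_infsum_le [OF has_sum_infsum [OF abs_summable_summable [OF abs]] has_sum_infsum [OF sum(1)] le])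
  also have "\<dots> \<le> norm (apply_bcontfun (\<Sum>\<^sub>\<infinity>n. theta p u n) t)"
    unfolding sum(2) by simp
  also have "\<dots> \<le> trace_norm p u"
    unfolding trace_norm_def by (rule norm_bounded)
  finally show "norm (apply_bcontfun (tr p u) t) \<le> trace_norm p u" .
qed

text \<open>The fibre of a positive operator is self-adjoint and positive semidefinite, so its left
  and right singular vectors coincide and every inner product in the trace formula is
  \<open>1\<close> where the singular value is nonzero.\<close>

lemma tr_positive:
  assumes u: "u \<in> trace_class p" and pos: "op_positive (modH p) u"
  shows "tr p u = (\<Sum>\<^sub>\<infinity>n. theta p u n)"
proof (rule bcontfun_eqI)
  fix t
  obtain v where v: "v \<in> adjointable (modH p)" "u = adj (modH p) minner v \<circ> v"
    using pos unfolding op_positive_def by blast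
  obtain w where w: "w \<in> adjointable (modH p)" "is_adjoint (modH p) minner v w" "is_adjoint (modH p) minner w v"
    by (rule adjointableE [OF hmodule_H v(1)])
  have adj_v: "adj (modH p) minner v = w"
    by (rule adj_eqI [OF hmodule_H w(2) adjointable_in [OF v(1)]])
  have u_eq: "u \<xi> = w (v \<xi>)" for \<xi>
    unfolding v(2) by (simp add: adj_v)
  have inner_u: "minner (u \<xi>) \<eta> = minner (v \<xi>) (v \<eta>)" if "\<xi> \<in> modH p" "\<eta> \<in> modH p" for \<xi> \<eta>
    unfolding u_eq using that adjointable_in [OF v(1)] by (intro is_adjointD [OF w(3)])
  note ua = trace_class_adjointable [OF u]
  have "is_adjoint (modH p) minner u u"
    unfolding is_adjoint_def
  proof (intro conjI ballI allI impI)
    fix \<xi> \<eta> assume *: "\<xi> \<in> modH p" "\<eta> \<in> modH p"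
    have "minner \<xi> (u \<eta>) = estar (minner (u \<eta>) \<xi>)"
      by (intro minner_commute modH_K adjointable_in [OF ua] *)
    also have "\<dots> = minner (v \<xi>) (v \<eta>)"
      unfolding inner_u [OF *(2,1)] by (intro minner_commute [symmetric] modH_K adjointable_in [OF v(1)] *)
    finally show "minner (u \<xi>) \<eta> = minner \<xi> (u \<eta>)" unfolding inner_u [OF *] ..
  qed (use ua in \<open>auto simp: adjointable_def\<close>)
  then have adj: "kadj (Phi t u) (Phi t u)" by (rule kadj_Phi [OF ua ua])
  \<comment> \<open>Tested on the constant section, the factorisation of \<open>u\<close> turns the
    quadratic form at \<open>t\<close> into the squared norm of the fibre of
    \<open>v (psiv z)\<close>.\<close>
  have psd: "0 \<le> inner (Phi t u z) z" for z
  proof -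
    have "kinner (Phi t u z) z = apply_bcontfun (minner (u (psiv z)) (psiv z)) t"
      using adjointable_in [OF ua psiv_H]
      by (simp add: Phi_def minner_H_left psiv_K kinner_fib_psiv_self modH_K)
    also have "minner (u (psiv z)) (psiv z) = minner (v (psiv z)) (v (psiv z))"
      by (rule inner_u [OF psiv_H psiv_H])
    also have "apply_bcontfun \<dots> t = of_real ((norm (fib t (v (psiv z))))\<^sup>2)"
      using adjointable_in [OF v(1) psiv_H] by (simp add: minner_H_left modH_K kinner_self_norm)
    finally show ?thesis by (simp add: inner_ell2_def del: of_real_power)
  qed
  let ?c = "apn (Phi t u)"
  obtain \<xi> \<eta> where tr: "apply_bcontfun (tr p u) t = (\<Sum>\<^sub>\<infinity>n. of_real (?c n) * kinner (\<xi> n) (\<eta> n))"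
    and unit: "\<And>n. ?c n \<noteq> 0 \<Longrightarrow> norm (\<eta> n) = 1"
    and xy: "\<And>n. Phi t u (\<eta> n) = kscale (of_real (?c n)) (\<xi> n)" "\<And>n. Phi t u (\<xi> n) = kscale (of_real (?c n)) (\<eta> n)"
    by (rule tr_singular_vectors [OF u adj]) blast
  txt \<open>\<open>\<eta> n - \<xi> n\<close> is an eigenvector for \<open>- ?c n\<close>, so positivity forces it to vanish.\<close>
  have diag: "of_real (?c n) * kinner (\<xi> n) (\<eta> n) = (of_real (?c n) :: 'k)" for n
  proof (cases "?c n = 0")
    case False
    then have c: "?c n > 0"
      using apn_nonneg [OF cpt_Phi [OF trace_class_compact [OF u]], of t n] by linarith
    have "Phi t u (\<eta> n - \<xi> n) = (- ?c n) *\<^sub>R (\<eta> n - \<xi> n)"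
      unfolding kadj_diff [OF adj] xy by (simp add: scaleR_ell2_def kscale.diff_right kscale.minus_left)
    then have "0 \<le> - ?c n * inner (\<eta> n - \<xi> n) (\<eta> n - \<xi> n)"
      using psd [of "\<eta> n - \<xi> n"] by simp
    then have "inner (\<eta> n - \<xi> n) (\<eta> n - \<xi> n) \<le> 0" using c by (simp add: mult_le_0_iff)
    then have "\<eta> n = \<xi> n" using inner_ge_zero [of "\<eta> n - \<xi> n"] by (simp add: antisym)
    then show ?thesis using unit [OF False] by (simp add: kinner_self_norm)
  qed simp
  have "apply_bcontfun (tr p u) t = (\<Sum>\<^sub>\<infinity>n. of_real (?c n))"
    unfolding tr by (rule infsum_cong) (rule diag)
  also have "\<dots> = of_real (\<Sum>\<^sub>\<infinity>n. ?c n)"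
    using has_sum_bounded_linear [OF bounded_linear_of_real has_sum_infsum [OF sum_theta(1) [OF u, of t]]]
    by (intro infsumI) (simp add: o_def)
  finally show "apply_bcontfun (tr p u) t = apply_bcontfun (\<Sum>\<^sub>\<infinity>n. theta p u n) t"
    unfolding sum_theta(2) [OF u] .
qed

text \<open>The constant section \<open>e\<close> through a unit vector gives
  \<open>rank1 (modH p) e e\<close>, whose fibres are the rank one projection onto that vector where
  \<open>p \<iota>\<close> is \<open>1\<close> and \<open>0\<close> elsewhere. It shows that the
  norm \<open>1\<close> of the trace is attained.\<close>

lemma exists_normalized_trace:
  assumes "p \<iota> \<noteq> 0"
  shows "\<exists>u\<in>trace_class p. trace_norm p u \<le> 1 \<and> norm (tr p u) = 1"
proof -
  define e where "e = psiv (unit_vec \<iota>)"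
  have eH: "e \<in> modH p" and eK: "e \<in> modK p" by (simp_all add: e_def psiv_H psiv_K)
  have ne: "norm (fib t e) \<le> 1" for t
    using norm_fib_psiv [of t "unit_vec \<iota>"] by (simp add: e_def)
  define u where "u = rank1 (modH p) e e"
  have ua: "u \<in> adjointable (modH p)" unfolding u_def by (rule rank1_is_adjoint [OF hmodule_H eH eH])
  have uc: "u \<in> compact_ops (modH p)"
  proof (rule compact_opsI [OF hmodule_H ua])
    fix \<epsilon> :: real assume "\<epsilon> > 0"
    have "mnorm (u \<xi> - (\<Sum>k<1 :: nat. rank1 (modH p) e e) \<xi>) \<le> \<epsilon> * mnorm \<xi>" for \<xi>
    proof -
      have "u \<xi> - (\<Sum>k<1 :: nat. rank1 (modH p) e e) \<xi> = 0" by (simp add: u_def fun_eq_iff)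
      then show ?thesis using \<open>\<epsilon> > 0\<close> by (simp only: mnorm_0) simp
    qed
    then show "\<exists>n X Y. (\<forall>k<n :: nat. X k \<in> modH p \<and> Y k \<in> modH p) \<and>
        (\<forall>\<xi>\<in>modH p. mnorm (u \<xi> - (\<Sum>k<n. rank1 (modH p) (X k) (Y k)) \<xi>) \<le> \<epsilon> * mnorm \<xi>)"
      using eH by (intro exI [of _ 1] exI [of _ "\<lambda>_. e"]) auto
  qed
  have Phi_u: "Phi t u z = kscale (kinner z (fib t e)) (fib t e)" for t z
  proof -
    have "u (psiv z) = (\<lambda>\<kappa>. e \<kappa> * minner (psiv z) e)" by (simp add: u_def rank1_def psiv_H)
    then show ?thesis
      unfolding Phi_def by (simp add: modK_mult(2) [OF eK] minner_H_left psiv_H eK kinner_psiv_fib)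
  qed
  have apn0: "apn (Phi t u) 0 \<le> 1" for t
  proof (intro apn_le rk_approx_0)
    fix z
    have "norm (kinner z (fib t e)) * norm (fib t e) \<le> norm z * norm (fib t e) * norm (fib t e)"
      by (intro mult_right_mono norm_kinner_le) simp
    also have "\<dots> \<le> norm z * 1 * 1" using ne [of t] by (intro mult_mono) auto
    finally show "norm (Phi t u z) \<le> 1 * norm z" by (simp add: Phi_u norm_kscale)
  qed simp
  have apn_pos: "apn (Phi t u) n = 0" if "n \<noteq> 0" for t n
  proof (rule antisym)
    have "rk_approx (Phi t u) 1 0"
      unfolding rk_approx_def
      by (intro exI [of _ "\<lambda>_. fib t e"]) (simp add: frank_def Phi_u)
    then have "rk_approx (Phi t u) n 0" by (rule rk_approx_mono) (use that in simp)
    then show "apn (Phi t u) n \<le> 0" by (intro apn_le) simp_all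
    show "0 \<le> apn (Phi t u) n" by (rule apn_nonneg [OF cpt_Phi [OF uc]])
  qed
  have theta0: "theta p u n = 0" if "n \<noteq> 0" for n
    by (rule bcontfun_eqI) (simp add: theta_apply uc apn_pos that)
  have sum: "(theta p u has_sum theta p u 0) UNIV"
    using has_sum_finite [of "{0}" "theta p u"]
    by (subst has_sum_cong_neutral [where T = "{0}"]) (auto simp: theta0)
  then have u: "u \<in> trace_class p" using uc by (auto simp: trace_class_def summable_on_def)
  have "norm (theta p u 0) \<le> 1"
    by (rule norm_bcontfun_le) (simp add: theta_apply uc apn0 apn_nonneg cpt_Phi)
  then have tn: "trace_norm p u \<le> 1" using infsumI [OF sum] by (simp add: trace_norm_def)
  obtain t where "apply_bcontfun (p \<iota>) t \<noteq> 0"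
    using assms bcontfun_eqI [of "p \<iota>" 0] by auto
  then have pt: "apply_bcontfun (p \<iota>) t = 1" using p_cases by blast
  have "((\<lambda>\<kappa>. Rep_ell2 (Phi t u (unit_vec \<kappa>)) \<kappa>) has_sum kinner (fib t e) (fib t e)) UNIV"
  proof -
    have "kinner (unit_vec \<kappa>) (fib t e) = cnjg (Rep_ell2 (fib t e) \<kappa>)" for \<kappa>
      by (metis kinner_commute kinner_unit_vec)
    then show ?thesis
      using kinner_has_sum [of "fib t e" "fib t e"] by (simp add: Phi_u mult.commute del: Rep_fib)
  qed
  then have tr: "apply_bcontfun (tr p u) t = of_real ((norm (fib t e))\<^sup>2)"
    using has_sum_unique [OF tr_has_sum [OF u]] by (simp add: kinner_self_norm)
  have "norm (Rep_ell2 (fib t e) \<iota>) = 1"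
    unfolding e_def Rep_fib_psiv by (simp add: pt unit_vec.rep_eq)
  then have "1 \<le> norm (fib t e)" using norm_Rep_ell2_le [of "fib t e" \<iota>] by simp
  then have "1 \<le> norm (apply_bcontfun (tr p u) t)"
    unfolding tr by (simp add: norm_power one_le_power)
  then have "1 \<le> norm (tr p u)" using norm_bounded order_trans by blast
  then show ?thesis using norm_tr_le [OF u] tn u by (intro bexI [OF _ u]) auto
qed

end

text \<open>The clause on the norm is conditional because for vanishing \<open>p\<close> the
  modules, and with them the trace, are zero.\<close>

theorem corollary4p5:
  fixes p :: "'i \<Rightarrow> ('t::t2_space \<Rightarrow>\<^sub>C 'k::real_or_complex)"
  assumes "hyperstonian TYPE('t)"
    and "\<And>\<iota>. projection (p \<iota>)"
  shows
    "(\<forall>u\<in>trace_class p. \<forall>v\<in>trace_class p.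
        u + v \<in> trace_class p \<and> tr p (u + v) = tr p u + tr p v) \<and>
     (\<forall>u\<in>trace_class p. \<forall>c.
        op_mult u (const_bcontfun c) \<in> trace_class p \<and>
        tr p (op_mult u (const_bcontfun c)) = const_bcontfun c * tr p u) \<and>
     (\<forall>u\<in>trace_class p.
        adj (modH p) minner u \<in> trace_class p \<and>
        tr p (adj (modH p) minner u) = estar (tr p u)) \<and>
     (\<forall>u\<in>trace_class p. op_positive (modH p) u \<longrightarrow> e_nonneg (tr p u)) \<and>
     (\<forall>u\<in>trace_class p. \<forall>\<epsilon>>0. \<exists>\<delta>>0. \<forall>v\<in>trace_class p.
        trace_norm p (v - u) < \<delta> \<longrightarrow> norm (tr p v - tr p u) < \<epsilon>) \<and>
     (\<forall>u\<in>trace_class p. norm (tr p u) \<le> trace_norm p u) \<and>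
     ((\<exists>\<iota>. p \<iota> \<noteq> 0) \<longrightarrow>
        (SUP u\<in>{u\<in>trace_class p. trace_norm p u \<le> 1}. norm (tr p u)) = 1) \<and>
     (\<forall>u\<in>trace_class p. op_positive (modH p) u \<longrightarrow> norm (tr p u) = trace_norm p u) \<and>
     (\<forall>u\<in>trace_class p. \<forall>x.
        op_mult u x \<in> trace_class p \<and> tr p (op_mult u x) = tr p u * x)"
proof -
  interpret hilbert_family "TYPE('t)" p
    using assms by unfold_locales auto
  have adjoint: "adj (modH p) minner u \<in> trace_class p \<and> tr p (adj (modH p) minner u) = estar (tr p u)"
    if u: "u \<in> trace_class p" for u
  proof -
    obtain v where v: "v \<in> adjointable (modH p)" "is_adjoint (modH p) minner u v"
      by (rule adjointableE [OF hmodule_H trace_class_adjointable [OF u]])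
    have "adj (modH p) minner u = v"
      by (rule adj_eqI [OF hmodule_H v(2) adjointable_in [OF trace_class_adjointable [OF u]]])
    then show ?thesis using trace_class_adjoint [OF u v] tr_adjoint [OF u v] by simp
  qed
  have nonneg: "e_nonneg (tr p u)" if "u \<in> trace_class p" "op_positive (modH p) u" for u
    unfolding e_nonneg_def tr_positive [OF that] sum_theta(2) [OF that(1)] scalar_nonneg_iff rpart_of_real
    by (intro allI conjI infsum_nonneg apn_nonneg cpt_Phi trace_class_compact that(1) refl)
  have diff: "v - u \<in> trace_class p \<and> tr p (v - u) = tr p v - tr p u"
    if "u \<in> trace_class p" "v \<in> trace_class p" for u v
  proof -
    have eq: "v - u = v + op_mult u (const_bcontfun (- 1))"
      by (intro ext bcontfun_eqI) (simp add: op_mult_def)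
    have "tr p v + tr p u * const_bcontfun (- 1) = tr p v - tr p u"
      by (rule bcontfun_eqI) simp
    then show ?thesis
      unfolding eq using that trace_class_add trace_class_op_mult tr_add tr_op_mult by metis
  qed
  have continuous: "\<exists>\<delta>>0. \<forall>v\<in>trace_class p. trace_norm p (v - u) < \<delta> \<longrightarrow> norm (tr p v - tr p u) < \<epsilon>"
    if "u \<in> trace_class p" "\<epsilon> > 0" for u \<epsilon>
  \<comment> \<open>The choice \<open>\<delta> = \<epsilon>\<close> works by
    \<open>norm_tr_le\<close> applied to the difference, which is again of trace class.\<close>
  proof (intro exI [of _ \<epsilon>] conjI ballI impI that(2))
    fix v assume v: "v \<in> trace_class p" "trace_norm p (v - u) < \<epsilon>"
    have "norm (tr p (v - u)) \<le> trace_norm p (v - u)"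
      using diff [OF that(1) v(1)] by (intro norm_tr_le) blast
    then show "norm (tr p v - tr p u) < \<epsilon>"
      using diff [OF that(1) v(1)] v(2) by simp
  qed
  have norm1: "(SUP u\<in>{u\<in>trace_class p. trace_norm p u \<le> 1}. norm (tr p u)) = 1" if "\<exists>\<iota>. p \<iota> \<noteq> 0"
  proof (rule cSup_eq_maximum)
    show "1 \<in> (\<lambda>u. norm (tr p u)) ` {u \<in> trace_class p. trace_norm p u \<le> 1}"
      using that exists_normalized_trace by (force simp: image_iff)
    show "x \<le> 1" if "x \<in> (\<lambda>u. norm (tr p u)) ` {u \<in> trace_class p. trace_norm p u \<le> 1}" for x
      using that norm_tr_le by force
  qed
  show ?thesis
    using trace_class_add tr_add trace_class_op_mult tr_op_mult adjoint nonneg continuous norm_tr_le norm1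
      tr_positive
    by (intro conjI ballI allI impI) (simp_all add: mult.commute trace_norm_def)
qed

end
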